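(* Let $r\ge2$ and let $\Gamma$ be a subgroup of an irreducible arithmetic group $\Delta$ in $\mathrm{PSL}(2,\mathbb{R})^r$ such that, for one $j\in\{1,\dots,r\}$, $p_j(\Gamma)$ is a cofinite Fuchsian group, for all other $i\in\{1,\dots,r\}$, $i\ne j$, the group $p_i(\Gamma)$ is not discrete, and, for every hyperbolic $g_j\in p_j(\Gamma)$, $\mathbb{Q}(\mathrm{tr}(g_j^2))=\mathbb{Q}(\mathrm{Tr}(p_j(\Gamma^{(2)})))$. Then the Furstenberg limit set $F_\Gamma$ is the whole Furstenberg boundary $(\partial\mathbb{H}^2)^r$.
   Context: $\mathrm{PSL}(2,\mathbb{R})^r$ acts componentwise on $(\mathbb{H}^2)^r$; $p_i$ is the projection to the $i$-th factor. For $g=\pm\begin{pmatrix}a&b\\c&d\end{pmatrix}\in\mathrm{PSL}(2,\mathbb{R})$ put $\mathrm{tr}(g)=|a+d|$. For a subgroup $H$ of $\mathrm{PSL}(2,\mathbb{R})$ put $\mathrm{Tr}(H)=\{\mathrm{tr}(g)\mid g\in H\}$. For a group $S$, $S^{(2)}$ is the subgroup generated by $\{g^2\mid g\in S\}$. Boundary and limit sets. The geometric boundary $\partial((\mathbb{H}^2)^r)$ is the set of classes of asymptotic unit speed geodesic rays, with the cone topology. A geodesic is regular if all its projections to the factors are nonconstant. The regular boundary (classes of regular geodesics) is identified with $(\partial\mathbb{H}^2)^r\times\mathbb{RP}^{r-1}_+$, where $\mathbb{RP}^{r-1}_+=\{(x_1:\dots:x_r)\mid x_i>0\ \forall i\}$: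 a regular ray $\gamma=(\gamma_1,\dots,\gamma_r)$ corresponds to the endpoints $\gamma_i(+\infty)$ together with $(\|\gamma_1'\|:\dots:\|\gamma_r'\|)$. $(\partial\mathbb{H}^2)^r$ is the Furstenberg boundary. The limit set is $\mathcal{L}_\Gamma=\overline{\Gamma(x)}\cap\partial((\mathbb{H}^2)^r)$ (independent of $x$). The regular limit set $\mathcal{L}_\Gamma^{reg}$ is its intersection with the regular boundary. $F_\Gamma$ is the projection of $\mathcal{L}_\Gamma^{reg}$ to $(\partial\mathbb{H}^2)^r$. Irreducible arithmetic groups. Let $K\subset\mathbb{R}$ be a totally real number field of degree $n$ with embeddings $\phi_1=\mathrm{id},\phi_2,\dots,\phi_n$ into $\mathbb{R}$. Let $A$ be a quaternion algebra over $K$ that is unramified (isomorphic to $M(2,\mathbb{R})$) at $\phi_1,\dots,\phi_r$ and ramified (isomorphic to Hamilton's quaternions) at $\phi_{r+1},\dots,\phi_n$. Fix extensions of $\phi_1,\dots,\phi_r$ to embeddings $\phi_i:A\to M(2,\mathbb{R})$. For an order $\mathcal{O}$ of $A$ let $\mathcal{O}^1$ be its group of units (of reduced norm 1), and let $\Gamma(A,\mathcal{O})^*$ be the image in $\mathrm{PSL}(2,\mathbb{R})^r$ of $\{(\phi_1(\varepsilon),\dots,\phi_r(\varepsilon))\mid\varepsilon\in\mathcal{O}^1\}$. The irreducible arithmetic subgroups of $\mathrm{PSL}(2,\mathbb{R})^r$ are the subgroups commensurable to some $\Gamma(A,\mathcal{O})^*$. *)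

theory Defs
  imports
    "HOL-Analysis.Analysis"
    "HOL-Algebra.Product_Groups"
    "HOL-Algebra.Generated_Groups"
    "HOL-Algebra.Subrings"
begin

section \<open>The groups \<open>PSL(2,\<real>)\<close> and \<open>PSL(2,\<real>)\<^sup>r\<close>\<close>

type_synonym psl = "(real^2^2) set"

definition SL2R :: "(real^2^2) monoid" where
  "SL2R = \<lparr>carrier = {A. det A = 1}, monoid.mult = (**), one = mat 1\<rparr>"

definition PSL2R :: "psl monoid" where
  "PSL2R = SL2R Mod {mat 1, - mat 1}"

definition psl_class :: "real^2^2 \<Rightarrow> psl" where
  "psl_class A = {mat 1, - mat 1} #>\<^bsub>SL2R\<^esub> A"

(* The factors are numbered 0, ..., r - 1. *)
definition PSL2R_pow :: "nat \<Rightarrow> (nat \<Rightarrow> psl) monoid" where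
  "PSL2R_pow r = product_group {..<r} (\<lambda>_. PSL2R)"

lemma psl_class_eq: "psl_class A = {A, - A}"
proof -
  have "(- mat 1 :: real^2^2) ** A = - A"
    by (simp add: vec_eq_iff matrix_matrix_mult_def mat_def sum_2 forall_2)
  then show ?thesis
    by (simp add: psl_class_def SL2R_def r_coset_def insert_commute)
qed

lemma carrier_PSL2R: "carrier PSL2R = psl_class ` {A. det A = 1}"
  by (simp add: PSL2R_def carrier_FactGroup psl_class_def SL2R_def)

lemma group_SL2R: "group SL2R"
proof (rule groupI)
  fix A assume "A \<in> carrier SL2R"
  then have d: "det A = 1" by (simp add: SL2R_def)
  then obtain B where B: "A ** B = mat 1" "B ** A = mat 1"
    by (metis invertible_def invertible_det_nz zero_neq_one)
  then have "det B = 1"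
    using d by (metis det_I det_mul mult_1)
  with B show "\<exists>B\<in>carrier SL2R. B \<otimes>\<^bsub>SL2R\<^esub> A = \<one>\<^bsub>SL2R\<^esub>"
    by (auto simp: SL2R_def)
qed (auto simp: SL2R_def det_mul det_I matrix_mul_assoc)

lemma neg_matrix_mult:
  fixes A B :: "real^2^2"
  shows "(- A) ** B = - (A ** B)" "A ** (- B) = - (A ** B)"
  by (simp_all add: vec_eq_iff matrix_matrix_mult_def sum_negf)

lemma group_PSL2R: "group PSL2R"
proof -
  interpret group SL2R by (rule group_SL2R)
  have d: "det (- mat 1 :: real^2^2) = 1"
    by (simp add: det_2 mat_def)
  have inv1: "inv\<^bsub>SL2R\<^esub> (- mat 1) = - mat 1"
    by (rule inv_equality) (auto simp: SL2R_def d neg_matrix_mult)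
  have "subgroup {mat 1, - mat 1} SL2R"
  proof (rule subgroupI)
    fix a assume "a \<in> {mat 1, - mat 1 :: real^2^2}"
    moreover have "inv\<^bsub>SL2R\<^esub> (mat 1) = mat 1"
      using inv_one by (simp add: SL2R_def)
    ultimately show "inv\<^bsub>SL2R\<^esub> a \<in> {mat 1, - mat 1}"
      using inv1 by auto
  qed (auto simp: SL2R_def d neg_matrix_mult)
  then have "{mat 1, - mat 1} \<lhd> SL2R"
    by (rule normalI) (auto simp: r_coset_def l_coset_def SL2R_def neg_matrix_mult)
  then show ?thesis
    unfolding PSL2R_def by (rule normal.factorgroup_is_group)
qed

lemma group_PSL2R_pow: "group (PSL2R_pow r)"
  unfolding PSL2R_pow_def by (simp add: group_PSL2R)

(* Elements of PSL2R are the two-element sets {A, - A}; the functions below are constant on them. *)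
definition psl_tr :: "psl \<Rightarrow> real" where
  "psl_tr g = the_elem ((\<lambda>A. \<bar>trace A\<bar>) ` g)"

lemma psl_tr_class: "psl_tr (psl_class A) = \<bar>trace A\<bar>"
  by (simp add: psl_tr_def psl_class_eq trace_def sum_negf)

definition hyperbolic :: "psl \<Rightarrow> bool" where
  "hyperbolic g \<longleftrightarrow> psl_tr g > 2"

definition upper_half_plane :: "complex set" where
  "upper_half_plane = {z. Im z > 0}"

definition moebius :: "real^2^2 \<Rightarrow> complex \<Rightarrow> complex" where
  "moebius A z = (of_real (A $ 1 $ 1) * z + of_real (A $ 1 $ 2)) /
                 (of_real (A $ 2 $ 1) * z + of_real (A $ 2 $ 2))"

definition psl_act :: "psl \<Rightarrow> complex \<Rightarrow> complex" where
  "psl_act g z = the_elem ((\<lambda>A. moebius A z) ` g)"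

lemma psl_act_class: "psl_act (psl_class A) z = moebius A z"
proof -
  have "moebius (- A) z =
      (- (of_real (A $ 1 $ 1) * z + of_real (A $ 1 $ 2))) /
      (- (of_real (A $ 2 $ 1) * z + of_real (A $ 2 $ 2)))"
    by (simp add: moebius_def)
  then have "moebius (- A) z = moebius A z"
    by (simp only: moebius_def minus_divide_divide)
  then show ?thesis
    by (simp add: psl_act_def psl_class_eq)
qed

definition psl_pow_act :: "nat \<Rightarrow> (nat \<Rightarrow> psl) \<Rightarrow> (nat \<Rightarrow> complex) \<Rightarrow> nat \<Rightarrow> complex" where
  "psl_pow_act r g x = (\<lambda>i\<in>{..<r}. psl_act (g i) (x i))"

definition factor :: "nat \<Rightarrow> (nat \<Rightarrow> psl) set \<Rightarrow> psl set" where
  "factor i \<Gamma> = (\<lambda>g. g i) ` \<Gamma>"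

definition squares_group :: "('a, 'b) monoid_scheme \<Rightarrow> 'a set \<Rightarrow> 'a set" where
  "squares_group G S = generate G {g \<otimes>\<^bsub>G\<^esub> g | g. g \<in> S}"

definition finite_index :: "('a, 'b) monoid_scheme \<Rightarrow> 'a set \<Rightarrow> 'a set \<Rightarrow> bool" where
  "finite_index G H S \<longleftrightarrow> finite (rcosets\<^bsub>G\<lparr>carrier := S\<rparr>\<^esub> H)"

definition commensurable :: "('a, 'b) monoid_scheme \<Rightarrow> 'a set \<Rightarrow> 'a set \<Rightarrow> bool" where
  "commensurable G S T \<longleftrightarrow> subgroup S G \<and> subgroup T G \<and>
     finite_index G (S \<inter> T) S \<and> finite_index G (S \<inter> T) T"


section \<open>Cofinite Fuchsian groups\<close>

(* The quotient topology: as elements of PSL2R are cosets, the union of U is the preimage of U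
   under psl_class. *)
definition PSL2R_topology :: "psl topology" where
  "PSL2R_topology = topology (\<lambda>U. U \<subseteq> carrier PSL2R \<and>
     openin (top_of_set (carrier SL2R)) (\<Union>U))"

lemma istopology_PSL2R:
  "istopology (\<lambda>U. U \<subseteq> carrier PSL2R \<and> openin (top_of_set (carrier SL2R)) (\<Union>U))"
proof -
  have disj: "g = h" if "g \<in> carrier PSL2R" "h \<in> carrier PSL2R" "A \<in> g" "A \<in> h" for g h A
    using that by (auto simp: carrier_PSL2R psl_class_eq)
  have "\<Union>(U \<inter> V) = \<Union>U \<inter> \<Union>V" if "U \<subseteq> carrier PSL2R" "V \<subseteq> carrier PSL2R" for U V
    using that disj by blast
  moreover have "openin T (\<Union>(\<Union>\<U>))" if "\<forall>U\<in>\<U>. openin T (\<Union>U)"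
    for T :: "(real^2^2) topology" and \<U>
  proof -
    have "\<Union>(\<Union>\<U>) = (\<Union>U\<in>\<U>. \<Union>U)" by blast
    with that show ?thesis by (auto intro: openin_clauses(3))
  qed
  ultimately show ?thesis
    unfolding istopology_def by (metis (no_types, lifting) Sup_least le_infI1 openin_Int)
qed

definition discrete_in_PSL2R :: "psl set \<Rightarrow> bool" where
  "discrete_in_PSL2R H \<longleftrightarrow> subtopology PSL2R_topology H = discrete_topology H"

definition fuchsian :: "psl set \<Rightarrow> bool" where
  "fuchsian H \<longleftrightarrow> subgroup H PSL2R \<and> discrete_in_PSL2R H"

definition hyperbolic_area :: "complex set \<Rightarrow> ennreal" where
  "hyperbolic_area F = (\<integral>\<^sup>+z\<in>F. ennreal (1 / (Im z)\<^sup>2) \<partial>lborel)"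

definition fundamental_domain :: "psl set \<Rightarrow> complex set \<Rightarrow> bool" where
  "fundamental_domain H F \<longleftrightarrow> F \<in> sets borel \<and> F \<subseteq> upper_half_plane \<and>
     (\<Union>g\<in>H. psl_act g ` F) = upper_half_plane \<and>
     (\<forall>g\<in>H. g \<noteq> \<one>\<^bsub>PSL2R\<^esub> \<longrightarrow> hyperbolic_area (F \<inter> psl_act g ` F) = 0)"

definition cofinite_fuchsian :: "psl set \<Rightarrow> bool" where
  "cofinite_fuchsian H \<longleftrightarrow> fuchsian H \<and>
     (\<exists>F. fundamental_domain H F \<and> hyperbolic_area F < \<infinity>)"


section \<open>Real number fields\<close>

definition real_subfield :: "real set \<Rightarrow> bool" where
  "real_subfield K \<longleftrightarrow> 1 \<in> K \<and> (\<forall>x\<in>K. \<forall>y\<in>K. x - y \<in> K \<and> x * y \<in> K) \<and>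
     (\<forall>x\<in>K. inverse x \<in> K)"

definition generated_field :: "real set \<Rightarrow> real set" where
  "generated_field S = real_subfield hull S"

definition number_field_of_degree :: "real set \<Rightarrow> nat \<Rightarrow> bool" where
  "number_field_of_degree K n \<longleftrightarrow> real_subfield K \<and>
     (\<exists>B. finite B \<and> card B = n \<and>
       \<not> Modules.module.dependent (\<lambda>(q::rat) (x::real). of_rat q * x) B \<and>
       Modules.module.span (\<lambda>(q::rat) (x::real). of_rat q * x) B = K)"

definition field_embeddings :: "real set \<Rightarrow> (real \<Rightarrow> 'a::field) set" where
  "field_embeddings K = {f \<in> extensional K. f 1 = 1 \<and>
     (\<forall>x\<in>K. \<forall>y\<in>K. f (x + y) = f x + f y \<and> f (x * y) = f x * f y)}"

definition totally_real :: "real set \<Rightarrow> bool" where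
  "totally_real K \<longleftrightarrow> (\<forall>f \<in> (field_embeddings K :: (real \<Rightarrow> complex) set). f ` K \<subseteq> \<real>)"

definition ring_of_integers :: "real set \<Rightarrow> real set" where
  "ring_of_integers K = {x \<in> K. algebraic_int x}"


section \<open>Quaternion algebras\<close>

(* (x0, x1, x2, x3) stands for x0 + x1 i + x2 j + x3 k *)
type_synonym quad = "real \<times> real \<times> real \<times> real"

(* i i = a, j j = b, i j = - j i = k *)
fun quat_mult :: "real \<Rightarrow> real \<Rightarrow> quad \<Rightarrow> quad \<Rightarrow> quad" where
  "quat_mult a b (x0, x1, x2, x3) (y0, y1, y2, y3) =
    (x0 * y0 + a * (x1 * y1) + b * (x2 * y2) - a * b * (x3 * y3),
     x0 * y1 + x1 * y0 - b * (x2 * y3) + b * (x3 * y2),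
     x0 * y2 + x2 * y0 + a * (x1 * y3) - a * (x3 * y1),
     x0 * y3 + x3 * y0 + x1 * y2 - x2 * y1)"

fun reduced_norm :: "real \<Rightarrow> real \<Rightarrow> quad \<Rightarrow> real" where
  "reduced_norm a b (x0, x1, x2, x3) = x0\<^sup>2 - a * x1\<^sup>2 - b * x2\<^sup>2 + a * b * x3\<^sup>2"

(* The quaternion algebra (a, b / K). *)
definition quaternion_algebra :: "real set \<Rightarrow> real \<Rightarrow> real \<Rightarrow> quad ring" where
  "quaternion_algebra K a b = \<lparr>carrier = K \<times> K \<times> K \<times> K, monoid.mult = quat_mult a b,
     one = (1, 0, 0, 0), zero = 0, add = (+)\<rparr>"

definition M2R :: "(real^2^2) ring" where
  "M2R = \<lparr>carrier = UNIV, monoid.mult = (**), one = mat 1, zero = 0, add = (+)\<rparr>"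

definition real_algebra_iso :: "('a::real_vector) ring \<Rightarrow> ('b::real_vector) ring \<Rightarrow> bool" where
  "real_algebra_iso R S \<longleftrightarrow>
     (\<exists>h \<in> ring_iso R S. \<forall>c. \<forall>x \<in> carrier R. h (c *\<^sub>R x) = c *\<^sub>R h x)"

(* For an embedding f of K into the reals, extension of scalars of (a, b / K) along f is
   (f a, f b / R). *)
definition unramified_at :: "(real \<Rightarrow> real) \<Rightarrow> real \<Rightarrow> real \<Rightarrow> bool" where
  "unramified_at f a b \<longleftrightarrow> real_algebra_iso (quaternion_algebra UNIV (f a) (f b)) M2R"

definition ramified_at :: "(real \<Rightarrow> real) \<Rightarrow> real \<Rightarrow> real \<Rightarrow> bool" where
  "ramified_at f a b \<longleftrightarrow>
     real_algebra_iso (quaternion_algebra UNIV (f a) (f b)) (quaternion_algebra UNIV (- 1) (- 1))"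

definition extends_embedding ::
  "real set \<Rightarrow> real \<Rightarrow> real \<Rightarrow> (real \<Rightarrow> real) \<Rightarrow> (quad \<Rightarrow> real^2^2) \<Rightarrow> bool" where
  "extends_embedding K a b f \<rho> \<longleftrightarrow> \<rho> \<in> ring_hom (quaternion_algebra K a b) M2R \<and>
     inj_on \<rho> (carrier (quaternion_algebra K a b)) \<and>
     (\<forall>x\<in>K. \<rho> (x, 0, 0, 0) = mat (f x))"

definition linear_span :: "real set \<Rightarrow> 'a::real_vector set \<Rightarrow> 'a set" where
  "linear_span R S = {(\<Sum>s\<in>T. c s *\<^sub>R s) | T c. finite T \<and> T \<subseteq> S \<and> (\<forall>s\<in>T. c s \<in> R)}"

definition quaternion_order :: "real set \<Rightarrow> real \<Rightarrow> real \<Rightarrow> quad set \<Rightarrow> bool" where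
  "quaternion_order K a b \<O> \<longleftrightarrow> subring \<O> (quaternion_algebra K a b) \<and>
     (\<exists>S. finite S \<and> \<O> = linear_span (ring_of_integers K) S) \<and>
     linear_span K \<O> = carrier (quaternion_algebra K a b)"

definition norm_one_units :: "real \<Rightarrow> real \<Rightarrow> quad set \<Rightarrow> quad set" where
  "norm_one_units a b \<O> = {\<epsilon> \<in> \<O>. reduced_norm a b \<epsilon> = 1}"

definition arithmetic_image ::
  "nat \<Rightarrow> real \<Rightarrow> real \<Rightarrow> quad set \<Rightarrow> (nat \<Rightarrow> quad \<Rightarrow> real^2^2) \<Rightarrow> (nat \<Rightarrow> psl) set" where
  "arithmetic_image r a b \<O> \<rho> =
     (\<lambda>\<epsilon>. \<lambda>i\<in>{..<r}. psl_class (\<rho> i \<epsilon>)) ` norm_one_units a b \<O>"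

definition irreducible_arithmetic :: "nat \<Rightarrow> (nat \<Rightarrow> psl) set \<Rightarrow> bool" where
  "irreducible_arithmetic r \<Delta> \<longleftrightarrow>
     (\<exists>K n \<phi> a b \<rho> \<O>.
        number_field_of_degree K n \<and> totally_real K \<and>
        bij_betw \<phi> {..<n} (field_embeddings K) \<and> \<phi> 0 = (\<lambda>x\<in>K. x) \<and>
        r \<le> n \<and> a \<in> K - {0} \<and> b \<in> K - {0} \<and>
        (\<forall>i<r. unramified_at (\<phi> i) a b) \<and>
        (\<forall>i. r \<le> i \<and> i < n \<longrightarrow> ramified_at (\<phi> i) a b) \<and>
        (\<forall>i<r. extends_embedding K a b (\<phi> i) (\<rho> i)) \<and>
        quaternion_order K a b \<O> \<and>
        commensurable (PSL2R_pow r) \<Delta> (arithmetic_image r a b \<O> \<rho>))"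


section \<open>Geometric boundary and cone topology\<close>

(* A metric space is given by a carrier X and a distance d; a ray is a function whose values
   at negative arguments are irrelevant. *)
definition geodesic_rays :: "'a set \<Rightarrow> ('a \<Rightarrow> 'a \<Rightarrow> real) \<Rightarrow> (real \<Rightarrow> 'a) set" where
  "geodesic_rays X d = {c. (\<forall>t\<ge>0. c t \<in> X) \<and> (\<forall>s\<ge>0. \<forall>t\<ge>0. d (c s) (c t) = \<bar>s - t\<bar>)}"

definition asymptotic :: "'a set \<Rightarrow> ('a \<Rightarrow> 'a \<Rightarrow> real) \<Rightarrow> ((real \<Rightarrow> 'a) \<times> (real \<Rightarrow> 'a)) set" where
  "asymptotic X d = {(c, c'). c \<in> geodesic_rays X d \<and> c' \<in> geodesic_rays X d \<and>
     (\<exists>B. \<forall>t\<ge>0. d (c t) (c' t) \<le> B)}"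

definition geometric_boundary :: "'a set \<Rightarrow> ('a \<Rightarrow> 'a \<Rightarrow> real) \<Rightarrow> (real \<Rightarrow> 'a) set set" where
  "geometric_boundary X d = geodesic_rays X d // asymptotic X d"

(* The endpoint c(+\<infinity>) of a nonconstant geodesic ray c that is parametrized
   proportionally to arc length. *)
definition endpoint :: "'a set \<Rightarrow> ('a \<Rightarrow> 'a \<Rightarrow> real) \<Rightarrow> (real \<Rightarrow> 'a) \<Rightarrow> (real \<Rightarrow> 'a) set" where
  "endpoint X d c = (THE \<eta>. \<eta> \<in> geometric_boundary X d \<and>
     (\<exists>\<sigma>\<in>\<eta>. \<exists>v>0. \<forall>t\<ge>0. c t = \<sigma> (v * t)))"

(* Inl embeds the space, Inr its boundary. For a ray c from p, the neighbourhood U(c, R, e)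
   consists of the points at distance more than R from p (boundary points included) such that
   the geodesic from p towards the point passes within e of c R at time R. *)
definition cone_neighbourhood ::
  "'a set \<Rightarrow> ('a \<Rightarrow> 'a \<Rightarrow> real) \<Rightarrow> (real \<Rightarrow> 'a) \<Rightarrow> real \<Rightarrow> real \<Rightarrow> ('a + (real \<Rightarrow> 'a) set) set" where
  "cone_neighbourhood X d c R e =
     Inl ` {x \<in> X. d (c 0) x > R \<and>
       (\<exists>y\<in>X. d (c 0) y = R \<and> d y x = d (c 0) x - R \<and> d y (c R) < e)} \<union>
     Inr ` {\<xi> \<in> geometric_boundary X d. \<exists>c'\<in>\<xi>. c' 0 = c 0 \<and> d (c' R) (c R) < e}"

(* For a Hadamard space the topology does not depend on the base point p. *)
definition cone_topology ::
  "'a set \<Rightarrow> ('a \<Rightarrow> 'a \<Rightarrow> real) \<Rightarrow> 'a \<Rightarrow> ('a + (real \<Rightarrow> 'a) set) topology" where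
  "cone_topology X d p = topology_generated_by
     ({Inl ` {y \<in> X. d x y < e} | x e. x \<in> X \<and> e > 0} \<union>
      {cone_neighbourhood X d c R e | c R e.
         c \<in> geodesic_rays X d \<and> c 0 = p \<and> R > 0 \<and> e > 0})"


section \<open>Limit sets in \<open>(H\<^sup>2)\<^sup>r\<close>\<close>

definition hyp_dist :: "complex \<Rightarrow> complex \<Rightarrow> real" where
  "hyp_dist z w = arcosh (1 + (cmod (z - w))\<^sup>2 / (2 * Im z * Im w))"

definition H2_pow :: "nat \<Rightarrow> (nat \<Rightarrow> complex) set" where
  "H2_pow r = (\<Pi>\<^sub>E i\<in>{..<r}. upper_half_plane)"

definition H2_pow_dist :: "nat \<Rightarrow> (nat \<Rightarrow> complex) \<Rightarrow> (nat \<Rightarrow> complex) \<Rightarrow> real" where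
  "H2_pow_dist r x y = L2_set (\<lambda>i. hyp_dist (x i) (y i)) {..<r}"

definition H2_pow_basepoint :: "nat \<Rightarrow> nat \<Rightarrow> complex" where
  "H2_pow_basepoint r = (\<lambda>i\<in>{..<r}. \<i>)"

definition boundary_H2_pow :: "nat \<Rightarrow> (real \<Rightarrow> nat \<Rightarrow> complex) set set" where
  "boundary_H2_pow r = geometric_boundary (H2_pow r) (H2_pow_dist r)"

definition furstenberg_boundary :: "nat \<Rightarrow> (nat \<Rightarrow> (real \<Rightarrow> complex) set) set" where
  "furstenberg_boundary r = (\<Pi>\<^sub>E i\<in>{..<r}. geometric_boundary upper_half_plane hyp_dist)"

definition limit_set ::
  "nat \<Rightarrow> (nat \<Rightarrow> psl) set \<Rightarrow> (nat \<Rightarrow> complex) \<Rightarrow> (real \<Rightarrow> nat \<Rightarrow> complex) set set" where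
  "limit_set r \<Gamma> x = {\<xi> \<in> boundary_H2_pow r.
     Inr \<xi> \<in> cone_topology (H2_pow r) (H2_pow_dist r) (H2_pow_basepoint r) closure_of
       (Inl ` ((\<lambda>g. psl_pow_act r g x) ` \<Gamma>))}"

definition regular_ray :: "nat \<Rightarrow> (real \<Rightarrow> nat \<Rightarrow> complex) \<Rightarrow> bool" where
  "regular_ray r c \<longleftrightarrow> c \<in> geodesic_rays (H2_pow r) (H2_pow_dist r) \<and>
     (\<forall>i<r. \<not> (\<exists>z. \<forall>t\<ge>0. c t i = z))"

definition regular_boundary :: "nat \<Rightarrow> (real \<Rightarrow> nat \<Rightarrow> complex) set set" where
  "regular_boundary r =
     (\<lambda>c. asymptotic (H2_pow r) (H2_pow_dist r) `` {c}) ` {c. regular_ray r c}"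

definition regular_limit_set ::
  "nat \<Rightarrow> (nat \<Rightarrow> psl) set \<Rightarrow> (nat \<Rightarrow> complex) \<Rightarrow> (real \<Rightarrow> nat \<Rightarrow> complex) set set" where
  "regular_limit_set r \<Gamma> x = limit_set r \<Gamma> x \<inter> regular_boundary r"

(* Each component of a ray representing a regular boundary point is a geodesic ray of positive
   constant speed. *)
definition furstenberg_limit_set ::
  "nat \<Rightarrow> (nat \<Rightarrow> psl) set \<Rightarrow> (nat \<Rightarrow> complex) \<Rightarrow> (nat \<Rightarrow> (real \<Rightarrow> complex) set) set" where
  "furstenberg_limit_set r \<Gamma> x =
     {(\<lambda>i\<in>{..<r}. endpoint upper_half_plane hyp_dist (\<lambda>t. c t i)) | c \<xi>.
        \<xi> \<in> regular_limit_set r \<Gamma> x \<and> c \<in> \<xi>}"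

end

theory Submission
  imports Defs "Jordan_Normal_Form.Char_Poly"
begin

hide_const (open) Matrix.mat Matrix.vec Determinant.det Matrix.row Matrix.col Matrix.unit_vec Matrix.transpose_mat Ring_Hom.ring_hom
hide_type (open) Matrix.vec Matrix.mat
hide_fact (open) Matrix.mat_def Matrix.vec_eq_iff Ring_Hom.ring_hom_def
no_notation Matrix.vec_index (infixl "$" 100)

text \<open>
  Lift \<open>\<Gamma>\<close> to tuples of matrices and call a tuple of singular matrices a limit if it can be
  approximated, up to scaling in each factor, by lifts of elements of \<open>\<Gamma>\<close>. The point is that every tuple
  of singular matrices is a limit. Then elements \<open>\<delta> g\<^sup>k\<close>, with \<open>g\<close> hyperbolic in every factor and \<open>\<delta>\<close>
  close to a tuple of rank one with prescribed images, move the orbit point towards any prescribed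
  tuple of endpoints, at rates that are determined by the translation lengths of \<open>g\<close> and are
  therefore positive in every factor.

  In the factor \<open>j\<close> alone the claim follows from finite area: a half strip of infinite area
  meets infinitely many of its translates, hence limits have image or kernel in every prescribed interval. The
  other factors are added one at a time. A subset of the factors to which \<open>\<Gamma>\<close> projects
  non-discretely is treated by producing unipotent limits and separating the factors with the help of a
  hyperbolic \<open>g\<close>; if the projection to a set of factors is discrete, there are elements of \<open>\<Gamma>\<close> that
  converge to the identity on a maximal non-discrete subset and are unbounded on its complement.

  Separating the factors requires that the conjugates of the squared trace of \<open>g\<close>
  are distinct. They are the roots of a rational characteristic polynomial, so it is enough that the conjugate
  at \<open>j\<close> is a simple root. It exceeds 4 while the conjugates at ramified places are at most 4. If it were equal to
  another conjugate at an unramified place \<open>l\<close>, then by the hypothesis on the trace fields the traces of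
  the squares in the factors \<open>l\<close> and \<open>j\<close> would agree, so that \<open>p\<^sub>l(\<Gamma>)\<close> would be discrete together with
  \<open>p\<^sub>j(\<Gamma>)\<close>.
\<close>
section \<open>Real two by two matrices\<close>

text \<open>Scaling every factor by a scalar of its own lets one closure serve all purposes: where a
  sequence of the group converges the limit component is invertible, where it escapes the component
  is singular, and both may occur in one tuple. The closure is multiplicative and stable under
  adjugates, so density becomes algebra with rank one matrices, whose products keep the first image
  and the last kernel.

  The arithmetic enters through traces. A norm one quaternion has a reduced trace that is conjugated
  by the embeddings, so trace 2 or -2 in one factor is trace 2 or -2 in all of them; this transports
  the absence of common fixed points from the factor \<open>j\<close> to the others. Elements of
  \<Gamma> need not come from norm one units: commensurability only gives a fixed power of each of
  them, and density at \<open>j\<close> as well as non-discreteness must be shown to survive the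
  passage to powers. Signs are tracked because \<open>PSL2R\<close> determines matrices up to a sign
  in each factor.\<close>

definition mat2 :: "real \<Rightarrow> real \<Rightarrow> real \<Rightarrow> real \<Rightarrow> real^2^2" where
  "mat2 a b c d = vector [vector [a, b], vector [c, d]]"

text \<open>The adjugate. It is the inverse on determinant one, but stays linear and continuous on
  all matrices, so it can be applied to scaled elements and to their singular limits.\<close>

definition adj2 :: "real^2^2 \<Rightarrow> real^2^2" where
  "adj2 X = mat2 (X $ 2 $ 2) (- X $ 1 $ 2) (- X $ 2 $ 1) (X $ 1 $ 1)"

text \<open>The area form. It vanishes exactly on dependent pairs and so compares points of the
  projective line without a chart.\<close>

definition cross :: "real \<times> real \<Rightarrow> real \<times> real \<Rightarrow> real" where
  "cross x y = fst x * snd y - snd x * fst y"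

definition mat_app :: "real^2^2 \<Rightarrow> real \<times> real \<Rightarrow> real \<times> real" where
  "mat_app X v = (X $ 1 $ 1 * fst v + X $ 1 $ 2 * snd v, X $ 2 $ 1 * fst v + X $ 2 $ 2 * snd v)"

(* The operator v \<mapsto> cross z v * x: its image is spanned by x and its kernel by z. *)
definition rank1 :: "real \<times> real \<Rightarrow> real \<times> real \<Rightarrow> real^2^2" where
  "rank1 x z = mat2 (- fst x * snd z) (fst x * fst z) (- snd x * snd z) (snd x * fst z)"

lemma mat2_nth [simp]:
  "mat2 a b c d $ 1 $ 1 = a" "mat2 a b c d $ 1 $ 2 = b"
  "mat2 a b c d $ 2 $ 1 = c" "mat2 a b c d $ 2 $ 2 = d"
  by (simp_all add: mat2_def)

lemma mat2_ext:
  "X = Y \<longleftrightarrow> X $ 1 $ 1 = Y $ 1 $ 1 \<and> X $ 1 $ 2 = Y $ 1 $ 2 \<and>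
     X $ 2 $ 1 = Y $ 2 $ 1 \<and> X $ 2 $ 2 = (Y :: real^2^2) $ 2 $ 2"
  by (auto simp: vec_eq_iff forall_2)

lemma mat2_eq: "X = mat2 (X $ 1 $ 1) (X $ 1 $ 2) (X $ 2 $ 1) (X $ 2 $ 2)"
  by (simp add: mat2_ext)

lemma mat2_cases: obtains a b c d where "X = mat2 a b c d"
  using mat2_eq by blast

lemma matrix_mult_nth:
  fixes X Y :: "real^2^2"
  shows "(X ** Y) $ i $ j = X $ i $ 1 * Y $ 1 $ j + X $ i $ 2 * Y $ 2 $ j"
  by (simp add: matrix_matrix_mult_def sum_2)

lemma mat_1_eq: "(mat 1 :: real^2^2) = mat2 1 0 0 1"
  by (simp add: mat2_ext mat_def)

lemma mat2_mult [simp]: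
  "mat2 a b c d ** mat2 e f g h = mat2 (a*e + b*g) (a*f + b*h) (c*e + d*g) (c*f + d*h)"
  by (simp add: mat2_ext matrix_mult_nth)

lemma mat2_add [simp]: "mat2 a b c d + mat2 e f g h = mat2 (a+e) (b+f) (c+g) (d+h)"
  by (simp add: mat2_ext)

lemma mat2_diff [simp]: "mat2 a b c d - mat2 e f g h = mat2 (a-e) (b-f) (c-g) (d-h)"
  by (simp add: mat2_ext)

lemma mat2_uminus [simp]: "- mat2 a b c d = mat2 (-a) (-b) (-c) (-d)"
  by (simp add: mat2_ext)

lemma mat2_scaleR [simp]: "s *\<^sub>R mat2 a b c d = mat2 (s*a) (s*b) (s*c) (s*d)"
  by (simp add: mat2_ext)

lemma mat2_inject [simp]: "mat2 a b c d = mat2 e f g h \<longleftrightarrow> a = e \<and> b = f \<and> c = g \<and> d = h"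
  by (simp add: mat2_ext)

lemma mat2_zero: "(0 :: real^2^2) = mat2 0 0 0 0"
  by (simp add: mat2_ext)

lemma det_mat2 [simp]: "det (mat2 a b c d) = a * d - b * c"
  by (simp add: det_2)

lemma trace_mat2 [simp]: "trace (mat2 a b c d) = a + d"
  by (simp add: trace_def sum_2)

lemma adj2_mat2 [simp]: "adj2 (mat2 a b c d) = mat2 d (-b) (-c) a"
  by (simp add: adj2_def)

lemma det_eq: "det (X :: real^2^2) = X $ 1 $ 1 * X $ 2 $ 2 - X $ 1 $ 2 * X $ 2 $ 1"
  by (simp add: det_2)

lemma trace_eq: "trace (X :: real^2^2) = X $ 1 $ 1 + X $ 2 $ 2"
  by (simp add: trace_def sum_2)

lemma adj2_mult: "adj2 (X ** Y) = adj2 Y ** adj2 X"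
  by (cases X rule: mat2_cases; cases Y rule: mat2_cases) (simp add: algebra_simps)

lemma adj2_adj2 [simp]: "adj2 (adj2 X) = X"
  by (cases X rule: mat2_cases) simp

lemma adj2_scaleR: "adj2 (c *\<^sub>R X) = c *\<^sub>R adj2 X"
  by (cases X rule: mat2_cases) simp

lemma adj2_mat_1 [simp]: "adj2 (mat 1) = mat 1"
  by (simp add: mat_1_eq)

lemma det_adj2 [simp]: "det (adj2 X) = det X"
  by (cases X rule: mat2_cases) simp

lemma mult_adj2: "X ** adj2 X = det X *\<^sub>R mat 1" "adj2 X ** X = det X *\<^sub>R mat 1"
  by (cases X rule: mat2_cases; simp add: mat_1_eq)+

lemma mult_adj2_1: "det X = 1 \<Longrightarrow> X ** adj2 X = mat 1" "det X = 1 \<Longrightarrow> adj2 X ** X = mat 1"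
  by (simp_all add: mult_adj2)

lemma scaleR_matrix_mult:
  fixes X Y :: "real^2^2"
  shows "(c *\<^sub>R X) ** Y = c *\<^sub>R (X ** Y)" "X ** (c *\<^sub>R Y) = c *\<^sub>R (X ** Y)"
  by (cases X rule: mat2_cases; cases Y rule: mat2_cases; simp add: algebra_simps)+

lemma det_scaleR2: "det (c *\<^sub>R X) = c\<^sup>2 * det (X :: real^2^2)"
  by (cases X rule: mat2_cases) (simp add: power2_eq_square algebra_simps)

lemma trace_scaleR: "trace (c *\<^sub>R X) = c * trace (X :: real^2^2)"
  by (cases X rule: mat2_cases) (simp add: algebra_simps)

lemma trace_conj: "det Q = 1 \<Longrightarrow> trace (Q ** X ** adj2 Q) = trace X"
proof -
  assume "det Q = 1"
  moreover have "trace (Q ** X ** adj2 Q) = det Q * trace X"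
    by (cases X rule: mat2_cases; cases Q rule: mat2_cases) (simp add: algebra_simps)
  ultimately show ?thesis by simp
qed

lemma tendsto_mat_iff:
  fixes f :: "'a \<Rightarrow> real^2^2"
  shows "(f \<longlongrightarrow> X) F \<longleftrightarrow> ((\<lambda>n. f n $ 1 $ 1) \<longlongrightarrow> X $ 1 $ 1) F \<and> ((\<lambda>n. f n $ 1 $ 2) \<longlongrightarrow> X $ 1 $ 2) F \<and>
    ((\<lambda>n. f n $ 2 $ 1) \<longlongrightarrow> X $ 2 $ 1) F \<and> ((\<lambda>n. f n $ 2 $ 2) \<longlongrightarrow> X $ 2 $ 2) F"
proof (intro iffI conjI)
  assume *: "((\<lambda>n. f n $ 1 $ 1) \<longlongrightarrow> X $ 1 $ 1) F \<and> ((\<lambda>n. f n $ 1 $ 2) \<longlongrightarrow> X $ 1 $ 2) F \<and>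
    ((\<lambda>n. f n $ 2 $ 1) \<longlongrightarrow> X $ 2 $ 1) F \<and> ((\<lambda>n. f n $ 2 $ 2) \<longlongrightarrow> X $ 2 $ 2) F"
  have "((\<lambda>n. f n $ i $ j) \<longlongrightarrow> X $ i $ j) F" for i j
    using * exhaust_2[of i] exhaust_2[of j] by auto
  then show "(f \<longlongrightarrow> X) F" by (intro vec_tendstoI)
qed (intro tendsto_vec_nth; assumption)+

lemma tendsto_mat2 [tendsto_intros]:
  "(a \<longlongrightarrow> a') F \<Longrightarrow> (b \<longlongrightarrow> b') F \<Longrightarrow> (c \<longlongrightarrow> c') F \<Longrightarrow> (d \<longlongrightarrow> d') F \<Longrightarrow>
   ((\<lambda>n. mat2 (a n) (b n) (c n) (d n)) \<longlongrightarrow> mat2 a' b' c' d') F"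
  by (simp add: tendsto_mat_iff)

lemma tendsto_matrix_mult [tendsto_intros]:
  fixes f g :: "'a \<Rightarrow> real^2^2"
  assumes "(f \<longlongrightarrow> X) F" "(g \<longlongrightarrow> Y) F"
  shows "((\<lambda>n. f n ** g n) \<longlongrightarrow> X ** Y) F"
  using assms unfolding tendsto_mat_iff matrix_mult_nth by (auto intro!: tendsto_intros)

lemma tendsto_adj2 [tendsto_intros]: "(f \<longlongrightarrow> X) F \<Longrightarrow> ((\<lambda>n. adj2 (f n)) \<longlongrightarrow> adj2 X) F"
  unfolding adj2_def by (auto simp: tendsto_mat_iff intro!: tendsto_intros)

lemma tendsto_det2 [tendsto_intros]:
  fixes f :: "'a \<Rightarrow> real^2^2"
  shows "(f \<longlongrightarrow> X) F \<Longrightarrow> ((\<lambda>n. det (f n)) \<longlongrightarrow> det X) F"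
  unfolding det_eq by (auto simp: tendsto_mat_iff intro!: tendsto_intros)

lemma tendsto_trace2 [tendsto_intros]:
  fixes f :: "'a \<Rightarrow> real^2^2"
  shows "(f \<longlongrightarrow> X) F \<Longrightarrow> ((\<lambda>n. trace (f n)) \<longlongrightarrow> trace X) F"
  unfolding trace_eq by (auto simp: tendsto_mat_iff intro!: tendsto_intros)

lemma mat_nth_le_norm: "\<bar>X $ i $ j\<bar> \<le> norm (X :: real^2^2)"
proof -
  have "\<bar>X $ i $ j\<bar> \<le> norm (X $ i)" by (rule component_le_norm_cart)
  also have "\<dots> \<le> norm X" by (rule Finite_Cartesian_Product.norm_nth_le)
  finally show ?thesis .
qed

lemma norm_mat_sq: "(norm (X :: real^2^2))\<^sup>2 = (X $ 1 $ 1)\<^sup>2 + (X $ 1 $ 2)\<^sup>2 + (X $ 2 $ 1)\<^sup>2 + (X $ 2 $ 2)\<^sup>2"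
  by (simp add: norm_vec_def L2_set_def sum_2)

section \<open>Matrices of rank one in terms of image and kernel\<close>

lemma tendsto_rank1 [tendsto_intros]:
  "(x \<longlongrightarrow> x') F \<Longrightarrow> (z \<longlongrightarrow> z') F \<Longrightarrow> ((\<lambda>n. rank1 (x n) (z n)) \<longlongrightarrow> rank1 x' z') F"
  unfolding rank1_def by (intro tendsto_intros)

lemma rank1_mult_rank1: "rank1 x z ** rank1 x' z' = cross z x' *\<^sub>R rank1 x z'"
  by (simp add: rank1_def cross_def algebra_simps)

lemma adj2_rank1: "adj2 (rank1 x z) = - rank1 z x"
  by (simp add: rank1_def)

lemma mult_rank1: "X ** rank1 x z = rank1 (mat_app X x) z"
  by (cases X rule: mat2_cases) (simp add: rank1_def mat_app_def algebra_simps)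

lemma rank1_mult: "rank1 x z ** X = rank1 x (mat_app (adj2 X) z)"
  by (cases X rule: mat2_cases) (simp add: rank1_def mat_app_def algebra_simps)

lemma det_rank1 [simp]: "det (rank1 x z) = 0"
  by (simp add: rank1_def)

lemma trace_rank1: "trace (rank1 x z) = cross z x"
  by (simp add: rank1_def cross_def)

lemma scaleR_rank1: "rank1 (s *\<^sub>R x) z = s *\<^sub>R rank1 x z" "rank1 x (s *\<^sub>R z) = s *\<^sub>R rank1 x z"
  by (simp_all add: rank1_def)

lemma rank1_eq_0: "rank1 x z = 0 \<longleftrightarrow> x = 0 \<or> z = 0"
  by (cases x; cases z) (auto simp: rank1_def mat2_zero prod_eq_iff)

lemma cross_same [simp]: "cross x x = 0"
  by (simp add: cross_def)

lemma cross_swap: "cross x y = - cross y x"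
  by (simp add: cross_def)

lemma mat_app_mult: "mat_app (X ** Y) v = mat_app X (mat_app Y v)"
  by (simp add: mat_app_def matrix_mult_nth algebra_simps)

lemma cross_mat_app: "cross (mat_app X u) (mat_app X v) = det X * cross u v"
  by (cases X rule: mat2_cases) (simp add: mat_app_def cross_def algebra_simps)

lemma mat_app_rank1: "mat_app (rank1 x z) v = cross z v *\<^sub>R x"
  by (simp add: rank1_def mat_app_def cross_def prod_eq_iff algebra_simps)

lemma det_zero_rank1:
  assumes "det X = 0" obtains x z where "X = rank1 x z"
proof -
  obtain a b c d where X: "X = mat2 a b c d" by (rule mat2_cases)
  with assms have d: "a * d = b * c" by simp
  show thesis
  proof (cases "b = 0 \<and> d = 0")
    case True
    then have "X = rank1 (a, c) (0, -1)" by (simp add: X rank1_def)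
    then show ?thesis using that by blast
  next
    case False
    then consider "b \<noteq> 0" | "d \<noteq> 0" by blast
    then show ?thesis
    proof cases
      case 1
      with d have "X = rank1 (b, d) (1, -a/b)" by (simp add: X rank1_def field_simps)
      then show ?thesis using that by blast
    next
      case 2
      with d have "X = rank1 (b, d) (1, -c/d)" by (simp add: X rank1_def field_simps)
      then show ?thesis using that by blast
    qed
  qed
qed

lemma cross_eq_0_iff:
  assumes "x \<noteq> 0" shows "cross x y = 0 \<longleftrightarrow> (\<exists>s. y = s *\<^sub>R x)"
proof
  assume c: "cross x y = 0"
  show "\<exists>s. y = s *\<^sub>R x"
  proof (cases "fst x = 0")
    case True
    with assms have "snd x \<noteq> 0" by (simp add: prod_eq_iff)
    with True c have "y = (snd y / snd x) *\<^sub>R x" by (auto simp: prod_eq_iff cross_def)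
    then show ?thesis by blast
  next
    case False
    with c have "y = (fst y / fst x) *\<^sub>R x" by (auto simp: prod_eq_iff cross_def field_simps)
    then show ?thesis by blast
  qed
qed (auto simp: cross_def)

text \<open>When both vectors move along the fixed directions in \<open>f\<close> and
  \<open>h\<close>, the three unwanted conditions become the roots of one polynomial in
  \<open>t\<close>, which is nonzero since its leading coefficient is 1.\<close>

lemma approx_rank1_generic:
  assumes "e > 0"
  shows "\<exists>x' z'. norm (rank1 x' z' - rank1 x z) < e \<and> cross x' z' \<noteq> 0 \<and> snd x' \<noteq> 0 \<and> snd z' \<noteq> 0"
proof -
  define f where "f t = (x + t *\<^sub>R (1, 1))" for t :: real
  define h where "h t = (z + t *\<^sub>R (0, 1))" for t :: real
  have "((\<lambda>t. rank1 (f t) (h t)) \<longlongrightarrow> rank1 (f 0) (h 0)) (at 0)"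
    unfolding f_def h_def by (intro tendsto_intros)
  then have "eventually (\<lambda>t. dist (rank1 (f t) (h t)) (rank1 x z) < e) (at 0)"
    using assms unfolding tendsto_iff by (auto simp: f_def h_def zero_prod_def[symmetric])
  then have "eventually (\<lambda>t. dist (rank1 (f t) (h t)) (rank1 x z) < e) (at_right 0)"
    by (simp add: eventually_at_split)
  then obtain d where d: "d > 0" "\<And>t. 0 < t \<Longrightarrow> t < d \<Longrightarrow> dist (rank1 (f t) (h t)) (rank1 x z) < e"
    unfolding eventually_at_right_field by auto
  define p where "p = [:cross x z, fst x + cross (1, 1) z, 1:] * [:snd x, 1:] * [:snd z, 1:]"
  have p: "poly p t = cross (f t) (h t) * snd (f t) * snd (h t)" for t
    by (simp add: p_def f_def h_def cross_def algebra_simps)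
  have "p \<noteq> 0" by (simp add: p_def)
  then have "finite {t. poly p t = 0}" by (rule poly_roots_finite)
  moreover have "infinite {0<..<d}" using d(1) by (simp add: infinite_Ioo)
  ultimately obtain t where "t \<in> {0<..<d}" "poly p t \<noteq> 0"
    by (metis (mono_tags, lifting) finite_subset mem_Collect_eq subsetI)
  then show ?thesis
    using d(2)[of t] by (intro exI[of _ "f t"] exI[of _ "h t"]) (auto simp: p dist_norm)
qed

section \<open>Projective closures of groups of tuples of matrices\<close>

locale tuple_group =
  fixes G :: "(nat \<Rightarrow> real^2^2) set"
  assumes one_mem: "(\<lambda>_. mat 1) \<in> G"
    and mult_mem: "A \<in> G \<Longrightarrow> B \<in> G \<Longrightarrow> (\<lambda>i. A i ** B i) \<in> G"
    and inv_mem: "A \<in> G \<Longrightarrow> (\<lambda>i. adj2 (A i)) \<in> G"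
    and det_mem: "A \<in> G \<Longrightarrow> det (A i) = 1"

text \<open>On tuples with nonzero components this is the closure of \<open>G\<close> in the product
  over \<open>T\<close> of the projective spaces of matrices. The scalars may vanish, so zero
  components are approximated trivially.\<close>

definition proj_closure :: "nat set \<Rightarrow> (nat \<Rightarrow> real^2^2) set \<Rightarrow> (nat \<Rightarrow> real^2^2) set" where
  "proj_closure T G = {X. \<forall>e>0. \<exists>A\<in>G. \<exists>c. \<forall>i\<in>T. norm (c i *\<^sub>R A i - X i) < e}"

definition proj_full :: "nat set \<Rightarrow> (nat \<Rightarrow> real^2^2) set \<Rightarrow> bool" where
  "proj_full T G \<longleftrightarrow> (\<forall>X. (\<forall>i\<in>T. det (X i) = 0) \<longrightarrow> X \<in> proj_closure T G)"

definition central :: "real^2^2 \<Rightarrow> bool" where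
  "central A \<longleftrightarrow> A = mat 1 \<or> A = - mat 1"

text \<open>Non-discreteness on the factors in \<open>T\<close>. The signs make it a condition in
  PSL(2,R), and the last clause excludes elements that are trivial there in every component.\<close>

definition near_one :: "nat set \<Rightarrow> (nat \<Rightarrow> real^2^2) set \<Rightarrow> bool" where
  "near_one T G \<longleftrightarrow> (\<forall>e>0. \<exists>A\<in>G. \<exists>s. (\<forall>i. \<bar>s i\<bar> = 1) \<and> (\<forall>i\<in>T. norm (s i *\<^sub>R A i - mat 1) < e) \<and>
     \<not> (\<forall>i. central (A i)))"

lemma proj_closure_seqI:
  assumes "finite T" "\<And>n. A n \<in> G" "\<And>i. i \<in> T \<Longrightarrow> (\<lambda>n. c n i *\<^sub>R A n i) \<longlonglongrightarrow> X i"
  shows "X \<in> proj_closure T G"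
  unfolding proj_closure_def
proof safe
  fix e :: real assume "e > 0"
  then have "\<forall>i\<in>T. eventually (\<lambda>n. norm (c n i *\<^sub>R A n i - X i) < e) sequentially"
    using assms(3) by (auto simp: tendsto_iff dist_norm)
  then have "eventually (\<lambda>n. \<forall>i\<in>T. norm (c n i *\<^sub>R A n i - X i) < e) sequentially"
    using assms(1) by (simp add: eventually_ball_finite)
  then obtain n where "\<forall>i\<in>T. norm (c n i *\<^sub>R A n i - X i) < e"
    by (auto simp: eventually_sequentially)
  with assms(2) show "\<exists>A\<in>G. \<exists>c. \<forall>i\<in>T. norm (c i *\<^sub>R A i - X i) < e" by blast
qed

lemma tendsto_inverse_SucI:
  fixes f :: "nat \<Rightarrow> 'a::real_normed_vector"
  assumes "\<And>n. norm (f n - l) < inverse (real (Suc n))"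
  shows "f \<longlonglongrightarrow> l"
proof (rule LIM_zero_cancel, rule Lim_null_comparison[OF _ LIMSEQ_inverse_real_of_nat])
  show "eventually (\<lambda>n. norm (f n - l) \<le> inverse (real (Suc n))) sequentially"
    using assms by (intro always_eventually allI less_imp_le)
qed

lemma proj_closure_seqE:
  assumes "X \<in> proj_closure T G"
  obtains A c where "\<And>n::nat. A n \<in> G" "\<And>i. i \<in> T \<Longrightarrow> (\<lambda>n. c n i *\<^sub>R A n i) \<longlonglongrightarrow> X i"
proof -
  have "\<exists>A c. A \<in> G \<and> (\<forall>i\<in>T. norm (c i *\<^sub>R A i - X i) < inverse (real (Suc n)))" for n
  proof -
    have "inverse (real (Suc n)) > 0" by simp
    with assms show ?thesis unfolding proj_closure_def by blast
  qed
  then obtain A c where "\<And>n. A n \<in> G \<and> (\<forall>i\<in>T. norm (c n i *\<^sub>R A n i - X i) < inverse (real (Suc n)))"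
    by metis
  then show thesis by (intro that[of A c] tendsto_inverse_SucI) auto
qed

lemma proj_closure_cong:
  "(\<And>i. i \<in> T \<Longrightarrow> X i = Y i) \<Longrightarrow> X \<in> proj_closure T G \<longleftrightarrow> Y \<in> proj_closure T G"
  by (simp add: proj_closure_def)

lemma proj_closure_closed:
  assumes "\<And>e. e > 0 \<Longrightarrow> \<exists>Y\<in>proj_closure T G. \<forall>i\<in>T. norm (Y i - X i) < e"
  shows "X \<in> proj_closure T G"
  unfolding proj_closure_def
proof safe
  fix e :: real assume "e > 0"
  then obtain Y where Y: "Y \<in> proj_closure T G" "\<forall>i\<in>T. norm (Y i - X i) < e/2"
    using assms[of "e/2"] by auto
  then obtain A c where "A \<in> G" "\<forall>i\<in>T. norm (c i *\<^sub>R A i - Y i) < e/2"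
    using \<open>e > 0\<close> unfolding proj_closure_def by (auto dest: spec[of _ "e/2"])
  then have "norm (c i *\<^sub>R A i - X i) < e" if "i \<in> T" for i
    using Y(2) that norm_triangle_lt[of "c i *\<^sub>R A i - Y i" "Y i - X i" e] by fastforce
  then show "\<exists>A\<in>G. \<exists>c. \<forall>i\<in>T. norm (c i *\<^sub>R A i - X i) < e"
    using \<open>A \<in> G\<close> by blast
qed

lemma proj_closure_limit:
  assumes "finite T" "\<And>n. Y n \<in> proj_closure T G" "\<And>i. i \<in> T \<Longrightarrow> (\<lambda>n. Y n i) \<longlonglongrightarrow> X i"
  shows "X \<in> proj_closure T G"
proof (rule proj_closure_closed)
  fix e :: real assume "e > 0"
  then have "\<forall>i\<in>T. eventually (\<lambda>n. norm (Y n i - X i) < e) sequentially"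
    using assms(3) by (auto simp: tendsto_iff dist_norm)
  then have "eventually (\<lambda>n. \<forall>i\<in>T. norm (Y n i - X i) < e) sequentially"
    using assms(1) by (simp add: eventually_ball_finite)
  then show "\<exists>Y\<in>proj_closure T G. \<forall>i\<in>T. norm (Y i - X i) < e"
    using assms(2) by (auto simp: eventually_sequentially)
qed

lemma proj_closure_scale:
  assumes "finite T" "X \<in> proj_closure T G"
  shows "(\<lambda>i. s i *\<^sub>R X i) \<in> proj_closure T G"
proof -
  obtain A c where A: "\<And>n::nat. A n \<in> G" "\<And>i. i \<in> T \<Longrightarrow> (\<lambda>n. c n i *\<^sub>R A n i) \<longlonglongrightarrow> X i"
    using assms(2) by (rule proj_closure_seqE) blast
  show ?thesis
  proof (rule proj_closure_seqI[where c = "\<lambda>n i. s i * c n i"])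
    show "(\<lambda>n. (s i * c n i) *\<^sub>R A n i) \<longlonglongrightarrow> s i *\<^sub>R X i" if "i \<in> T" for i
      using tendsto_scaleR[OF tendsto_const[of "s i"] A(2)[OF that]] by simp
  qed (use assms(1) A in auto)
qed

text \<open>By density and closedness it is enough to treat rank one matrices in general position on
  \<open>R\<close>: image and kernel differ, and neither is the direction (1, 0). The other
  components are kept.\<close>

lemma proj_closure_generic:
  assumes "\<And>i. i \<in> R \<Longrightarrow> det (X i) = 0"
    and "\<And>x z. (\<And>i. i \<in> R \<Longrightarrow> cross (x i) (z i) \<noteq> 0 \<and> snd (x i) \<noteq> 0 \<and> snd (z i) \<noteq> 0) \<Longrightarrow>
      (\<lambda>i. if i \<in> R then rank1 (x i) (z i) else X i) \<in> proj_closure T G"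
  shows "X \<in> proj_closure T G"
proof (rule proj_closure_closed)
  fix e :: real assume "e > 0"
  have "\<exists>x' z'. norm (rank1 x' z' - X i) < e \<and> cross x' z' \<noteq> 0 \<and> snd x' \<noteq> 0 \<and> snd z' \<noteq> 0"
    if i: "i \<in> R" for i
    using det_zero_rank1[OF assms(1)[OF i]] approx_rank1_generic[OF \<open>e > 0\<close>] by metis
  then obtain x z where xz: "\<And>i. i \<in> R \<Longrightarrow> norm (rank1 (x i) (z i) - X i) < e \<and>
      cross (x i) (z i) \<noteq> 0 \<and> snd (x i) \<noteq> 0 \<and> snd (z i) \<noteq> 0"
    by metis
  have "\<forall>i\<in>T. norm ((if i \<in> R then rank1 (x i) (z i) else X i) - X i) < e"
    using xz \<open>e > 0\<close> by auto
  moreover have "(\<lambda>i. if i \<in> R then rank1 (x i) (z i) else X i) \<in> proj_closure T G"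
    using xz by (intro assms(2)) auto
  ultimately show "\<exists>Y\<in>proj_closure T G. \<forall>i\<in>T. norm (Y i - X i) < e"
    by (rule bexI)
qed

lemma bounded_seqs_convergent_subseq:
  fixes f :: "nat \<Rightarrow> 'i \<Rightarrow> 'a::{heine_borel, real_normed_vector}"
  assumes "finite T" "\<And>i. i \<in> T \<Longrightarrow> bounded (range (\<lambda>n. f n i))"
  shows "\<exists>\<sigma> l. strict_mono \<sigma> \<and> (\<forall>i\<in>T. (\<lambda>n. f (\<sigma> n) i) \<longlonglongrightarrow> l i)"
  using assms
proof (induction T rule: finite_induct)
  case empty
  show ?case by (intro exI[of _ id]) (auto simp: strict_mono_def)
next
  case (insert k T)
  then obtain \<sigma> l where \<sigma>: "strict_mono \<sigma>" "\<forall>i\<in>T. (\<lambda>n. f (\<sigma> n) i) \<longlonglongrightarrow> l i" by auto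
  have "bounded (range (\<lambda>n. f (\<sigma> n) k))"
    by (rule bounded_subset[OF insert.prems[of k]]) auto
  then obtain m \<tau> where \<tau>: "strict_mono \<tau>" "(\<lambda>n. f (\<sigma> (\<tau> n)) k) \<longlonglongrightarrow> m"
    using bounded_imp_convergent_subsequence[of "\<lambda>n. f (\<sigma> n) k"] by (auto simp: o_def)
  have "(\<lambda>n. f (\<sigma> (\<tau> n)) i) \<longlonglongrightarrow> l i" if "i \<in> T" for i
    using LIMSEQ_subseq_LIMSEQ[OF _ \<tau>(1)] \<sigma>(2) that by (auto simp: o_def)
  then show ?case
    using \<tau> strict_mono_o[OF \<sigma>(1) \<tau>(1)] insert.hyps
    by (intro exI[of _ "\<sigma> \<circ> \<tau>"] exI[of _ "l(k := m)"]) (auto simp: o_def)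
qed

context tuple_group
begin

lemma mem_proj_closure: "A \<in> G \<Longrightarrow> A \<in> proj_closure T G"
  unfolding proj_closure_def by (auto intro!: bexI[of _ A] exI[of _ "\<lambda>_. 1"])

lemma proj_closure_mult:
  assumes "finite T" "X \<in> proj_closure T G" "Y \<in> proj_closure T G"
  shows "(\<lambda>i. X i ** Y i) \<in> proj_closure T G"
proof -
  obtain A c where A: "\<And>n::nat. A n \<in> G" "\<And>i. i \<in> T \<Longrightarrow> (\<lambda>n. c n i *\<^sub>R A n i) \<longlonglongrightarrow> X i"
    using assms(2) by (rule proj_closure_seqE) blast
  obtain B d where B: "\<And>n::nat. B n \<in> G" "\<And>i. i \<in> T \<Longrightarrow> (\<lambda>n. d n i *\<^sub>R B n i) \<longlonglongrightarrow> Y i"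
    using assms(3) by (rule proj_closure_seqE) blast
  show ?thesis
  proof (rule proj_closure_seqI[where c = "\<lambda>n i. c n i * d n i"])
    show "(\<lambda>i. A n i ** B n i) \<in> G" for n using A B mult_mem by simp
    show "(\<lambda>n. (c n i * d n i) *\<^sub>R (A n i ** B n i)) \<longlonglongrightarrow> X i ** Y i" if "i \<in> T" for i
      using tendsto_matrix_mult[OF A(2) B(2), OF that that]
      by (simp add: scaleR_matrix_mult mult.commute)
  qed (rule assms(1))
qed

lemma proj_closure_adj2:
  assumes "finite T" "X \<in> proj_closure T G"
  shows "(\<lambda>i. adj2 (X i)) \<in> proj_closure T G"
proof -
  obtain A c where A: "\<And>n::nat. A n \<in> G" "\<And>i. i \<in> T \<Longrightarrow> (\<lambda>n. c n i *\<^sub>R A n i) \<longlonglongrightarrow> X i"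
    using assms(2) by (rule proj_closure_seqE) blast
  show ?thesis
  proof (rule proj_closure_seqI[where c = c])
    show "(\<lambda>i. adj2 (A n i)) \<in> G" for n using A inv_mem by simp
    show "(\<lambda>n. c n i *\<^sub>R adj2 (A n i)) \<longlonglongrightarrow> adj2 (X i)" if "i \<in> T" for i
      using tendsto_adj2[OF A(2)[OF that]] by (simp add: adj2_scaleR)
  qed (rule assms(1))
qed

text \<open>Group elements \<open>A n\<close> approximate \<open>Y\<close> on \<open>S\<close>; the
  left factor \<open>W n\<close> then corrects them on \<open>R\<close> and is invisible on
  \<open>S\<close>.\<close>

lemma proj_full_combine:
  assumes T: "finite T" "T = S \<union> R" "S \<inter> R = {}"
    and R: "\<And>X. (\<And>i. i \<in> R \<Longrightarrow> det (X i) = 0) \<Longrightarrow> (\<lambda>i. if i \<in> R then X i else mat 1) \<in> proj_closure T G"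
    and S: "proj_full S G"
  shows "proj_full T G"
  unfolding proj_full_def
proof safe
  fix Y assume Y: "\<forall>i\<in>T. det (Y i :: real^2^2) = 0"
  then have "Y \<in> proj_closure S G" using S T by (auto simp: proj_full_def)
  then obtain A c where A: "\<And>n::nat. A n \<in> G" "\<And>i. i \<in> S \<Longrightarrow> (\<lambda>n. c n i *\<^sub>R A n i) \<longlonglongrightarrow> Y i"
    by (rule proj_closure_seqE) blast
  define W where "W n = (\<lambda>i. if i \<in> R then Y i ** adj2 (A n i) else mat 1)" for n
  define Z where "Z n = (\<lambda>i. (if i \<in> R then 1 else c n i) *\<^sub>R (W n i ** A n i))" for n
  have "W n \<in> proj_closure T G" for n
    unfolding W_def using Y T(2) by (intro R) (simp add: det_mul)
  then have Z: "Z n \<in> proj_closure T G" for n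
    unfolding Z_def using A mem_proj_closure T(1)
    by (intro proj_closure_scale proj_closure_mult) auto
  have "Z n i = Y i" if "i \<in> R" for n i
    using that A det_mem by (simp add: Z_def W_def matrix_mul_assoc[symmetric] mult_adj2_1)
  moreover have "Z n i = c n i *\<^sub>R A n i" if "i \<in> S" for n i
    using that T(3) by (auto simp: Z_def W_def)
  ultimately have "(\<lambda>n. Z n i) \<longlonglongrightarrow> Y i" if "i \<in> T" for i
    using that T(2) A(2) by auto
  then show "Y \<in> proj_closure T G" by (rule proj_closure_limit[OF T(1) Z])
qed

text \<open>Conjugating \<open>X\<close> by elements close to \<open>rank1 (x i) (y i)\<close> on
  \<open>R\<close> keeps the identity on \<open>S\<close> and produces nilpotents
  \<open>rank1 (x i) (x i)\<close> on \<open>R\<close>. Products of two nilpotents realize every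
  image and kernel, so \<open>R\<close> moves while \<open>S\<close> stands still.\<close>

lemma proj_full_split:
  assumes T: "finite T" "T = S \<union> R" "S \<inter> R = {}"
    and X: "X \<in> proj_closure T G" "\<And>i. i \<in> S \<Longrightarrow> X i = mat 1" "\<And>i. i \<in> R \<Longrightarrow> det (X i) = 0 \<and> X i \<noteq> 0"
    and full: "proj_full S G" "proj_full R G"
  shows "proj_full T G"
proof -
  have "\<exists>p q. X i = rank1 p q \<and> p \<noteq> 0 \<and> q \<noteq> 0" if "i \<in> R" for i
    using X(3)[OF that] det_zero_rank1[of "X i"] by (metis rank1_eq_0)
  then obtain p q where pq: "\<And>i. i \<in> R \<Longrightarrow> X i = rank1 (p i) (q i) \<and> p i \<noteq> 0 \<and> q i \<noteq> 0"
    by metis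
  \<comment> \<open>Each of \<open>p\<close> and \<open>q\<close> rules out at most one of four
    pairwise independent directions.\<close>
  have ex: "\<exists>y. cross y p \<noteq> 0 \<and> cross q y \<noteq> 0" if "p \<noteq> 0" "q \<noteq> 0" for p q :: "real \<times> real"
  proof -
    have "\<not> (\<forall>y\<in>{(1,0),(0,1),(1,1),(1,-1)}. cross y p = 0 \<or> cross q y = 0)"
      using that by (cases p; cases q) (auto simp: cross_def zero_prod_def)
    then show ?thesis by blast
  qed
  have "\<forall>i\<in>R. \<exists>y. cross y (p i) \<noteq> 0 \<and> cross (q i) y \<noteq> 0"
    using ex pq by blast
  then obtain y where y: "\<And>i. i \<in> R \<Longrightarrow> cross (y i) (p i) \<noteq> 0 \<and> cross (q i) (y i) \<noteq> 0"
    by metis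
  have nil: "(\<lambda>i. if i \<in> R then rank1 (x i) (x i) else mat 1) \<in> proj_closure T G" for x
  proof -
    have "(\<lambda>i. rank1 (x i) (y i)) \<in> proj_closure R G"
      using full(2) by (simp add: proj_full_def)
    then obtain A c where A: "\<And>n::nat. A n \<in> G"
      "\<And>i. i \<in> R \<Longrightarrow> (\<lambda>n. c n i *\<^sub>R A n i) \<longlonglongrightarrow> rank1 (x i) (y i)"
      by (rule proj_closure_seqE) blast
    \<comment> \<open>\<open>s i\<close> cancels the scalar left by the two contractions; its sign
      comes from \<open>adj2_rank1\<close>.\<close>
    define s where "s i = - inverse (cross (y i) (p i) * cross (q i) (y i))" for i
    define Z where "Z n = (\<lambda>i. (if i \<in> R then s i * (c n i)\<^sup>2 else 1) *\<^sub>R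
      (A n i ** X i ** adj2 (A n i)))" for n
    have Z: "Z n \<in> proj_closure T G" for n
      unfolding Z_def using T(1) A X(1) mem_proj_closure
      by (intro proj_closure_scale proj_closure_mult proj_closure_adj2) auto
    have "(\<lambda>n. Z n i) \<longlonglongrightarrow> rank1 (x i) (x i)" if i: "i \<in> R" for i
    proof -
      have "(\<lambda>n. s i *\<^sub>R ((c n i *\<^sub>R A n i) ** X i ** adj2 (c n i *\<^sub>R A n i))) \<longlonglongrightarrow>
          s i *\<^sub>R (rank1 (x i) (y i) ** X i ** adj2 (rank1 (x i) (y i)))"
        by (intro tendsto_intros A(2) i)
      also have "rank1 (x i) (y i) ** X i ** adj2 (rank1 (x i) (y i)) =
          - (cross (y i) (p i) * cross (q i) (y i)) *\<^sub>R rank1 (x i) (x i)"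
        using pq[OF i] by (simp add: adj2_rank1 rank1_mult_rank1 scaleR_matrix_mult neg_matrix_mult)
      also have "s i *\<^sub>R \<dots> = rank1 (x i) (x i)"
        using y[OF i] by (simp add: s_def inverse_eq_divide)
      finally show ?thesis
        using i by (simp add: Z_def adj2_scaleR scaleR_matrix_mult power2_eq_square mult.assoc)
    qed
    moreover have "Z n i = mat 1" if "i \<in> S" for n i
      using that T(3) X(2) A det_mem by (auto simp: Z_def mult_adj2_1)
    ultimately have "(\<lambda>n. Z n i) \<longlonglongrightarrow> (if i \<in> R then rank1 (x i) (x i) else mat 1)" if "i \<in> T" for i
      using that T by auto
    then show ?thesis by (rule proj_closure_limit[OF T(1) Z])
  qed
  show ?thesis
  proof (rule proj_full_combine[OF T _ full(1)])
    fix Y assume Y: "\<And>i. i \<in> R \<Longrightarrow> det (Y i :: real^2^2) = 0"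
    show "(\<lambda>i. if i \<in> R then Y i else mat 1) \<in> proj_closure T G"
    proof (rule proj_closure_generic[where R = R])
      fix x z :: "nat \<Rightarrow> real \<times> real"
      assume xz: "\<And>i. i \<in> R \<Longrightarrow> cross (x i) (z i) \<noteq> 0 \<and> snd (x i) \<noteq> 0 \<and> snd (z i) \<noteq> 0"
      have "(\<lambda>i. (if i \<in> R then inverse (cross (x i) (z i)) else 1) *\<^sub>R
          ((if i \<in> R then rank1 (x i) (x i) else mat 1) ** (if i \<in> R then rank1 (z i) (z i) else mat 1)))
          \<in> proj_closure T G"
        by (intro proj_closure_scale proj_closure_mult T(1) nil)
      moreover have "(\<lambda>i. (if i \<in> R then inverse (cross (x i) (z i)) else 1) *\<^sub>R
          ((if i \<in> R then rank1 (x i) (x i) else mat 1) ** (if i \<in> R then rank1 (z i) (z i) else mat 1)))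
        = (\<lambda>i. if i \<in> R then rank1 (x i) (z i) else if i \<in> R then Y i else mat 1)"
        using xz by (auto simp: fun_eq_iff rank1_mult_rank1)
      ultimately show "(\<lambda>i. if i \<in> R then rank1 (x i) (z i) else if i \<in> R then Y i else mat 1)
          \<in> proj_closure T G" by simp
    qed (use Y in auto)
  qed
qed

text \<open>If \<open>G\<close> has elements close to the centre on \<open>S\<close> but on no larger subset of \<open>T\<close>, then
  these are unbounded in every component outside \<open>S\<close>: otherwise, quotients of two of them would
  be close to the centre on a larger set.\<close>
lemma near_one_maximal_limit:
  assumes T: "finite T" "S \<subseteq> T" "near_one S G" "\<And>k. k \<in> T - S \<Longrightarrow> \<not> near_one (insert k S) G"
    and faithful: "\<And>A i k. A \<in> G \<Longrightarrow> i \<in> T \<Longrightarrow> central (A i) \<Longrightarrow> central (A k)"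
    and "S \<noteq> {}"
  shows "\<exists>X\<in>proj_closure T G. (\<forall>i\<in>S. X i = mat 1) \<and> (\<forall>i\<in>T - S. det (X i) = 0 \<and> X i \<noteq> 0)"
proof -
  have "\<exists>A s. A \<in> G \<and> (\<forall>i. \<bar>s i\<bar> = 1) \<and> (\<forall>i\<in>S. norm (s i *\<^sub>R A i - mat 1) < inverse (real (Suc n))) \<and>
     \<not> (\<forall>i. central (A i))" for n
  proof -
    have "inverse (real (Suc n)) > 0" by simp
    with T(3) show ?thesis unfolding near_one_def by blast
  qed
  then obtain A s where A: "\<And>n. A n \<in> G" "\<And>n i. \<bar>s n i\<bar> = (1::real)" "\<And>n. \<not> (\<forall>i. central (A n i))"
    "\<And>n i. i \<in> S \<Longrightarrow> norm (s n i *\<^sub>R A n i - mat 1) < inverse (real (Suc n))"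
    by metis
  have limS: "(\<lambda>n. s n i *\<^sub>R A n i) \<longlonglongrightarrow> mat 1" if "i \<in> S" for i
    using A(4) that by (intro tendsto_inverse_SucI) auto
  have sne: "s n i \<noteq> 0" for n i using A(2)[of n i] by auto
  \<comment> \<open>If component \<open>k\<close> stayed bounded along a subsequence, a further
    subsequence would converge on \<open>insert k S\<close> to a tuple \<open>M\<close> of
    determinant one, and quotients of late terms would contradict the maximality of
    \<open>S\<close>.\<close>
  have unb: "filterlim (\<lambda>n. norm (A n k)) at_top sequentially" if k: "k \<in> T - S" for k
  proof (rule ccontr)
    assume "\<not> ?thesis"
    then obtain Z where Z: "\<exists>\<^sub>F n in sequentially. norm (A n k) < Z"
      by (auto simp: filterlim_at_top not_eventually not_le)
    define U where "U = {n. norm (A n k) < Z}"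
    have "infinite U"
      using Z by (simp add: U_def frequently_cofinite[symmetric] cofinite_eq_sequentially)
    define \<sigma> where "\<sigma> = enumerate U"
    have \<sigma>: "strict_mono \<sigma>" "\<And>n. norm (A (\<sigma> n) k) < Z"
      using \<open>infinite U\<close> enumerate_in_set[OF \<open>infinite U\<close>]
      by (auto simp: \<sigma>_def strict_mono_enumerate) (auto simp: U_def)
    have "bounded (range (\<lambda>n. s (\<sigma> n) k *\<^sub>R A (\<sigma> n) k))"
      using \<sigma>(2) A(2) by (intro boundedI[of _ Z]) (auto intro: less_imp_le)
    then obtain L \<tau> where \<tau>: "strict_mono \<tau>" "(\<lambda>n. s (\<sigma> (\<tau> n)) k *\<^sub>R A (\<sigma> (\<tau> n)) k) \<longlonglongrightarrow> L"
      using bounded_imp_convergent_subsequence by (force simp: o_def)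
    define \<omega> where "\<omega> = \<sigma> \<circ> \<tau>"
    have \<omega>: "strict_mono \<omega>" using \<sigma> \<tau> by (simp add: \<omega>_def strict_mono_o)
    define M where "M i = (if i = k then L else mat 1)" for i
    have lim: "(\<lambda>n. s (\<omega> n) i *\<^sub>R A (\<omega> n) i) \<longlonglongrightarrow> M i" if "i \<in> insert k S" for i
      using that k \<tau>(2) LIMSEQ_subseq_LIMSEQ[OF limS \<omega>] by (auto simp: \<omega>_def M_def o_def)
    have detM: "det (M i) = 1" if "i \<in> insert k S" for i
    proof -
      have "(\<lambda>n. det (s (\<omega> n) i *\<^sub>R A (\<omega> n) i)) \<longlonglongrightarrow> det (M i)"
        by (intro tendsto_intros lim that)
      moreover have "det (s (\<omega> n) i *\<^sub>R A (\<omega> n) i) = 1" for n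
        using A(1,2) det_mem by (simp add: det_scaleR2 abs_square_eq_1)
      ultimately show ?thesis by (simp add: LIMSEQ_const_iff)
    qed
    have "near_one (insert k S) G"
      unfolding near_one_def
    proof safe
      fix e :: real assume "e > 0"
      obtain i0 where i0: "i0 \<in> S" using \<open>S \<noteq> {}\<close> by blast
      have finS: "finite (insert k S)" using T finite_subset by auto
      define F where "F m n i = (s (\<omega> m) i * s (\<omega> n) i) *\<^sub>R (A (\<omega> m) i ** adj2 (A (\<omega> n) i))" for m n i
      have FL: "(\<lambda>n. F n n i) \<longlonglongrightarrow> mat 1 \<and> (\<lambda>n. F m n i) \<longlonglongrightarrow> s (\<omega> m) i *\<^sub>R A (\<omega> m) i ** adj2 (M i)"
        if "i \<in> insert k S" for i m
      proof -
        have *: "F m n i = (s (\<omega> m) i *\<^sub>R A (\<omega> m) i) ** adj2 (s (\<omega> n) i *\<^sub>R A (\<omega> n) i)" for m n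
          by (simp add: F_def adj2_scaleR scaleR_matrix_mult mult.commute)
        have "(\<lambda>n. F n n i) \<longlonglongrightarrow> M i ** adj2 (M i)"
          unfolding * by (intro tendsto_intros lim that)
        moreover have "(\<lambda>n. F m n i) \<longlonglongrightarrow> (s (\<omega> m) i *\<^sub>R A (\<omega> m) i) ** adj2 (M i)"
          unfolding * by (intro tendsto_intros lim that)
        ultimately show ?thesis using detM[OF that] by (simp add: mult_adj2_1)
      qed
      have "(\<lambda>m. (s (\<omega> m) i *\<^sub>R A (\<omega> m) i) ** adj2 (M i)) \<longlonglongrightarrow> M i ** adj2 (M i)"
        if "i \<in> insert k S" for i by (intro tendsto_intros lim that)
      then have "\<forall>i\<in>insert k S. eventually (\<lambda>m. norm ((s (\<omega> m) i *\<^sub>R A (\<omega> m) i) ** adj2 (M i) - mat 1) < e) sequentially"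
        using detM \<open>e > 0\<close> by (auto simp: mult_adj2_1 tendsto_iff dist_norm)
      then have "eventually (\<lambda>m. \<forall>i\<in>insert k S. norm ((s (\<omega> m) i *\<^sub>R A (\<omega> m) i) ** adj2 (M i) - mat 1) < e) sequentially"
        using finS by (rule eventually_ball_finite[rotated])
      then obtain m where m: "\<forall>i\<in>insert k S. norm ((s (\<omega> m) i *\<^sub>R A (\<omega> m) i) ** adj2 (M i) - mat 1) < e"
        by (auto simp: eventually_sequentially)
      have "eventually (\<lambda>n. norm (F m n i - mat 1) < e) sequentially" if i: "i \<in> insert k S" for i
      proof -
        have "(\<lambda>n. norm (F m n i - mat 1)) \<longlonglongrightarrow> norm (s (\<omega> m) i *\<^sub>R A (\<omega> m) i ** adj2 (M i) - mat 1)"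
          using FL[OF i] by (intro tendsto_intros) blast
        then show ?thesis using m i by (auto intro: order_tendstoD)
      qed
      then have ev1: "eventually (\<lambda>n. \<forall>i\<in>insert k S. norm (F m n i - mat 1) < e) sequentially"
        using finS by (intro eventually_ball_finite) auto
      \<comment> \<open>With \<open>m\<close> fixed and \<open>n\<close> growing, the quotient at
        \<open>i0\<close> tends to a signed component of \<open>A (\<omega> m)\<close>, because
        \<open>M i0\<close> is the identity. That component is not central, hence neither is the
        quotient for large \<open>n\<close>.\<close>
      have nc: "\<not> central (A (\<omega> m) i0)" using faithful[OF A(1)] A(3) i0 T(2) by blast
      have "(\<lambda>n. F m n i0) \<longlonglongrightarrow> s (\<omega> m) i0 *\<^sub>R A (\<omega> m) i0"
        using FL[of i0 m] i0 k by (auto simp: M_def split: if_splits)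
      moreover have "\<not> central (s (\<omega> m) i0 *\<^sub>R A (\<omega> m) i0)"
        using nc A(2)[of "\<omega> m" i0] by (auto simp: central_def abs_if split: if_splits)
          (metis minus_minus)+
      ultimately have "eventually (\<lambda>n. F m n i0 \<noteq> mat 1) sequentially"
        "eventually (\<lambda>n. F m n i0 \<noteq> - mat 1) sequentially"
        by (auto intro!: tendsto_imp_eventually_ne simp: central_def)
      with ev1 have "eventually (\<lambda>n. (\<forall>i\<in>insert k S. norm (F m n i - mat 1) < e) \<and>
          F m n i0 \<noteq> mat 1 \<and> F m n i0 \<noteq> - mat 1) sequentially"
        by eventually_elim auto
      then obtain n where n: "\<forall>i\<in>insert k S. norm (F m n i - mat 1) < e"
          "F m n i0 \<noteq> mat 1" "F m n i0 \<noteq> - mat 1"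
        by (auto simp: eventually_sequentially)
      have s1: "\<bar>s (\<omega> m) i * s (\<omega> n) i\<bar> = 1" for i using A(2) by (simp add: abs_mult)
      have "\<not> central (A (\<omega> m) i0 ** adj2 (A (\<omega> n) i0))"
        using n(2,3) s1[of i0] by (auto simp: F_def central_def abs_if split: if_splits)
      then show "\<exists>A\<in>G. \<exists>s. (\<forall>i. \<bar>s i\<bar> = 1) \<and> (\<forall>i\<in>insert k S. norm (s i *\<^sub>R A i - mat 1) < e) \<and> \<not> (\<forall>i. central (A i))"
        using n(1) s1 mult_mem[OF A(1) inv_mem[OF A(1)], of "\<omega> m" "\<omega> n"] unfolding F_def
        by (intro bexI[of _ "\<lambda>i. A (\<omega> m) i ** adj2 (A (\<omega> n) i)"] exI[of _ "\<lambda>i. s (\<omega> m) i * s (\<omega> n) i"]) auto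
    qed
    with T(4) k show False by blast
  qed
  \<comment> \<open>Off \<open>S\<close> the norms tend to infinity, so normalizing by them forces
    the determinant to 0.\<close>
  define f where "f n k = inverse (norm (A n k)) *\<^sub>R A n k" for n k
  have nz: "A n k \<noteq> 0" for n k using det_mem[OF A(1), of n k] by (auto simp: det_eq)
  have nf: "norm (f n k) = 1" for n k using nz by (simp add: f_def)
  have "\<exists>\<sigma> l. strict_mono \<sigma> \<and> (\<forall>i\<in>T - S. (\<lambda>n. f (\<sigma> n) i) \<longlonglongrightarrow> l i)"
    by (rule bounded_seqs_convergent_subseq) (use T nf in \<open>auto intro!: boundedI[of _ 1]\<close>)
  then obtain \<sigma> l where \<sigma>: "strict_mono \<sigma>" and l: "\<And>i. i \<in> T - S \<Longrightarrow> (\<lambda>n. f (\<sigma> n) i) \<longlonglongrightarrow> l i" by blast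
  have "det (l i) = 0 \<and> l i \<noteq> 0" if i: "i \<in> T - S" for i
  proof
    have "(\<lambda>n. (inverse (norm (A (\<sigma> n) i)))\<^sup>2) \<longlonglongrightarrow> 0\<^sup>2"
      by (intro tendsto_power LIMSEQ_subseq_LIMSEQ[OF _ \<sigma>, unfolded o_def]
          tendsto_inverse_0_at_top unb i)
    moreover have "det (f (\<sigma> n) i) = (inverse (norm (A (\<sigma> n) i)))\<^sup>2" for n
      using det_mem[OF A(1)] by (simp add: f_def det_scaleR2)
    ultimately have "(\<lambda>n. det (f (\<sigma> n) i)) \<longlonglongrightarrow> 0" by simp
    moreover have "(\<lambda>n. det (f (\<sigma> n) i)) \<longlonglongrightarrow> det (l i)" by (intro tendsto_intros l i)
    ultimately show "det (l i) = 0" using LIMSEQ_unique by blast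
    have "(\<lambda>n. norm (f (\<sigma> n) i)) \<longlonglongrightarrow> norm (l i)" by (intro tendsto_intros l i)
    then have "norm (l i) = 1" by (simp add: nf LIMSEQ_const_iff)
    then show "l i \<noteq> 0" by auto
  qed
  moreover have "(\<lambda>i. if i \<in> S then mat 1 else l i) \<in> proj_closure T G"
  proof (rule proj_closure_seqI[OF T(1), of "\<lambda>n. A (\<sigma> n)" _
        "\<lambda>n i. if i \<in> S then s (\<sigma> n) i else inverse (norm (A (\<sigma> n) i))"])
    fix i assume "i \<in> T"
    then show "(\<lambda>n. (if i \<in> S then s (\<sigma> n) i else inverse (norm (A (\<sigma> n) i))) *\<^sub>R A (\<sigma> n) i) \<longlonglongrightarrow>
        (if i \<in> S then mat 1 else l i)"
      using l[of i] LIMSEQ_subseq_LIMSEQ[OF limS \<sigma>, of i] by (auto simp: f_def o_def)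
  qed (rule A(1))
  ultimately show ?thesis
    by (intro bexI[of _ "\<lambda>i. if i \<in> S then mat 1 else l i"]) auto
qed

end

section \<open>Hyperbolic elements and commutators\<close>

primrec mpow :: "real^2^2 \<Rightarrow> nat \<Rightarrow> real^2^2" where
  "mpow A 0 = mat 1"
| "mpow A (Suc n) = A ** mpow A n"

definition commutator :: "real^2^2 \<Rightarrow> real^2^2 \<Rightarrow> real^2^2" where
  "commutator A B = A ** B ** adj2 A ** adj2 B"

lemma det_mpow: "det A = 1 \<Longrightarrow> det (mpow A n) = 1"
  by (induction n) (auto simp: det_mul)

lemma mpow_conj:
  assumes "det Q = 1"
  shows "mpow (Q ** A ** adj2 Q) n = Q ** mpow A n ** adj2 Q"
proof (induction n)
  case (Suc n)
  have "mpow (Q ** A ** adj2 Q) (Suc n) = Q ** A ** (adj2 Q ** Q) ** mpow A n ** adj2 Q"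
    by (simp add: Suc matrix_mul_assoc)
  then show ?case using assms by (simp add: mult_adj2_1 matrix_mul_assoc)
qed (simp add: assms mult_adj2_1)

lemma mpow_diag: "mpow (mat2 a 0 0 b) n = mat2 (a ^ n) 0 0 (b ^ n)"
  by (induction n) (auto simp: mat_1_eq)

lemma mpow_scaleR: "mpow (c *\<^sub>R A) n = c ^ n *\<^sub>R mpow A n"
  by (induction n) (auto simp: scaleR_matrix_mult)

lemma tendsto_mpow [tendsto_intros]: "(f \<longlongrightarrow> X) F \<Longrightarrow> ((\<lambda>n. mpow (f n) k) \<longlongrightarrow> mpow X k) F"
  by (induction k) (auto intro!: tendsto_intros)

lemma conj_adj2: "det Q = 1 \<Longrightarrow> Q ** (adj2 Q ** X ** Q) ** adj2 Q = X"
  by (metis matrix_mul_assoc matrix_mul_lid matrix_mul_rid mult_adj2_1(1))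

lemma conj_mult: "det Q = 1 \<Longrightarrow> (Q ** X ** adj2 Q) ** (Q ** Y ** adj2 Q) = Q ** (X ** Y) ** adj2 Q"
proof -
  assume "det Q = 1"
  moreover have "(Q ** X ** adj2 Q) ** (Q ** Y ** adj2 Q) = Q ** X ** (adj2 Q ** Q) ** Y ** adj2 Q"
    by (simp add: matrix_mul_assoc)
  ultimately show ?thesis by (simp add: mult_adj2_1 matrix_mul_assoc)
qed

lemma adj2_conj: "adj2 (Q ** X ** adj2 Q) = Q ** adj2 X ** adj2 Q"
  by (simp add: adj2_mult matrix_mul_assoc)

lemma commutator_conj:
  "det Q = 1 \<Longrightarrow> commutator (Q ** X ** adj2 Q) (Q ** Y ** adj2 Q) = Q ** commutator X Y ** adj2 Q"
  by (simp add: commutator_def conj_mult adj2_conj)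

lemma mat_app_scaleR: "mat_app X (s *\<^sub>R v) = s *\<^sub>R mat_app X v"
  by (simp add: mat_app_def algebra_simps)

lemma cross_scaleR: "cross (s *\<^sub>R x) y = s * cross x y" "cross x (s *\<^sub>R y) = s * cross x y"
  by (simp_all add: cross_def algebra_simps)

lemma hyperbolic_diagonalize:
  assumes "det A = 1" "\<bar>trace A\<bar> > 2"
  obtains Q l where "det Q = 1" "\<bar>l\<bar> > 1" "A = Q ** mat2 l 0 0 (1/l) ** adj2 Q"
proof -
  define t where "t = trace A"
  have t4: "t\<^sup>2 > 4" using assms(2) abs_le_square_iff[of t 2] by (auto simp: t_def not_le)
  define w where "w = sqrt (t\<^sup>2 - 4)"
  have w: "w > 0" "w\<^sup>2 = t\<^sup>2 - 4" using t4 by (auto simp: w_def)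
  \<comment> \<open>The sign in front of \<open>w\<close> follows that of \<open>t\<close>, which
    selects the eigenvalue of modulus greater than 1.\<close>
  define l where "l = (if t > 0 then (t + w) / 2 else (t - w) / 2)"
  have l: "l\<^sup>2 - t * l + 1 = 0" using w(2) by (auto simp: l_def power2_eq_square field_simps)
  have l1: "\<bar>l\<bar> > 1" using w(1) assms(2) by (auto simp: l_def t_def abs_if split: if_splits)
  then have l0: "l \<noteq> 0" by auto
  have ev: "\<exists>b. b \<noteq> 0 \<and> mat_app A b = m *\<^sub>R b" if m: "m\<^sup>2 - t * m + 1 = 0" "\<bar>m\<bar> \<noteq> 1" for m
  proof -
    have "det (A - m *\<^sub>R mat 1) = 0"
      using m(1) assms(1) by (cases A rule: mat2_cases)
        (simp add: t_def mat_1_eq power2_eq_square algebra_simps)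
    \<comment> \<open>The kernel of \<open>rank1 a b\<close> is spanned by \<open>b\<close>, which
      is therefore the eigenvector sought.\<close>
    then obtain a b where ab: "A - m *\<^sub>R mat 1 = rank1 a b" by (rule det_zero_rank1)
    have "b \<noteq> 0"
    proof
      assume "b = 0"
      then have "A - m *\<^sub>R mat 1 = 0" unfolding ab by (simp add: rank1_eq_0)
      then have "A = m *\<^sub>R mat 1" by simp
      then have "m\<^sup>2 = 1" using assms(1) by (simp add: det_scaleR2)
      with m(2) show False by (simp add: power2_eq_1_iff abs_if split: if_splits)
    qed
    moreover have "mat_app (A - m *\<^sub>R mat 1) b = 0" by (simp add: ab mat_app_rank1)
    then have "mat_app A b = m *\<^sub>R b"
      by (cases A rule: mat2_cases) (auto simp: mat_app_def mat_1_eq prod_eq_iff algebra_simps)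
    ultimately show ?thesis by blast
  qed
  have "(1/l)\<^sup>2 - t * (1/l) + 1 = 0" using l l0 by (simp add: field_simps power2_eq_square)
  moreover have "\<bar>1/l\<bar> \<noteq> 1" "\<bar>l\<bar> \<noteq> 1" using l1 by auto
  ultimately obtain x y where x: "x \<noteq> 0" "mat_app A x = l *\<^sub>R x" and y: "y \<noteq> 0" "mat_app A y = (1/l) *\<^sub>R y"
    using ev l by blast
  have c: "cross x y \<noteq> 0"
  proof
    assume "cross x y = 0"
    then obtain s where s: "y = s *\<^sub>R x" using x(1) cross_eq_0_iff by blast
    then have "mat_app A y = l *\<^sub>R y"
      using x(2) by (simp add: mat_app_scaleR mult.commute)
    with y have "(l - 1/l) *\<^sub>R y = 0" by (simp add: scaleR_diff_left)
    with y(1) have "l * l = 1" using l0 by (simp add: field_simps)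
    then show False using l1 by (simp add: power2_eq_square[symmetric] power2_eq_1_iff abs_if split: if_splits)
  qed
  define z where "z = (1 / cross x y) *\<^sub>R y"
  define Q where "Q = mat2 (fst x) (fst z) (snd x) (snd z)"
  have "det Q = cross x z" by (simp add: Q_def cross_def)
  then have dQ: "det Q = 1" using c by (simp add: z_def cross_scaleR)
  have z: "mat_app A z = (1/l) *\<^sub>R z"
    using y(2) by (simp add: z_def mat_app_scaleR)
  have "A ** Q = Q ** mat2 l 0 0 (1/l)"
    using x(2) z by (cases A rule: mat2_cases) (auto simp: Q_def mat_app_def prod_eq_iff)
  then have "A ** (Q ** adj2 Q) = Q ** mat2 l 0 0 (1/l) ** adj2 Q"
    by (simp add: matrix_mul_assoc)
  then have "A = Q ** mat2 l 0 0 (1/l) ** adj2 Q" using dQ by (simp add: mult_adj2_1)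
  with dQ l1 that show thesis by blast
qed

text \<open>When l^2 is not 1, the trace is 2 exactly if an off-diagonal entry of \<open>E\<close>
  vanishes, that is, if \<open>E\<close> fixes one of the two fixed points of the diagonal
  matrix.\<close>

lemma trace_commutator_diag:
  assumes "det E = 1" "l \<noteq> 0"
  shows "trace (commutator (mat2 l 0 0 (1/l)) E) = 2 - E $ 1 $ 2 * E $ 2 $ 1 * (l - 1/l)\<^sup>2"
proof -
  obtain a b c d where E: "E = mat2 a b c d" by (rule mat2_cases)
  have ad: "a * d = 1 + b * c" using assms(1) by (simp add: E)
  have "trace (commutator (mat2 l 0 0 (1/l)) E) = 2 * (a * d) - b * c * (l * l + 1 / l * (1 / l))"
    using assms(2) by (simp add: commutator_def E algebra_simps)
  also have "\<dots> = 2 - b * c * (l - 1/l)\<^sup>2"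
    unfolding ad using assms(2) by (simp add: power2_eq_square algebra_simps)
  finally show ?thesis by (simp add: E)
qed

text \<open>A vanishing entry of \<open>E\<close> is a common fixed point of the diagonal matrix and
  its conjugate, so a trace other than 2 certifies that they have none.\<close>

lemma trace_commutator_diag_conj:
  assumes "det E = 1" "l \<noteq> 0"
  shows "trace (commutator (mat2 l 0 0 (1/l)) (E ** mat2 l 0 0 (1/l) ** adj2 E)) =
    2 + E $ 1 $ 1 * E $ 1 $ 2 * E $ 2 $ 1 * E $ 2 $ 2 * (l - 1/l)^4"
proof -
  have d: "det (E ** mat2 l 0 0 (1/l) ** adj2 E) = 1" using assms by (simp add: det_mul)
  define m where "m = 1 / l"
  have X: "(E ** mat2 l 0 0 m ** adj2 E) $ 1 $ 2 = - (E $ 1 $ 1 * E $ 1 $ 2 * (l - m))"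
    "(E ** mat2 l 0 0 m ** adj2 E) $ 2 $ 1 = E $ 2 $ 1 * E $ 2 $ 2 * (l - m)"
    by (cases E rule: mat2_cases; simp add: algebra_simps)+
  show ?thesis
    unfolding trace_commutator_diag[OF d assms(2)] unfolding m_def[symmetric] X
    by (simp add: power2_eq_square power4_eq_xxxx)
qed

lemma matrix_diff_distrib:
  fixes X Y Z :: "real^2^2"
  shows "X ** (Y - Z) = X ** Y - X ** Z" "(Y - Z) ** X = Y ** X - Z ** X"
  by (cases X rule: mat2_cases; cases Y rule: mat2_cases; cases Z rule: mat2_cases;
      simp add: algebra_simps)+

text \<open>Split \<open>A\<close> into the scalar \<open>t\<close> and a traceless part
  \<open>A0\<close>. On traceless matrices the determinant is a Lorentzian form, and
  \<open>A0\<close> and its conjugate by \<open>B\<close> are timelike vectors of the same length on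
  the same sheet. The reverse Cauchy-Schwarz inequality bounds the trace of their product by -2e,
  where e = 1 - t^2.\<close>

lemma trace_commutator_elliptic:
  assumes "det A = 1" "det B = 1" "\<bar>trace A\<bar> < 2"
  shows "trace (commutator A B) \<ge> 2"
proof -
  obtain a b c d where A: "A = mat2 a b c d" by (rule mat2_cases)
  define t where "t = (a + d) / 2"
  define p where "p = a - t"
  have ap: "a = t + p" "d = t - p" by (auto simp: p_def t_def field_simps)
  define e where "e = 1 - t\<^sup>2"
  have "\<bar>t\<bar> < 1" using assms(3) by (simp add: A t_def)
  then have "t\<^sup>2 < 1" by (simp only: abs_square_less_1)
  then have e: "e > 0" by (simp add: e_def)
  have det: "p * p + b * c = - e"
    using assms(1) by (simp add: A ap e_def power2_eq_square algebra_simps)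
  obtain x y g h where B: "B = mat2 x y g h" by (rule mat2_cases)
  have dB: "x * h - y * g = 1" using assms(2) by (simp add: B)
  define A0 where "A0 = mat2 p b c (-p)"
  define p' q' r' where "p' = (B ** A0 ** adj2 B) $ 1 $ 1" and "q' = (B ** A0 ** adj2 B) $ 1 $ 2"
    and "r' = (B ** A0 ** adj2 B) $ 2 $ 1"
  have A0': "B ** A0 ** adj2 B = mat2 p' q' r' (- p')"
    by (simp only: mat2_ext mat2_nth p'_def q'_def r'_def) (simp add: A0_def B algebra_simps)
  have "det (B ** A0 ** adj2 B) = det A0" using assms(2) by (simp add: det_mul)
  then have det': "p' * p' + q' * r' = - e"
    unfolding A0' using det by (simp add: A0_def algebra_simps)
  have cnz: "c \<noteq> 0"
  proof
    assume "c = 0"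
    with det have "p * p = - e" by simp
    with e zero_le_square[of p] show False by linarith
  qed
  have rnz: "r' \<noteq> 0"
  proof
    assume "r' = 0"
    with det' have "p' * p' = - e" by simp
    with e zero_le_square[of p'] show False by linarith
  qed
  have e': "e = - (p * p) - b * c" using det by linarith
  have r': "r' = c * h * h + 2 * p * g * h - b * g * g"
    by (simp add: r'_def A0_def B algebra_simps)
  \<comment> \<open>Equal signs of the lower left entries mean that both matrices lie on one sheet
    of the hyperboloid.\<close>
  have "c * r' = (c * h + p * g)\<^sup>2 + e * g\<^sup>2"
    unfolding r' e' by (simp add: power2_eq_square algebra_simps)
  then have "c * r' \<ge> 0" using e by simp
  then have cr: "c * r' > 0" using cnz rnz by (simp add: less_le)
  have tr: "trace (commutator A B) = 2 * t\<^sup>2 - (2 * p * p' + b * r' + c * q')"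
  proof -
    have "commutator A B = A ** (B ** adj2 A ** adj2 B)" by (simp add: commutator_def matrix_mul_assoc)
    also have "B ** adj2 A ** adj2 B = t *\<^sub>R mat 1 - B ** A0 ** adj2 B"
    proof -
      have "adj2 A = t *\<^sub>R mat 1 - A0" by (simp add: A A0_def ap mat_1_eq)
      then have "B ** adj2 A ** adj2 B = t *\<^sub>R (B ** adj2 B) - B ** A0 ** adj2 B"
        by (simp add: matrix_diff_distrib scaleR_matrix_mult)
      then show ?thesis using assms(2) by (simp add: mult_adj2_1)
    qed
    finally show ?thesis
      unfolding A0' by (simp add: A ap mat_1_eq power2_eq_square algebra_simps)
  qed
  \<comment> \<open>Multiplication by c r' eliminates b and q' through the two determinant relations
    and leaves a negative sum of squares.\<close>
  have "c * r' * (2 * p * p' + b * r' + c * q') = - (e * (c * c + r' * r') + (p * r' - p' * c)\<^sup>2)"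
  proof -
    have "c * r' * (2 * p * p' + b * r' + c * q') = 2 * p * p' * c * r' + (b * c) * r' * r' + (q' * r') * c * c"
      by (simp add: algebra_simps)
    also have "b * c = - e - p * p" using det by simp
    also have "q' * r' = - e - p' * p'" using det' by simp
    finally show ?thesis by (simp add: power2_eq_square algebra_simps)
  qed
  also have "\<dots> \<le> - (2 * e * (c * r'))"
  proof -
    have "0 \<le> e * (c - r')\<^sup>2 + (p * r' - p' * c)\<^sup>2" using e by simp
    then show ?thesis by (simp add: power2_eq_square algebra_simps)
  qed
  finally have "(c * r') * (2 * p * p' + b * r' + c * q') \<le> (c * r') * (- 2 * e)" by (simp add: algebra_simps)
  then have "2 * p * p' + b * r' + c * q' \<le> - 2 * e" using cr by (simp only: mult_le_cancel_left_pos)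
  then show ?thesis unfolding tr by (simp add: e_def)
qed

lemma mpow_linear: "\<exists>p q. mpow A n = p *\<^sub>R A + q *\<^sub>R mat 1"
proof (induction n)
  case 0
  show ?case by (intro exI[of _ 0] exI[of _ 1]) simp
next
  case (Suc n)
  then obtain p q where "mpow A n = p *\<^sub>R A + q *\<^sub>R mat 1" by blast
  then have "mpow A (Suc n) = A ** (p *\<^sub>R A + q *\<^sub>R mat 1)" by simp
  also have "\<dots> = (p * trace A + q) *\<^sub>R A + (- p * det A) *\<^sub>R mat 1"
    by (cases A rule: mat2_cases) (simp add: mat_1_eq algebra_simps)
  finally have "mpow A (Suc n) = (p * trace A + q) *\<^sub>R A + (- p * det A) *\<^sub>R mat 1" .
  then show ?case by blast
qed

text \<open>By Cayley-Hamilton the power is p A + q, and the deviation of the commutator trace from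
  2 is multiplied by p^2. Central and elliptic powers need no distinction.\<close>

lemma trace_commutator_mpow_elliptic:
  assumes "det A = 1" "det B = 1" "\<bar>trace A\<bar> < 2"
  shows "trace (commutator (mpow A n) B) \<ge> 2"
proof -
  obtain p q where pq: "mpow A n = p *\<^sub>R A + q *\<^sub>R mat 1" using mpow_linear by blast
  have d: "det (mpow A n) = p\<^sup>2 * det A + p * q * trace A + q\<^sup>2"
    unfolding pq by (cases A rule: mat2_cases) (simp add: mat_1_eq power2_eq_square algebra_simps)
  have com: "trace (commutator (mpow A n) B) = p\<^sup>2 * trace (commutator A B) +
      2 * p * q * trace A * det B + 2 * q\<^sup>2 * det B"
    unfolding pq commutator_def
    by (cases A rule: mat2_cases; cases B rule: mat2_cases)
       (simp add: mat_1_eq power2_eq_square algebra_simps)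
  have "trace (commutator (mpow A n) B) - 2 = p\<^sup>2 * (trace (commutator A B) - 2)"
    using com d assms det_mpow[OF assms(1), of n] by (simp add: algebra_simps)
  also have "\<dots> \<ge> 0" using trace_commutator_elliptic[OF assms] by simp
  finally show ?thesis by simp
qed

text \<open>In a diagonalizing basis the trace is 2 - k (l^n - l^(-n))^2, and \<open>k\<close> is
  nonzero because the trace for n = 1 is not 2.\<close>

lemma trace_commutator_mpow_hyperbolic:
  assumes "det A = 1" "det B = 1" "\<bar>trace A\<bar> > 2" "trace (commutator A B) \<noteq> 2"
  shows "eventually (\<lambda>n. \<bar>trace (commutator (mpow A n) B)\<bar> > 2) sequentially"
proof -
  obtain Q l where Q: "det Q = 1" "\<bar>l\<bar> > 1" "A = Q ** mat2 l 0 0 (1/l) ** adj2 Q"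
    using hyperbolic_diagonalize[OF assms(1,3)] by blast
  define E where "E = adj2 Q ** B ** Q"
  have l0: "l \<noteq> 0" using Q(2) by auto
  have E: "B = Q ** E ** adj2 Q" "det E = 1"
    using Q(1) assms(2) by (simp_all add: E_def conj_adj2 det_mul)
  have tr: "trace (commutator (mpow A n) B) = 2 - E $ 1 $ 2 * E $ 2 $ 1 * (l^n - 1/l^n)\<^sup>2" for n
  proof -
    have "mpow A n = Q ** mat2 (l^n) 0 0 (1/l^n) ** adj2 Q"
      using Q by (simp add: mpow_conj mpow_diag power_one_over)
    then show ?thesis
      using trace_commutator_diag[OF E(2), of "l^n"] l0 Q(1) E(1)
      by (simp add: commutator_conj trace_conj)
  qed
  define k where "k = E $ 1 $ 2 * E $ 2 $ 1"
  have "k \<noteq> 0" using tr[of 1] assms(4) by (auto simp: k_def)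
  have "filterlim (\<lambda>n. \<bar>l\<bar> ^ n) at_top sequentially"
    using filterlim_realpow_sequentially_gt1[of "\<bar>l\<bar>"] Q(2)
    by (simp add: filterlim_at_infinity_imp_filterlim_at_top)
  \<comment> \<open>The summand 2 absorbs l^(-n) and leaves |l^n - l^(-n)| above 4 / |k| and above
    1. Its square then exceeds 4 / |k|, and subtracting more than 4 in modulus from 2 leaves the
    interval [-2, 2].\<close>
  then have "eventually (\<lambda>n. \<bar>l\<bar>^n > 4 / \<bar>k\<bar> + 2) sequentially"
    by (simp add: filterlim_at_top_dense)
  then show ?thesis
  proof eventually_elim
    case (elim n)
    have l1: "\<bar>l^n\<bar> \<ge> 1" using Q(2) by (simp add: power_abs)
    have "4 / \<bar>k\<bar> + 1 < \<bar>l^n\<bar> - \<bar>1/l^n\<bar>"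
    proof -
      have "\<bar>1/l^n\<bar> \<le> 1" using l1 by (simp only: abs_divide abs_one divide_le_eq_1) auto
      then show ?thesis using elim by (simp add: power_abs)
    qed
    also have "\<dots> \<le> \<bar>l^n - 1/l^n\<bar>" by (rule abs_triangle_ineq2)
    finally have *: "4 / \<bar>k\<bar> + 1 < \<bar>l^n - 1/l^n\<bar>" .
    have "4 / \<bar>k\<bar> \<ge> 0" by simp
    with * have a: "4 / \<bar>k\<bar> < \<bar>l^n - 1/l^n\<bar>" and b: "1 \<le> \<bar>l^n - 1/l^n\<bar>" by linarith+
    have "4 / \<bar>k\<bar> < \<bar>l^n - 1/l^n\<bar> * \<bar>l^n - 1/l^n\<bar>"
      using a mult_left_mono[OF b abs_ge_zero[of "l^n - 1/l^n"]] by (simp only: mult_1_right)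
    then have "4 < \<bar>k * (l^n - 1/l^n)\<^sup>2\<bar>"
      using \<open>k \<noteq> 0\<close> unfolding abs_mult power2_eq_square
      by (subst (asm) divide_less_eq) (simp add: mult.commute)
    then show ?case unfolding tr k_def by (simp add: abs_if split: if_splits)
  qed
qed

section \<open>Density in the projective closure\<close>

lemma power_unbounded: "x > (1::real) \<Longrightarrow> a > 0 \<Longrightarrow> \<exists>n. a * x ^ n \<ge> b"
  using real_arch_pow[of x "b / a"] by (auto simp: field_simps intro: less_imp_le)

context tuple_group
begin

lemma mpow_mem: "A \<in> G \<Longrightarrow> (\<lambda>i. mpow (A i) n) \<in> G"
  by (induction n) (auto intro: one_mem mult_mem)

lemma conj_mem: "A \<in> G \<Longrightarrow> B \<in> G \<Longrightarrow> (\<lambda>i. B i ** A i ** adj2 (B i)) \<in> G"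
  using mult_mem[OF mult_mem inv_mem, of B A B] by simp

lemma commutator_mem: "A \<in> G \<Longrightarrow> B \<in> G \<Longrightarrow> (\<lambda>i. commutator (A i) (B i)) \<in> G"
  unfolding commutator_def using mult_mem[OF mult_mem[OF mult_mem inv_mem] inv_mem, of A B A B] by simp

text \<open>Conjugates of an element by \<open>1\<close>, \<open>h\<close> and \<open>g h\<close> fix the repelling fixed point of \<open>g\<close> only if
  the element fixes three distinct points of the projective line.\<close>
lemma upper_right_nonzero:
  assumes Y: "det Y = 1" "\<not> central Y" and l: "\<bar>l\<bar> > 1"
    and E: "E $ 1 $ 1 \<noteq> 0" "E $ 1 $ 2 \<noteq> 0" "E $ 2 $ 1 \<noteq> 0" "E $ 2 $ 2 \<noteq> 0"
  shows "\<exists>K\<in>{mat 1, E, mat2 l 0 0 (1/l) ** E}. (adj2 K ** Y ** K) $ 1 $ 2 \<noteq> 0"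
proof (rule ccontr)
  assume "\<not> ?thesis"
  then have z: "(adj2 (mat 1) ** Y ** mat 1) $ 1 $ 2 = 0" "(adj2 E ** Y ** E) $ 1 $ 2 = 0"
    "(adj2 (mat2 l 0 0 (1/l) ** E) ** Y ** (mat2 l 0 0 (1/l) ** E)) $ 1 $ 2 = 0" by blast+
  obtain p q r s where Y': "Y = mat2 p q r s" by (rule mat2_cases)
  obtain a b c d where E': "E = mat2 a b c d" by (rule mat2_cases)
  have l0: "l \<noteq> 0" using l by auto
  have ll: "l * l \<noteq> 1" using l by (auto simp: power2_eq_square[symmetric] power2_eq_1_iff)
  have q: "q = 0" using z(1) by (simp add: Y')
  have "b * (d * (p - s) - r * b) = 0" using z(2) q by (simp add: Y' E' algebra_simps)
  then have 1: "d * (p - s) = r * b" using E(2) by (simp add: E')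
  have "b * (d * (p - s) - r * b * (l * l)) = 0"
    using z(3) q l0 by (simp add: Y' E' algebra_simps)
  then have "d * (p - s) = r * b * (l * l)" using E(2) by (simp add: E')
  with 1 have "r * b * (l * l - 1) = 0" by (simp add: algebra_simps)
  then have r: "r = 0" using E(2) ll by (simp add: E')
  with 1 E(4) have ps: "p = s" by (simp add: E')
  with Y(1) q r have "p = 1 \<or> p = -1"
    by (simp add: Y' power2_eq_square[symmetric] power2_eq_1_iff)
  then show False using Y(2) q r ps by (auto simp: Y' central_def mat_1_eq)
qed

text \<open>Conjugation by powers of \<open>g\<close> expands the upper right entries of elements
  near the identity, contracts the lower left ones and keeps the diagonal. Stopping as soon as the
  total size of the upper right entries reaches 1 gives a limit that is unipotent and
  nontrivial.\<close>

lemma near_one_unipotent: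
  assumes T: "finite T" "near_one T G" and gh: "g \<in> G" "h \<in> G"
    and Q: "\<And>i. i \<in> T \<Longrightarrow> det (Q i) = 1 \<and> \<bar>l i\<bar> > 1 \<and> g i = Q i ** mat2 (l i) 0 0 (1 / l i) ** adj2 (Q i)"
    and k: "k \<in> T" "\<And>a b. (adj2 (Q k) ** h k ** Q k) $ a $ b \<noteq> 0"
    and faithful: "\<And>A i. A \<in> G \<Longrightarrow> central (A k) \<Longrightarrow> central (A i)"
  shows "\<exists>u. (\<exists>i\<in>T. u i \<noteq> 0) \<and> (\<lambda>i. Q i ** mat2 1 (u i) 0 1 ** adj2 (Q i)) \<in> proj_closure T G"
proof -
  have "\<exists>A s. A \<in> G \<and> (\<forall>i. \<bar>s i\<bar> = 1) \<and> (\<forall>i\<in>T. norm (s i *\<^sub>R A i - mat 1) < inverse (real (Suc n))) \<and>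
     \<not> (\<forall>i. central (A i))" for n
  proof -
    have "inverse (real (Suc n)) > 0" by simp
    with T(2) show ?thesis unfolding near_one_def by blast
  qed
  then obtain A s where A: "\<And>n. A n \<in> G" "\<And>n i. \<bar>s n i\<bar> = (1::real)" "\<And>n. \<not> (\<forall>i. central (A n i))"
    "\<And>n i. i \<in> T \<Longrightarrow> norm (s n i *\<^sub>R A n i - mat 1) < inverse (real (Suc n))"
    by metis
  have limA: "(\<lambda>n. s n i *\<^sub>R A n i) \<longlonglongrightarrow> mat 1" if "i \<in> T" for i
    using A(4) that by (intro tendsto_inverse_SucI) auto
  \<comment> \<open>One of these three conjugators makes the upper right entry at \<open>k\<close>
    nonzero. Being a fixed finite set, they do not disturb convergence to the identity.\<close>
  define KK where "KK = {\<lambda>_. mat 1, h, \<lambda>i. g i ** h i}"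
  have KG: "K \<in> G" if "K \<in> KK" for K using that one_mem gh mult_mem by (auto simp: KK_def)
  define E where "E = adj2 (Q k) ** h k ** Q k"
  have Qk: "det (Q k) = 1" and lk: "\<bar>l k\<bar> > 1" using Q k(1) by auto
  have hk: "h k = Q k ** E ** adj2 (Q k)" using Qk by (simp add: E_def conj_adj2)
  define V where "V K n i = adj2 (Q i) ** (adj2 (K i) ** A n i ** K i) ** Q i" for K n i
  have "\<exists>K\<in>KK. V K n k $ 1 $ 2 \<noteq> 0" for n
  proof -
    define Y where "Y = adj2 (Q k) ** A n k ** Q k"
    have dY: "det Y = 1" using Qk A(1) det_mem by (simp add: Y_def det_mul)
    have AY: "A n k = Q k ** Y ** adj2 (Q k)" using Qk by (simp add: Y_def conj_adj2)
    have nY: "\<not> central Y"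
    proof
      assume "central Y"
      then have "central (A n k)"
        unfolding AY using Qk by (auto simp: central_def neg_matrix_mult mult_adj2_1)
      with faithful A(1,3) show False by blast
    qed
    obtain K where K: "K \<in> {mat 1, E, mat2 (l k) 0 0 (1 / l k) ** E}" "(adj2 K ** Y ** K) $ 1 $ 2 \<noteq> 0"
      using upper_right_nonzero[OF dY nY lk, of E] k(2) unfolding E_def by blast
    have tr: "V K' n k = adj2 K ** Y ** K" if "K' k = Q k ** K ** adj2 (Q k)" for K'
    proof -
      have "adj2 (K' k) ** A n k ** K' k = Q k ** (adj2 K ** Y ** K) ** adj2 (Q k)"
        unfolding that AY using Qk by (simp add: adj2_conj conj_mult)
      then show ?thesis
        using Qk conj_adj2[of "adj2 (Q k)"] by (simp add: V_def)
    qed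
    have "\<exists>K'\<in>KK. K' k = Q k ** K ** adj2 (Q k)"
      using K(1) Q[OF k(1)] hk by (auto simp: KK_def mult_adj2_1 conj_mult)
    with tr K(2) show ?thesis by metis
  qed
  then obtain K where K: "\<And>n. K n \<in> KK" "\<And>n. V (K n) n k $ 1 $ 2 \<noteq> 0" by metis
  define Y where "Y n i = s n i *\<^sub>R V (K n) n i" for n i
  have limY: "(\<lambda>n. Y n i) \<longlonglongrightarrow> mat 1" if i: "i \<in> T" for i
  proof -
    have *: "(\<lambda>n. s n i *\<^sub>R V K n i) \<longlonglongrightarrow> mat 1" if "K \<in> KK" for K
    proof -
      have "(\<lambda>n. adj2 (Q i) ** (adj2 (K i) ** (s n i *\<^sub>R A n i) ** K i) ** Q i) \<longlonglongrightarrow>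
          adj2 (Q i) ** (adj2 (K i) ** mat 1 ** K i) ** Q i"
        by (intro tendsto_intros limA i)
      then show ?thesis
        using Q[OF i] det_mem[OF KG[OF that], of i]
        by (simp add: V_def scaleR_matrix_mult mult_adj2_1)
    qed
    show ?thesis
    proof (rule tendstoI)
      fix e :: real assume "e > 0"
      then have "\<forall>K\<in>KK. eventually (\<lambda>n. dist (s n i *\<^sub>R V K n i) (mat 1) < e) sequentially"
        using * by (auto simp: tendsto_iff)
      then have "eventually (\<lambda>n. \<forall>K\<in>KK. dist (s n i *\<^sub>R V K n i) (mat 1) < e) sequentially"
        by (intro eventually_ball_finite) (auto simp: KK_def)
      then show "eventually (\<lambda>n. dist (Y n i) (mat 1) < e) sequentially"
        by eventually_elim (use K(1) in \<open>auto simp: Y_def\<close>)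
    qed
  qed
  define \<mu> where "\<mu> i = (l i)\<^sup>2" for i
  have \<mu>: "\<mu> i > 1" if "i \<in> T" for i
    using Q[OF that] by (simp add: \<mu>_def) (metis abs_square_le_1 not_le)
  have \<mu>0: "\<mu> i \<ge> 0" for i by (simp add: \<mu>_def)
  define q where "q n i = Y n i $ 1 $ 2" for n i
  have qk: "q n k \<noteq> 0" for n using K(2)[of n] A(2)[of n k] by (auto simp: q_def Y_def)
  define f where "f n m = (\<Sum>i\<in>T. \<bar>q n i\<bar> * \<mu> i ^ m)" for n m
  have "\<exists>m. f n m \<ge> 1" for n
  proof -
    obtain m where "\<bar>q n k\<bar> * \<mu> k ^ m \<ge> 1"
      using power_unbounded[OF \<mu>[OF k(1)], of "\<bar>q n k\<bar>" 1] qk[of n] by auto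
    also have "\<bar>q n k\<bar> * \<mu> k ^ m \<le> f n m"
      unfolding f_def using \<mu> T(1) k(1)
      by (intro member_le_sum) (auto intro!: mult_nonneg_nonneg zero_le_power \<mu>0)
    finally show ?thesis by blast
  qed
  \<comment> \<open>Minimality bounds the entries: one step earlier the sum is below 1, and a step
    multiplies each term by at most \<open>C\<close>.\<close>
  define M where "M n = (LEAST m. f n m \<ge> 1)" for n
  have M1: "f n (M n) \<ge> 1" for n unfolding M_def using \<open>\<exists>m. f n m \<ge> 1\<close> by (rule LeastI_ex)
  have M2: "f n m < 1" if "m < M n" for n m using not_less_Least[of m "\<lambda>m. f n m \<ge> 1"] that by (simp add: M_def not_le)
  define C where "C = (\<Sum>i\<in>T. \<mu> i)"
  have C: "\<mu> i \<le> C" if "i \<in> T" for i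
    unfolding C_def using that T(1) \<mu> by (intro member_le_sum) (auto intro!: \<mu>0)
  have "(\<lambda>n. f n 0) \<longlonglongrightarrow> (\<Sum>i\<in>T. \<bar>(mat 1 :: real^2^2) $ 1 $ 2\<bar> * 1)"
    unfolding f_def q_def power_0 by (intro tendsto_intros limY)
  then have "(\<lambda>n. f n 0) \<longlonglongrightarrow> 0" by (simp add: mat_def)
  then have "eventually (\<lambda>n. f n 0 < 1) sequentially" by (rule order_tendstoD) simp
  \<comment> \<open>From \<open>N\<close> on the sum at exponent 0 is below 1, so the stopping
    exponent is positive and has a predecessor.\<close>
  then obtain N where N: "\<And>n. n \<ge> N \<Longrightarrow> f n 0 < 1" by (auto simp: eventually_sequentially)
  have qb: "\<bar>q n i * \<mu> i ^ M n\<bar> \<le> C" if i: "i \<in> T" and n: "n \<ge> N" for n i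
  proof -
    have "M n \<noteq> 0" using M1[of n] N[OF n] by (metis not_le)
    then obtain m where m: "M n = Suc m" by (cases "M n") auto
    have "\<bar>q n i\<bar> * \<mu> i ^ m \<le> f n m"
      unfolding f_def using \<mu> T(1) i
      by (intro member_le_sum) (auto intro!: mult_nonneg_nonneg zero_le_power \<mu>0)
    also have "\<dots> < 1" using M2 m by simp
    finally have "\<bar>q n i\<bar> * \<mu> i ^ m * \<mu> i \<le> 1 * \<mu> i"
      using \<mu>[OF i] by (intro mult_right_mono) auto
    also have "\<dots> \<le> C" using C[OF i] by simp
    finally show ?thesis using \<mu>[OF i] by (simp add: m abs_mult mult_ac)
  qed
  define Z where "Z n i = mat2 (Y n i $ 1 $ 1) (q n i * \<mu> i ^ M n) (Y n i $ 2 $ 1 / \<mu> i ^ M n) (Y n i $ 2 $ 2)" for n i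
  have ZP: "(\<lambda>i. Q i ** Z n i ** adj2 (Q i)) \<in> proj_closure T G" for n
  proof -
    define g' where "g' i = mpow (g i) (M n)" for i
    have "g' \<in> G" unfolding g'_def by (rule mpow_mem) (rule gh)
    then have "(\<lambda>i. s n i *\<^sub>R (g' i ** (adj2 (K n i) ** A n i ** K n i) ** adj2 (g' i))) \<in> proj_closure T G"
      using T(1) A(1) KG[OF K(1)]
      by (intro proj_closure_scale mem_proj_closure conj_mem mult_mem inv_mem) auto
    moreover have "s n i *\<^sub>R (g' i ** (adj2 (K n i) ** A n i ** K n i) ** adj2 (g' i)) =
        Q i ** Z n i ** adj2 (Q i)" if i: "i \<in> T" for i
    proof -
      have l0: "l i \<noteq> 0" using Q[OF i] by auto
      have g': "g' i = Q i ** mat2 (l i ^ M n) 0 0 (1 / l i ^ M n) ** adj2 (Q i)"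
        using Q[OF i] by (simp add: g'_def mpow_conj mpow_diag power_one_over)
      have sY: "s n i *\<^sub>R (adj2 (K n i) ** A n i ** K n i) = Q i ** Y n i ** adj2 (Q i)"
        unfolding Y_def V_def using conj_adj2[of "Q i"] Q[OF i]
        by (simp add: scaleR_matrix_mult)
      have "s n i *\<^sub>R (g' i ** (adj2 (K n i) ** A n i ** K n i) ** adj2 (g' i)) =
          g' i ** (Q i ** Y n i ** adj2 (Q i)) ** adj2 (g' i)"
        unfolding sY[symmetric] by (simp add: scaleR_matrix_mult)
      also have "\<dots> = Q i ** (mat2 (l i ^ M n) 0 0 (1 / l i ^ M n) ** Y n i ** adj2 (mat2 (l i ^ M n) 0 0 (1 / l i ^ M n))) ** adj2 (Q i)"
        unfolding g' using Q[OF i] by (simp add: adj2_conj conj_mult)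
      also have "mat2 (l i ^ M n) 0 0 (1 / l i ^ M n) ** Y n i ** adj2 (mat2 (l i ^ M n) 0 0 (1 / l i ^ M n)) = Z n i"
        using l0 unfolding Z_def q_def \<mu>_def
        by (subst mat2_eq[of "Y n i"]) (simp add: power2_eq_square power_mult_distrib)
      finally show ?thesis .
    qed
    ultimately show ?thesis using proj_closure_cong by (metis (no_types, lifting))
  qed
  have "\<exists>\<sigma> u. strict_mono \<sigma> \<and> (\<forall>i\<in>T. (\<lambda>n. q (\<sigma> n + N) i * \<mu> i ^ M (\<sigma> n + N)) \<longlonglongrightarrow> u i)"
    by (rule bounded_seqs_convergent_subseq[of T "\<lambda>n i. q (n + N) i * \<mu> i ^ M (n + N)"])
       (use T qb in \<open>auto intro!: boundedI[of _ C]\<close>)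
  then obtain \<sigma> u where \<sigma>: "strict_mono \<sigma>"
    and u: "\<And>i. i \<in> T \<Longrightarrow> (\<lambda>n. q (\<sigma> n + N) i * \<mu> i ^ M (\<sigma> n + N)) \<longlonglongrightarrow> u i" by blast
  define \<omega> where "\<omega> n = \<sigma> n + N" for n
  have \<omega>: "strict_mono \<omega>" using \<sigma> by (simp add: \<omega>_def strict_mono_def)
  have "(\<lambda>n. f (\<omega> n) (M (\<omega> n))) \<longlonglongrightarrow> (\<Sum>i\<in>T. \<bar>u i\<bar>)"
  proof -
    have "(\<lambda>n. \<Sum>i\<in>T. \<bar>q (\<omega> n) i * \<mu> i ^ M (\<omega> n)\<bar>) \<longlonglongrightarrow> (\<Sum>i\<in>T. \<bar>u i\<bar>)"
      unfolding \<omega>_def by (intro tendsto_intros u)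
    moreover have "(\<Sum>i\<in>T. \<bar>q (\<omega> n) i * \<mu> i ^ M (\<omega> n)\<bar>) = f (\<omega> n) (M (\<omega> n))" for n
      unfolding f_def using \<mu> by (intro sum.cong) (auto simp: abs_mult power_abs \<mu>0)
    ultimately show ?thesis by simp
  qed
  then have "(\<Sum>i\<in>T. \<bar>u i\<bar>) \<ge> 1" by (rule LIMSEQ_le_const) (use M1 in auto)
  then have "\<exists>i\<in>T. u i \<noteq> 0" by (metis abs_zero not_one_le_zero sum.neutral)
  moreover have "(\<lambda>i. Q i ** mat2 1 (u i) 0 1 ** adj2 (Q i)) \<in> proj_closure T G"
  proof (rule proj_closure_limit[OF T(1), where Y = "\<lambda>n i. Q i ** Z (\<omega> n) i ** adj2 (Q i)"])
    fix i assume i: "i \<in> T"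
    have lim: "(\<lambda>n. Y (\<omega> n) i $ a $ b) \<longlonglongrightarrow> (mat 1 :: real^2^2) $ a $ b" for a b
      using LIMSEQ_subseq_LIMSEQ[OF limY[OF i] \<omega>] by (intro tendsto_intros) (simp add: o_def)
    have r: "(\<lambda>n. Y (\<omega> n) i $ 2 $ 1 / \<mu> i ^ M (\<omega> n)) \<longlonglongrightarrow> 0"
    proof (rule Lim_null_comparison)
      show "(\<lambda>n. \<bar>Y (\<omega> n) i $ 2 $ 1\<bar>) \<longlonglongrightarrow> 0"
        using tendsto_rabs[OF lim[of 2 1]] by (simp add: mat_def)
      have "norm (Y (\<omega> n) i $ 2 $ 1 / \<mu> i ^ M (\<omega> n)) \<le> \<bar>Y (\<omega> n) i $ 2 $ 1\<bar>" for n
      proof -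
        have "1 \<le> \<mu> i ^ M (\<omega> n)" using \<mu>[OF i] by simp
        then have "\<bar>Y (\<omega> n) i $ 2 $ 1\<bar> / \<mu> i ^ M (\<omega> n) \<le> \<bar>Y (\<omega> n) i $ 2 $ 1\<bar> / 1"
          by (intro divide_left_mono) auto
        then show ?thesis by (simp add: \<mu>0)
      qed
      then show "eventually (\<lambda>n. norm (Y (\<omega> n) i $ 2 $ 1 / \<mu> i ^ M (\<omega> n)) \<le> \<bar>Y (\<omega> n) i $ 2 $ 1\<bar>) sequentially"
        by simp
    qed
    have "(\<lambda>n. Z (\<omega> n) i) \<longlonglongrightarrow> mat2 1 (u i) 0 1"
      unfolding Z_def using lim[of 1 1] lim[of 2 2] u[OF i] r
      by (intro tendsto_mat2) (auto simp: mat_def \<omega>_def)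
    then show "(\<lambda>n. Q i ** Z (\<omega> n) i ** adj2 (Q i)) \<longlonglongrightarrow> Q i ** mat2 1 (u i) 0 1 ** adj2 (Q i)"
      by (intro tendsto_intros)
  qed (rule ZP)
  ultimately show ?thesis by blast
qed

end

lemma rank1_uminus: "rank1 (- x) z = - rank1 x z"
  by (simp add: rank1_def)

context tuple_group
begin

lemma proj_closure_conj:
  assumes "finite T" "X \<in> proj_closure T G" "B \<in> G"
  shows "(\<lambda>i. B i ** X i ** adj2 (B i)) \<in> proj_closure T G"
proof -
  have "(\<lambda>i. B i ** X i) \<in> proj_closure T G"
    by (rule proj_closure_mult[OF assms(1) mem_proj_closure[OF assms(3)] assms(2)])
  then show ?thesis
    by (rule proj_closure_mult[OF assms(1) _ mem_proj_closure[OF inv_mem[OF assms(3)]]])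
qed

text \<open>The exponent vectors of unipotent limits form a closed additive group stable under
  division by the weights \<open>\<mu> i\<close>. Dividing often and multiplying back by integers
  adapted to the coordinate \<open>k\<close> of least weight in the support of \<open>u\<close>
  makes all other coordinates die out.\<close>

lemma unipotent_single:
  assumes T: "finite T" and g: "g \<in> G"
    and Q: "\<And>i. i \<in> T \<Longrightarrow> det (Q i) = 1 \<and> \<bar>l i\<bar> > 1 \<and> g i = Q i ** mat2 (l i) 0 0 (1 / l i) ** adj2 (Q i)"
    and dist: "inj_on (\<lambda>i. (l i)\<^sup>2) T"
    and u: "\<exists>i\<in>T. u i \<noteq> 0" "(\<lambda>i. Q i ** mat2 1 (u i) 0 1 ** adj2 (Q i)) \<in> proj_closure T G"
  shows "\<exists>k\<in>T. \<forall>s. (\<lambda>i. Q i ** mat2 1 (if i = k then s else 0) 0 1 ** adj2 (Q i)) \<in> proj_closure T G"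
proof -
  define U where "U v \<longleftrightarrow> (\<lambda>i. Q i ** mat2 1 (v i) 0 1 ** adj2 (Q i)) \<in> proj_closure T G" for v
  have Uu: "U u" using u(2) by (simp add: U_def)
  have add: "U (\<lambda>i. v i + w i)" if "U v" "U w" for v w
  proof -
    have "(\<lambda>i. (Q i ** mat2 1 (v i) 0 1 ** adj2 (Q i)) ** (Q i ** mat2 1 (w i) 0 1 ** adj2 (Q i))) \<in> proj_closure T G"
      using that unfolding U_def by (rule proj_closure_mult[OF T])
    then show ?thesis unfolding U_def
      by (rule proj_closure_cong[THEN iffD1, rotated]) (use Q in \<open>simp add: conj_mult add.commute\<close>)
  qed
  have neg: "U (\<lambda>i. - v i)" if "U v" for v
    using proj_closure_adj2[OF T] that unfolding U_def by (force simp: adj2_conj)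
  have zero: "U (\<lambda>i. 0)"
    unfolding U_def
    by (rule proj_closure_cong[THEN iffD1, OF _ mem_proj_closure[OF one_mem]])
       (use Q in \<open>simp add: mat_1_eq[symmetric] mult_adj2_1\<close>)
  have nat: "U (\<lambda>i. of_nat n * v i)" if "U v" for v n
    using that by (induction n) (auto simp: zero distrib_right intro!: add)
  have int: "U (\<lambda>i. of_int n * v i)" if "U v" for v n
  proof (cases "n \<ge> 0")
    case True
    then show ?thesis using nat[OF that, of "nat n"] by simp
  next
    case False
    then show ?thesis using neg[OF nat[OF that, of "nat (- n)"]] by simp
  qed
  define \<mu> where "\<mu> i = (l i)\<^sup>2" for i
  have \<mu>: "\<mu> i > 1" if "i \<in> T" for i
    using Q[OF that] by (simp add: \<mu>_def) (metis abs_square_le_1 not_le)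
  have down: "U (\<lambda>i. v i / \<mu> i)" if "U v" for v
  proof -
    have "(\<lambda>i. adj2 (g i) ** (Q i ** mat2 1 (v i) 0 1 ** adj2 (Q i)) ** g i) \<in> proj_closure T G"
      using proj_closure_conj[OF T that[unfolded U_def] inv_mem[OF g]] by simp
    moreover have "adj2 (g i) ** (Q i ** mat2 1 (v i) 0 1 ** adj2 (Q i)) ** g i =
        Q i ** mat2 1 (v i / \<mu> i) 0 1 ** adj2 (Q i)" if "i \<in> T" for i
    proof -
      have l0: "l i \<noteq> 0" and dQ: "det (Q i) = 1" using Q[OF that] by auto
      have gi: "g i = Q i ** mat2 (l i) 0 0 (1 / l i) ** adj2 (Q i)" using Q[OF that] by auto
      have "adj2 (g i) ** (Q i ** mat2 1 (v i) 0 1 ** adj2 (Q i)) ** g i =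
        Q i ** (adj2 (mat2 (l i) 0 0 (1 / l i)) ** mat2 1 (v i) 0 1 ** mat2 (l i) 0 0 (1 / l i)) ** adj2 (Q i)"
        unfolding gi adj2_conj conj_mult[OF dQ] ..
      then show ?thesis using l0 by (simp add: \<mu>_def power2_eq_square)
    qed
    ultimately show ?thesis unfolding U_def
      by (rule proj_closure_cong[THEN iffD1, rotated])
  qed
  have pow: "U (\<lambda>i. u i / \<mu> i ^ n)" for n
  proof (induction n)
    case 0 then show ?case using Uu by simp
  next
    case (Suc n) then show ?case using down[OF Suc] by (simp add: mult.commute)
  qed
  define W where "W = {i \<in> T. u i \<noteq> 0}"
  have "finite W" "W \<noteq> {}" using T u(1) by (auto simp: W_def)
  then obtain k where k: "k \<in> W" "\<And>i. i \<in> W \<Longrightarrow> \<mu> k \<le> \<mu> i"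
    using ex_min_if_finite[of "\<mu> ` W"] by (metis (no_types, lifting) finite_imageI image_iff image_is_empty not_le)
  then have kT: "k \<in> T" "u k \<noteq> 0" by (auto simp: W_def)
  have "U (\<lambda>i. if i = k then s else 0)" for s
  proof -
    define a where "a n = u k / \<mu> k ^ n" for n
    have a0: "a n \<noteq> 0" for n using kT \<mu>[OF kT(1)] by (auto simp: a_def)
    \<comment> \<open>Taking the integer part changes coordinate \<open>k\<close> by at most
      \<open>a n\<close>, which tends to 0, so this coordinate can be steered to any real
      \<open>s\<close>.\<close>
    define w where "w n i = of_int \<lfloor>s / a n\<rfloor> * (u i / \<mu> i ^ n)" for n i
    have U: "U (w n)" for n unfolding w_def by (rule int) (rule pow)
    have "a \<longlonglongrightarrow> 0"
      unfolding a_def divide_inverse power_inverse[symmetric]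
      using \<mu>[OF kT(1)] by (intro tendsto_mult_right_zero LIMSEQ_power_zero) (auto simp: inverse_eq_divide)
    have lk: "(\<lambda>n. of_int \<lfloor>s / a n\<rfloor> * a n) \<longlonglongrightarrow> s"
    proof (rule LIM_zero_cancel, rule Lim_null_comparison)
      show "(\<lambda>n. \<bar>a n\<bar>) \<longlonglongrightarrow> 0" using \<open>a \<longlonglongrightarrow> 0\<close> by (rule tendsto_rabs_zero)
      have "norm (of_int \<lfloor>s / a n\<rfloor> * a n - s) \<le> \<bar>a n\<bar>" for n
      proof -
        have "of_int \<lfloor>s / a n\<rfloor> * a n - s = (of_int \<lfloor>s / a n\<rfloor> - s / a n) * a n"
          using a0[of n] by (simp add: algebra_simps)
        also have "norm \<dots> \<le> 1 * \<bar>a n\<bar>"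
          unfolding real_norm_def abs_mult by (intro mult_right_mono) linarith+
        finally show ?thesis by simp
      qed
      then show "eventually (\<lambda>n. norm (of_int \<lfloor>s / a n\<rfloor> * a n - s) \<le> \<bar>a n\<bar>) sequentially" by simp
    qed
    have lim: "(\<lambda>n. w n i) \<longlonglongrightarrow> (if i = k then s else 0)" if i: "i \<in> T" for i
    proof (cases "i = k")
      case True
      then show ?thesis using lk by (simp add: w_def a_def)
    next
      case False
      show ?thesis
      proof (cases "u i = 0")
        case True
        then show ?thesis using False by (simp add: w_def)
      next
        case nz: False
        have "\<mu> k \<le> \<mu> i" using k(2) i nz by (simp add: W_def)
        moreover have "\<mu> k \<noteq> \<mu> i" using dist False i kT(1) by (auto simp: \<mu>_def inj_on_def)
        ultimately have lt: "\<mu> k / \<mu> i < 1" "\<mu> k / \<mu> i \<ge> 0" using \<mu>[OF i] \<mu>[OF kT(1)] by auto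
        have "w n i = of_int \<lfloor>s / a n\<rfloor> * a n * (u i / u k) * (\<mu> k / \<mu> i) ^ n" for n
          using \<mu>[OF kT(1)] kT(2) by (simp add: w_def a_def power_divide)
        moreover have "(\<lambda>n. of_int \<lfloor>s / a n\<rfloor> * a n * (u i / u k) * (\<mu> k / \<mu> i) ^ n) \<longlonglongrightarrow> s * (u i / u k) * 0"
          using lt by (intro tendsto_intros lk LIMSEQ_power_zero) auto
        ultimately show ?thesis using False by simp
      qed
    qed
    have "(\<lambda>n. Q i ** mat2 1 (w n i) 0 1 ** adj2 (Q i)) \<longlonglongrightarrow>
        Q i ** mat2 1 (if i = k then s else 0) 0 1 ** adj2 (Q i)" if "i \<in> T" for i
      by (intro tendsto_intros lim that)
    then show ?thesis unfolding U_def
      by (rule proj_closure_limit[OF T U[unfolded U_def]])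
  qed
  then show ?thesis using kT(1) unfolding U_def by blast
qed

text \<open>Unipotents divided by their parameter tend to the nilpotent with image and kernel (1,
  0). Conjugation by \<open>h\<close> moves both away from that direction, and unipotents on the
  left and right then move image and kernel independently over the rest of the projective
  line.\<close>

lemma single_full:
  assumes T: "finite T" "k \<in> T" and h: "h \<in> G" and Q: "det (Q k) = 1"
    and E: "(adj2 (Q k) ** h k ** Q k) $ 2 $ 1 \<noteq> 0"
    and U: "\<And>s. (\<lambda>i. if i = k then Q k ** mat2 1 s 0 1 ** adj2 (Q k) else mat 1) \<in> proj_closure T G"
    and X: "det X = 0"
  shows "(\<lambda>i. if i = k then X else mat 1) \<in> proj_closure T G"
proof -
  define V where "V X \<longleftrightarrow> (\<lambda>i. if i = k then Q k ** X ** adj2 (Q k) else mat 1) \<in> proj_closure T G" for X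
  have mult: "V (X ** Y)" if "V X" "V Y" for X Y
    using proj_closure_mult[OF T(1) that[unfolded V_def]] unfolding V_def
    by (rule proj_closure_cong[THEN iffD1, rotated]) (use Q in \<open>auto simp: conj_mult\<close>)
  have scale: "V (c *\<^sub>R X)" if "V X" for X c
    using proj_closure_scale[OF T(1) that[unfolded V_def], of "\<lambda>i. if i = k then c else 1"] unfolding V_def
    by (rule proj_closure_cong[THEN iffD1, rotated]) (auto simp: scaleR_matrix_mult)
  have lim: "V X" if "\<And>n. V (Y n)" "Y \<longlonglongrightarrow> X" for X Y
    unfolding V_def
    by (rule proj_closure_limit[OF T(1) that(1)[unfolded V_def]]) (auto intro!: tendsto_intros that(2))
  have u: "V (mat2 1 s 0 1)" for s using U by (simp add: V_def)
  have "(\<lambda>n. inverse (real (Suc n)) *\<^sub>R mat2 1 (real (Suc n)) 0 1) \<longlonglongrightarrow> mat2 0 1 0 0"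
    unfolding mat2_scaleR using LIMSEQ_inverse_real_of_nat by (intro tendsto_mat2) auto
  then have "V (mat2 0 1 0 0)" by (rule lim[rotated]) (rule scale[OF u])
  then have N: "V (rank1 (1, 0) (1, 0))" by (simp add: rank1_def)
  define F where "F = adj2 (Q k) ** h k ** Q k"
  have hk: "h k = Q k ** F ** adj2 (Q k)" using Q by (simp add: F_def conj_adj2)
  have N': "V (F ** rank1 (1, 0) (1, 0) ** adj2 F)"
  proof -
    have "(\<lambda>i. h i ** (if i = k then Q k ** rank1 (1, 0) (1, 0) ** adj2 (Q k) else mat 1) ** adj2 (h i))
        \<in> proj_closure T G"
      using N unfolding V_def by (rule proj_closure_conj[OF T(1) _ h])
    then show ?thesis unfolding V_def
      by (rule proj_closure_cong[THEN iffD1, rotated])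
         (use Q det_mem[OF h] in \<open>auto simp: hk adj2_conj conj_mult mult_adj2_1\<close>)
  qed
  obtain a b c d where F: "F = mat2 a b c d" by (rule mat2_cases)
  have c: "c \<noteq> 0" using E by (simp add: F_def[symmetric] F)
  have N'': "F ** rank1 (1, 0) (1, 0) ** adj2 F = rank1 (a, c) (a, c)"
    by (simp add: F rank1_def)
  have gen: "V (rank1 x z)" if xz: "snd x \<noteq> 0" "snd z \<noteq> 0" for x z
  proof -
    \<comment> \<open>The translations by \<open>s\<close> on the left and \<open>t\<close> on the
      right carry the direction (a, c) to those of \<open>x\<close> and \<open>z\<close>; on the
      right the adjugate in \<open>rank1_mult\<close> reverses the sign.\<close>
    define s where "s = (fst x * c / snd x - a) / c"
    define t where "t = (a - fst z * c / snd z) / c"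
    have "V ((snd x * snd z / c\<^sup>2) *\<^sub>R (mat2 1 s 0 1 ** rank1 (a, c) (a, c) ** mat2 1 t 0 1))"
      using N' N'' u by (intro scale mult) auto
    moreover have "mat2 1 s 0 1 ** rank1 (a, c) (a, c) ** mat2 1 t 0 1 =
        rank1 (fst x * c / snd x, c) (fst z * c / snd z, c)"
      using c by (simp add: rank1_mult mult_rank1 mat_app_def s_def t_def)
    moreover have "(snd x * snd z / c\<^sup>2) *\<^sub>R rank1 (fst x * c / snd x, c) (fst z * c / snd z, c) = rank1 x z"
      using c xz by (simp add: rank1_def power2_eq_square field_simps)
    ultimately show ?thesis by simp
  qed
  define X' where "X' = adj2 (Q k) ** X ** Q k"
  have "det X' = 0" using X by (simp add: X'_def det_mul)
  then obtain x z where X': "X' = rank1 x z" by (rule det_zero_rank1)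
  have "\<exists>Y. norm (Y - X') < inverse (real (Suc n)) \<and> V Y" for n
    using approx_rank1_generic[of "inverse (real (Suc n))" x z] gen unfolding X'
    by (metis inverse_positive_iff_positive of_nat_0_less_iff zero_less_Suc)
  then obtain Y where Y: "\<And>n. norm (Y n - X') < inverse (real (Suc n))" "\<And>n. V (Y n)" by metis
  have "V X'" using lim[OF Y(2) tendsto_inverse_SucI[OF Y(1)]] .
  moreover have "Q k ** X' ** adj2 (Q k) = X" unfolding X'_def by (rule conj_adj2[OF Q])
  ultimately show ?thesis unfolding V_def by (simp cong: if_cong)
qed

end

text \<open>The groups of interest: the components of an element are conjugate under the embeddings of a
  number field, \<open>G\<close> is a lattice in the factor \<open>j\<close> and is not discrete in the others.\<close>
locale galois_tuple_group = tuple_group +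
  fixes I :: "nat set" and j :: nat
  assumes finite_I: "finite I" and j_mem: "j \<in> I"
    and faithful: "A \<in> G \<Longrightarrow> i \<in> I \<Longrightarrow> central (A i) \<Longrightarrow> central (A k)"
    and trace_two: "A \<in> G \<Longrightarrow> i \<in> I \<Longrightarrow> k \<in> I \<Longrightarrow> trace (A i) = s \<Longrightarrow> \<bar>s\<bar> = 2 \<Longrightarrow> trace (A k) = s"
    and trace_distinct: "A \<in> G \<Longrightarrow> \<bar>trace (A j)\<bar> > 2 \<Longrightarrow> i \<in> I \<Longrightarrow> k \<in> I \<Longrightarrow> i \<noteq> k \<Longrightarrow>
      (trace (A i))\<^sup>2 \<noteq> (trace (A k))\<^sup>2"
    and full_j: "proj_full {j} G" and discrete_j: "\<not> near_one {j} G"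
    and nondiscrete: "i \<in> I \<Longrightarrow> i \<noteq> j \<Longrightarrow> near_one {i} G"
begin

text \<open>Approximate a projection, of trace 1. Its determinant 0 forces the scalars to tend to 0,
  and with bounded traces the limit would have trace 0.\<close>

lemma exists_hyperbolic_j: "\<exists>A\<in>G. \<bar>trace (A j)\<bar> > 2"
proof (rule ccontr)
  assume neg: "\<not> ?thesis"
  have "(\<lambda>_. mat2 1 0 0 0) \<in> proj_closure {j} G"
    using full_j by (simp add: proj_full_def)
  then obtain A c where A: "\<And>n::nat. A n \<in> G"
    "\<And>i. i \<in> {j} \<Longrightarrow> (\<lambda>n. c n i *\<^sub>R A n i) \<longlonglongrightarrow> mat2 1 0 0 0" by (rule proj_closure_seqE) blast
  have lim: "(\<lambda>n. c n j *\<^sub>R A n j) \<longlonglongrightarrow> mat2 1 0 0 0" using A(2) by simp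
  have "(\<lambda>n. det (c n j *\<^sub>R A n j)) \<longlonglongrightarrow> det (mat2 1 0 0 0)" by (intro tendsto_intros lim)
  then have c0: "(\<lambda>n. (c n j)\<^sup>2) \<longlonglongrightarrow> 0" using A(1) det_mem by (simp add: det_scaleR2)
  have "(\<lambda>n. (trace (c n j *\<^sub>R A n j))\<^sup>2) \<longlonglongrightarrow> (trace (mat2 1 0 0 0))\<^sup>2" by (intro tendsto_intros lim)
  then have "(\<lambda>n. (c n j)\<^sup>2 * (trace (A n j))\<^sup>2) \<longlonglongrightarrow> 1"
    by (simp add: trace_scaleR power_mult_distrib)
  moreover have "(c n j)\<^sup>2 * (trace (A n j))\<^sup>2 \<le> (c n j)\<^sup>2 * 4" for n
  proof -
    have "\<bar>trace (A n j)\<bar> \<le> \<bar>2\<bar>" using neg A(1) by (auto simp: not_less)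
    then have "(trace (A n j))\<^sup>2 \<le> 2\<^sup>2" by (simp only: abs_le_square_iff)
    then show ?thesis by (intro mult_left_mono) auto
  qed
  moreover have "(\<lambda>n. (c n j)\<^sup>2 * 4) \<longlonglongrightarrow> 0" using tendsto_mult_left_zero[OF c0, of 4] by simp
  ultimately have "(1::real) \<le> 0" using LIMSEQ_le by blast
  then show False by simp
qed

text \<open>Written with adjugates, the commutator is homogeneous of degree 4 in \<open>h\<close>.
  If its trace were always 2, it would tend to 0 along scaled elements converging to a singular
  matrix, but at \<open>rank1 x x\<close> it is the fourth power of a nonzero number.\<close>

lemma exists_transversal:
  assumes g: "g \<in> G" "\<bar>trace (g j)\<bar> > 2"
  shows "\<exists>h\<in>G. trace (commutator (g j) (h j ** g j ** adj2 (h j))) \<noteq> 2"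
proof (rule ccontr)
  assume "\<not> ?thesis"
  then have neg: "trace (commutator (g j) (h j ** g j ** adj2 (h j))) = 2" if "h \<in> G" for h
    using that by blast
  have dg: "det (g j) = 1" using g(1) by (rule det_mem)
  obtain Q l where Q: "det Q = 1" "\<bar>l\<bar> > 1" "g j = Q ** mat2 l 0 0 (1/l) ** adj2 Q"
    using hyperbolic_diagonalize[OF dg g(2)] by blast
  have l0: "l \<noteq> 0" and ll: "l * l \<noteq> 1" using Q(2) by (auto simp: power2_eq_square[symmetric] power2_eq_1_iff)
  \<comment> \<open>\<open>x\<close> is the sum of two eigenvectors of \<open>g j\<close> with
    different eigenvalues, hence no eigenvector, which makes \<open>w\<close> nonzero.\<close>
  define x where "x = mat_app Q (1, 1)"
  define w where "w = cross x (mat_app (g j) x)"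
  have "mat_app (g j) x = mat_app (Q ** mat2 l 0 0 (1/l) ** (adj2 Q ** Q)) (1, 1)"
    unfolding x_def mat_app_mult[symmetric] Q(3) by (simp add: matrix_mul_assoc)
  also have "\<dots> = mat_app Q (l, 1/l)" using Q(1) by (simp add: mult_adj2_1 mat_app_mult) (simp add: mat_app_def)
  finally have "w = 1/l - l" unfolding w_def x_def using Q(1) by (simp add: cross_mat_app) (simp add: cross_def)
  then have w0: "w \<noteq> 0" using l0 ll by (auto simp: field_simps)
  have wa: "cross x (mat_app (adj2 (g j)) x) = - w"
  proof -
    have "cross (mat_app (g j) x) (mat_app (g j) (mat_app (adj2 (g j)) x)) = cross x (mat_app (adj2 (g j)) x)"
      using dg by (simp add: cross_mat_app)
    moreover have "mat_app (g j) (mat_app (adj2 (g j)) x) = x"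
      using dg by (simp add: mat_app_mult[symmetric] mult_adj2_1) (simp add: mat_app_def mat_def)
    ultimately show ?thesis using cross_swap[of "mat_app (g j) x" x] by (simp add: w_def)
  qed
  have "(\<lambda>_. rank1 x x) \<in> proj_closure {j} G" using full_j by (simp add: proj_full_def)
  then obtain A c where A: "\<And>n::nat. A n \<in> G"
    "\<And>i. i \<in> {j} \<Longrightarrow> (\<lambda>n. c n i *\<^sub>R A n i) \<longlonglongrightarrow> rank1 x x" by (rule proj_closure_seqE) blast
  have lim: "(\<lambda>n. c n j *\<^sub>R A n j) \<longlonglongrightarrow> rank1 x x" using A(2) by simp
  define C where "C Y = commutator (g j) (Y ** g j ** adj2 Y)" for Y
  have CA: "trace (C (c n j *\<^sub>R A n j)) = (c n j)\<^sup>2 * (c n j)\<^sup>2 * 2" for n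
  proof -
    have "C (c n j *\<^sub>R A n j) = ((c n j)\<^sup>2 * (c n j)\<^sup>2) *\<^sub>R C (A n j)"
      by (simp add: C_def commutator_def scaleR_matrix_mult adj2_scaleR power2_eq_square mult_ac)
    then show ?thesis using neg[OF A(1)] by (simp add: C_def trace_scaleR)
  qed
  have "(\<lambda>n. det (c n j *\<^sub>R A n j)) \<longlonglongrightarrow> det (rank1 x x)" by (intro tendsto_intros lim)
  then have c0: "(\<lambda>n. (c n j)\<^sup>2) \<longlonglongrightarrow> 0" using A(1) det_mem by (simp add: det_scaleR2)
  have "(\<lambda>n. (c n j)\<^sup>2 * (c n j)\<^sup>2 * 2) \<longlonglongrightarrow> 0 * 0 * 2" by (intro tendsto_intros c0)
  moreover have "(\<lambda>n. trace (C (c n j *\<^sub>R A n j))) \<longlonglongrightarrow> trace (C (rank1 x x))"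
    unfolding C_def commutator_def by (intro tendsto_intros lim)
  ultimately have "trace (C (rank1 x x)) = 0 * 0 * 2" unfolding CA by (rule LIMSEQ_unique[rotated])
  moreover have "trace (C (rank1 x x)) = w^4"
  proof -
    have M: "rank1 x x ** g j ** adj2 (rank1 x x) = (- w) *\<^sub>R rank1 x x"
    proof -
      have "rank1 x x ** g j ** rank1 x x = w *\<^sub>R rank1 x x"
        by (simp add: mult_rank1 mat_app_rank1 scaleR_rank1 w_def mat_app_mult)
      then show ?thesis by (simp add: adj2_rank1 neg_matrix_mult)
    qed
    have "g j ** rank1 x x ** adj2 (g j) ** rank1 x x = (- w) *\<^sub>R rank1 (mat_app (g j) x) x"
      using rank1_uminus by (simp add: mult_rank1 mat_app_rank1 scaleR_rank1 wa mat_app_scaleR mat_app_mult)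
    moreover have "adj2 ((- w) *\<^sub>R rank1 x x) = w *\<^sub>R rank1 x x"
      by (simp add: rank1_def)
    ultimately have "C (rank1 x x) = ((- w) * w * (- w)) *\<^sub>R rank1 (mat_app (g j) x) x"
      unfolding C_def commutator_def M by (simp add: scaleR_matrix_mult neg_matrix_mult)
    then show ?thesis by (simp add: trace_scaleR trace_rank1 w_def[symmetric] power4_eq_xxxx)
  qed
  ultimately show False using w0 by simp
qed

text \<open>Take commutators of powers of \<open>A\<close> with a transversal conjugate. Where
  \<open>A\<close> is hyperbolic the traces grow. Where it is elliptic they are at least 2, and 2 is
  excluded by \<open>trace_two\<close> because the factor \<open>j\<close> is already hyperbolic.
  The same assumption rules out traces 2 and -2 of \<open>A\<close> itself.\<close>

lemma exists_all_hyperbolic: "\<exists>g\<in>G. \<forall>i\<in>I. \<bar>trace (g i)\<bar> > 2"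
proof -
  obtain A where A: "A \<in> G" "\<bar>trace (A j)\<bar> > 2" using exists_hyperbolic_j by blast
  then obtain h where h: "h \<in> G" "trace (commutator (A j) (h j ** A j ** adj2 (h j))) \<noteq> 2"
    using exists_transversal by blast
  define B where "B i = h i ** A i ** adj2 (h i)" for i
  have B: "B \<in> G" unfolding B_def using A h by (intro conj_mem) auto
  define C where "C n i = commutator (mpow (A i) n) (B i)" for n i
  have C: "C n \<in> G" for n unfolding C_def by (intro commutator_mem mpow_mem A B)
  have C1: "trace (commutator (A i) (B i)) \<noteq> 2" if "i \<in> I" for i
    using trace_two[OF commutator_mem[OF A(1) B] that j_mem, of 2] h(2) by (auto simp: B_def)
  have evj: "eventually (\<lambda>n. \<bar>trace (C n j)\<bar> > 2) sequentially"
    unfolding C_def using A B det_mem C1[OF j_mem] by (intro trace_commutator_mpow_hyperbolic) auto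
  have "eventually (\<lambda>n. \<bar>trace (C n i)\<bar> > 2) sequentially" if i: "i \<in> I" for i
  proof -
    have "\<bar>trace (A i)\<bar> \<noteq> 2" using trace_two[OF A(1) i j_mem refl] A(2) by auto
    then consider "\<bar>trace (A i)\<bar> > 2" | "\<bar>trace (A i)\<bar> < 2" by linarith
    then show ?thesis
    proof cases
      case 1
      then show ?thesis
        unfolding C_def using A B det_mem C1[OF i] by (intro trace_commutator_mpow_hyperbolic) auto
    next
      case 2
      from evj show ?thesis
      proof eventually_elim
        case (elim n)
        have "trace (C n i) \<ge> 2"
          unfolding C_def using A B det_mem 2 by (intro trace_commutator_mpow_elliptic) auto
        moreover have "trace (C n i) \<noteq> 2"
          using trace_two[OF C i j_mem, of n 2] elim by auto
        ultimately show ?case by simp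
      qed
    qed
  qed
  then have "eventually (\<lambda>n. \<forall>i\<in>I. \<bar>trace (C n i)\<bar> > 2) sequentially"
    using finite_I by (intro eventually_ball_finite) auto
  then show ?thesis using C by (auto simp: eventually_sequentially)
qed

theorem proj_full_all: "T \<subseteq> I \<Longrightarrow> proj_full T G"
proof -
  obtain g where g: "g \<in> G" "\<And>i. i \<in> I \<Longrightarrow> \<bar>trace (g i)\<bar> > 2" using exists_all_hyperbolic by blast
  have "\<exists>Q l. det Q = 1 \<and> \<bar>l\<bar> > 1 \<and> g i = Q ** mat2 l 0 0 (1/l) ** adj2 Q" if "i \<in> I" for i
    using hyperbolic_diagonalize[OF det_mem[OF g(1)] g(2)[OF that]] by metis
  then obtain Q l where Q: "\<And>i. i \<in> I \<Longrightarrow> det (Q i) = 1 \<and> \<bar>l i\<bar> > 1 \<and> g i = Q i ** mat2 (l i) 0 0 (1 / l i) ** adj2 (Q i)"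
    by metis
  have dist: "inj_on (\<lambda>i. (l i)\<^sup>2) I"
  proof (rule inj_onI, rule ccontr)
    fix i k assume ik: "i \<in> I" "k \<in> I" "(l i)\<^sup>2 = (l k)\<^sup>2" "i \<noteq> k"
    have tr: "(trace (g i))\<^sup>2 = (l i)\<^sup>2 + 2 + 1 / (l i)\<^sup>2" if "i \<in> I" for i
    proof -
      have "l i \<noteq> 0" "trace (g i) = l i + 1 / l i" using Q[OF that] by (auto simp: trace_conj)
      then show ?thesis by (simp add: power2_eq_square algebra_simps)
    qed
    show False
      using trace_distinct[OF g(1) g(2)[OF j_mem] ik(1,2,4)] ik by (simp add: tr)
  qed
  obtain h where h: "h \<in> G" "trace (commutator (g j) (h j ** g j ** adj2 (h j))) \<noteq> 2"
    using exists_transversal[OF g(1) g(2)[OF j_mem]] by blast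
  \<comment> \<open>Transversality is given in the factor \<open>j\<close> only; a commutator trace
    2 in any other factor would by \<open>trace_two\<close> also occur at \<open>j\<close>.\<close>
  have E: "(adj2 (Q i) ** h i ** Q i) $ a $ b \<noteq> 0" if i: "i \<in> I" for i a b
  proof -
    define F where "F = adj2 (Q i) ** h i ** Q i"
    have Qi: "det (Q i) = 1" "l i \<noteq> 0" using Q[OF i] by auto
    have hi: "h i = Q i ** F ** adj2 (Q i)" using Qi by (simp add: F_def conj_adj2)
    have dF: "det F = 1" using Qi det_mem[OF h(1)] by (simp add: F_def det_mul)
    have "trace (commutator (g i) (h i ** g i ** adj2 (h i))) \<noteq> 2"
      using trace_two[OF commutator_mem[OF g(1) conj_mem[OF g(1) h(1)]] i j_mem, of 2] h(2) by auto
    moreover have "commutator (g i) (h i ** g i ** adj2 (h i)) =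
        Q i ** commutator (mat2 (l i) 0 0 (1 / l i)) (F ** mat2 (l i) 0 0 (1 / l i) ** adj2 F) ** adj2 (Q i)"
      using Q[OF i] hi by (simp add: adj2_conj conj_mult commutator_conj)
    ultimately have "F $ 1 $ 1 * F $ 1 $ 2 * F $ 2 $ 1 * F $ 2 $ 2 \<noteq> 0"
      using trace_commutator_diag_conj[OF dF Qi(2)] Qi(1) by (auto simp: trace_conj)
    then show ?thesis using exhaust_2[of a] exhaust_2[of b] by (auto simp: F_def)
  qed
  assume "T \<subseteq> I"
  with finite_I have "finite T" by (rule finite_subset[rotated])
  then show ?thesis using \<open>T \<subseteq> I\<close>
  proof (induction T rule: finite_psubset_induct)
    case (psubset T)
    have QT: "\<And>i. i \<in> T \<Longrightarrow> det (Q i) = 1 \<and> \<bar>l i\<bar> > 1 \<and> g i = Q i ** mat2 (l i) 0 0 (1 / l i) ** adj2 (Q i)"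
      using psubset.prems Q by blast
    consider "T = {}" | "T = {j}" | k where "T \<noteq> {j}" "k \<in> T" "near_one T G"
      | k where "T \<noteq> {j}" "k \<in> T" "k \<noteq> j" "\<not> near_one T G" by blast
    then show ?case
    proof cases
      case 1
      then show ?thesis using one_mem by (auto simp: proj_full_def proj_closure_def)
    next
      case 2
      then show ?thesis using full_j by simp
    next
      case 3
      have "\<exists>u. (\<exists>i\<in>T. u i \<noteq> 0) \<and> (\<lambda>i. Q i ** mat2 1 (u i) 0 1 ** adj2 (Q i)) \<in> proj_closure T G"
        using near_one_unipotent[OF psubset.hyps 3(3) g(1) h(1) QT 3(2)] E psubset.prems 3(2) faithful
        by blast
      then obtain u where u: "\<exists>i\<in>T. u i \<noteq> 0" "(\<lambda>i. Q i ** mat2 1 (u i) 0 1 ** adj2 (Q i)) \<in> proj_closure T G"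
        by blast
      have "inj_on (\<lambda>i. (l i)\<^sup>2) T" using dist psubset.prems inj_on_subset by blast
      from unipotent_single[OF psubset.hyps g(1) QT this u]
      obtain m where m: "m \<in> T"
        "\<And>s. (\<lambda>i. Q i ** mat2 1 (if i = m then s else 0) 0 1 ** adj2 (Q i)) \<in> proj_closure T G" by blast
      have U: "(\<lambda>i. if i = m then Q m ** mat2 1 s 0 1 ** adj2 (Q m) else mat 1) \<in> proj_closure T G" for s
        using m(2)[of s] by (rule proj_closure_cong[THEN iffD1, rotated])
          (use QT in \<open>auto simp: mat_1_eq[symmetric] mult_adj2_1\<close>)
      \<comment> \<open>The unipotents \<open>U\<close> move the factor \<open>m\<close> alone, and
        the other factors are full by induction.\<close>
      show ?thesis
      proof (rule proj_full_combine[OF psubset.hyps, of "T - {m}" "{m}"])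
        show "T = T - {m} \<union> {m}" "(T - {m}) \<inter> {m} = {}" using m(1) by auto
        show "proj_full (T - {m}) G" using psubset.IH[of "T - {m}"] psubset.prems m(1) by blast
        fix X assume X: "\<And>i. i \<in> {m} \<Longrightarrow> det (X i :: real^2^2) = 0"
        have mI: "m \<in> I" using m(1) psubset.prems by blast
        have "(\<lambda>i. if i = m then X m else mat 1) \<in> proj_closure T G"
          by (rule single_full[where Q = Q and h = h and X = "X m", OF psubset.hyps m(1) h(1) _ E[OF mI] U])
             (use QT[OF m(1)] X in auto)
        then show "(\<lambda>i. if i \<in> {m} then X i else mat 1) \<in> proj_closure T G"
          by (rule proj_closure_cong[THEN iffD1, rotated]) auto
      qed
    next
      case 4
      define \<S> where "\<S> = {S. S \<subseteq> T \<and> k \<in> S \<and> near_one S G}"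
      have "finite \<S>" unfolding \<S>_def by (rule finite_subset[of _ "Pow T"]) (use psubset.hyps in auto)
      \<comment> \<open>The singleton of a factor other than \<open>j\<close> is non-discrete, so a
        maximal non-discrete subset \<open>S\<close> exists. It is nonempty, and proper because
        \<open>T\<close> fails \<open>near_one\<close>.\<close>
      moreover have "{k} \<in> \<S>" using nondiscrete[of k] 4 psubset.prems by (auto simp: \<S>_def)
      ultimately obtain S where S: "S \<in> \<S>" "\<forall>S'\<in>\<S>. S \<subseteq> S' \<longrightarrow> S = S'"
        using finite_has_maximal[of \<S>] by blast
      then have S': "S \<subseteq> T" "k \<in> S" "near_one S G" by (auto simp: \<S>_def)
      have max: "\<not> near_one (insert m S) G" if "m \<in> T - S" for m
      proof
        assume "near_one (insert m S) G"
        then have "insert m S \<in> \<S>" using S' that by (auto simp: \<S>_def)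
        with S(2) that show False by blast
      qed
      obtain X where X: "X \<in> proj_closure T G" "\<forall>i\<in>S. X i = mat 1" "\<forall>i\<in>T - S. det (X i) = 0 \<and> X i \<noteq> 0"
        using near_one_maximal_limit[OF psubset.hyps S'(1,3) max] faithful S'(2) psubset.prems by blast
      have "S \<noteq> T" using S'(3) 4 by auto
      show ?thesis
      proof (rule proj_full_split[OF psubset.hyps _ _ X(1)])
        show "T = S \<union> (T - S)" "S \<inter> (T - S) = {}" using S' by auto
        show "proj_full S G" using psubset.IH[of S] S' \<open>S \<noteq> T\<close> psubset.prems by blast
        show "proj_full (T - S) G" using psubset.IH[of "T - S"] S' psubset.prems by blast
      qed (use X in auto)
    qed
  qed
qed

end

section \<open>Hyperbolic area\<close>

text \<open>Areas are transformed on \<open>real^2\<close>, where a derivative has a matrix and a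
  determinant; the identification preserves Lebesgue measure.\<close>

definition complex_of_vec :: "real^2 \<Rightarrow> complex" where
  "complex_of_vec v = Complex (v $ 1) (v $ 2)"

definition vec_of_complex :: "complex \<Rightarrow> real^2" where
  "vec_of_complex z = vector [Re z, Im z]"

lemma complex_vec_inverse [simp]:
  "complex_of_vec (vec_of_complex z) = z" "vec_of_complex (complex_of_vec v) = v"
  by (simp_all add: complex_of_vec_def vec_of_complex_def vec_eq_iff forall_2)

lemma linear_complex_of_vec: "bounded_linear complex_of_vec"
  unfolding complex_of_vec_def
  by (intro linear_conv_bounded_linear[THEN iffD1] linearI) (auto simp: complex_eq_iff)

lemma linear_vec_of_complex: "bounded_linear vec_of_complex"
  unfolding vec_of_complex_def
  by (intro linear_conv_bounded_linear[THEN iffD1] linearI) (auto simp: vec_eq_iff forall_2)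

lemma measurable_complex_of_vec [measurable]: "complex_of_vec \<in> borel \<rightarrow>\<^sub>M borel"
  by (intro borel_measurable_continuous_onI linear_continuous_on linear_complex_of_vec)

lemma lborel_complex_of_vec: "lborel = distr lborel borel complex_of_vec"
proof (rule lborel_eqI)
  fix l u :: complex
  assume le: "\<And>b. b \<in> Basis \<Longrightarrow> l \<bullet> b \<le> u \<bullet> b"
  have eq: "complex_of_vec -` box l u = box (vec_of_complex l) (vec_of_complex u)"
    by (auto simp: box_def Basis_complex_def complex_of_vec_def vec_of_complex_def Basis_vec_def
        inner_axis forall_2)
  have B: "(Basis :: (real^2) set) = {axis 1 1, axis 2 1}"
    by (auto simp: Basis_vec_def UNIV_2)
  have ax: "axis 1 (1::real) \<noteq> (axis 2 1 :: real^2)" by (simp add: axis_eq_axis)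
  have "emeasure (distr lborel borel complex_of_vec) (box l u) = emeasure lborel (box (vec_of_complex l) (vec_of_complex u))"
    by (simp add: emeasure_distr eq)
  also have "\<dots> = (\<Prod>b\<in>Basis. (vec_of_complex u - vec_of_complex l) \<bullet> b)"
    using le[of 1] le[of \<i>]
    by (intro emeasure_lborel_box) (auto simp: B Basis_complex_def vec_of_complex_def inner_axis)
  also have "\<dots> = (\<Prod>b\<in>Basis. (u - l) \<bullet> b)"
    using ax by (simp add: B Basis_complex_def vec_of_complex_def inner_axis)
  finally show "emeasure (distr lborel borel complex_of_vec) (box l u) = (\<Prod>b\<in>Basis. (u - l) \<bullet> b)" .
qed simp

lemma nn_integral_complex_of_vec:
  "f \<in> borel_measurable borel \<Longrightarrow> (\<integral>\<^sup>+z. f z \<partial>lborel) = (\<integral>\<^sup>+v. f (complex_of_vec v) \<partial>lborel)"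
  by (subst lborel_complex_of_vec) (simp add: nn_integral_distr)

text \<open>Finiteness of the right-hand side allows passing from nonnegative integrals to gauge
  integrals, where the substitution rule applies, and back. The densities are wrapped as vectors of
  length one to fit that rule.\<close>

lemma nn_integral_change_of_variables:
  fixes g :: "real^2 \<Rightarrow> real^2" and \<phi> :: "real^2 \<Rightarrow> real"
  assumes S: "S \<in> sets borel" "g ` S \<in> sets borel"
    and der: "\<And>x. x \<in> S \<Longrightarrow> (g has_derivative g' x) (at x within S)" and inj: "inj_on g S"
    and \<phi>: "\<phi> \<in> borel_measurable borel" "\<And>x. 0 \<le> \<phi> x" and \<psi>: "\<psi> \<in> borel_measurable borel" "\<And>x. 0 \<le> \<psi> x"
    and eq: "\<And>x. x \<in> S \<Longrightarrow> \<bar>det (matrix (g' x))\<bar> * \<phi> (g x) = \<psi> x"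
    and fin: "(\<integral>\<^sup>+x. ennreal (\<psi> x) * indicator S x \<partial>lborel) < \<infinity>"
  shows "(\<integral>\<^sup>+x. ennreal (\<phi> x) * indicator (g ` S) x \<partial>lborel) = (\<integral>\<^sup>+x. ennreal (\<psi> x) * indicator S x \<partial>lborel)"
proof -
  define r where "r = enn2real (\<integral>\<^sup>+x. ennreal (\<psi> x) * indicator S x \<partial>lborel)"
  have r: "(\<integral>\<^sup>+x. ennreal (\<psi> x) * indicator S x \<partial>lborel) = ennreal r" "r \<ge> 0"
    using fin by (auto simp: r_def less_top)
  have ind: "ennreal (if x \<in> A then f x else 0) = ennreal (f x) * indicator A x" for A f and x :: "real^2"
    by (auto simp: indicator_def)
  have "((\<lambda>x. if x \<in> S then \<psi> x else 0) has_integral r) UNIV"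
    using S(1) \<psi> r by (subst has_integral_iff_nn_integral_lebesgue)
      (auto simp: nn_integral_completion ind intro!: measurable_completion)
  then have 1: "(\<psi> has_integral r) S" by (simp add: has_integral_restrict_UNIV)
  then have 1: "((\<lambda>x. \<bar>det (matrix (g' x))\<bar> * \<phi> (g x)) has_integral r) S"
    by (rule has_integral_eq[rotated]) (simp add: eq)
  then have "(\<lambda>x. \<bar>det (matrix (g' x))\<bar> * \<phi> (g x)) absolutely_integrable_on S"
    using \<phi>(2) by (intro nonnegative_absolutely_integrable_1) auto
  then have "(\<lambda>x. \<bar>det (matrix (g' x))\<bar> *\<^sub>R (vec (\<phi> (g x)) :: real^1)) absolutely_integrable_on S \<and>
      integral S (\<lambda>x. \<bar>det (matrix (g' x))\<bar> *\<^sub>R (vec (\<phi> (g x)) :: real^1)) = vec r"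
    using 1 by (auto simp: absolutely_integrable_on_1_iff integral_on_1_eq integral_unique)
  moreover have "S \<in> sets lebesgue" using S(1) by simp
  ultimately have "(\<lambda>x. vec (\<phi> x) :: real^1) absolutely_integrable_on (g ` S) \<and>
      integral (g ` S) (\<lambda>x. vec (\<phi> x) :: real^1) = vec r"
    using has_absolute_integral_change_of_variables[OF _ der inj, of "\<lambda>x. vec (\<phi> x) :: real^1" "vec r"] by blast
  then have "\<phi> absolutely_integrable_on (g ` S) \<and> integral (g ` S) \<phi> = r"
    by (auto simp: absolutely_integrable_on_1_iff integral_on_1_eq vec_eq_iff)
  then have "(\<phi> has_integral r) (g ` S)"
    by (metis absolutely_integrable_on_def integrable_integral)
  then have "((\<lambda>x. if x \<in> g ` S then \<phi> x else 0) has_integral r) UNIV"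
    by (simp only: has_integral_restrict_UNIV)
  then have "(\<integral>\<^sup>+x. ennreal (if x \<in> g ` S then \<phi> x else 0) \<partial>lebesgue) = ennreal r"
    using \<phi>(2) by (subst (asm) has_integral_iff_nn_integral_lebesgue) auto
  then show ?thesis unfolding r(1) ind by (simp add: nn_integral_completion)
qed

lemma Im_moebius:
  assumes "det A = 1"
  shows "Im (moebius A z) = Im z / (cmod (of_real (A $ 2 $ 1) * z + of_real (A $ 2 $ 2)))\<^sup>2"
proof -
  have "Im (moebius A z) = (A $ 1 $ 1 * A $ 2 $ 2 - A $ 1 $ 2 * A $ 2 $ 1) * Im z /
      (cmod (of_real (A $ 2 $ 1) * z + of_real (A $ 2 $ 2)))\<^sup>2"
    unfolding moebius_def Im_divide cmod_power2 by (simp add: algebra_simps)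
  then show ?thesis using assms by (simp add: det_eq)
qed

lemma moebius_denom_nonzero:
  fixes A :: "real^2^2"
  assumes "det A = 1" "Im z > 0"
  shows "of_real (A $ 2 $ 1) * z + of_real (A $ 2 $ 2) \<noteq> (0::complex)"
proof
  assume "of_real (A $ 2 $ 1) * z + of_real (A $ 2 $ 2) = (0::complex)"
  then have "A $ 2 $ 1 * Re z + A $ 2 $ 2 = 0" "A $ 2 $ 1 * Im z = 0"
    by (auto simp: complex_eq_iff)
  then have "A $ 2 $ 1 = 0" "A $ 2 $ 2 = 0" using assms(2) by auto
  with assms(1) show False by (simp add: det_eq)
qed

lemma moebius_upper:
  assumes "det A = 1" "z \<in> upper_half_plane"
  shows "moebius A z \<in> upper_half_plane"
  using assms moebius_denom_nonzero[OF assms(1), of z] by (simp add: upper_half_plane_def Im_moebius)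

lemma moebius_mult:
  assumes "det B = 1" "z \<in> upper_half_plane"
  shows "moebius (A ** B) z = moebius A (moebius B z)"
proof -
  obtain a b c d where A: "A = mat2 a b c d" by (rule mat2_cases)
  obtain e f g h where B: "B = mat2 e f g h" by (rule mat2_cases)
  define D where "D = of_real g * z + (of_real h :: complex)"
  have D: "D \<noteq> 0" using moebius_denom_nonzero[OF assms(1), of z] assms(2) by (simp add: B D_def upper_half_plane_def)
  define N where "N = of_real e * z + (of_real f :: complex)"
  have "moebius A (moebius B z) = (of_real a * (N / D) + of_real b) / (of_real c * (N / D) + of_real d)"
    by (simp add: moebius_def A B N_def D_def)
  also have "\<dots> = (of_real a * N + of_real b * D) / (of_real c * N + of_real d * D)"
  proof -
    have "of_real a * (N / D) + of_real b = (of_real a * N + of_real b * D) / D"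
      "of_real c * (N / D) + of_real d = (of_real c * N + of_real d * D) / D"
      using D by (simp_all add: add_divide_distrib)
    then show ?thesis using D by simp
  qed
  also have "\<dots> = moebius (A ** B) z"
    by (simp add: moebius_def A B N_def D_def algebra_simps)
  finally show ?thesis by simp
qed

lemma moebius_one [simp]: "moebius (mat 1) z = z"
  by (simp add: moebius_def mat_1_eq)

lemma moebius_inverse:
  assumes "det A = 1" "z \<in> upper_half_plane"
  shows "moebius (adj2 A) (moebius A z) = z" "moebius A (moebius (adj2 A) z) = z"
  using moebius_mult[of A z "adj2 A"] moebius_mult[of "adj2 A" z A] assms by (simp_all add: mult_adj2_1)

lemma moebius_has_field_derivative:
  assumes "det A = 1" "Im z > 0"
  shows "(moebius A has_field_derivative 1 / (of_real (A $ 2 $ 1) * z + of_real (A $ 2 $ 2))\<^sup>2) (at z within S)"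
proof -
  let ?D = "of_real (A $ 2 $ 1) * z + of_real (A $ 2 $ 2) :: complex"
  have D: "?D \<noteq> 0" by (rule moebius_denom_nonzero[OF assms])
  have "((\<lambda>z. (of_real (A $ 1 $ 1) * z + of_real (A $ 1 $ 2)) / (of_real (A $ 2 $ 1) * z + of_real (A $ 2 $ 2)))
    has_field_derivative (of_real (A $ 1 $ 1) * ?D - (of_real (A $ 1 $ 1) * z + of_real (A $ 1 $ 2)) * of_real (A $ 2 $ 1)) / (?D * ?D))
     (at z within S)"
    using D by (auto intro!: derivative_eq_intros)
  moreover have "of_real (A $ 1 $ 1) * ?D - (of_real (A $ 1 $ 1) * z + of_real (A $ 1 $ 2)) * of_real (A $ 2 $ 1) =
      of_real (det A)"
    by (simp add: det_eq algebra_simps)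
  ultimately show ?thesis using assms(1) by (simp add: moebius_def[abs_def] power2_eq_square)
qed

lemma continuous_on_moebius:
  assumes "det A = 1" shows "continuous_on upper_half_plane (moebius A)"
  using moebius_has_field_derivative[OF assms]
  by (intro DERIV_continuous_on) (auto simp: upper_half_plane_def)

lemma borel_upper_half_plane: "upper_half_plane \<in> sets borel"
proof -
  have "open upper_half_plane" unfolding upper_half_plane_def by (rule open_halfspace_Im_gt)
  then show ?thesis by simp
qed

lemma borel_moebius_vimage:
  assumes "det A = 1" "E \<in> sets borel"
  shows "{z \<in> upper_half_plane. moebius A z \<in> E} \<in> sets borel"
proof -
  have "moebius A \<in> borel_measurable (restrict_space borel upper_half_plane)"
    using continuous_on_moebius[OF assms(1)] borel_upper_half_plane
    by (intro borel_measurable_continuous_on_restrict)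
  then have "moebius A -` E \<inter> space (restrict_space borel upper_half_plane) \<in> sets (restrict_space borel upper_half_plane)"
    using assms(2) by (rule measurable_sets)
  then have "moebius A -` E \<inter> upper_half_plane \<in> sets borel"
    using borel_upper_half_plane by (simp add: sets_restrict_space_iff space_restrict_space)
  then show ?thesis by (simp add: vimage_def Int_def conj_commute)
qed

lemma moebius_image_eq:
  assumes "det A = 1" "E \<subseteq> upper_half_plane"
  shows "moebius A ` E = {z \<in> upper_half_plane. moebius (adj2 A) z \<in> E}"
proof safe
  fix z assume "z \<in> E"
  then show "moebius A z \<in> upper_half_plane" "moebius (adj2 A) (moebius A z) \<in> E"
    using assms moebius_upper moebius_inverse by auto
next
  fix z assume "z \<in> upper_half_plane" "moebius (adj2 A) z \<in> E"
  then show "z \<in> moebius A ` E" using moebius_inverse(2)[OF assms(1)] by (metis image_eqI)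
qed

text \<open>The derivative 1 / (c z + d)^2 scales Euclidean area by |c z + d|^(-4), and the
  imaginary part is scaled by |c z + d|^(-2), so the density is invariant.\<close>

lemma hyperbolic_area_moebius:
  assumes A: "det A = 1" and E: "E \<in> sets borel" "E \<subseteq> upper_half_plane" and fin: "hyperbolic_area E < \<infinity>"
  shows "hyperbolic_area (moebius A ` E) = hyperbolic_area E"
proof -
  define S where "S = complex_of_vec -` E"
  define g where "g v = vec_of_complex (moebius A (complex_of_vec v))" for v
  define \<phi> where "\<phi> v = 1 / (v $ 2)\<^sup>2" for v :: "real^2"
  define k where "k v = 1 / (of_real (A $ 2 $ 1) * complex_of_vec v + of_real (A $ 2 $ 2))\<^sup>2" for v
  define g' where "g' v h = vec_of_complex (k v * complex_of_vec h)" for v h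
  have AE: "moebius A ` E \<in> sets borel"
    unfolding moebius_image_eq[OF A E(2)] using A E(1) by (intro borel_moebius_vimage) simp_all
  have gS: "g ` S = complex_of_vec -` (moebius A ` E)"
  proof safe
    fix v assume "v \<in> S"
    then show "g v \<in> complex_of_vec -` (moebius A ` E)" by (simp add: g_def S_def)
  next
    fix v z assume z: "complex_of_vec v = moebius A z" "z \<in> E"
    then have "g (vec_of_complex z) = v" "vec_of_complex z \<in> S"
      by (simp_all add: g_def S_def z(1)[symmetric])
    then show "v \<in> g ` S" by blast
  qed
  have vim: "complex_of_vec -` X \<in> sets borel" if "X \<in> sets borel" for X
    using measurable_sets[OF measurable_complex_of_vec that] by simp
  have area: "hyperbolic_area X = (\<integral>\<^sup>+v. ennreal (\<phi> v) * indicator (complex_of_vec -` X) v \<partial>lborel)"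
    if "X \<in> sets borel" for X
  proof -
    have "(\<lambda>z. ennreal (1 / (Im z)\<^sup>2) * indicator X z) \<in> borel_measurable borel"
      using that by measurable
    from nn_integral_complex_of_vec[OF this] show ?thesis
      unfolding hyperbolic_area_def
      by (simp add: \<phi>_def complex_of_vec_def[of v for v] indicator_def vimage_def)
  qed
  have "(\<integral>\<^sup>+v. ennreal (\<phi> v) * indicator (g ` S) v \<partial>lborel) = (\<integral>\<^sup>+v. ennreal (\<phi> v) * indicator S v \<partial>lborel)"
  proof (rule nn_integral_change_of_variables)
    show "S \<in> sets borel" "g ` S \<in> sets borel" using vim[OF E(1)] vim[OF AE] by (simp_all only: S_def gS[unfolded S_def])
    show "\<phi> \<in> borel_measurable borel" unfolding \<phi>_def by measurable
    then show "\<phi> \<in> borel_measurable borel" .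
    show "0 \<le> \<phi> v" "0 \<le> \<phi> v" for v by (simp_all add: \<phi>_def)
    show "(\<integral>\<^sup>+v. ennreal (\<phi> v) * indicator S v \<partial>lborel) < \<infinity>"
      using fin area[OF E(1)] by (simp add: S_def)
    show "inj_on g S"
    proof (rule inj_onI)
      fix v w assume vw: "v \<in> S" "w \<in> S" "g v = g w"
      then have "moebius A (complex_of_vec v) = moebius A (complex_of_vec w)"
        unfolding g_def by (metis complex_vec_inverse(1))
      then have "complex_of_vec v = complex_of_vec w"
        using moebius_inverse(1)[OF A] vw E(2) unfolding S_def by (metis subsetD vimageE)
      then show "v = w" by (metis complex_vec_inverse(2))
    qed
    fix v assume "v \<in> S"
    then have v: "complex_of_vec v \<in> upper_half_plane" using E(2) by (auto simp: S_def)
    then have v2: "v $ 2 > 0" by (simp add: upper_half_plane_def complex_of_vec_def)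
    have "(moebius A has_derivative (*) (k v)) (at (complex_of_vec v) within complex_of_vec ` S)"
      using moebius_has_field_derivative[OF A] v unfolding k_def has_field_derivative_def
      by (simp add: upper_half_plane_def)
    then have "((moebius A \<circ> complex_of_vec) has_derivative ((*) (k v) \<circ> complex_of_vec)) (at v within S)"
      using bounded_linear_imp_has_derivative[OF linear_complex_of_vec] by (intro diff_chain_within)
    then show "(g has_derivative g' v) (at v within S)"
      unfolding g_def g'_def o_def by (rule bounded_linear.has_derivative[OF linear_vec_of_complex])
    have "matrix (g' v) = mat2 (Re (k v)) (- Im (k v)) (Im (k v)) (Re (k v))"
      by (simp add: mat2_ext matrix_def g'_def vec_of_complex_def complex_of_vec_def axis_def)
    then have "det (matrix (g' v)) = (cmod (k v))\<^sup>2"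
      by (simp only: det_mat2 cmod_power2) (simp add: power2_eq_square)
    moreover have "g v $ 2 = Im (moebius A (complex_of_vec v))" by (simp add: g_def vec_of_complex_def)
    ultimately have "\<bar>det (matrix (g' v))\<bar> * \<phi> (g v) = (cmod (k v))\<^sup>2 / (Im (moebius A (complex_of_vec v)))\<^sup>2"
      by (simp add: \<phi>_def)
    also have "\<dots> = \<phi> v"
    proof -
      define D where "D = of_real (A $ 2 $ 1) * complex_of_vec v + of_real (A $ 2 $ 2)"
      have D: "cmod D \<noteq> 0" using moebius_denom_nonzero[OF A, of "complex_of_vec v"] v by (simp add: D_def upper_half_plane_def)
      have "cmod (k v) = 1 / (cmod D)\<^sup>2" by (simp add: k_def D_def norm_divide norm_power)
      moreover have "Im (moebius A (complex_of_vec v)) = v $ 2 / (cmod D)\<^sup>2"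
        by (simp add: Im_moebius[OF A] D_def) (simp add: complex_of_vec_def)
      ultimately show ?thesis using D v2 by (simp add: \<phi>_def power_divide)
    qed
    finally show "\<bar>det (matrix (g' v))\<bar> * \<phi> (g v) = \<phi> v" .
  qed
  then show ?thesis unfolding area[OF E(1)] area[OF AE] gS[symmetric] S_def[symmetric] .
qed

text \<open>Bounded in the plane, so sequences of its points accumulate, and yet of infinite area
  near its base.\<close>

definition strip :: "real \<Rightarrow> real \<Rightarrow> complex set" where
  "strip s t = {z. s \<le> Re z \<and> Re z \<le> t \<and> 0 < Im z \<and> Im z \<le> 1}"

lemma borel_strip: "strip s t \<in> sets borel"
  unfolding strip_def by measurable

lemma hyperbolic_area_strip:
  assumes "s < t" shows "hyperbolic_area (strip s t) = \<infinity>"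
proof -
  have le: "ennreal c \<le> hyperbolic_area (strip s t)" if "c \<ge> 0" for c
  proof -
  \<comment> \<open>The box between heights \<delta> and 2 \<delta> has hyperbolic area at least (t
    - s) / (4 \<delta>), which exceeds \<open>c\<close> for this \<delta>; the bound 1/2 keeps the
    box inside the strip.\<close>
  define \<delta> where "\<delta> = min (1/2) ((t - s) / (4 * (c + 1)))"
  have "\<delta> > 0" using assms \<open>c \<ge> 0\<close> by (simp add: \<delta>_def)
  moreover have "\<delta> \<le> 1/2" "\<delta> \<le> (t - s) / (4 * (c + 1))"
    unfolding \<delta>_def by (rule min.cobounded1, rule min.cobounded2)
  ultimately have \<delta>: "\<delta> > 0" "\<delta> \<le> 1/2" "\<delta> \<le> (t - s) / (4 * (c + 1))" by blast+
  define B where "B = box (Complex s \<delta>) (Complex t (2 * \<delta>))"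
  have "c \<le> (t - s) / (4 * \<delta>)"
    using \<delta> \<open>c \<ge> 0\<close> by (simp add: field_simps)
  also have "\<dots> = 1 / (2 * \<delta>)\<^sup>2 * ((t - s) * \<delta>)"
    using \<delta> by (simp add: power2_eq_square field_simps)
  finally have "ennreal c \<le> ennreal (1 / (2 * \<delta>)\<^sup>2 * ((t - s) * \<delta>))" by (rule ennreal_leI)
  also have "\<dots> = ennreal (1 / (2 * \<delta>)\<^sup>2) * emeasure lborel B"
    using assms \<delta> unfolding B_def
    by (subst emeasure_lborel_box) (auto simp: Basis_complex_def ennreal_mult[symmetric])
  also have "\<dots> = (\<integral>\<^sup>+z. ennreal (1 / (2 * \<delta>)\<^sup>2) * indicator B z \<partial>lborel)"
    by (subst nn_integral_cmult_indicator) (auto simp: B_def)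
  also have "\<dots> \<le> hyperbolic_area (strip s t)"
    unfolding hyperbolic_area_def
  proof (rule nn_integral_mono)
    fix z
    show "ennreal (1 / (2 * \<delta>)\<^sup>2) * indicator B z \<le> ennreal (1 / (Im z)\<^sup>2) * indicator (strip s t) z"
    proof (cases "z \<in> B")
      case True
      then have z: "s < Re z" "Re z < t" "\<delta> < Im z" "Im z < 2 * \<delta>"
        by (auto simp: B_def box_def Basis_complex_def)
      then have "z \<in> strip s t" using \<delta> by (auto simp: strip_def)
      moreover have "1 / (2 * \<delta>)\<^sup>2 \<le> 1 / (Im z)\<^sup>2"
        using z \<delta> by (intro divide_left_mono power_mono) auto
      ultimately show ?thesis using True by (simp add: ennreal_leI)
    qed simp
  qed
  finally show ?thesis .
  qed
  show ?thesis
  proof (rule ccontr)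
    assume "hyperbolic_area (strip s t) \<noteq> \<infinity>"
    then obtain r where "hyperbolic_area (strip s t) = ennreal r" "r \<ge> 0"
      by (cases "hyperbolic_area (strip s t)") auto
    with le[of "r + 1"] show False by simp
  qed
qed

text \<open>If only a finite set \<open>M\<close> returned the strip to itself, a point of
  \<open>F\<close> would be carried into the strip by at most \<open>card M\<close> elements, since
  any two of these differ by an element of \<open>M\<close>. Exchanging sum and integral and using
  invariance, the area of the strip would be at most \<open>card M\<close> times that of
  \<open>F\<close>.\<close>

lemma strip_recurrence_infinite:
  fixes H :: "(real^2^2) set"
  assumes H: "countable H" "\<And>A B. A \<in> H \<Longrightarrow> B \<in> H \<Longrightarrow> A ** B \<in> H" "\<And>A. A \<in> H \<Longrightarrow> adj2 A \<in> H"
      "\<And>A. A \<in> H \<Longrightarrow> det A = 1"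
    and F: "F \<in> sets borel" "F \<subseteq> upper_half_plane" "upper_half_plane \<subseteq> (\<Union>A\<in>H. moebius A ` F)"
      "hyperbolic_area F < \<infinity>"
    and "s < t"
  shows "infinite {A \<in> H. \<exists>z\<in>strip s t. moebius A z \<in> strip s t}"
proof
  define M where "M = {A \<in> H. \<exists>z\<in>strip s t. moebius A z \<in> strip s t}"
  assume "finite {A \<in> H. \<exists>z\<in>strip s t. moebius A z \<in> strip s t}"
  then have fM: "finite M" by (simp add: M_def)
  define D where "D = strip s t"
  have D: "D \<in> sets borel" "D \<subseteq> upper_half_plane"
    using borel_strip by (auto simp: D_def strip_def upper_half_plane_def)
  define E where "E A = {z \<in> F. moebius A z \<in> D}" for A
  have E: "E A \<in> sets borel" "E A \<subseteq> upper_half_plane" "hyperbolic_area (E A) < \<infinity>" if "A \<in> H" for A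
  proof -
    have "E A = F \<inter> {z \<in> upper_half_plane. moebius A z \<in> D}" using F(2) by (auto simp: E_def)
    then show "E A \<in> sets borel" using F(1) borel_moebius_vimage[OF H(4)[OF that] D(1)] by simp
    show "E A \<subseteq> upper_half_plane" using F(2) by (auto simp: E_def)
    have "hyperbolic_area (E A) \<le> hyperbolic_area F"
      unfolding hyperbolic_area_def by (intro nn_integral_mono) (auto simp: E_def indicator_def)
    then show "hyperbolic_area (E A) < \<infinity>" using F(4) by (rule le_less_trans)
  qed
  have AE: "moebius A ` E A \<in> sets borel" if "A \<in> H" for A
    unfolding moebius_image_eq[OF H(4)[OF that] E(2)[OF that]]
    using E(1)[OF that] H(4)[OF that] by (intro borel_moebius_vimage) simp_all
  define w where "w z = ennreal (1 / (Im z)\<^sup>2)" for z :: complex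
  have w: "w \<in> borel_measurable lborel" unfolding w_def by measurable
  have count: "(\<integral>\<^sup>+A. indicator (E A) z \<partial>count_space H) \<le> of_nat (card M) * indicator F z" for z
  proof -
    define N where "N = {A \<in> H. z \<in> E A}"
    have "(\<integral>\<^sup>+A. indicator (E A) z \<partial>count_space H) = (\<integral>\<^sup>+A. indicator N A \<partial>count_space H)"
      by (intro nn_integral_cong) (auto simp: N_def indicator_def)
    also have "\<dots> = emeasure (count_space H) N"
      by (rule nn_integral_indicator) (auto simp: N_def)
    also have "\<dots> \<le> of_nat (card M) * indicator F z"
    proof (cases "N = {}")
      case True then show ?thesis by simp
    next
      case False
      then obtain B where B: "B \<in> H" "z \<in> F" "moebius B z \<in> D" by (auto simp: N_def E_def)
      have "(\<lambda>A. A ** adj2 B) ` N \<subseteq> M"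
      proof safe
        fix A assume "A \<in> N"
        then have A: "A \<in> H" "moebius A z \<in> D" by (auto simp: N_def E_def)
        have "moebius (A ** adj2 B) (moebius B z) = moebius A z"
          using moebius_mult[of "adj2 B" "moebius B z" A] moebius_inverse(1)[of B z] moebius_upper[of B z] H(4)[OF B(1)] B(2) F(2)
          by auto
        then show "A ** adj2 B \<in> M"
          using A B H by (auto simp: M_def D_def intro!: bexI[of _ "moebius B z"])
      qed
      moreover have inj: "inj_on (\<lambda>A. A ** adj2 B) N"
      proof (rule inj_onI)
        fix X Y assume "X ** adj2 B = Y ** adj2 B"
        then have "X ** (adj2 B ** B) = Y ** (adj2 B ** B)" by (simp add: matrix_mul_assoc)
        then show "X = Y" using H(4)[OF B(1)] by (simp add: mult_adj2_1)
      qed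
      ultimately have "finite N" "card N \<le> card M"
        using fM finite_subset[of _ M] finite_imageD card_inj_on_le by blast+
      then show ?thesis using B(2) N_def by (simp add: emeasure_count_space)
    qed
    finally show ?thesis .
  qed
  have "hyperbolic_area D = (\<integral>\<^sup>+z. w z * indicator D z \<partial>lborel)" by (simp add: hyperbolic_area_def w_def)
  also have "\<dots> \<le> (\<integral>\<^sup>+z. (\<integral>\<^sup>+A. w z * indicator (moebius A ` E A) z \<partial>count_space H) \<partial>lborel)"
  proof (rule nn_integral_mono)
    fix z
    show "w z * indicator D z \<le> (\<integral>\<^sup>+A. w z * indicator (moebius A ` E A) z \<partial>count_space H)"
    proof (cases "z \<in> D")
      case True
      then obtain A y where A: "A \<in> H" "y \<in> F" "z = moebius A y" using F(3) D(2) by blast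
      then have "z \<in> moebius A ` E A" using True by (auto simp: E_def)
      then show ?thesis
        using nn_integral_ge_point[OF A(1), of "\<lambda>A. w z * indicator (moebius A ` E A) z"] True by simp
    qed simp
  qed
  also have "\<dots> = (\<integral>\<^sup>+A. (\<integral>\<^sup>+z. w z * indicator (moebius A ` E A) z \<partial>lborel) \<partial>count_space H)"
    using AE w by (intro nn_integral_count_space_nn_integral H(1)) auto
  also have "\<dots> = (\<integral>\<^sup>+A. hyperbolic_area (moebius A ` E A) \<partial>count_space H)"
    by (simp add: hyperbolic_area_def w_def)
  also have "\<dots> = (\<integral>\<^sup>+A. hyperbolic_area (E A) \<partial>count_space H)"
    using E H(4) by (intro nn_integral_cong hyperbolic_area_moebius) auto
  also have "\<dots> = (\<integral>\<^sup>+A. (\<integral>\<^sup>+z. w z * indicator (E A) z \<partial>lborel) \<partial>count_space H)"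
    by (simp add: hyperbolic_area_def w_def)
  also have "\<dots> = (\<integral>\<^sup>+z. (\<integral>\<^sup>+A. w z * indicator (E A) z \<partial>count_space H) \<partial>lborel)"
    using E w by (intro nn_integral_count_space_nn_integral[symmetric] H(1)) auto
  also have "\<dots> = (\<integral>\<^sup>+z. w z * (\<integral>\<^sup>+A. indicator (E A) z \<partial>count_space H) \<partial>lborel)"
    by (intro nn_integral_cong nn_integral_cmult) auto
  also have "\<dots> \<le> (\<integral>\<^sup>+z. of_nat (card M) * (w z * indicator F z) \<partial>lborel)"
  proof (rule nn_integral_mono)
    fix z
    have "w z * (\<integral>\<^sup>+A. indicator (E A) z \<partial>count_space H) \<le> w z * (of_nat (card M) * indicator F z)"
      by (intro mult_left_mono count) simp
    then show "w z * (\<integral>\<^sup>+A. indicator (E A) z \<partial>count_space H) \<le> of_nat (card M) * (w z * indicator F z)"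
      by (simp only: mult_ac)
  qed
  also have "\<dots> = of_nat (card M) * hyperbolic_area F"
    using F(1) w unfolding hyperbolic_area_def w_def[symmetric] by (intro nn_integral_cmult) auto
  also have "\<dots> < \<infinity>"
    using F(4) by (simp add: ennreal_mult_less_top ennreal_of_nat_eq_real_of_nat)
  finally show False using hyperbolic_area_strip[OF \<open>s < t\<close>] by (simp add: D_def)
qed

section \<open>Discrete groups with recurrence on half strips\<close>

text \<open>A limit of real matrices taking points of a bounded strip to points of the strip has its kernel or
  its image in the closure of the strip, hence in the interval at its base.\<close>
lemma rank1_strip_limit:
  assumes zw: "of_real (L $ 1 $ 1) * z + of_real (L $ 1 $ 2) = (of_real (L $ 2 $ 1) * z + of_real (L $ 2 $ 2)) * (w::complex)"
    and re: "s \<le> Re z" "Re z \<le> t" "s \<le> Re w" "Re w \<le> t"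
    and L: "L = rank1 p q" "p \<noteq> 0" "q \<noteq> 0"
  shows "(\<exists>x. s \<le> x \<and> x \<le> t \<and> cross p (x, 1) = 0) \<or> (\<exists>x. s \<le> x \<and> x \<le> t \<and> cross q (x, 1) = 0)"
proof -
  define \<kappa> where "\<kappa> = of_real (- snd q) * z + of_real (fst q)"
  have eq: "of_real (fst p) * \<kappa> = of_real (snd p) * \<kappa> * w"
    using zw by (simp add: L rank1_def \<kappa>_def algebra_simps)
  show ?thesis
  proof (cases "\<kappa> = 0")
    case True
    then have 1: "- snd q * Re z + fst q = 0" "snd q * Im z = 0"
      by (auto simp: \<kappa>_def complex_eq_iff)
    then have "cross q (Re z, 1) = 0" by (simp add: cross_def)
    then show ?thesis using re by blast
  next
    case False
    then have "of_real (fst p) = of_real (snd p) * w"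
      using eq by (metis mult.assoc mult.commute mult_cancel_left)
    then have "fst p = snd p * Re w" by (auto simp: complex_eq_iff)
    then have "cross p (Re w, 1) = 0" by (simp add: cross_def)
    then show ?thesis using re by blast
  qed
qed

lemma parallel_snd1: "cross p (x, 1) = 0 \<Longrightarrow> p = snd p *\<^sub>R (x, 1)"
  by (simp add: cross_def prod_eq_iff)

context tuple_group
begin

text \<open>In an injective convergent sequence of elements the quotients of consecutive terms tend
  to the identity, so discreteness would make two terms equal.\<close>

lemma discrete_finite_ball:
  assumes disc: "e > 0" "\<forall>A\<in>G. norm (A j - mat 1) < e \<longrightarrow> A j = mat 1"
  shows "finite {A j | A. A \<in> G \<and> norm (A j) \<le> R}"
proof (rule ccontr)
  define S where "S = {A j | A. A \<in> G \<and> norm (A j) \<le> R}"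
  assume "\<not> ?thesis"
  then obtain f :: "nat \<Rightarrow> real^2^2" where f: "inj f" "range f \<subseteq> S"
    using infinite_countable_subset unfolding S_def by blast
  have "\<exists>A. A \<in> G \<and> f n = A j \<and> norm (A j) \<le> R" for n using f(2) by (auto simp: S_def)
  then obtain A where A: "\<And>n. A n \<in> G" "\<And>n. f n = A n j" "\<And>n. norm (A n j) \<le> R" by metis
  have "bounded (range f)" using A by (intro boundedI[of _ R]) auto
  then obtain L \<sigma> where \<sigma>: "strict_mono \<sigma>" "(\<lambda>n. f (\<sigma> n)) \<longlonglongrightarrow> L"
    using bounded_imp_convergent_subsequence[of f] by (auto simp: o_def)
  have df: "det (f n) = 1" for n using A det_mem by simp
  have "(\<lambda>n. det (f (\<sigma> n))) \<longlonglongrightarrow> det L" by (intro tendsto_intros \<sigma>)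
  then have dL: "det L = 1" by (simp add: df LIMSEQ_const_iff)
  have "(\<lambda>n. f (\<sigma> n) ** adj2 (f (\<sigma> (Suc n)))) \<longlonglongrightarrow> L ** adj2 L"
    using LIMSEQ_Suc[OF \<sigma>(2)] by (intro tendsto_intros \<sigma>(2))
  then have "eventually (\<lambda>n. norm (f (\<sigma> n) ** adj2 (f (\<sigma> (Suc n))) - mat 1) < e) sequentially"
    using disc(1) dL by (auto simp: tendsto_iff dist_norm mult_adj2_1)
  then obtain n where n: "norm (f (\<sigma> n) ** adj2 (f (\<sigma> (Suc n))) - mat 1) < e"
    by (auto simp: eventually_sequentially)
  have "f (\<sigma> n) ** adj2 (f (\<sigma> (Suc n))) = mat 1"
    using disc(2)[rule_format, OF mult_mem[OF A(1) inv_mem[OF A(1)]], of "\<sigma> n" "\<sigma> (Suc n)"] n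
    by (simp add: A(2))
  then have "f (\<sigma> n) ** (adj2 (f (\<sigma> (Suc n))) ** f (\<sigma> (Suc n))) = f (\<sigma> (Suc n))"
    by (simp add: matrix_mul_assoc)
  then have "f (\<sigma> n) = f (\<sigma> (Suc n))" by (simp add: df mult_adj2_1)
  then have "\<sigma> n = \<sigma> (Suc n)" using f(1) by (simp add: inj_eq)
  then show False using \<sigma>(1) by (metis lessI less_irrefl strict_mono_less)
qed

text \<open>By discreteness the norms of infinitely many elements tend to infinity, so their
  normalizations accumulate at a singular matrix, which still relates the limits of the strip
  points.\<close>

lemma strip_recurrence_rank1:
  assumes disc: "e > 0" "\<forall>A\<in>G. norm (A j - mat 1) < e \<longrightarrow> A j = mat 1"
    and inf: "infinite {A j | A. A \<in> G \<and> (\<exists>z\<in>strip s t. moebius (A j) z \<in> strip s t)}"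
  shows "\<exists>x q. s \<le> x \<and> x \<le> t \<and> q \<noteq> 0 \<and> (\<lambda>_. rank1 (x, 1) q) \<in> proj_closure {j} G"
proof -
  define S where "S = {A j | A. A \<in> G \<and> (\<exists>z\<in>strip s t. moebius (A j) z \<in> strip s t)}"
  obtain f :: "nat \<Rightarrow> real^2^2" where f: "inj f" "range f \<subseteq> S"
    using inf infinite_countable_subset unfolding S_def by blast
  have "\<exists>A z. A \<in> G \<and> f n = A j \<and> z \<in> strip s t \<and> moebius (A j) z \<in> strip s t" for n
  proof -
    have "f n \<in> S" using f(2) by auto
    then show ?thesis unfolding S_def by blast
  qed
  then obtain A z where A: "\<And>n. A n \<in> G" "\<And>n. f n = A n j" "\<And>n. z n \<in> strip s t"
    "\<And>n. moebius (A n j) (z n) \<in> strip s t" by metis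
  define w where "w n = moebius (f n) (z n)" for n
  have df: "det (f n) = 1" for n using A det_mem by simp
  have unb: "filterlim (\<lambda>n. norm (f n)) at_top sequentially"
  proof (rule ccontr)
    assume "\<not> ?thesis"
    then obtain Z where Z: "\<exists>\<^sub>F n in sequentially. norm (f n) < Z"
      by (auto simp: filterlim_at_top not_eventually not_le)
    then have "infinite {n. norm (f n) < Z}"
      by (simp add: frequently_cofinite[symmetric] cofinite_eq_sequentially)
    then have "infinite (f ` {n. norm (f n) < Z})"
      using f(1) by (metis finite_imageD inj_on_subset subset_UNIV)
    moreover have "f n \<in> {A j | A. A \<in> G \<and> norm (A j) \<le> Z}" if "norm (f n) < Z" for n
      using that A(1)[of n] A(2)[of n] by (intro CollectI exI[of _ "A n"]) auto
    then have "f ` {n. norm (f n) < Z} \<subseteq> {A j | A. A \<in> G \<and> norm (A j) \<le> Z}" by blast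
    ultimately show False using finite_subset[OF _ discrete_finite_ball[OF disc, of Z]] by blast
  qed
  define h where "h n = inverse (norm (f n)) *\<^sub>R f n" for n
  have nz: "f n \<noteq> 0" for n using df[of n] by (auto simp: det_eq)
  have nh: "norm (h n) = 1" for n using nz by (simp add: h_def)
  have bst: "norm z \<le> \<bar>s\<bar> + \<bar>t\<bar> + 1" if "z \<in> strip s t" for z
    using that cmod_le[of z] by (auto simp: strip_def)
  have "bounded (range (\<lambda>n. (h n, z n, w n)))"
  proof (rule boundedI)
    fix y assume "y \<in> range (\<lambda>n. (h n, z n, w n))"
    then obtain n where y: "y = (h n, z n, w n)" by blast
    have "norm y \<le> norm (h n) + (norm (z n) + norm (w n))"
      unfolding y using norm_Pair_le[of "h n" "(z n, w n)"] norm_Pair_le[of "z n" "w n"] by linarith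
    also have "\<dots> \<le> 1 + ((\<bar>s\<bar> + \<bar>t\<bar> + 1) + (\<bar>s\<bar> + \<bar>t\<bar> + 1))"
      using nh bst A(2,3,4) by (intro add_mono) (auto simp: w_def)
    finally show "norm y \<le> 1 + ((\<bar>s\<bar> + \<bar>t\<bar> + 1) + (\<bar>s\<bar> + \<bar>t\<bar> + 1))" .
  qed
  then obtain l \<sigma> where \<sigma>: "strict_mono \<sigma>" and l: "(\<lambda>n. (h (\<sigma> n), z (\<sigma> n), w (\<sigma> n))) \<longlonglongrightarrow> l"
    using bounded_imp_convergent_subsequence[of "\<lambda>n. (h n, z n, w n)"] by (auto simp: o_def)
  obtain L z' w' where l': "l = (L, z', w')" by (metis prod.exhaust)
  have lim: "(\<lambda>n. h (\<sigma> n)) \<longlonglongrightarrow> L" "(\<lambda>n. z (\<sigma> n)) \<longlonglongrightarrow> z'" "(\<lambda>n. w (\<sigma> n)) \<longlonglongrightarrow> w'"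
    using tendsto_fst[OF l] tendsto_fst[OF tendsto_snd[OF l]] tendsto_snd[OF tendsto_snd[OF l]]
    by (auto simp: l')
  have "(\<lambda>n. norm (h (\<sigma> n))) \<longlonglongrightarrow> norm L" by (intro tendsto_intros lim)
  then have L0: "L \<noteq> 0" by (auto simp: nh LIMSEQ_const_iff)
  have "(\<lambda>n. (inverse (norm (f (\<sigma> n))))\<^sup>2) \<longlonglongrightarrow> 0\<^sup>2"
    by (intro tendsto_power LIMSEQ_subseq_LIMSEQ[OF _ \<sigma>, unfolded o_def] tendsto_inverse_0_at_top unb)
  moreover have "det (h n) = (inverse (norm (f n)))\<^sup>2" for n by (simp add: h_def det_scaleR2 df)
  ultimately have "(\<lambda>n. det (h (\<sigma> n))) \<longlonglongrightarrow> 0" by simp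
  moreover have "(\<lambda>n. det (h (\<sigma> n))) \<longlonglongrightarrow> det L" by (intro tendsto_intros lim)
  ultimately have "det L = 0" using LIMSEQ_unique by blast
  then obtain p q where pq: "L = rank1 p q" by (rule det_zero_rank1)
  then have pq0: "p \<noteq> 0" "q \<noteq> 0" using L0 by (auto simp: rank1_eq_0)
  have P: "(\<lambda>_. rank1 p q) \<in> proj_closure {j} G"
    by (rule proj_closure_seqI[where A = "\<lambda>n. A (\<sigma> n)" and c = "\<lambda>n _. inverse (norm (f (\<sigma> n)))"])
       (use A lim(1) in \<open>auto simp: h_def pq\<close>)
  have eq: "of_real (h n $ 1 $ 1) * z n + of_real (h n $ 1 $ 2) =
      (of_real (h n $ 2 $ 1) * z n + of_real (h n $ 2 $ 2)) * w n" for n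
  proof -
    have "of_real (f n $ 1 $ 1) * z n + of_real (f n $ 1 $ 2) =
      (of_real (f n $ 2 $ 1) * z n + of_real (f n $ 2 $ 2)) * w n"
      using moebius_denom_nonzero[OF df, of "z n" n] A(3)[of n]
      by (simp add: w_def moebius_def strip_def)
    then have "of_real (inverse (norm (f n))) * (of_real (f n $ 1 $ 1) * z n + of_real (f n $ 1 $ 2)) =
      of_real (inverse (norm (f n))) * ((of_real (f n $ 2 $ 1) * z n + of_real (f n $ 2 $ 2)) * w n)" by simp
    then show ?thesis by (simp add: h_def algebra_simps)
  qed
  have limh: "(\<lambda>n. h (\<sigma> n) $ a $ b) \<longlonglongrightarrow> L $ a $ b" for a b
    by (intro tendsto_intros lim)
  have eqL: "of_real (L $ 1 $ 1) * z' + of_real (L $ 1 $ 2) = (of_real (L $ 2 $ 1) * z' + of_real (L $ 2 $ 2)) * w'"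
  proof (rule LIMSEQ_unique)
    show "(\<lambda>n. of_real (h (\<sigma> n) $ 1 $ 1) * z (\<sigma> n) + of_real (h (\<sigma> n) $ 1 $ 2)) \<longlonglongrightarrow>
        of_real (L $ 1 $ 1) * z' + of_real (L $ 1 $ 2)"
      by (intro tendsto_intros lim limh)
    show "(\<lambda>n. of_real (h (\<sigma> n) $ 1 $ 1) * z (\<sigma> n) + of_real (h (\<sigma> n) $ 1 $ 2)) \<longlonglongrightarrow>
        (of_real (L $ 2 $ 1) * z' + of_real (L $ 2 $ 2)) * w'"
      unfolding eq by (intro tendsto_intros lim limh)
  qed
  have zwS: "s \<le> Re (z n) \<and> Re (z n) \<le> t \<and> s \<le> Re (w n) \<and> Re (w n) \<le> t" for n
    using A(3)[of n] A(4)[of n] by (simp add: strip_def w_def A(2))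
  have re: "s \<le> Re z'" "Re z' \<le> t" "s \<le> Re w'" "Re w' \<le> t"
    using LIMSEQ_le_const[OF tendsto_Re[OF lim(2)], of s] LIMSEQ_le_const2[OF tendsto_Re[OF lim(2)], of t]
      LIMSEQ_le_const[OF tendsto_Re[OF lim(3)], of s] LIMSEQ_le_const2[OF tendsto_Re[OF lim(3)], of t] zwS
    by blast+
  from rank1_strip_limit[OF eqL re pq pq0] show ?thesis
  proof (elim disjE exE conjE)
    fix x assume x: "s \<le> x" "x \<le> t" "cross p (x, 1) = 0"
    then have p: "p = snd p *\<^sub>R (x, 1)" by (intro parallel_snd1)
    have "(\<lambda>_. inverse (snd p) *\<^sub>R rank1 p q) \<in> proj_closure {j} G"
      using P by (rule proj_closure_scale[rotated]) simp
    moreover have "snd p \<noteq> 0" using p pq0 by (metis scaleR_zero_left)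
    then have "inverse (snd p) *\<^sub>R rank1 p q = rank1 (x, 1) q"
      using arg_cong[OF p, of "\<lambda>p. rank1 p q"] by (simp add: scaleR_rank1 del: scaleR_Pair)
    ultimately show ?thesis using x pq0 by (intro exI[of _ x] exI[of _ q]) simp
  next
    fix x assume x: "s \<le> x" "x \<le> t" "cross q (x, 1) = 0"
    then have q: "q = snd q *\<^sub>R (x, 1)" by (intro parallel_snd1)
    \<comment> \<open>If the kernel lies over the interval instead of the image, the adjugate
      exchanges the two.\<close>
    have "(\<lambda>_. - inverse (snd q) *\<^sub>R adj2 (rank1 p q)) \<in> proj_closure {j} G"
      using proj_closure_adj2[OF _ P] by (intro proj_closure_scale) simp_all
    moreover have "snd q \<noteq> 0" using q pq0 by (metis scaleR_zero_left)
    then have "- inverse (snd q) *\<^sub>R adj2 (rank1 p q) = rank1 (x, 1) p"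
      using arg_cong[OF q, of "\<lambda>q. rank1 p q"]
      by (simp add: adj2_rank1 adj2_scaleR scaleR_rank1 del: scaleR_Pair)
    ultimately show ?thesis using x pq0 by (intro exI[of _ x] exI[of _ p]) simp
  qed
qed

lemma proj_closure_commute:
  assumes ab: "\<forall>A\<in>G. \<forall>B\<in>G. A j ** B j = B j ** A j"
    and "X \<in> proj_closure {j} G" "Y \<in> proj_closure {j} G"
  shows "X j ** Y j = Y j ** X j"
proof -
  obtain A c where A: "\<And>n::nat. A n \<in> G" "\<And>i. i \<in> {j} \<Longrightarrow> (\<lambda>n. c n i *\<^sub>R A n i) \<longlonglongrightarrow> X i"
    using assms(2) by (rule proj_closure_seqE) blast
  obtain B d where B: "\<And>n::nat. B n \<in> G" "\<And>i. i \<in> {j} \<Longrightarrow> (\<lambda>n. d n i *\<^sub>R B n i) \<longlonglongrightarrow> Y i"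
    using assms(3) by (rule proj_closure_seqE) blast
  have 1: "(\<lambda>n. (c n j *\<^sub>R A n j) ** (d n j *\<^sub>R B n j)) \<longlonglongrightarrow> X j ** Y j"
    by (intro tendsto_intros A(2) B(2)) auto
  have 2: "(\<lambda>n. (d n j *\<^sub>R B n j) ** (c n j *\<^sub>R A n j)) \<longlonglongrightarrow> Y j ** X j"
    by (intro tendsto_intros A(2) B(2)) auto
  have "(c n j *\<^sub>R A n j) ** (d n j *\<^sub>R B n j) = (d n j *\<^sub>R B n j) ** (c n j *\<^sub>R A n j)" for n
    using ab A(1)[of n] B(1)[of n] by (simp add: scaleR_matrix_mult mult.commute)
  then show ?thesis using LIMSEQ_unique[OF 1] 2 by simp
qed


text \<open>The set of pairs \<open>(image, kernel)\<close> of rank one limits is a symmetric relation that is closed under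
  composition off the diagonal. If it is not full, all its pairs have a common point, which is then
  fixed by the group. In a discrete group of upper triangular matrices containing a
  contraction there are no unipotents, so it is commutative, a property that the limits inherit.\<close>
lemma strip_recurrence_full:
  assumes disc: "e > 0" "\<forall>A\<in>G. norm (A j - mat 1) < e \<longrightarrow> A j = mat 1"
    and inf: "\<And>s t. s < t \<Longrightarrow> infinite {A j | A. A \<in> G \<and> (\<exists>z\<in>strip s t. moebius (A j) z \<in> strip s t)}"
  shows "proj_full {j} G"
proof -
  define R where "R x z \<longleftrightarrow> (\<lambda>_. rank1 x z) \<in> proj_closure {j} G" for x z
  have scale: "(\<lambda>_. c *\<^sub>R X) \<in> proj_closure {j} G" if "(\<lambda>_. X) \<in> proj_closure {j} G" for c X
    using proj_closure_scale[OF _ that, of "\<lambda>_. c"] by simp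
  have R_scale: "R (a *\<^sub>R x) (b *\<^sub>R z)" if "R x z" for a b x z
    using scale[OF scale[OF that[unfolded R_def]]] unfolding R_def scaleR_rank1 .
  have R_sym: "R z x" if "R x z" for x z
  proof -
    have "(\<lambda>_. (-1) *\<^sub>R adj2 (rank1 x z)) \<in> proj_closure {j} G"
      using proj_closure_adj2[OF _ that[unfolded R_def]] by (intro scale) simp
    then show ?thesis by (simp add: R_def adj2_rank1)
  qed
  have R_trans: "R x z'" if "R x z" "R x' z'" "cross z x' \<noteq> 0" for x z x' z'
  proof -
    have "(\<lambda>_. inverse (cross z x') *\<^sub>R (rank1 x z ** rank1 x' z')) \<in> proj_closure {j} G"
      using proj_closure_mult[OF _ that(1,2)[unfolded R_def]] by (intro scale) simp
    then show ?thesis using that(3) by (simp add: R_def rank1_mult_rank1)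
  qed
  \<comment> \<open>Recurrence on intervals shrinking to \<open>a\<close> gives images near
    \<open>a\<close>; normalized kernels have a limit.\<close>
  have ex: "\<exists>q. q \<noteq> 0 \<and> R (a, 1) q" for a
  proof -
    have "\<exists>x q. \<bar>x - a\<bar> \<le> inverse (real (Suc n)) \<and> norm q = 1 \<and> R (x, 1) q" for n
    proof -
      obtain x q where xq: "a \<le> x" "x \<le> a + inverse (real (Suc n))" "q \<noteq> 0" "R (x, 1) q"
      proof -
        have "a < a + inverse (real (Suc n))" by simp
        from strip_recurrence_rank1[OF disc inf[OF this]] that
        show thesis unfolding R_def by blast
      qed
      then show ?thesis
        using R_scale[OF xq(4), of 1 "inverse (norm q)"]
        by (intro exI[of _ x] exI[of _ "inverse (norm q) *\<^sub>R q"]) auto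
    qed
    then obtain x q where xq: "\<And>n. \<bar>x n - a\<bar> \<le> inverse (real (Suc n))" "\<And>n. norm (q n) = 1"
      "\<And>n. R (x n, 1) (q n)" by metis
    have limx: "x \<longlonglongrightarrow> a"
      by (rule LIM_zero_cancel, rule Lim_null_comparison[OF _ LIMSEQ_inverse_real_of_nat]) (use xq(1) in auto)
    have "bounded (range q)" using xq(2) by (intro boundedI[of _ 1]) auto
    then obtain l \<sigma> where \<sigma>: "strict_mono \<sigma>" "(\<lambda>n. q (\<sigma> n)) \<longlonglongrightarrow> l"
      using bounded_imp_convergent_subsequence[of q] by (auto simp: o_def)
    have "(\<lambda>n. rank1 (x (\<sigma> n), 1) (q (\<sigma> n))) \<longlonglongrightarrow> rank1 (a, 1) l"
      using LIMSEQ_subseq_LIMSEQ[OF limx \<sigma>(1)] by (intro tendsto_intros \<sigma>(2)) (simp add: o_def)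
    then have "R (a, 1) l"
      unfolding R_def
      by (rule proj_closure_limit[of "{j}" "\<lambda>n _. rank1 (x (\<sigma> n), 1) (q (\<sigma> n))", rotated 2])
         (simp_all only: finite.intros xq(3)[unfolded R_def])
    moreover have "(\<lambda>n. norm (q (\<sigma> n))) \<longlonglongrightarrow> norm l" by (intro tendsto_intros \<sigma>(2))
    then have "l \<noteq> 0" by (auto simp: xq(2) LIMSEQ_const_iff)
    ultimately show ?thesis by blast
  qed
  have full: "R (a, 1) (b, 1)" for a b
  proof (rule ccontr)
    assume neg: "\<not> R (a, 1) (b, 1)"
    \<comment> \<open>If (a, 1) and (b, 1) are unrelated, their partners \<open>z\<close> and
      \<open>u\<close> must be proportional. Then \<open>star\<close> says that \<open>z\<close>
      belongs to every related pair.\<close>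
    obtain z where z: "z \<noteq> 0" "R (a, 1) z" using ex by blast
    obtain u where u: "u \<noteq> 0" "R (b, 1) u" using ex by blast
    have nbr: "R (a, 1) q" if "R p q" "cross z p \<noteq> 0" for p q
      using R_trans[OF z(2) that] .
    have "cross z u = 0" using nbr[OF R_sym[OF u(2)]] neg by blast
    then obtain c where "u = c *\<^sub>R z" using z(1) cross_eq_0_iff by blast
    then have "R (b, 1) z" using R_scale[OF u(2), of 1 "inverse c"] u(1) by auto
    have star: "cross z q = 0" if "R p q" "cross z p \<noteq> 0" for p q
    proof (rule ccontr)
      assume "cross z q \<noteq> 0"
      have "R (a, 1) q" using nbr that by blast
      from R_trans[OF \<open>R (b, 1) z\<close> R_sym[OF this]] 
      have "R (a, 1) (b, 1)" using R_sym \<open>cross z q \<noteq> 0\<close> by blast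
      with neg show False by blast
    qed
    have ex_edge: "R (c, 1) z" if c: "cross z (c, 1) \<noteq> 0" for c
    proof -
      obtain v where v: "v \<noteq> 0" "R (c, 1) v" using ex by blast
      then obtain m where "v = m *\<^sub>R z" using star c cross_eq_0_iff[OF z(1)] by blast
      then show ?thesis using R_scale[OF v(2), of 1 "inverse m"] v(1) by auto
    qed
    have "\<exists>c d. c \<noteq> d \<and> cross z (c, 1) \<noteq> 0 \<and> cross z (d, 1) \<noteq> 0"
    proof (cases "snd z = 0")
      case True
      then have "fst z \<noteq> 0" using z(1) by (simp add: prod_eq_iff)
      then show ?thesis using True by (intro exI[of _ 0] exI[of _ 1]) (simp add: cross_def)
    next
      case False
      then show ?thesis
        by (intro exI[of _ "fst z / snd z + 1"] exI[of _ "fst z / snd z + 2"]) (auto simp: cross_def field_simps)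
    qed
    then obtain c d where cd: "c \<noteq> d" "cross z (c, 1) \<noteq> 0" "cross z (d, 1) \<noteq> 0" by blast
    \<comment> \<open>The columns of \<open>M\<close> are \<open>z\<close> and a multiple of (c, 1),
      normalized to determinant 1. Conjugation by \<open>M\<close> makes a group that fixes the
      direction of \<open>z\<close> upper triangular.\<close>
    define M where "M = mat2 (fst z) (c / cross z (c, 1)) (snd z) (1 / cross z (c, 1))"
    have k: "fst z - snd z * c = cross z (c, 1)" by (simp add: cross_def)
    have "det M = (fst z - snd z * c) / cross z (c, 1)"
      unfolding M_def det_mat2 by (simp add: diff_divide_distrib mult.commute)
    then have dM: "det M = 1" using cd(2) unfolding k by simp
    have Me: "mat_app M (1, 0) = z" by (simp add: M_def mat_app_def)
    define T where "T X = adj2 M ** X ** M" for X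
    have T_eq: "T X = adj2 M ** X ** adj2 (adj2 M)" for X by (simp add: T_def)
    have T_mult: "T (X ** Y) = T X ** T Y" for X Y
      unfolding T_eq by (rule conj_mult[symmetric]) (simp add: dM)
    have T_adj: "T (adj2 X) = adj2 (T X)" for X
      unfolding T_eq by (rule adj2_conj[symmetric])
    \<comment> \<open>Multiplying a limit with kernel \<open>z\<close> by an inverse on the right
      moves the kernel to the image of \<open>z\<close> under the element; by \<open>star\<close>
      that is again the direction of \<open>z\<close>.\<close>
    have upper: "T (A j) $ 2 $ 1 = 0" if A: "A \<in> G" for A
    proof -
      have "(\<lambda>i. rank1 (c, 1) z ** adj2 (A i)) \<in> proj_closure {j} G"
        by (rule proj_closure_mult[OF _ ex_edge[OF cd(2), unfolded R_def] mem_proj_closure[OF inv_mem[OF A]]]) simp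
      then have "(\<lambda>_. rank1 (c, 1) (mat_app (A j) z)) \<in> proj_closure {j} G"
        by (rule proj_closure_cong[THEN iffD1, rotated]) (simp add: rank1_mult)
      then have "cross z (mat_app (A j) z) = 0" using star cd(2) unfolding R_def by blast
      moreover have "cross z (mat_app (A j) z) = cross (mat_app M (1, 0)) (mat_app M (mat_app (T (A j)) (1, 0)))"
      proof -
        have "mat_app (A j) z = mat_app (M ** T (A j) ** adj2 M) (mat_app M (1, 0))"
          using conj_adj2[OF dM, of "A j"] Me by (simp add: T_def)
        also have "\<dots> = mat_app (M ** T (A j) ** (adj2 M ** M)) (1, 0)"
          by (simp only: mat_app_mult)
        finally show ?thesis using dM Me by (simp add: mult_adj2_1 mat_app_mult)
      qed
      ultimately show ?thesis using dM by (simp add: cross_mat_app) (simp add: cross_def mat_app_def)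
    qed
    have "(\<lambda>_. rank1 (c, 1) z) \<in> proj_closure {j} G" using ex_edge cd R_def by blast
    then obtain A k where A: "\<And>n::nat. A n \<in> G" "\<And>i. i \<in> {j} \<Longrightarrow> (\<lambda>n. k n i *\<^sub>R A n i) \<longlonglongrightarrow> rank1 (c, 1) z"
      by (rule proj_closure_seqE) blast
    have "(\<lambda>n. T (k n j *\<^sub>R A n j)) \<longlonglongrightarrow> T (rank1 (c, 1) z)"
      unfolding T_def by (intro tendsto_intros A(2)) simp
    moreover have "T (k n j *\<^sub>R A n j) = k n j *\<^sub>R T (A n j)" for n
      by (simp add: T_def scaleR_matrix_mult)
    moreover have "T (rank1 (c, 1) z) = mat2 0 0 0 (cross z (c, 1))"
    proof -
      have "mat_app (adj2 M) z = mat_app (adj2 M ** M) (1, 0)" unfolding mat_app_mult Me ..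
      then have 1: "mat_app (adj2 M) z = (1, 0)" using dM by (simp add: mult_adj2_1) (simp add: mat_app_def mat_def)
      have "mat_app (adj2 M) (c, 1) = (0, fst z - snd z * c)" by (simp add: M_def mat_app_def)
      then have 2: "mat_app (adj2 M) (c, 1) = (0, cross z (c, 1))" unfolding k .
      show ?thesis unfolding T_def mult_rank1 rank1_mult 1 2 by (simp add: rank1_def)
    qed
    ultimately have limT: "(\<lambda>n. k n j *\<^sub>R T (A n j)) \<longlonglongrightarrow> mat2 0 0 0 (cross z (c, 1))" by simp
    have "(\<lambda>n. \<bar>k n j * T (A n j) $ 1 $ 1\<bar>) \<longlonglongrightarrow> \<bar>0\<bar>"
      using tendsto_mat_iff[THEN iffD1, OF limT] by (intro tendsto_rabs) simp
    moreover have "(\<lambda>n. \<bar>k n j * T (A n j) $ 2 $ 2\<bar>) \<longlonglongrightarrow> \<bar>cross z (c, 1)\<bar>"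
      using tendsto_mat_iff[THEN iffD1, OF limT] by (intro tendsto_rabs) simp
    ultimately have "(\<lambda>n. \<bar>k n j * T (A n j) $ 2 $ 2\<bar> - \<bar>k n j * T (A n j) $ 1 $ 1\<bar>) \<longlonglongrightarrow> \<bar>cross z (c, 1)\<bar> - \<bar>0\<bar>"
      by (intro tendsto_diff)
    then have "eventually (\<lambda>n. \<bar>k n j * T (A n j) $ 2 $ 2\<bar> - \<bar>k n j * T (A n j) $ 1 $ 1\<bar> > 0) sequentially"
      by (rule order_tendstoD) (use cd(2) in simp)
    then obtain n where "\<bar>k n j * T (A n j) $ 1 $ 1\<bar> < \<bar>k n j * T (A n j) $ 2 $ 2\<bar>"
      by (auto simp: eventually_sequentially)
    then have lt: "\<bar>T (A n j) $ 1 $ 1\<bar> < \<bar>T (A n j) $ 2 $ 2\<bar>"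
      by (simp add: abs_mult mult_less_cancel_left)
    \<comment> \<open>After conjugation only the lower right entry of the limit survives, so a late
      element has the larger diagonal entry there and contracts upper unipotents by
      conjugation.\<close>
    define B where "B = A n"
    have B: "B \<in> G" by (simp add: B_def A(1))
    define \<alpha> \<beta> where "\<alpha> = T (B j) $ 1 $ 1" and "\<beta> = T (B j) $ 1 $ 2"
    have dT: "det (T (X j)) = 1" if "X \<in> G" for X using det_mem[OF that] dM by (simp add: T_def det_mul)
    have TB: "T (B j) = mat2 \<alpha> \<beta> 0 (1 / \<alpha>)" and \<alpha>: "\<alpha> \<noteq> 0" "\<bar>\<alpha>\<bar> < 1"
    proof -
      have 1: "\<alpha> * T (B j) $ 2 $ 2 = 1" using dT[OF B] upper[OF B] by (simp add: det_eq \<alpha>_def)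
      then show a0: "\<alpha> \<noteq> 0" by auto
      have 2: "T (B j) $ 2 $ 2 = 1 / \<alpha>" using 1 a0 by (simp add: field_simps)
      show "T (B j) = mat2 \<alpha> \<beta> 0 (1 / \<alpha>)"
        using 2 upper[OF B] by (simp add: mat2_ext \<alpha>_def \<beta>_def)
      have "\<bar>\<alpha>\<bar> < 1 / \<bar>\<alpha>\<bar>" using lt 2 by (simp add: B_def[symmetric] \<alpha>_def[symmetric])
      then have "\<bar>\<alpha>\<bar> * \<bar>\<alpha>\<bar> < 1" using a0 by (simp add: field_simps)
      then show "\<bar>\<alpha>\<bar> < 1" by (metis abs_ge_zero abs_mult_self_eq mult_le_one mult.right_neutral mult_left_mono not_le order_trans)
    qed
    have TBpow: "\<exists>b. mpow (T (B j)) m = mat2 (\<alpha> ^ m) b 0 (1 / \<alpha> ^ m)" for m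
    proof (induction m)
      case (Suc m)
      then show ?case using \<alpha> by (auto simp: TB)
    qed (simp add: mat_1_eq)
    \<comment> \<open>Conjugation by powers of \<open>B\<close> shrinks \<tau> to 0, and
      discreteness then forces \<tau> = 0.\<close>
    have unip: "C j = mat 1" if C: "C \<in> G" "T (C j) = mat2 1 \<tau> 0 1" for C \<tau>
    proof -
      define D where "D m i = mpow (B i) m ** C i ** adj2 (mpow (B i) m)" for m i
      have D: "D m \<in> G" for m unfolding D_def by (intro conj_mem mpow_mem B C)
      have TD: "T (D m j) = mat2 1 (\<alpha> ^ m * \<alpha> ^ m * \<tau>) 0 1" for m
      proof -
        have Tp: "T (mpow (B j) m) = mpow (T (B j)) m"
          using mpow_conj[of "adj2 M" "B j" m] dM by (simp add: T_def)
        obtain b where "mpow (T (B j)) m = mat2 (\<alpha> ^ m) b 0 (1 / \<alpha> ^ m)" using TBpow by blast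
        then show ?thesis using \<alpha> C(2) by (simp add: D_def T_mult T_adj Tp algebra_simps)
      qed
      have T_back: "M ** T X ** adj2 M = X" for X using conj_adj2[OF dM] by (simp add: T_def)
      have "(\<lambda>m. M ** T (D m j) ** adj2 M) \<longlonglongrightarrow> M ** mat2 1 (0 * 0 * \<tau>) 0 1 ** adj2 M"
        unfolding TD using \<alpha> by (intro tendsto_intros LIMSEQ_power_zero) auto
      then have "(\<lambda>m. D m j) \<longlonglongrightarrow> mat 1" using dM by (simp add: T_back mat_1_eq[symmetric] mult_adj2_1)
      then have "eventually (\<lambda>m. norm (D m j - mat 1) < e) sequentially"
        using disc(1) by (auto simp: tendsto_iff dist_norm)
      then obtain m where "norm (D m j - mat 1) < e" by (auto simp: eventually_sequentially)
      then have "D m j = mat 1" using disc(2) D by blast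
      then have "T (D m j) = mat 1" using dM by (simp add: T_def mult_adj2_1)
      then have "\<tau> = 0" using \<alpha> by (simp add: TD mat_1_eq)
      then have "T (C j) = mat 1" using C(2) by (simp add: mat_1_eq)
      then have "M ** T (C j) ** adj2 M = mat 1" using dM by (simp add: mult_adj2_1)
      then show ?thesis by (simp add: T_back)
    qed
    have comm: "X j ** Y j = Y j ** X j" if XY: "X \<in> G" "Y \<in> G" for X Y
    proof -
      define C where "C i = commutator (X i) (Y i)" for i
      have C: "C \<in> G" unfolding C_def by (intro commutator_mem XY)
      obtain a b f where x: "T (X j) = mat2 a b 0 f" using upper[OF XY(1)] mat2_eq[of "T (X j)"] by metis
      obtain a' b' f' where y: "T (Y j) = mat2 a' b' 0 f'" using upper[OF XY(2)] mat2_eq[of "T (Y j)"] by metis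
      have 1: "a * f = 1" "a' * f' = 1" using dT[OF XY(1)] dT[OF XY(2)] by (auto simp: x y)
      have 2: "T (C j) = commutator (T (X j)) (T (Y j))"
        by (simp add: C_def commutator_def T_mult T_adj)
      have "\<exists>\<tau>. T (C j) = mat2 1 \<tau> 0 1"
      proof -
        have "T (C j) = mat2 ((a * f) * (a' * f')) (T (C j) $ 1 $ 2) 0 ((a * f) * (a' * f'))"
          unfolding 2 x y by (simp add: commutator_def algebra_simps)
        then show ?thesis unfolding 1 by (simp only: mult_1) blast
      qed
      then have "C j = mat 1" using unip[OF C] by blast
      then have "X j ** Y j ** adj2 (X j) ** adj2 (Y j) ** (Y j ** X j) = Y j ** X j"
        by (simp add: C_def commutator_def)
      moreover have "X j ** Y j ** adj2 (X j) ** adj2 (Y j) ** (Y j ** X j) =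
          X j ** Y j ** (adj2 (X j) ** ((adj2 (Y j) ** Y j) ** X j))" by (simp add: matrix_mul_assoc)
      ultimately show ?thesis using det_mem XY by (simp add: mult_adj2_1)
    qed
    \<comment> \<open>Two limits with the common kernel \<open>z\<close> and different images do not
      commute.\<close>
    have "rank1 (c, 1) z ** rank1 (d, 1) z = rank1 (d, 1) z ** rank1 (c, 1) z"
      by (rule proj_closure_commute[of j "\<lambda>_. rank1 (c, 1) z" "\<lambda>_. rank1 (d, 1) z"])
         (use comm ex_edge[OF cd(2), unfolded R_def] ex_edge[OF cd(3), unfolded R_def] in blast)+
    have "rank1 (cross z (d, 1) *\<^sub>R (c, 1) - cross z (c, 1) *\<^sub>R (d, 1)) z = 0"
    proof -
      have "rank1 (a *\<^sub>R x - b *\<^sub>R y) z = a *\<^sub>R rank1 x z - b *\<^sub>R rank1 y z" for a b x y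
        by (simp add: rank1_def algebra_simps)
      then show ?thesis using \<open>rank1 (c, 1) z ** rank1 (d, 1) z = rank1 (d, 1) z ** rank1 (c, 1) z\<close>
        unfolding rank1_mult_rank1 by (simp del: scaleR_Pair diff_Pair)
    qed
    then have p: "cross z (d, 1) *\<^sub>R (c, 1) - cross z (c, 1) *\<^sub>R (d, 1) = (0 :: real \<times> real)"
      using z(1) by (simp only: rank1_eq_0) simp
    have "cross z (d, 1) = cross z (c, 1)" using arg_cong[OF p, of snd] by simp
    moreover have "cross z (d, 1) * c = cross z (c, 1) * d" using arg_cong[OF p, of fst] by simp
    ultimately show False using cd by simp
  qed
  show ?thesis
    unfolding proj_full_def
  proof (intro allI impI)
    fix X assume X: "\<forall>i\<in>{j}. det (X i :: real^2^2) = 0"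
    show "X \<in> proj_closure {j} G"
    proof (rule proj_closure_generic[where R = "{j}"])
      fix x z :: "nat \<Rightarrow> real \<times> real"
      assume xz: "\<And>i. i \<in> {j} \<Longrightarrow> cross (x i) (z i) \<noteq> 0 \<and> snd (x i) \<noteq> 0 \<and> snd (z i) \<noteq> 0"
      have eq: "y = snd y *\<^sub>R (fst y / snd y, 1)" if "snd y \<noteq> 0" for y :: "real \<times> real"
        using that by (simp add: prod_eq_iff)
      have "R (x j) (z j)"
        using R_scale[OF full, of "snd (x j)" "fst (x j) / snd (x j)" "snd (z j)" "fst (z j) / snd (z j)"]
          eq[of "x j"] eq[of "z j"] xz[of j] by simp
      then show "(\<lambda>i. if i \<in> {j} then rank1 (x i) (z i) else X i) \<in> proj_closure {j} G"
        unfolding R_def by (rule proj_closure_cong[THEN iffD1, rotated]) auto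
    qed (use X in auto)
  qed
qed

end

section \<open>Lifts of subgroups of \<open>PSL(2,\<real>)\<^sup>r\<close>\<close>

lemma psl_class_uminus: "psl_class (- A) = psl_class A"
  by (auto simp: psl_class_eq)

lemma psl_class_eq_iff: "psl_class A = psl_class B \<longleftrightarrow> A = B \<or> A = - B"
  by (auto simp: psl_class_eq doubleton_eq_iff)

lemma det_uminus2: "det (- A :: real^2^2) = det A"
  by (simp add: det_eq)

lemma psl_class_mult:
  assumes "det A = 1" "det B = 1"
  shows "psl_class A \<otimes>\<^bsub>PSL2R\<^esub> psl_class B = psl_class (A ** B)"
  unfolding PSL2R_def psl_class_eq by (auto simp: FactGroup_def set_mult_def SL2R_def neg_matrix_mult)

lemma psl_class_one: "\<one>\<^bsub>PSL2R\<^esub> = psl_class (mat 1)"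
  unfolding PSL2R_def psl_class_eq by (auto simp: FactGroup_def)

lemma psl_class_carrier: "det A = 1 \<Longrightarrow> psl_class A \<in> carrier PSL2R"
  by (auto simp: carrier_PSL2R)

lemma psl_class_inv:
  assumes "det A = 1"
  shows "inv\<^bsub>PSL2R\<^esub> (psl_class A) = psl_class (adj2 A)"
proof (rule group.inv_equality[OF group_PSL2R])
  show "psl_class (adj2 A) \<otimes>\<^bsub>PSL2R\<^esub> psl_class A = \<one>\<^bsub>PSL2R\<^esub>"
    using assms by (simp add: psl_class_mult psl_class_one mult_adj2_1)
qed (use assms in \<open>simp_all add: psl_class_carrier\<close>)

section \<open>Discreteness in the quotient topology\<close>

lemma openin_PSL2R:
  "openin PSL2R_topology U \<longleftrightarrow> U \<subseteq> carrier PSL2R \<and> openin (top_of_set (carrier SL2R)) (\<Union>U)"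
  unfolding PSL2R_topology_def topology_inverse'[OF istopology_PSL2R] ..

lemma mem_psl_class: "A \<in> g \<Longrightarrow> g \<in> carrier PSL2R \<Longrightarrow> g = psl_class A"
  by (auto simp: carrier_PSL2R psl_class_eq)

lemma carrier_SL2R: "carrier SL2R = {A. det A = 1}"
  by (simp add: SL2R_def)

lemma norm_mat_1: "norm (mat 1 :: real^2^2) > 1"
proof -
  have "(norm (mat 1 :: real^2^2))\<^sup>2 = 2" by (simp add: norm_mat_sq mat_def)
  then have "(norm (mat 1 :: real^2^2))\<^sup>2 > 1\<^sup>2" by simp
  then show ?thesis by (rule power_less_imp_less_base) simp
qed

text \<open>A lift within distance 1 of the identity is thus not minus the identity, which settles
  the sign of lifts near the identity.\<close>

lemma uminus_mat_1_far: "norm (- mat 1 - mat 1 :: real^2^2) > 1"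
proof -
  have "- mat 1 - mat 1 = (- 2) *\<^sub>R (mat 1 :: real^2^2)" by (simp add: mat_1_eq)
  then have "norm (- mat 1 - mat 1 :: real^2^2) = 2 * norm (mat 1 :: real^2^2)" by (simp only: norm_scaleR)
  then show ?thesis using norm_mat_1 by linarith
qed

lemma discrete_in_PSL2R_imp:
  assumes "discrete_in_PSL2R H" "subgroup H PSL2R"
  shows "\<exists>e>0. \<forall>A. det A = 1 \<longrightarrow> psl_class A \<in> H \<longrightarrow> norm (A - mat 1) < e \<longrightarrow> A = mat 1"
proof -
  have one: "psl_class (mat 1) \<in> H" using subgroup.one_closed[OF assms(2)] by (simp add: psl_class_one)
  have "openin (subtopology PSL2R_topology H) {psl_class (mat 1)}"
    using assms(1) one by (simp add: discrete_in_PSL2R_def)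
  then obtain U where U: "openin PSL2R_topology U" "{psl_class (mat 1)} = U \<inter> H"
    by (auto simp: openin_subtopology)
  have U': "U \<subseteq> carrier PSL2R" "openin (top_of_set (carrier SL2R)) (\<Union>U)"
    using U(1) by (auto simp: openin_PSL2R)
  have "mat 1 \<in> \<Union>U" using U(2) by (auto simp: psl_class_eq intro!: bexI[of _ "psl_class (mat 1)"])
  then obtain e where e: "e > 0" "ball (mat 1) e \<inter> carrier SL2R \<subseteq> \<Union>U"
    using U'(2) unfolding openin_contains_ball by blast
  show ?thesis
  proof (intro exI[of _ "min e 1"] conjI allI impI)
    show "min e 1 > 0" using e(1) by simp
    fix A assume A: "det A = 1" "psl_class A \<in> H" "norm (A - mat 1) < min e 1"
    then have "A \<in> ball (mat 1) e \<inter> carrier SL2R" by (auto simp: dist_norm norm_minus_commute carrier_SL2R)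
    then obtain g where "g \<in> U" "A \<in> g" using e(2) by blast
    then have "psl_class A \<in> U \<inter> H" using mem_psl_class U'(1) A(2) by blast
    then have "psl_class A = psl_class (mat 1)" using U(2) by blast
    then have "A = mat 1 \<or> A = - mat 1" by (simp add: psl_class_eq_iff)
    then show "A = mat 1" using A(3) uminus_mat_1_far by auto
  qed
qed

lemma discrete_in_PSL2RI:
  assumes H: "subgroup H PSL2R"
    and e: "e > 0" "\<And>A. det A = 1 \<Longrightarrow> psl_class A \<in> H \<Longrightarrow> norm (A - mat 1) < e \<Longrightarrow> A = mat 1"
  shows "discrete_in_PSL2R H"
proof -
  have Hc: "H \<subseteq> carrier PSL2R" using H by (rule subgroup.subset)
  have nbhd: "\<exists>U. openin PSL2R_topology U \<and> {g} = U \<inter> H" if g: "g \<in> H" for g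
  proof -
    obtain B where B: "det B = 1" "g = psl_class B" using g Hc by (auto simp: carrier_PSL2R)
    define V where "V = {A. norm (adj2 B ** A - mat 1) < e}"
    \<comment> \<open>\<open>V'\<close> is the negative of \<open>V\<close>; the classes in
      \<open>U\<close> fill both, so their union is open.\<close>
    define V' where "V' = {A. norm (- (adj2 B ** A) - mat 1) < e}"
    define U where "U = psl_class ` {A. det A = 1 \<and> A \<in> V}"
    have cont: "continuous_on UNIV (\<lambda>A. norm (adj2 B ** A - mat 1))"
      "continuous_on UNIV (\<lambda>A. norm (- (adj2 B ** A) - mat 1))"
      unfolding continuous_on_def by (auto intro!: tendsto_intros)
    have "open V" "open V'"
      unfolding V_def V'_def by (intro open_Collect_less cont continuous_on_const)+
    have V': "A \<in> V' \<longleftrightarrow> - A \<in> V" for A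
      by (simp add: V_def V'_def neg_matrix_mult)
    have UV: "\<Union>U = carrier SL2R \<inter> (V \<union> V')"
    proof (intro Set.set_eqI iffI)
      fix A assume "A \<in> \<Union>U"
      then obtain C where C: "det C = 1" "C \<in> V" "A = C \<or> A = - C" by (auto simp: U_def psl_class_eq)
      then have "det A = 1" "A \<in> V \<union> V'" using V'[of A] det_uminus2[of C] by auto
      then show "A \<in> carrier SL2R \<inter> (V \<union> V')" by (simp add: carrier_SL2R)
    next
      fix A assume "A \<in> carrier SL2R \<inter> (V \<union> V')"
      then have dA: "det A = 1" and "A \<in> V \<or> - A \<in> V" using V' by (auto simp: carrier_SL2R)
      then consider "A \<in> V" | "- A \<in> V" by blast
      then have "psl_class A \<in> U"
      proof cases
        case 1 then show ?thesis using dA by (auto simp: U_def)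
      next
        case 2
        moreover have "det (- A) = 1" using dA by (simp only: det_uminus2)
        ultimately have "psl_class (- A) \<in> U" unfolding U_def by (intro imageI CollectI conjI)
        then show ?thesis by (simp add: psl_class_uminus)
      qed
      moreover have "A \<in> psl_class A" by (simp add: psl_class_eq)
      ultimately show "A \<in> \<Union>U" by (rule UnionI)
    qed
    have "openin (top_of_set (carrier SL2R)) (\<Union>U)"
      unfolding UV by (intro openin_open_Int open_Un \<open>open V\<close> \<open>open V'\<close>)
    moreover have "U \<subseteq> carrier PSL2R" by (auto simp: U_def psl_class_carrier)
    ultimately have "openin PSL2R_topology U" unfolding openin_PSL2R by blast
    moreover have "{g} = U \<inter> H"
    proof -
      have "g \<in> U" using B e(1) by (auto simp: U_def V_def mult_adj2_1)
      moreover have "h = g" if h: "h \<in> U" "h \<in> H" for h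
      proof -
      obtain A where A: "det A = 1" "A \<in> V" "h = psl_class A" using h by (auto simp: U_def)
      have "inv\<^bsub>PSL2R\<^esub> g \<otimes>\<^bsub>PSL2R\<^esub> h \<in> H"
        using H g h by (intro subgroup.m_closed subgroup.m_inv_closed)
      then have "psl_class (adj2 B ** A) \<in> H" using A B by (simp add: psl_class_inv psl_class_mult)
      then have "adj2 B ** A = mat 1" using A B by (intro e(2)) (auto simp: det_mul V_def)
      then have "B ** (adj2 B ** A) = B" by simp
      then have "A = B" using B(1) by (simp add: matrix_mul_assoc mult_adj2_1)
      then show "h = g" using A B by simp
      qed
      ultimately show ?thesis using g by blast
    qed
    ultimately show ?thesis by blast
  qed
  have "topspace PSL2R_topology = carrier PSL2R"
  proof -
    have "openin PSL2R_topology (carrier PSL2R)"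
    proof -
      have "\<Union>(carrier PSL2R) = carrier SL2R"
        by (auto simp: carrier_PSL2R carrier_SL2R psl_class_eq det_uminus2)
      then show ?thesis by (simp add: openin_PSL2R)
    qed
    then show ?thesis by (auto simp: topspace_def openin_PSL2R)
  qed
  then have "topspace (subtopology PSL2R_topology H) = H" using Hc by auto
  moreover have "\<forall>g\<in>H. openin (subtopology PSL2R_topology H) {g}"
    using nbhd by (auto simp: openin_subtopology)
  ultimately have "discrete_topology H = subtopology PSL2R_topology H"
    by (simp add: discrete_topology_unique)
  then show ?thesis by (simp add: discrete_in_PSL2R_def)
qed

text \<open>The full preimage in SL(2,R)^r, with signs free in each factor. Components from
  \<open>r\<close> on are the identity, so that tuples can be indexed by all natural
  numbers.\<close>

definition lifts :: "nat \<Rightarrow> (nat \<Rightarrow> psl) set \<Rightarrow> (nat \<Rightarrow> real^2^2) set" where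
  "lifts r \<Gamma> = {A. (\<forall>i. det (A i) = 1) \<and> (\<forall>i\<ge>r. A i = mat 1) \<and> (\<lambda>i\<in>{..<r}. psl_class (A i)) \<in> \<Gamma>}"

lemma PSL2R_pow_mult:
  assumes "\<And>i. det (A i) = 1" "\<And>i. det (B i) = 1"
  shows "(\<lambda>i\<in>{..<r}. psl_class (A i)) \<otimes>\<^bsub>PSL2R_pow r\<^esub> (\<lambda>i\<in>{..<r}. psl_class (B i)) =
    (\<lambda>i\<in>{..<r}. psl_class (A i ** B i))"
  using assms by (auto simp: PSL2R_pow_def product_group_def psl_class_mult fun_eq_iff restrict_def)

lemma PSL2R_pow_carrier:
  "(\<And>i. det (A i) = 1) \<Longrightarrow> (\<lambda>i\<in>{..<r}. psl_class (A i)) \<in> carrier (PSL2R_pow r)"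
  by (auto simp: PSL2R_pow_def carrier_product_group psl_class_carrier)

lemma PSL2R_pow_one: "\<one>\<^bsub>PSL2R_pow r\<^esub> = (\<lambda>i\<in>{..<r}. psl_class (mat 1))"
  by (simp add: PSL2R_pow_def psl_class_one product_group_def)

lemma PSL2R_pow_inv:
  assumes "\<And>i. det (A i) = 1"
  shows "inv\<^bsub>PSL2R_pow r\<^esub> (\<lambda>i\<in>{..<r}. psl_class (A i)) = (\<lambda>i\<in>{..<r}. psl_class (adj2 (A i)))"
proof (rule group.inv_equality[OF group_PSL2R_pow])
  show "(\<lambda>i\<in>{..<r}. psl_class (adj2 (A i))) \<otimes>\<^bsub>PSL2R_pow r\<^esub> (\<lambda>i\<in>{..<r}. psl_class (A i)) = \<one>\<^bsub>PSL2R_pow r\<^esub>"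
    using assms by (simp add: PSL2R_pow_mult PSL2R_pow_one mult_adj2_1)
qed (use assms in \<open>simp_all add: PSL2R_pow_carrier\<close>)

lemma tuple_group_lifts:
  assumes "subgroup \<Gamma> (PSL2R_pow r)"
  shows "tuple_group (lifts r \<Gamma>)"
proof
  show "(\<lambda>_. mat 1) \<in> lifts r \<Gamma>"
    using subgroup.one_closed[OF assms] by (simp add: lifts_def PSL2R_pow_one)
  fix A B assume "A \<in> lifts r \<Gamma>" "B \<in> lifts r \<Gamma>"
  then show "(\<lambda>i. A i ** B i) \<in> lifts r \<Gamma>"
    using subgroup.m_closed[OF assms, of "\<lambda>i\<in>{..<r}. psl_class (A i)" "\<lambda>i\<in>{..<r}. psl_class (B i)"]
    by (auto simp: lifts_def PSL2R_pow_mult det_mul)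
next
  fix A assume A: "A \<in> lifts r \<Gamma>"
  then show "det (A i) = 1" for i by (simp add: lifts_def)
  show "(\<lambda>i. adj2 (A i)) \<in> lifts r \<Gamma>"
    using A subgroup.m_inv_closed[OF assms, of "\<lambda>i\<in>{..<r}. psl_class (A i)"]
    by (auto simp: lifts_def PSL2R_pow_inv)
qed

lemma exists_lift:
  assumes "\<gamma> \<in> carrier (PSL2R_pow r)" "i < r" "det B = 1" "\<gamma> i = psl_class B"
  obtains A where "\<And>k. det (A k) = 1" "\<And>k. k \<ge> r \<Longrightarrow> A k = mat 1" "(\<lambda>k\<in>{..<r}. psl_class (A k)) = \<gamma>" "A i = B"
proof -
  have "\<exists>C. det C = 1 \<and> \<gamma> k = psl_class C" if "k < r" for k
    using assms(1) that by (auto simp: PSL2R_pow_def carrier_product_group PiE_iff carrier_PSL2R)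
  then obtain C where C: "\<And>k. k < r \<Longrightarrow> det (C k) = 1 \<and> \<gamma> k = psl_class (C k)" by metis
  define A where "A k = (if k = i then B else if k < r then C k else mat 1)" for k
  have "\<gamma> \<in> extensional {..<r}"
    using assms(1) by (auto simp: PSL2R_pow_def carrier_product_group PiE_def)
  then have "(\<lambda>k\<in>{..<r}. psl_class (A k)) = \<gamma>"
    using C assms(4) by (auto simp: A_def fun_eq_iff restrict_def extensional_def)
  then show thesis
    using that[of A] C assms by (auto simp: A_def)
qed

lemma factor_lifts:
  assumes "subgroup \<Gamma> (PSL2R_pow r)" "i < r"
  shows "det B = 1 \<and> psl_class B \<in> factor i \<Gamma> \<longleftrightarrow> (\<exists>A\<in>lifts r \<Gamma>. A i = B)"
proof
  assume B: "det B = 1 \<and> psl_class B \<in> factor i \<Gamma>"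
  then obtain \<gamma> where g: "\<gamma> \<in> \<Gamma>" "\<gamma> i = psl_class B" by (auto simp: factor_def)
  then have "\<gamma> \<in> carrier (PSL2R_pow r)" using subgroup.subset[OF assms(1)] by blast
  moreover have "det B = 1" using B by blast
  ultimately obtain A where A: "\<And>k. det (A k) = 1" "\<And>k. k \<ge> r \<Longrightarrow> A k = mat 1"
    "(\<lambda>k\<in>{..<r}. psl_class (A k)) = \<gamma>" "A i = B"
    using g(2) by (rule exists_lift[OF _ assms(2)]) blast
  then have "A \<in> lifts r \<Gamma>" using g(1) by (simp add: lifts_def)
  then show "\<exists>A\<in>lifts r \<Gamma>. A i = B" using A(4) by blast
next
  assume "\<exists>A\<in>lifts r \<Gamma>. A i = B"
  then obtain A where A: "A \<in> lifts r \<Gamma>" "A i = B" by blast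
  have "(\<lambda>k\<in>{..<r}. psl_class (A k)) \<in> \<Gamma>" "det (A i) = 1" using A(1) by (simp_all add: lifts_def)
  then have "(\<lambda>k\<in>{..<r}. psl_class (A k)) i \<in> factor i \<Gamma>" unfolding factor_def by blast
  then show "det B = 1 \<and> psl_class B \<in> factor i \<Gamma>" using A(2) assms(2) \<open>det (A i) = 1\<close> by simp
qed

lemma subgroup_factor:
  assumes "subgroup \<Gamma> (PSL2R_pow r)" "i < r"
  shows "subgroup (factor i \<Gamma>) PSL2R"
proof -
  interpret tuple_group "lifts r \<Gamma>" by (rule tuple_group_lifts) fact
  have sub: "factor i \<Gamma> \<subseteq> carrier PSL2R"
    using subgroup.subset[OF assms(1)] assms(2)
    by (auto simp: factor_def PSL2R_pow_def carrier_product_group PiE_iff)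
  have rep: "\<exists>A\<in>lifts r \<Gamma>. g = psl_class (A i)" if "g \<in> factor i \<Gamma>" for g
  proof -
    obtain B where "det B = 1" "g = psl_class B" using sub \<open>g \<in> _\<close> by (auto simp: carrier_PSL2R)
    then show ?thesis using factor_lifts[OF assms, of B] that by metis
  qed
  have mem: "psl_class (A i) \<in> factor i \<Gamma>" if "A \<in> lifts r \<Gamma>" for A
    using factor_lifts[OF assms, of "A i"] that by blast
  show ?thesis
  proof (rule group.subgroupI[OF group_PSL2R sub])
    show "factor i \<Gamma> \<noteq> {}" using mem[OF one_mem] by blast
    fix g assume "g \<in> factor i \<Gamma>"
    then obtain A where A: "A \<in> lifts r \<Gamma>" "g = psl_class (A i)" using rep by blast
    then show "inv\<^bsub>PSL2R\<^esub> g \<in> factor i \<Gamma>"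
      using mem[OF inv_mem[OF A(1)]] det_mem by (simp add: psl_class_inv)
    fix h assume "h \<in> factor i \<Gamma>"
    then obtain B where B: "B \<in> lifts r \<Gamma>" "h = psl_class (B i)" using rep by blast
    then show "g \<otimes>\<^bsub>PSL2R\<^esub> h \<in> factor i \<Gamma>"
      using mem[OF mult_mem[OF A(1) B(1)]] A det_mem by (simp add: psl_class_mult)
  qed
qed

lemma lifts_discrete:
  assumes "subgroup \<Gamma> (PSL2R_pow r)" "i < r" "discrete_in_PSL2R (factor i \<Gamma>)"
  shows "\<exists>e>0. \<forall>A\<in>lifts r \<Gamma>. norm (A i - mat 1) < e \<longrightarrow> A i = mat 1"
proof -
  obtain e where e: "e > 0" "\<And>A. det A = 1 \<Longrightarrow> psl_class A \<in> factor i \<Gamma> \<Longrightarrow> norm (A - mat 1) < e \<Longrightarrow> A = mat 1"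
    using discrete_in_PSL2R_imp[OF assms(3) subgroup_factor[OF assms(1,2)]] by blast
  have "A i = mat 1" if "A \<in> lifts r \<Gamma>" "norm (A i - mat 1) < e" for A
    using e(2)[of "A i"] factor_lifts[OF assms(1,2), of "A i"] that by blast
  with e(1) show ?thesis by blast
qed

lemma lifts_nondiscrete:
  assumes "subgroup \<Gamma> (PSL2R_pow r)" "i < r" "\<not> discrete_in_PSL2R (factor i \<Gamma>)" "e > 0"
  shows "\<exists>A\<in>lifts r \<Gamma>. norm (A i - mat 1) < e \<and> A i \<noteq> mat 1"
proof (rule ccontr)
  assume neg: "\<not> ?thesis"
  have "discrete_in_PSL2R (factor i \<Gamma>)"
  proof (rule discrete_in_PSL2RI[OF subgroup_factor[OF assms(1,2)] assms(4)])
    fix B assume "det B = 1" "psl_class B \<in> factor i \<Gamma>" "norm (B - mat 1) < e"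
    then show "B = mat 1" using factor_lifts[OF assms(1,2), of B] neg by blast
  qed
  with assms(3) show False ..
qed

theorem lifts_lattice_full:
  assumes \<Gamma>: "subgroup \<Gamma> (PSL2R_pow r)" "i < r" and cof: "cofinite_fuchsian (factor i \<Gamma>)"
  shows "proj_full {i} (lifts r \<Gamma>)"
proof -
  interpret tuple_group "lifts r \<Gamma>" by (rule tuple_group_lifts) fact
  define H where "H = {A i | A. A \<in> lifts r \<Gamma>}"
  have HI: "A i \<in> H" if "A \<in> lifts r \<Gamma>" for A using that by (auto simp: H_def)
  have "discrete_in_PSL2R (factor i \<Gamma>)" using cof by (simp add: cofinite_fuchsian_def fuchsian_def)
  from lifts_discrete[OF \<Gamma> this] obtain e
    where e: "e > 0" "\<forall>A\<in>lifts r \<Gamma>. norm (A i - mat 1) < e \<longrightarrow> A i = mat 1" by blast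
  obtain F where F: "fundamental_domain (factor i \<Gamma>) F" "hyperbolic_area F < \<infinity>"
    using cof by (auto simp: cofinite_fuchsian_def)
  have "countable H"
  proof (rule countable_subset)
    show "H \<subseteq> (\<Union>n::nat. {A i | A. A \<in> lifts r \<Gamma> \<and> norm (A i) \<le> real n})"
      unfolding H_def using real_arch_simple by blast
    show "countable (\<Union>n::nat. {A i | A. A \<in> lifts r \<Gamma> \<and> norm (A i) \<le> real n})"
      by (rule countable_UN[OF countableI_type countable_finite[OF discrete_finite_ball[OF e]]])
  qed
  have Hm: "\<And>A B. A \<in> H \<Longrightarrow> B \<in> H \<Longrightarrow> A ** B \<in> H" "\<And>A. A \<in> H \<Longrightarrow> adj2 A \<in> H" "\<And>A. A \<in> H \<Longrightarrow> det A = 1"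
  proof -
    fix A assume "A \<in> H"
    then obtain X where X: "X \<in> lifts r \<Gamma>" "A = X i" by (auto simp: H_def)
    show "adj2 A \<in> H" using HI[OF inv_mem[OF X(1)]] X(2) by simp
    show "det A = 1" using det_mem[OF X(1)] X(2) by simp
    fix B assume "B \<in> H"
    then obtain Y where Y: "Y \<in> lifts r \<Gamma>" "B = Y i" by (auto simp: H_def)
    show "A ** B \<in> H" using HI[OF mult_mem[OF X(1) Y(1)]] X(2) Y(2) by simp
  qed
  have cover: "upper_half_plane \<subseteq> (\<Union>A\<in>H. moebius A ` F)"
  proof
    fix z assume "z \<in> upper_half_plane"
    then obtain g where g: "g \<in> factor i \<Gamma>" "z \<in> psl_act g ` F"
      using F(1) unfolding fundamental_domain_def by blast
    then obtain B where B: "det B = 1" "g = psl_class B"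
      using subgroup.subset[OF subgroup_factor[OF \<Gamma>]] by (auto simp: carrier_PSL2R)
    then have "B \<in> H" using factor_lifts[OF \<Gamma>, of B] g(1) by (auto simp: H_def)
    moreover have "z \<in> moebius B ` F" using g(2) B by (auto simp: psl_act_class)
    ultimately show "z \<in> (\<Union>A\<in>H. moebius A ` F)" by blast
  qed
  show ?thesis
  proof (rule strip_recurrence_full[OF e])
    fix s t :: real assume "s < t"
    \<comment> \<open>Each group element occurs in \<open>H\<close> with both of its lifts; a
      covering by translates tolerates the repetition.\<close>
    have "infinite {A \<in> H. \<exists>z\<in>strip s t. moebius A z \<in> strip s t}"
      using F \<open>countable H\<close> Hm cover \<open>s < t\<close>
      by (intro strip_recurrence_infinite[where F = F]) (auto simp: fundamental_domain_def)
    also have "{A \<in> H. \<exists>z\<in>strip s t. moebius A z \<in> strip s t} =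
        {A i | A. A \<in> lifts r \<Gamma> \<and> (\<exists>z\<in>strip s t. moebius (A i) z \<in> strip s t)}"
      by (auto simp: H_def)
    finally show "infinite {A i | A. A \<in> lifts r \<Gamma> \<and> (\<exists>z\<in>strip s t. moebius (A i) z \<in> strip s t)}" .
  qed
qed

section \<open>Embeddings of real number fields\<close>

text \<open>Dedekind's argument: subtracting \<open>\<phi> a y\<close> times the relation at x from
  the relation at y x removes the character \<open>a\<close>, and a suitable \<open>y\<close> leaves
  a nonzero factor at any other \<open>k\<close>.\<close>

lemma characters_independent:
  fixes \<phi> :: "'i \<Rightarrow> real \<Rightarrow> real"
  assumes "finite I" "1 \<in> K" "\<And>x y. x \<in> K \<Longrightarrow> y \<in> K \<Longrightarrow> x * y \<in> K"
    and "\<And>i x y. i \<in> I \<Longrightarrow> x \<in> K \<Longrightarrow> y \<in> K \<Longrightarrow> \<phi> i (x * y) = \<phi> i x * \<phi> i y"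
    and "\<And>i. i \<in> I \<Longrightarrow> \<phi> i 1 = 1"
    and "\<And>i k. i \<in> I \<Longrightarrow> k \<in> I \<Longrightarrow> i \<noteq> k \<Longrightarrow> \<exists>x\<in>K. \<phi> i x \<noteq> \<phi> k x"
    and "\<And>x. x \<in> K \<Longrightarrow> (\<Sum>i\<in>I. c i * \<phi> i x) = 0" and "i \<in> I"
  shows "c i = 0"
  using assms
proof (induction I arbitrary: c i rule: finite_induct)
  case (insert a I)
  have I0: "c k = 0" if k: "k \<in> I" for k
  proof -
    obtain y where y: "y \<in> K" "\<phi> k y \<noteq> \<phi> a y"
      using insert.prems(5)[of k a] k insert.hyps by auto
    have "c k * (\<phi> k y - \<phi> a y) = 0"
    proof (rule insert.IH[where c = "\<lambda>i. c i * (\<phi> i y - \<phi> a y)"])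
      fix x assume x: "x \<in> K"
      have "(\<Sum>i\<in>I. c i * (\<phi> i y - \<phi> a y) * \<phi> i x) =
          (\<Sum>i\<in>insert a I. c i * (\<phi> i y - \<phi> a y) * \<phi> i x)"
        using insert.hyps by simp
      also have "\<dots> = (\<Sum>i\<in>insert a I. c i * \<phi> i (y * x) - \<phi> a y * (c i * \<phi> i x))"
        using insert.prems(3) x y by (intro sum.cong) (auto simp: algebra_simps)
      also have "\<dots> = (\<Sum>i\<in>insert a I. c i * \<phi> i (y * x)) - \<phi> a y * (\<Sum>i\<in>insert a I. c i * \<phi> i x)"
        by (simp only: sum_subtractf sum_distrib_left)
      also have "\<dots> = 0" using insert.prems(6)[of "y * x"] insert.prems(6)[of x] insert.prems(2) x y by simp
      finally show "(\<Sum>i\<in>I. c i * (\<phi> i y - \<phi> a y) * \<phi> i x) = 0" .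
    qed (use insert.prems k in auto)
    then show ?thesis using y by simp
  qed
  moreover have "c a = 0"
    using insert.prems(6)[of 1] insert.prems(1,4) insert.hyps I0 by simp
  ultimately show ?case using insert.prems(7) by auto
qed simp

text \<open>The same \<open>n\<close> counts a spanning family over the rationals and the
  embeddings, so the matrix of the values \<open>\<phi> i (b k)\<close> is square.\<close>

locale number_field_embeddings =
  fixes K :: "real set" and n :: nat and b :: "nat \<Rightarrow> real" and \<phi> :: "nat \<Rightarrow> real \<Rightarrow> real"
  assumes one: "1 \<in> K" and diff: "x \<in> K \<Longrightarrow> y \<in> K \<Longrightarrow> x - y \<in> K" and mult: "x \<in> K \<Longrightarrow> y \<in> K \<Longrightarrow> x * y \<in> K"
    and rat: "of_rat q \<in> K"
    and basis: "k < n \<Longrightarrow> b k \<in> K" and span: "x \<in> K \<Longrightarrow> \<exists>q. x = (\<Sum>k<n. of_rat (q k) * b k)"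
    and emb_add: "i < n \<Longrightarrow> x \<in> K \<Longrightarrow> y \<in> K \<Longrightarrow> \<phi> i (x + y) = \<phi> i x + \<phi> i y"
    and emb_mult: "i < n \<Longrightarrow> x \<in> K \<Longrightarrow> y \<in> K \<Longrightarrow> \<phi> i (x * y) = \<phi> i x * \<phi> i y"
    and emb_rat: "i < n \<Longrightarrow> \<phi> i (of_rat q) = of_rat q"
    and emb_distinct: "i < n \<Longrightarrow> k < n \<Longrightarrow> i \<noteq> k \<Longrightarrow> \<exists>x\<in>K. \<phi> i x \<noteq> \<phi> k x"
begin

lemma add: "x \<in> K \<Longrightarrow> y \<in> K \<Longrightarrow> x + y \<in> K"
proof -
  assume x: "x \<in> K" and y: "y \<in> K"
  have "0 \<in> K" using rat[of 0] by simp
  from diff[OF x diff[OF this y]] show ?thesis by simp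
qed

lemma zero_mem: "0 \<in> K"
  using rat[of 0] by simp

lemma sum_mem: "finite A \<Longrightarrow> (\<And>a. a \<in> A \<Longrightarrow> f a \<in> K) \<Longrightarrow> sum f A \<in> K"
  by (induction A rule: finite_induct) (auto intro: add zero_mem)

lemma emb_sum:
  assumes "i < n" "finite A" "\<And>a. a \<in> A \<Longrightarrow> f a \<in> K"
  shows "\<phi> i (sum f A) = (\<Sum>a\<in>A. \<phi> i (f a))"
  using assms(2,1,3)
proof (induction A rule: finite_induct)
  case empty
  then show ?case using emb_rat[of i 0] by simp
next
  case (insert a A)
  then show ?case using emb_add[of i "f a" "sum f A"] sum_mem[of A f] by simp
qed

lemma emb_poly:
  assumes "i < n" "x \<in> K"
  shows "poly (map_poly of_rat p) x \<in> K \<and> \<phi> i (poly (map_poly of_rat p) x) = poly (map_poly of_rat p) (\<phi> i x)"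
proof (induction p)
  case 0
  then show ?case using rat[of 0] emb_rat[OF assms(1), of 0] by simp
next
  case (pCons a p)
  have "map_poly of_rat (pCons a p) = pCons (of_rat a :: real) (map_poly of_rat p)"
    by (rule of_rat_hom.map_poly_pCons_hom)
  then show ?case
    using pCons assms rat mult add emb_rat emb_mult emb_add by simp
qed

lemma emb_eq_0: "i < n \<Longrightarrow> x \<in> K \<Longrightarrow> \<phi> i x = 0 \<Longrightarrow> (\<And>x. x \<in> K \<Longrightarrow> inverse x \<in> K) \<Longrightarrow> x = 0"
  using emb_mult[of i x "inverse x"] emb_rat[of i 1] by (cases "x = 0") auto

text \<open>Multiplication by \<open>\<theta>\<close> is given by a rational matrix; it is diagonalized by the embeddings.\<close>
lemma char_poly_embeddings:
  assumes \<theta>: "\<theta> \<in> K"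
  shows "\<exists>p :: rat poly. map_poly of_rat p = (\<Prod>i<n. [:- \<phi> i \<theta>, 1:])"
proof -
  have "\<forall>k. \<exists>q. k < n \<longrightarrow> \<theta> * b k = (\<Sum>l<n. of_rat (q l) * b l)"
    using span mult[OF \<theta> basis] by blast
  then obtain m where m: "\<And>k. k < n \<Longrightarrow> \<theta> * b k = (\<Sum>l<n. of_rat (m k l) * b l)" by metis
  define M where "M = Matrix.mat n n (\<lambda>(k, l). m k l :: rat)"
  define M' where "M' = map_mat (of_rat :: rat \<Rightarrow> real) M"
  define V where "V = Matrix.mat n n (\<lambda>(k, i). \<phi> i (b k))"
  define D where "D = Matrix.mat n n (\<lambda>(k, i). if k = i then \<phi> i \<theta> else 0)"
  have carr: "M \<in> carrier_mat n n" "M' \<in> carrier_mat n n" "V \<in> carrier_mat n n" "D \<in> carrier_mat n n"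
    by (auto simp: M_def M'_def V_def D_def)
  \<comment> \<open>A kernel vector of \<open>V\<close> would be a linear relation among the
    embeddings on a spanning family, hence on all of \<open>K\<close>, against the independence of
    characters.\<close>
  have "Determinant.det V \<noteq> 0"
  proof
    assume "Determinant.det V = 0"
    then obtain v where v: "v \<in> carrier_vec n" "v \<noteq> 0\<^sub>v n" "V *\<^sub>v v = 0\<^sub>v n"
      using det_0_iff_vec_prod_zero_field[OF carr(3)] by blast
    have basis0: "(\<Sum>i<n. vec_index v i * \<phi> i (b k)) = 0" if k: "k < n" for k
    proof -
      have "vec_index (V *\<^sub>v v) k = 0" using v(3) k by simp
      moreover have "vec_index (V *\<^sub>v v) k = (\<Sum>i\<in>{0..<n}. \<phi> i (b k) * vec_index v i)"
        using k v(1) by (simp add: V_def scalar_prod_def)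
      ultimately show ?thesis by (simp add: lessThan_atLeast0 mult.commute)
    qed
    have all0: "(\<Sum>i<n. vec_index v i * \<phi> i x) = 0" if x: "x \<in> K" for x
    proof -
      obtain q where q: "x = (\<Sum>k<n. of_rat (q k) * b k)" using span[OF x] by blast
      have "\<phi> i x = (\<Sum>k<n. of_rat (q k) * \<phi> i (b k))" if "i < n" for i
        unfolding q using that by (subst emb_sum) (auto intro!: mult rat basis sum.cong simp: emb_mult emb_rat rat basis)
      then have "(\<Sum>i<n. vec_index v i * \<phi> i x) = (\<Sum>i<n. \<Sum>k<n. of_rat (q k) * (vec_index v i * \<phi> i (b k)))"
        by (intro sum.cong) (auto simp: sum_distrib_left mult_ac)
      also have "\<dots> = (\<Sum>k<n. of_rat (q k) * (\<Sum>i<n. vec_index v i * \<phi> i (b k)))"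
        by (subst sum.swap) (simp add: sum_distrib_left)
      also have "\<dots> = 0" using basis0 by simp
      finally show ?thesis .
    qed
    have "vec_index v i = 0" if "i < n" for i
    proof (rule characters_independent[of "{..<n}" K \<phi> "vec_index v"])
      show "\<phi> i 1 = 1" if "i \<in> {..<n}" for i using emb_rat[of i 1] that by simp
    qed (use that one mult emb_mult emb_distinct all0 in auto)
    then have "v = 0\<^sub>v n" using v(1) by (intro eq_vecI) auto
    with v(2) show False ..
  qed
  from det_non_zero_imp_unit[OF carr(3) this, of "()"]
  obtain W where W: "W \<in> carrier_mat n n" "W * V = 1\<^sub>m n" "V * W = 1\<^sub>m n"
    unfolding Units_def ring_mat_def by auto
  \<comment> \<open>Applying \<open>\<phi> i\<close> to the expansion of \<theta> b k shows that
    column \<open>i\<close> of \<open>V\<close> is an eigenvector with eigenvalue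
    \<open>\<phi> i \<theta>\<close>.\<close>
  have MV: "M' * V = V * D"
  proof (rule eq_matI)
    fix k i assume "k < dim_row (V * D)" "i < dim_col (V * D)"
    then have k: "k < n" and i: "i < n" by (auto simp: V_def D_def)
    have "(M' * V) $$ (k, i) = (\<Sum>l\<in>{0..<n}. of_rat (m k l) * \<phi> i (b l))"
      using k i by (simp add: M'_def M_def V_def scalar_prod_def)
    also have "\<dots> = (\<Sum>l<n. of_rat (m k l) * \<phi> i (b l))" by (simp add: lessThan_atLeast0)
    also have "\<dots> = \<phi> i (\<theta> * b k)"
      unfolding m[OF k] using i by (subst emb_sum) (auto intro!: mult rat basis sum.cong simp: emb_mult emb_rat rat basis)
    also have "\<dots> = \<phi> i (b k) * \<phi> i \<theta>" using i k \<theta> basis by (simp add: emb_mult mult.commute)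
    also have "\<dots> = (\<Sum>l\<in>{0..<n}. \<phi> l (b k) * (if l = i then \<phi> i \<theta> else 0))"
      using i by (simp add: if_distrib cong: if_cong)
    also have "\<dots> = (V * D) $$ (k, i)"
      using k i by (simp add: V_def D_def scalar_prod_def)
    finally show "(M' * V) $$ (k, i) = (V * D) $$ (k, i)" .
  qed (use carr in auto)
  have "M' = M' * (V * W)" using W carr by simp
  also have "\<dots> = M' * V * W" using carr(2,3) W(1) by (rule assoc_mult_mat[symmetric])
  also have "\<dots> = V * D * W" unfolding MV ..
  finally have "similar_mat M' D" using carr W by (intro similar_matI[of M' D V W n]) auto
  then have "char_poly M' = char_poly D" by (rule char_poly_similar)
  also have "\<dots> = (\<Prod>a\<leftarrow>diag_mat D. [:- a, 1:])"
    using carr(4) by (intro char_poly_upper_triangular[of D n]) (auto simp: D_def upper_triangular_def)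
  also have "\<dots> = (\<Prod>i<n. [:- \<phi> i \<theta>, 1:])"
    by (simp add: diag_mat_def D_def prod.distinct_set_conv_list[symmetric] lessThan_atLeast0 o_def cong: prod.cong map_cong)
       (simp add: prod.distinct_set_conv_list atLeast_upt[symmetric] atLeast0LessThan)
  finally have "char_poly M' = (\<Prod>i<n. [:- \<phi> i \<theta>, 1:])" .
  moreover have "char_poly M' = map_poly of_rat (char_poly M)"
    unfolding M'_def by (rule of_rat_hom.char_poly_hom[OF carr(1)])
  ultimately show ?thesis by metis
qed

text \<open>The rational polynomial above has a simple root at one conjugate of \<open>\<theta>\<close> only if its derivative does
  not vanish at \<open>\<theta>\<close>, and then all its roots are simple.\<close>
lemma embeddings_multiplicity:
  assumes inv: "\<And>x. x \<in> K \<Longrightarrow> inverse x \<in> K" and \<theta>: "\<theta> \<in> K"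
    and j: "j < n" "\<And>l. l < n \<Longrightarrow> l \<noteq> j \<Longrightarrow> \<phi> l \<theta> \<noteq> \<phi> j \<theta>"
    and ik: "i < n" "k < n" "i \<noteq> k"
  shows "\<phi> i \<theta> \<noteq> \<phi> k \<theta>"
proof
  assume eq: "\<phi> i \<theta> = \<phi> k \<theta>"
  obtain p :: "rat poly" where p: "map_poly of_rat p = (\<Prod>i<n. [:- \<phi> i \<theta>, 1:])"
    using char_poly_embeddings[OF \<theta>] by blast
  have pd: "map_poly of_rat (pderiv p) = pderiv (map_poly of_rat p :: real poly)"
    by (rule of_rat_hom.map_poly_pderiv)
  \<comment> \<open>The derivative at \<theta> is an element of the field \<open>K\<close>, so its
    conjugates vanish all at once or not at all.\<close>
  define x where "x = poly (map_poly of_rat (pderiv p)) \<theta>"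
  have x: "x \<in> K" "\<And>l. l < n \<Longrightarrow> \<phi> l x = poly (pderiv (map_poly of_rat p)) (\<phi> l \<theta>)"
    unfolding x_def pd[symmetric] using emb_poly[OF _ \<theta>] j(1) by auto
  have root: "poly (pderiv ([:- a, 1:] * q)) a = poly q a" for a :: real and q
    unfolding pderiv_mult poly_add poly_mult by (simp add: pderiv_pCons)
  have "\<phi> j x \<noteq> 0"
  proof -
    have "map_poly of_rat p = [:- \<phi> j \<theta>, 1:] * (\<Prod>i\<in>{..<n} - {j}. [:- \<phi> i \<theta>, 1:])"
      unfolding p using j(1) by (subst prod.remove[of _ j]) auto
    then have "\<phi> j x = poly (\<Prod>i\<in>{..<n} - {j}. [:- \<phi> i \<theta>, 1:]) (\<phi> j \<theta>)"
      unfolding x(2)[OF j(1)] by (simp only: root)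
    also have "\<dots> = (\<Prod>i\<in>{..<n} - {j}. \<phi> j \<theta> - \<phi> i \<theta>)" by (simp add: poly_prod)
    also have "\<dots> \<noteq> 0"
    proof -
      have "\<phi> j \<theta> - \<phi> i \<theta> \<noteq> 0" if "i \<in> {..<n} - {j}" for i
        using j(2)[of i] that by simp
      then show ?thesis by simp
    qed
    finally show ?thesis .
  qed
  then have "x \<noteq> 0" using emb_rat[OF j(1), of 0] by auto
  have "{..<n} = insert i (insert k ({..<n} - {i, k}))" using ik by auto
  then have "map_poly of_rat p = (\<Prod>i\<in>insert i (insert k ({..<n} - {i, k})). [:- \<phi> i \<theta>, 1:])" unfolding p by simp
  also have "\<dots> = [:- \<phi> i \<theta>, 1:] * ([:- \<phi> k \<theta>, 1:] * (\<Prod>i\<in>{..<n} - {i, k}. [:- \<phi> i \<theta>, 1:]))"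
    using ik by simp
  finally have "\<phi> i x = poly ([:- \<phi> k \<theta>, 1:] * (\<Prod>i\<in>{..<n} - {i, k}. [:- \<phi> i \<theta>, 1:])) (\<phi> i \<theta>)"
    unfolding x(2)[OF ik(1)] by (simp only: root)
  then have "\<phi> i x = 0" unfolding poly_mult using eq by simp
  then have "x = 0" using emb_eq_0[OF ik(1) x(1)] inv by blast
  with \<open>x \<noteq> 0\<close> show False ..
qed

end

section \<open>Subgroups of arithmetic groups\<close>

text \<open>A rank one matrix with nonzero trace is proportional to each of its powers, so powers of
  approximating elements still approximate it after rescaling. The generic position of image and
  kernel provides the nonzero trace.\<close>

lemma proj_full_power:
  assumes T: "finite T" and full: "proj_full T G"
    and pow: "\<And>A. A \<in> G \<Longrightarrow> \<exists>B\<in>G'. \<forall>i\<in>T. mpow (A i) (Suc m) = B i \<or> mpow (A i) (Suc m) = - B i"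
  shows "proj_full T G'"
  unfolding proj_full_def
proof (intro allI impI)
  fix X assume X: "\<forall>i\<in>T. det (X i :: real^2^2) = 0"
  show "X \<in> proj_closure T G'"
  proof (rule proj_closure_generic[where R = T])
    fix x z :: "nat \<Rightarrow> real \<times> real"
    assume xz: "\<And>i. i \<in> T \<Longrightarrow> cross (x i) (z i) \<noteq> 0 \<and> snd (x i) \<noteq> 0 \<and> snd (z i) \<noteq> 0"
    have "(\<lambda>i. rank1 (x i) (z i)) \<in> proj_closure T G" using full by (simp add: proj_full_def)
    then obtain A c where A: "\<And>n::nat. A n \<in> G" "\<And>i. i \<in> T \<Longrightarrow> (\<lambda>n. c n i *\<^sub>R A n i) \<longlonglongrightarrow> rank1 (x i) (z i)"
      by (rule proj_closure_seqE) blast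
    have "\<exists>B. B \<in> G' \<and> (\<forall>i\<in>T. mpow (A n i) (Suc m) = B i \<or> mpow (A n i) (Suc m) = - B i)" for n
      using pow[OF A(1)] by blast
    then obtain B where B: "\<And>n. B n \<in> G'"
      "\<And>n i. i \<in> T \<Longrightarrow> mpow (A n i) (Suc m) = B n i \<or> mpow (A n i) (Suc m) = - B n i" by metis
    define s where "s n i = (if mpow (A n i) (Suc m) = B n i then 1 else - 1 :: real)" for n i
    define k where "k i = inverse (cross (z i) (x i) ^ m)" for i
    have pow1: "mpow (rank1 p q) (Suc m) = cross q p ^ m *\<^sub>R rank1 p q" for p q
    proof (induction m)
      case (Suc m)
      have "mpow (rank1 p q) (Suc (Suc m)) = rank1 p q ** (cross q p ^ m *\<^sub>R rank1 p q)"
        using Suc by simp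
      then show ?case by (simp add: scaleR_matrix_mult rank1_mult_rank1)
    qed simp
    show "(\<lambda>i. if i \<in> T then rank1 (x i) (z i) else X i) \<in> proj_closure T G'"
    proof (rule proj_closure_seqI[OF T, where A = B and c = "\<lambda>n i. k i * (c n i ^ Suc m * s n i)"])
      fix i assume i: "i \<in> T"
      have cz: "cross (z i) (x i) \<noteq> 0" using xz[OF i] cross_swap[of "x i" "z i"] by simp
      have "(\<lambda>n. k i *\<^sub>R mpow (c n i *\<^sub>R A n i) (Suc m)) \<longlonglongrightarrow> k i *\<^sub>R mpow (rank1 (x i) (z i)) (Suc m)"
        by (intro tendsto_intros A(2) i)
      also have "k i *\<^sub>R mpow (rank1 (x i) (z i)) (Suc m) = rank1 (x i) (z i)"
        unfolding pow1 k_def using cz by simp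
      also have "(\<lambda>n. k i *\<^sub>R mpow (c n i *\<^sub>R A n i) (Suc m)) = (\<lambda>n. (k i * (c n i ^ Suc m * s n i)) *\<^sub>R B n i)"
      proof
        fix n
        have "mpow (A n i) (Suc m) = s n i *\<^sub>R B n i" using B(2)[OF i, of n] by (auto simp: s_def)
        then show "k i *\<^sub>R mpow (c n i *\<^sub>R A n i) (Suc m) = (k i * (c n i ^ Suc m * s n i)) *\<^sub>R B n i"
          unfolding mpow_scaleR by simp
      qed
      finally show "(\<lambda>n. (k i * (c n i ^ Suc m * s n i)) *\<^sub>R B n i) \<longlonglongrightarrow> (if i \<in> T then rank1 (x i) (z i) else X i)"
        using i by simp
    qed (rule B(1))
  qed (use X in auto)
qed

text \<open>A^(m+1) - 1 is A - 1 times the geometric sum \<open>f A\<close>, which equals m + 1 at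
  the identity and hence is invertible nearby.\<close>

lemma mpow_eq_one_near:
  "\<exists>e>0. \<forall>A. norm (A - mat 1) < e \<longrightarrow> mpow A (Suc m) = mat 1 \<longrightarrow> A = mat 1"
proof -
  define f where "f A = (\<Sum>k\<le>m. mpow A k)" for A
  have tele: "(A - mat 1) ** f A = mpow A (Suc m) - mat 1" for A
  proof -
    have "(A - mat 1) ** (\<Sum>k\<le>m. mpow A k) = mpow A (Suc m) - mat 1"
      by (induction m) (simp_all add: matrix_diff_distrib matrix_add_ldistrib)
    then show ?thesis by (simp add: f_def)
  qed
  have m1: "mpow (mat 1) k = mat 1" for k by (induction k) auto
  have "((\<lambda>A. det (f A)) \<longlongrightarrow> det (f (mat 1))) (nhds (mat 1))"
    unfolding f_def by (intro tendsto_intros filterlim_ident)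
  moreover have "f (mat 1) = real (Suc m) *\<^sub>R mat 1"
    unfolding f_def m1 by (simp add: scaleR_conv_of_real mat_1_eq)
  then have "det (f (mat 1)) \<noteq> 0" by (simp add: det_scaleR2)
  ultimately have "eventually (\<lambda>A. det (f A) \<noteq> 0) (nhds (mat 1))"
    by (rule tendsto_imp_eventually_ne)
  then obtain e where e: "e > 0" "\<And>A. dist A (mat 1) < e \<Longrightarrow> det (f A) \<noteq> 0"
    unfolding eventually_nhds_metric by blast
  show ?thesis
  proof (intro exI[of _ e] conjI allI impI e(1))
    fix A assume "norm (A - mat 1) < e" "mpow A (Suc m) = mat 1"
    then have "(A - mat 1) ** f A = 0" and d: "det (f A) \<noteq> 0" using e(2)[of A] by (auto simp: tele dist_norm)
    have z: "0 ** Y = 0" for Y :: "real^2^2" by (cases Y rule: mat2_cases) (simp add: mat2_zero)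
    have "(A - mat 1) ** (f A ** adj2 (f A)) = 0"
      unfolding matrix_mul_assoc \<open>(A - mat 1) ** f A = 0\<close> by (rule z)
    then have "det (f A) *\<^sub>R (A - mat 1) = 0"
      by (simp add: mult_adj2 scaleR_matrix_mult)
    then show "A = mat 1" using d by simp
  qed
qed

lemma mat_eq_one_of_square:
  assumes "det X = 1" "X ** X = mat 1" shows "central X"
proof -
  obtain a b c d where X: "X = mat2 a b c d" by (rule mat2_cases)
  have e: "a * d - b * c = 1" "a * a + b * c = 1" "(a + d) * b = 0" "(a + d) * c = 0" "c * b + d * d = 1"
    using assms by (auto simp: X mat_1_eq algebra_simps)
  have "(a + d) * a = 2" using e by (simp add: algebra_simps)
  then have "a + d \<noteq> 0" by auto
  then have bc: "b = 0" "c = 0" using e by auto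
  then have "a * a = 1" "a * d = 1" using e by auto
  then have "a = 1 \<or> a = - 1" by (simp add: square_eq_1_iff)
  then show ?thesis using bc \<open>a * d = 1\<close> by (auto simp: X central_def mat_1_eq)
qed

lemma PSL2R_pow_power:
  assumes "\<And>i. det (A i) = 1"
  shows "(\<lambda>i\<in>{..<r}. psl_class (A i)) [^]\<^bsub>PSL2R_pow r\<^esub> (k::nat) = (\<lambda>i\<in>{..<r}. psl_class (mpow (A i) k))"
proof (induction k)
  case 0
  show ?case by (simp add: PSL2R_pow_one)
next
  case (Suc k)
  have "mpow (A i) (Suc k) = mpow (A i) k ** A i" for i
  proof (induction k)
    case (Suc k)
    then show ?case by (simp add: matrix_mul_assoc)
  qed simp
  moreover have "x [^]\<^bsub>PSL2R_pow r\<^esub> Suc k = x [^]\<^bsub>PSL2R_pow r\<^esub> k \<otimes>\<^bsub>PSL2R_pow r\<^esub> x" for x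
    by (rule monoid.nat_pow_Suc[OF group.is_monoid[OF group_PSL2R_pow]])
  ultimately show ?case
    using PSL2R_pow_mult[OF det_mpow[OF assms] assms] by (simp only: Suc)
qed

text \<open>By the pigeonhole principle two of the first powers of \<open>x\<close> lie in one
  coset, so a power with positive exponent at most the index lies in \<open>S\<close>. The factorial
  of the index is a common multiple of all such exponents.\<close>

lemma finite_index_power:
  fixes G (structure)
  assumes "group G" "subgroup H G" "subgroup S G" "S \<subseteq> H" and fin: "finite_index G S H"
  shows "\<exists>m. \<forall>x\<in>H. x [^]\<^bsub>G\<^esub> Suc m \<in> S"
proof -
  interpret group G by fact
  define N where "N = card (rcosets\<^bsub>G\<lparr>carrier := H\<rparr>\<^esub> S)"
  have HG: "H \<subseteq> carrier G" by (rule subgroup.subset) fact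
  have "x [^]\<^bsub>G\<^esub> (fact N :: nat) \<in> S" if x: "x \<in> H" for x
  proof -
    have xG: "x \<in> carrier G" using x HG by blast
    have pow: "x [^] k \<in> H" for k :: nat
      by (induction k) (use x assms(2) in \<open>auto simp: subgroup.one_closed subgroup.m_closed\<close>)
    have coset: "S #>\<^bsub>G\<lparr>carrier := H\<rparr>\<^esub> y = S #> y" for y by (simp add: r_coset_def)
    have "(\<lambda>k. S #> x [^] k) ` {..N} \<subseteq> rcosets\<^bsub>G\<lparr>carrier := H\<rparr>\<^esub> S"
      using pow by (auto simp: RCOSETS_def coset)
    then have "card ((\<lambda>k. S #> x [^] k) ` {..N}) \<le> N"
      using fin by (auto simp: N_def finite_index_def intro: card_mono)
    then have "\<not> inj_on (\<lambda>k. S #> x [^] k) {..N}"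
      by (intro pigeonhole) simp
    then obtain k l where kl: "k \<le> N" "l \<le> N" "k < l" "S #> x [^] k = S #> x [^] l"
      by (auto simp: inj_on_def) (metis linorder_neqE_nat)
    have "x [^] l \<in> S #> x [^] l" using rcos_self[OF _ assms(3)] xG by auto
    then have "x [^] l \<in> S #> x [^] k" using kl(4) by simp
    then obtain s where s: "s \<in> S" "x [^] l = s \<otimes> x [^] k" by (auto simp: r_coset_def)
    have sG: "s \<in> carrier G" using s(1) subgroup.subset[OF assms(3)] by blast
    have "x [^] l = x [^] (l - k) \<otimes> x [^] k" using kl(3) xG by (simp add: nat_pow_mult)
    then have "x [^] (l - k) \<otimes> x [^] k = s \<otimes> x [^] k" using s by simp
    then have "x [^] (l - k) = s" using right_cancel[of "x [^] k" "x [^] (l - k)" s] sG xG by simp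
    then have mem: "x [^] (l - k) \<in> S" using s by simp
    have "(l - k) dvd (fact N :: nat)" using kl by (intro dvd_fact) auto
    then obtain q where q: "(fact N :: nat) = (l - k) * q" by (elim dvdE)
    have "y [^] q \<in> S" if "y \<in> S" for y and q :: nat
      by (induction q) (use that assms(3) in \<open>auto simp: subgroup.one_closed subgroup.m_closed\<close>)
    from this[OF mem] show ?thesis unfolding q using xG by (simp add: nat_pow_pow)
  qed
  moreover obtain m where "(fact N :: nat) = Suc m" by (metis fact_nonzero not0_implies_Suc)
  ultimately show ?thesis by (intro exI[of _ m]) simp
qed

text \<open>Serves to show that the images of i, j and k are traceless under any embedding into
  matrices.\<close>

lemma anticommute_trace:
  fixes X Y :: "real^2^2"
  assumes "X ** Y = - (Y ** X)" "Y ** Y = c *\<^sub>R mat 1" "c \<noteq> 0"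
  shows "trace X = 0"
proof -
  have cyc: "trace (A ** B) = trace (B ** A)" for A B :: "real^2^2"
    by (cases A rule: mat2_cases; cases B rule: mat2_cases) (simp add: algebra_simps)
  have "c * trace X = trace (X ** (Y ** Y))" by (simp add: assms(2) scaleR_matrix_mult trace_scaleR)
  also have "\<dots> = trace ((X ** Y) ** Y)" by (simp add: matrix_mul_assoc)
  also have "\<dots> = - trace (Y ** X ** Y)" by (simp add: assms(1) neg_matrix_mult trace_def sum_negf)
  also have "trace (Y ** X ** Y) = trace (Y ** (Y ** X))" by (rule cyc)
  also have "\<dots> = c * trace X" by (simp add: assms(2) matrix_mul_assoc scaleR_matrix_mult trace_scaleR)
  finally show ?thesis using assms(3) by simp
qed

lemma det_via_trace: "det X = ((trace X)\<^sup>2 - trace (X ** X)) / 2" for X :: "real^2^2"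
  by (cases X rule: mat2_cases) (simp add: power2_eq_square field_simps)

text \<open>A nonnegative \<open>f a\<close> or \<open>f b\<close> would have a real square root and
  hence produce zero divisors, while Hamilton's quaternions have none.\<close>

lemma ramified_negative:
  assumes "ramified_at f a b" "f a \<noteq> 0" "f b \<noteq> 0"
  shows "f a < 0" "f b < 0"
proof -
  let ?Q = "quaternion_algebra UNIV (f a) (f b)" and ?H = "quaternion_algebra UNIV (- 1) (- 1)"
  obtain h where "h \<in> ring_iso ?Q ?H"
    using assms(1) by (auto simp: ramified_at_def real_algebra_iso_def)
  then have h: "\<And>x y. h (quat_mult (f a) (f b) x y) = quat_mult (-1) (-1) (h x) (h y)"
    "\<And>x y. h (x + y) = h x + h y" "inj h"
    by (auto simp: ring_iso_def ring_hom_def quaternion_algebra_def bij_betw_def)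
  have h0: "h 0 = 0" using h(2)[of 0 0] by simp
  have dom: "x = 0 \<or> y = 0" if "quat_mult (-1) (-1) x y = 0" for x y
  proof -
    obtain x0 x1 x2 x3 where x: "x = (x0, x1, x2, x3)" by (metis prod.exhaust)
    obtain y0 y1 y2 y3 where y: "y = (y0, y1, y2, y3)" by (metis prod.exhaust)
    define Nx Ny where "Nx = x0\<^sup>2 + x1\<^sup>2 + x2\<^sup>2 + x3\<^sup>2" and "Ny = y0\<^sup>2 + y1\<^sup>2 + y2\<^sup>2 + y3\<^sup>2"
    have e: "x0 * y0 - x1 * y1 - x2 * y2 - x3 * y3 = 0" "x0 * y1 + x1 * y0 + x2 * y3 - x3 * y2 = 0"
      "x0 * y2 + x2 * y0 - x1 * y3 + x3 * y1 = 0" "x0 * y3 + x3 * y0 + x1 * y2 - x2 * y1 = 0"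
      using that by (auto simp: x y zero_prod_def algebra_simps)
    \<comment> \<open>Euler's four square identity: the quaternion norm is multiplicative.\<close>
    have "Nx * Ny = (x0 * y0 - x1 * y1 - x2 * y2 - x3 * y3)\<^sup>2 + (x0 * y1 + x1 * y0 + x2 * y3 - x3 * y2)\<^sup>2 +
       (x0 * y2 + x2 * y0 - x1 * y3 + x3 * y1)\<^sup>2 + (x0 * y3 + x3 * y0 + x1 * y2 - x2 * y1)\<^sup>2"
      by (simp add: Nx_def Ny_def power2_eq_square algebra_simps)
    also have "\<dots> = 0" by (simp add: e)
    finally have "Nx = 0 \<or> Ny = 0" by simp
    then have disj: "Nx = 0 \<or> Ny = 0" by blast
    have sq0: "w = 0 \<and> u = 0 \<and> v = 0 \<and> t = 0" if "w\<^sup>2 + u\<^sup>2 + v\<^sup>2 + t\<^sup>2 = 0" for w u v t :: real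
      using that by (smt (verit) zero_le_power2 power2_eq_square zero_eq_power2)
    from disj show ?thesis
    proof
      assume "Nx = 0"
      then have "x0 = 0 \<and> x1 = 0 \<and> x2 = 0 \<and> x3 = 0" unfolding Nx_def by (rule sq0)
      then show ?thesis by (simp add: x zero_prod_def)
    next
      assume "Ny = 0"
      then have "y0 = 0 \<and> y1 = 0 \<and> y2 = 0 \<and> y3 = 0" unfolding Ny_def by (rule sq0)
      then show ?thesis by (simp add: y zero_prod_def)
    qed
  qed
  have zd: "x = 0 \<or> y = 0" if "quat_mult (f a) (f b) x y = 0" for x y
  proof -
    have "quat_mult (-1) (-1) (h x) (h y) = 0" using h(1)[of x y] that h0 by simp
    then show ?thesis using dom[of "h x" "h y"] injD[OF h(3), of x 0] injD[OF h(3), of y 0] h0 by auto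
  qed
  show "f a < 0"
  proof (rule ccontr)
    assume "\<not> f a < 0"
    then have "f a = sqrt (f a) * sqrt (f a)" by simp
    then obtain c where "f a = c * c" by blast
    \<comment> \<open>The factorization of i^2 - c^2 into i - c and i + c.\<close>
    then have "quat_mult (f a) (f b) (- c, 1, 0, 0) (c, 1, 0, 0) = 0" by (simp add: zero_prod_def)
    from zd[OF this] show False by (simp add: zero_prod_def)
  qed
  show "f b < 0"
  proof (rule ccontr)
    assume "\<not> f b < 0"
    then have "f b = sqrt (f b) * sqrt (f b)" by simp
    then obtain c where "f b = c * c" by blast
    then have "quat_mult (f a) (f b) (- c, 0, 1, 0) (c, 0, 1, 0) = 0" by (simp add: zero_prod_def)
    from zd[OF this] show False by (simp add: zero_prod_def)
  qed
qed

lemma number_field_embeddingsI: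
  assumes nf: "number_field_of_degree K n" and \<phi>: "bij_betw \<phi> {..<n} (field_embeddings K)"
  shows "\<exists>b. number_field_embeddings K n b (\<phi> :: nat \<Rightarrow> real \<Rightarrow> real)"
proof -
  have K: "real_subfield K" using nf by (simp add: number_field_of_degree_def)
  interpret M: Modules.module "\<lambda>(q::rat) (x::real). of_rat q * x"
    by unfold_locales (auto simp: of_rat_add of_rat_mult algebra_simps)
  obtain B where B: "finite B" "card B = n" "M.span B = K"
    using nf by (auto simp: number_field_of_degree_def)
  obtain b where b: "bij_betw b {0..<n} B" using ex_bij_betw_nat_finite[OF B(1)] B(2) by auto
  have K1: "1 \<in> K" and Kd: "\<And>x y. x \<in> K \<Longrightarrow> y \<in> K \<Longrightarrow> x - y \<in> K" and Km: "\<And>x y. x \<in> K \<Longrightarrow> y \<in> K \<Longrightarrow> x * y \<in> K"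
    and Ki: "\<And>x. x \<in> K \<Longrightarrow> inverse x \<in> K"
    using K by (auto simp: real_subfield_def)
  have K0: "0 \<in> K" using Kd[OF K1 K1] by simp
  have Kneg: "- x \<in> K" if "x \<in> K" for x using Kd[OF K0 that] by simp
  have Ka: "x + y \<in> K" if "x \<in> K" "y \<in> K" for x y using Kd[OF that(1) Kneg[OF that(2)]] by simp
  have Kn: "of_nat m \<in> K" for m by (induction m) (auto intro: K0 K1 Ka)
  have Kz: "of_int m \<in> K" for m
  proof (cases "m \<ge> 0")
    case True then show ?thesis using Kn[of "nat m"] by simp
  next
    case False then show ?thesis using Kneg[OF Kn[of "nat (- m)"]] by simp
  qed
  have f: "f 1 = 1" "\<And>x y. x \<in> K \<Longrightarrow> y \<in> K \<Longrightarrow> f (x + y) = f x + f y" "\<And>x y. x \<in> K \<Longrightarrow> y \<in> K \<Longrightarrow> f (x * y) = f x * f y"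
      "f \<in> extensional K"
    if "f \<in> (field_embeddings K :: (real \<Rightarrow> real) set)" for f
    using that by (auto simp: field_embeddings_def)
  have fr: "of_rat q \<in> K \<and> f (of_rat q) = of_rat q" if fe: "f \<in> (field_embeddings K :: (real \<Rightarrow> real) set)" for f q
  proof -
    note f = f[OF fe]
    have f0: "f 0 = 0" using f(2)[OF K0 K0] by simp
    have fneg: "f (- x) = - f x" if "x \<in> K" for x using f(2)[OF that Kneg[OF that]] f0 by simp
    have fn: "f (of_nat m) = of_nat m" for m by (induction m) (auto simp: f0 f K1 Kn)
    have fz: "f (of_int m) = of_int m" for m
    proof (cases "m \<ge> 0")
      case True then show ?thesis using fn[of "nat m"] by simp
    next
      case False then show ?thesis using fn[of "nat (- m)"] fneg[OF Kn[of "nat (- m)"]] by simp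
    qed
    obtain u v where q: "q = Rat.Fract u v" "v > 0" by (cases q) auto
    then have q': "of_rat q = (of_int u / of_int v :: real)" by (simp add: of_rat_rat)
    then have qK: "of_rat q \<in> K" using Km[OF Kz[of u] Ki[OF Kz[of v]]] by (simp add: divide_inverse)
    have "f (of_rat q * of_int v) = f (of_rat q) * of_int v" using f(3)[OF qK Kz] fz by simp
    moreover have "of_rat q * of_int v = (of_int u :: real)" using q q' by simp
    ultimately have "f (of_rat q) * of_int v = of_int u" using fz by simp
    then have "f (of_rat q) = of_int u / of_int v" using q(2) by (simp only: eq_divide_eq) auto
    then have "f (of_rat q) = of_rat q" by (simp only: q')
    with qK show ?thesis ..
  qed
  have "number_field_embeddings K n b \<phi>"
  proof
    have \<phi>E: "\<phi> i \<in> field_embeddings K" if "i < n" for i using \<phi> that by (auto simp: bij_betw_def)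
    show "1 \<in> K" by (rule K1)
    show "x - y \<in> K" "x * y \<in> K" if "x \<in> K" "y \<in> K" for x y using Kd Km that by auto
    show "of_rat q \<in> K" for q
    proof -
      obtain u v where q: "q = Rat.Fract u v" "v > 0" by (cases q) auto
      then show ?thesis using Km[OF Kz[of u] Ki[OF Kz[of v]]] by (simp add: of_rat_rat divide_inverse)
    qed
    show "b k \<in> K" if "k < n" for k
    proof -
      have "b k \<in> B" using b that by (auto simp: bij_betw_def)
      then show ?thesis using M.span_base[of "b k" B] B(3) by simp
    qed
    show "\<exists>q. x = (\<Sum>k<n. of_rat (q k) * b k)" if "x \<in> K" for x
    proof -
      have "x \<in> range (\<lambda>u. \<Sum>v\<in>B. of_rat (u v) * v)"
        using that M.span_finite[OF B(1)] B(3) by simp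
      then obtain u where "x = (\<Sum>v\<in>B. of_rat (u v) * v)" by auto
      also have "\<dots> = (\<Sum>k<n. of_rat (u (b k)) * b k)"
        using sum.reindex_bij_betw[OF b, of "\<lambda>v. of_rat (u v) * v"] by (simp add: lessThan_atLeast0)
      finally show ?thesis by (intro exI[of _ "\<lambda>k. u (b k)"])
    qed
    show "\<phi> i (x + y) = \<phi> i x + \<phi> i y" "\<phi> i (x * y) = \<phi> i x * \<phi> i y" if "i < n" "x \<in> K" "y \<in> K" for i x y
      using f[OF \<phi>E[OF that(1)]] that by auto
    show "\<phi> i (of_rat q) = of_rat q" if "i < n" for i q using fr[OF \<phi>E[OF that]] by blast
    show "\<exists>x\<in>K. \<phi> i x \<noteq> \<phi> k x" if "i < n" "k < n" "i \<noteq> k" for i k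
    proof (rule ccontr)
      assume "\<not> ?thesis"
      then have "\<phi> i = \<phi> k"
        using f(4)[OF \<phi>E[OF that(1)]] f(4)[OF \<phi>E[OF that(2)]] by (intro extensionalityI[of _ K]) auto
      then show False using \<phi> that by (auto simp: bij_betw_def inj_on_def)
    qed
  qed
  then show ?thesis by (intro exI[of _ b])
qed

section \<open>Quaternion algebras over the field and their matrix embeddings\<close>

definition qconj :: "quad \<Rightarrow> quad" where
  "qconj x = (case x of (x0, x1, x2, x3) \<Rightarrow> (x0, - x1, - x2, - x3))"

lemma reduced_norm_mult: "reduced_norm a b (quat_mult a b x y) = reduced_norm a b x * reduced_norm a b y"
  by (cases x; cases y) (simp add: power2_eq_square algebra_simps)

lemma mult_qconj: "quat_mult a b x (qconj x) = (reduced_norm a b x, 0, 0, 0)"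
  by (cases x) (simp add: qconj_def power2_eq_square algebra_simps)

lemma reduced_norm_qconj: "reduced_norm a b (qconj x) = reduced_norm a b x"
  by (cases x) (simp add: qconj_def)

locale quaternion_embeddings = number_field_embeddings K n bas \<phi>
  for K :: "real set" and n :: nat and bas :: "nat \<Rightarrow> real" and \<phi> :: "nat \<Rightarrow> real \<Rightarrow> real" +
  fixes a b :: real and \<rho> :: "nat \<Rightarrow> quad \<Rightarrow> real^2^2" and r :: nat
  assumes inv: "x \<in> K \<Longrightarrow> inverse x \<in> K" and rn: "r \<le> n"
    and ab: "a \<in> K" "a \<noteq> 0" "b \<in> K" "b \<noteq> 0"
    and ram: "r \<le> i \<Longrightarrow> i < n \<Longrightarrow> ramified_at (\<phi> i) a b"
    and ext: "i < r \<Longrightarrow> extends_embedding K a b (\<phi> i) (\<rho> i)"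
begin

definition K4 :: "quad set" where "K4 = K \<times> K \<times> K \<times> K"

lemma uminus_mem: "x \<in> K \<Longrightarrow> - x \<in> K"
  using diff[of 0 x] rat[of 0] by simp

lemma zero_mem': "0 \<in> K"
  using rat[of 0] by simp

lemma add_mem: "x \<in> K \<Longrightarrow> y \<in> K \<Longrightarrow> x + y \<in> K"
  using diff[of x "- y"] uminus_mem[of y] by simp

lemma two_mem: "2 \<in> K"
  using rat[of 2] by simp

lemmas K_closed = one diff mult uminus_mem zero_mem' add_mem two_mem

lemma emb_1: "i < n \<Longrightarrow> \<phi> i 1 = 1"
  using emb_rat[of i 1] by simp

lemma emb_0: "i < n \<Longrightarrow> \<phi> i 0 = 0"
  using emb_rat[of i 0] by simp

lemma emb_2: "i < n \<Longrightarrow> \<phi> i 2 = 2"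
  using emb_rat[of i 2] by simp

lemma emb_uminus: "i < n \<Longrightarrow> x \<in> K \<Longrightarrow> \<phi> i (- x) = - \<phi> i x"
  using emb_add[of i x "- x"] uminus_mem[of x] emb_0[of i] by simp

lemma emb_diff: "i < n \<Longrightarrow> x \<in> K \<Longrightarrow> y \<in> K \<Longrightarrow> \<phi> i (x - y) = \<phi> i x - \<phi> i y"
  using emb_add[of i x "- y"] uminus_mem[of y] emb_uminus[of i y] by simp

lemma emb_eq_0_iff: "i < n \<Longrightarrow> x \<in> K \<Longrightarrow> \<phi> i x = 0 \<longleftrightarrow> x = 0"
  using emb_mult[of i x "inverse x"] emb_1[of i] emb_0[of i] inv[of x] by (cases "x = 0") auto

lemma emb_inject: "i < n \<Longrightarrow> x \<in> K \<Longrightarrow> y \<in> K \<Longrightarrow> \<phi> i x = \<phi> i y \<longleftrightarrow> x = y"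
  using emb_eq_0_iff[of i "x - y"] emb_diff[of i x y] diff[of x y] by auto

lemma emb_inverse: "i < n \<Longrightarrow> x \<in> K \<Longrightarrow> \<phi> i (inverse x) = inverse (\<phi> i x)"
proof (cases "x = 0")
  case False
  assume i: "i < n" and x: "x \<in> K"
  then have "\<phi> i x * \<phi> i (inverse x) = 1"
    using emb_mult[of i x "inverse x"] inv False emb_1 by simp
  then show ?thesis by (simp add: inverse_unique)
qed (simp add: emb_0)

lemmas emb_simps = emb_1 emb_0 emb_2 emb_uminus emb_diff emb_add emb_mult

lemma K4_quat_mult: "x \<in> K4 \<Longrightarrow> y \<in> K4 \<Longrightarrow> quat_mult a b x y \<in> K4"
  by (cases x; cases y) (auto simp: K4_def intro!: K_closed ab)

lemma K4_qconj: "x \<in> K4 \<Longrightarrow> qconj x \<in> K4"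
  by (cases x) (auto simp: K4_def qconj_def intro!: K_closed)

lemma K4_scalar: "x \<in> K \<Longrightarrow> (x, 0, 0, 0) \<in> K4"
  by (auto simp: K4_def intro: K_closed)

lemma rep:
  assumes "i < r"
  shows rep_mult: "x \<in> K4 \<Longrightarrow> y \<in> K4 \<Longrightarrow> \<rho> i (quat_mult a b x y) = \<rho> i x ** \<rho> i y"
    and rep_add: "x \<in> K4 \<Longrightarrow> y \<in> K4 \<Longrightarrow> \<rho> i (x + y) = \<rho> i x + \<rho> i y"
    and rep_scalar: "c \<in> K \<Longrightarrow> \<rho> i (c, 0, 0, 0) = \<phi> i c *\<^sub>R mat 1"
    and rep_inj: "x \<in> K4 \<Longrightarrow> y \<in> K4 \<Longrightarrow> \<rho> i x = \<rho> i y \<Longrightarrow> x = y"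
proof -
  have m: "mat c = c *\<^sub>R (mat 1 :: real^2^2)" for c :: real by (simp add: mat2_ext mat_def)
  let ?A = "quaternion_algebra K a b"
  have e: "\<rho> i \<in> ring_hom ?A M2R" "inj_on (\<rho> i) (carrier ?A)" "\<And>c. c \<in> K \<Longrightarrow> \<rho> i (c, 0, 0, 0) = mat (\<phi> i c)"
    using ext[OF assms] by (auto simp: extends_embedding_def)
  have A: "carrier ?A = K4" "x \<otimes>\<^bsub>?A\<^esub> y = quat_mult a b x y" "x \<oplus>\<^bsub>?A\<^esub> y = x + y" for x y
    by (simp_all add: quaternion_algebra_def K4_def)
  have M: "X \<otimes>\<^bsub>M2R\<^esub> Y = X ** Y" "X \<oplus>\<^bsub>M2R\<^esub> Y = X + Y" for X Y
    by (simp_all add: M2R_def)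
  show "x \<in> K4 \<Longrightarrow> y \<in> K4 \<Longrightarrow> \<rho> i (quat_mult a b x y) = \<rho> i x ** \<rho> i y"
    using ring_hom_mult[OF e(1), of x y] unfolding A M .
  show "x \<in> K4 \<Longrightarrow> y \<in> K4 \<Longrightarrow> \<rho> i (x + y) = \<rho> i x + \<rho> i y"
    using ring_hom_add[OF e(1), of x y] unfolding A M .
  show "c \<in> K \<Longrightarrow> \<rho> i (c, 0, 0, 0) = \<phi> i c *\<^sub>R mat 1"
    using e(3)[of c] m[of "\<phi> i c"] by simp
  show "x \<in> K4 \<Longrightarrow> y \<in> K4 \<Longrightarrow> \<rho> i x = \<rho> i y \<Longrightarrow> x = y"
    using inj_onD[OF e(2), of x y] unfolding A by blast
qed

lemma rep_uminus: "i < r \<Longrightarrow> x \<in> K4 \<Longrightarrow> \<rho> i (- x) = - \<rho> i x"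
proof -
  assume i: "i < r" and x: "x \<in> K4"
  have "- x \<in> K4" using x by (cases x) (auto simp: K4_def intro: K_closed)
  then have "\<rho> i x + \<rho> i (- x) = \<rho> i (0, 0, 0, 0)"
    using rep_add[OF i x, of "- x"] by (simp add: zero_prod_def)
  also have "\<dots> = 0" using rep_scalar[OF i zero_mem'] emb_0[of i] i rn by simp
  finally show ?thesis by (simp add: eq_neg_iff_add_eq_0 add.commute)
qed

text \<open>\<open>\<rho> i\<close> is an arbitrary ring embedding over \<open>\<phi> i\<close>, so
  only relations are available. Each of i, j and k anticommutes with an element whose image has a
  nonzero scalar square, hence has trace 0, and the trace is additive.\<close>

lemma trace_rep:
  assumes i: "i < r" and x: "x = (x0, x1, x2, x3)" "x \<in> K4"
  shows "trace (\<rho> i x) = 2 * \<phi> i x0"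
proof -
  have "i < n" using i rn by simp
  define I J L :: quad where "I = (0, 1, 0, 0)" and "J = (0, 0, 1, 0)" and "L = (0, 0, 0, 1)"
  have K4: "I \<in> K4" "J \<in> K4" "L \<in> K4" by (auto simp: I_def J_def L_def K4_def intro: K_closed)
  have sq: "\<rho> i I ** \<rho> i I = \<phi> i a *\<^sub>R mat 1" "\<rho> i J ** \<rho> i J = \<phi> i b *\<^sub>R mat 1"
    using rep_mult[OF i K4(1) K4(1)] rep_mult[OF i K4(2) K4(2)] rep_scalar[OF i ab(1)] rep_scalar[OF i ab(3)]
    by (simp_all add: I_def J_def)
  have ab0: "\<phi> i a \<noteq> 0" "\<phi> i b \<noteq> 0" using emb_eq_0_iff[OF \<open>i < n\<close>] ab by auto
  have anti: "\<rho> i I ** \<rho> i J = - (\<rho> i J ** \<rho> i I)" "\<rho> i J ** \<rho> i I = - (\<rho> i I ** \<rho> i J)"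
    "\<rho> i L ** \<rho> i I = - (\<rho> i I ** \<rho> i L)"
  proof -
    have 1: "\<rho> i (quat_mult a b I J) = - \<rho> i (quat_mult a b J I)"
      by (subst rep_uminus[OF i, symmetric]) (auto simp: I_def J_def K4_def intro: K_closed)
    then show "\<rho> i I ** \<rho> i J = - (\<rho> i J ** \<rho> i I)" using rep_mult[OF i] K4 by simp
    then show "\<rho> i J ** \<rho> i I = - (\<rho> i I ** \<rho> i J)" by simp
    have 2: "\<rho> i (quat_mult a b L I) = - \<rho> i (quat_mult a b I L)"
      by (subst rep_uminus[OF i, symmetric]) (auto simp: I_def L_def K4_def intro!: K_closed ab)
    then show "\<rho> i L ** \<rho> i I = - (\<rho> i I ** \<rho> i L)" using rep_mult[OF i] K4 by simp
  qed
  have tr0: "trace (\<rho> i I) = 0" "trace (\<rho> i J) = 0" "trace (\<rho> i L) = 0"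
    by (rule anticommute_trace[OF anti(1) sq(2) ab0(2)], rule anticommute_trace[OF anti(2) sq(1) ab0(1)],
        rule anticommute_trace[OF anti(3) sq(1) ab0(1)])
  have xK: "x0 \<in> K" "x1 \<in> K" "x2 \<in> K" "x3 \<in> K" using x by (auto simp: K4_def)
  have s: "(c, 0, 0, 0) \<in> K4" "quat_mult a b (c, 0, 0, 0) y \<in> K4" if "c \<in> K" "y \<in> K4" for c y
    using K4_scalar K4_quat_mult that by auto
  have trs: "trace (\<rho> i (quat_mult a b (c, 0, 0, 0) y)) = \<phi> i c * trace (\<rho> i y)" if "c \<in> K" "y \<in> K4" for c y
    using rep_mult[OF i s(1)[OF that] that(2)] rep_scalar[OF i that(1)] by (simp add: scaleR_matrix_mult trace_scaleR)
  have tradd: "trace (\<rho> i (y + z)) = trace (\<rho> i y) + trace (\<rho> i z)" if "y \<in> K4" "z \<in> K4" for y z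
    using rep_add[OF i that] by (simp add: trace_def sum.distrib)
  have x': "x = (x0, 0, 0, 0) + (quat_mult a b (x1, 0, 0, 0) I + (quat_mult a b (x2, 0, 0, 0) J + quat_mult a b (x3, 0, 0, 0) L))"
    by (simp add: x I_def J_def L_def)
  have add4: "y + z \<in> K4" if "y \<in> K4" "z \<in> K4" for y z
    using that by (cases y; cases z) (auto simp: K4_def intro: K_closed)
  show ?thesis
    unfolding x' using xK K4 s add4 tr0 rep_scalar[OF i xK(1)]
    by (simp add: tradd trs K4_scalar trace_scaleR mat_1_eq)
qed

lemma det_rep:
  assumes i: "i < r" and x: "x \<in> K4"
  shows "det (\<rho> i x) = \<phi> i (reduced_norm a b x)"
proof -
  have "i < n" using i rn by simp
  obtain x0 x1 x2 x3 where xx: "x = (x0, x1, x2, x3)" by (metis prod.exhaust)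
  then have xK: "x0 \<in> K" "x1 \<in> K" "x2 \<in> K" "x3 \<in> K" using x by (auto simp: K4_def)
  \<comment> \<open>\<open>y\<close> is the scalar part of the square of \<open>x\<close>, from
    which \<open>det_via_trace\<close> computes the determinant.\<close>
  define y where "y = x0 * x0 + a * (x1 * x1) + b * (x2 * x2) - a * b * (x3 * x3)"
  have yK: "y \<in> K" using xK unfolding y_def by (intro K_closed ab)
  have "trace (\<rho> i x ** \<rho> i x) = 2 * \<phi> i y"
  proof -
    obtain y1 y2 y3 where "quat_mult a b x x = (y, y1, y2, y3)" by (simp add: xx y_def)
    then show ?thesis
      using trace_rep[OF i _ K4_quat_mult[OF x x]] rep_mult[OF i x x] by metis
  qed
  then have "det (\<rho> i x) = ((2 * \<phi> i x0)\<^sup>2 - 2 * \<phi> i y) / 2"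
    using trace_rep[OF i xx x] by (simp add: det_via_trace)
  also have "\<dots> = \<phi> i (2 * (x0 * x0) - y)"
    using \<open>i < n\<close> xK yK by (simp add: emb_simps K_closed power2_eq_square)
  also have "2 * (x0 * x0) - y = reduced_norm a b x"
    by (simp add: xx y_def power2_eq_square)
  finally show ?thesis .
qed

lemma rep_qconj:
  assumes "i < r" "x \<in> K4" "reduced_norm a b x = 1"
  shows "\<rho> i (qconj x) = adj2 (\<rho> i x)"
proof -
  have d: "det (\<rho> i x) = 1" using det_rep assms emb_1[of i] rn by simp
  have "\<rho> i x ** \<rho> i (qconj x) = mat 1"
    using rep_mult[OF assms(1,2) K4_qconj[OF assms(2)]] rep_scalar[OF assms(1) one] emb_1[of i] assms rn
    by (simp add: mult_qconj)
  then have "adj2 (\<rho> i x) ** (\<rho> i x ** \<rho> i (qconj x)) = adj2 (\<rho> i x)" by simp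
  then show ?thesis using d by (simp add: matrix_mul_assoc mult_adj2_1)
qed

text \<open>At a ramified place the norm form is positive definite, so the square of the scalar part
  is at most the norm.\<close>

lemma ramified_trace_bound:
  assumes i: "r \<le> i" "i < n" and x: "x = (x0, x1, x2, x3)" "x \<in> K4" "reduced_norm a b x = 1"
  shows "(\<phi> i x0)\<^sup>2 \<le> 1"
proof -
  have "\<phi> i a \<noteq> 0" "\<phi> i b \<noteq> 0" using emb_eq_0_iff[OF i(2)] ab by auto
  note neg = ramified_negative[OF ram[OF i] this]
  have xK: "x0 \<in> K" "x1 \<in> K" "x2 \<in> K" "x3 \<in> K" using x by (auto simp: K4_def)
  have "\<phi> i (reduced_norm a b x) = 1" using x(3) emb_1[OF i(2)] by simp
  then have "(\<phi> i x0)\<^sup>2 - \<phi> i a * (\<phi> i x1)\<^sup>2 - \<phi> i b * (\<phi> i x2)\<^sup>2 + \<phi> i a * \<phi> i b * (\<phi> i x3)\<^sup>2 = 1"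
    using xK i(2) ab by (simp add: x(1) power2_eq_square emb_simps K_closed)
  moreover have "\<phi> i a * (\<phi> i x1)\<^sup>2 \<le> 0" "\<phi> i b * (\<phi> i x2)\<^sup>2 \<le> 0" "0 \<le> \<phi> i a * \<phi> i b * (\<phi> i x3)\<^sup>2"
    using neg by (auto simp: mult_le_0_iff zero_le_mult_iff)
  ultimately show ?thesis by linarith
qed

definition unit_lifts :: "(nat \<Rightarrow> psl) set \<Rightarrow> (nat \<Rightarrow> real^2^2) set" where
  "unit_lifts \<Gamma> = {A. \<exists>x\<in>K4. reduced_norm a b x = 1 \<and> A = (\<lambda>i. if i < r then \<rho> i x else mat 1) \<and>
     (\<lambda>i\<in>{..<r}. psl_class (\<rho> i x)) \<in> \<Gamma>}"

lemma unit_lifts_subset: "unit_lifts \<Gamma> \<subseteq> lifts r \<Gamma>"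
proof
  fix A assume "A \<in> unit_lifts \<Gamma>"
  then obtain x where x: "x \<in> K4" "reduced_norm a b x = 1" "A = (\<lambda>i. if i < r then \<rho> i x else mat 1)"
    "(\<lambda>i\<in>{..<r}. psl_class (\<rho> i x)) \<in> \<Gamma>" by (auto simp: unit_lifts_def)
  have "(\<lambda>i\<in>{..<r}. psl_class (A i)) = (\<lambda>i\<in>{..<r}. psl_class (\<rho> i x))" by (auto simp: x(3) fun_eq_iff)
  then show "A \<in> lifts r \<Gamma>" using x det_rep emb_1 rn by (auto simp: lifts_def)
qed

lemma tuple_group_unit_lifts:
  assumes \<Gamma>: "subgroup \<Gamma> (PSL2R_pow r)"
  shows "tuple_group (unit_lifts \<Gamma>)"
proof
  interpret L: tuple_group "lifts r \<Gamma>" by (rule tuple_group_lifts[OF \<Gamma>])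
  have mem: "A \<in> unit_lifts \<Gamma>" if "A \<in> lifts r \<Gamma>" "x \<in> K4" "reduced_norm a b x = 1" "\<And>i. i < r \<Longrightarrow> A i = \<rho> i x" for A x
  proof -
    have "A = (\<lambda>i. if i < r then \<rho> i x else mat 1)" using that by (auto simp: lifts_def)
    moreover have "(\<lambda>i\<in>{..<r}. psl_class (\<rho> i x)) = (\<lambda>i\<in>{..<r}. psl_class (A i))" using that(4) by (auto simp: fun_eq_iff)
    ultimately show ?thesis using that by (auto simp: unit_lifts_def lifts_def)
  qed
  show "(\<lambda>_. mat 1) \<in> unit_lifts \<Gamma>"
  proof (rule mem[OF L.one_mem K4_scalar[OF one]])
    show "mat 1 = \<rho> i (1, 0, 0, 0)" if "i < r" for i
      using rep_scalar[OF that one] emb_1[of i] that rn by simp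
  qed simp
  fix A assume A: "A \<in> unit_lifts \<Gamma>"
  then obtain x where x: "x \<in> K4" "reduced_norm a b x = 1" "A = (\<lambda>i. if i < r then \<rho> i x else mat 1)"
    by (auto simp: unit_lifts_def)
  have AL: "A \<in> lifts r \<Gamma>" using A unit_lifts_subset by blast
  show "det (A i) = 1" for i using AL by (simp add: lifts_def)
  show "(\<lambda>i. adj2 (A i)) \<in> unit_lifts \<Gamma>"
    by (rule mem[OF L.inv_mem[OF AL] K4_qconj[OF x(1)]]) (use x rep_qconj in \<open>auto simp: reduced_norm_qconj\<close>)
  fix B assume B: "B \<in> unit_lifts \<Gamma>"
  then obtain y where y: "y \<in> K4" "reduced_norm a b y = 1" "B = (\<lambda>i. if i < r then \<rho> i y else mat 1)"
    by (auto simp: unit_lifts_def)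
  have BL: "B \<in> lifts r \<Gamma>" using B unit_lifts_subset by blast
  show "(\<lambda>i. A i ** B i) \<in> unit_lifts \<Gamma>"
    by (rule mem[OF L.mult_mem[OF AL BL] K4_quat_mult[OF x(1) y(1)]])
       (use x y rep_mult in \<open>auto simp: reduced_norm_mult\<close>)
qed

end

lemma trace_square: "trace (X ** X) = (trace X)\<^sup>2 - 2 * det X" for X :: "real^2^2"
  by (cases X rule: mat2_cases) (simp add: power2_eq_square algebra_simps)

lemma psl_tr_square: "det X = 1 \<Longrightarrow> psl_tr (psl_class X \<otimes>\<^bsub>PSL2R\<^esub> psl_class X) = \<bar>(trace X)\<^sup>2 - 2\<bar>"
  by (simp add: psl_class_mult psl_tr_class trace_square)

context quaternion_embeddings
begin

lemma unit_lifts_trace: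
  assumes "A \<in> unit_lifts \<Gamma>"
  shows "\<exists>y\<in>K. (\<forall>i<r. trace (A i) = 2 * \<phi> i y) \<and> (\<forall>i. r \<le> i \<longrightarrow> i < n \<longrightarrow> (\<phi> i y)\<^sup>2 \<le> 1)"
proof -
  obtain x where x: "x \<in> K4" "reduced_norm a b x = 1" "A = (\<lambda>i. if i < r then \<rho> i x else mat 1)"
    using assms by (auto simp: unit_lifts_def)
  obtain x0 x1 x2 x3 where xx: "x = (x0, x1, x2, x3)" by (metis prod.exhaust)
  have "x0 \<in> K" using x(1) by (simp add: xx K4_def)
  moreover have "\<forall>i<r. trace (A i) = 2 * \<phi> i x0" using trace_rep[OF _ xx x(1)] x(3) by simp
  moreover have "\<forall>i. r \<le> i \<longrightarrow> i < n \<longrightarrow> (\<phi> i x0)\<^sup>2 \<le> 1" using ramified_trace_bound[OF _ _ xx x(1,2)] by blast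
  ultimately show ?thesis by blast
qed

text \<open>By injectivity of \<open>\<rho> i\<close>, a central component means that the quaternion
  itself is 1 or -1.\<close>

lemma unit_lifts_central:
  assumes "A \<in> unit_lifts \<Gamma>" "i < r" "central (A i)"
  shows "central (A k)"
proof -
  obtain x where x: "x \<in> K4" "A = (\<lambda>i. if i < r then \<rho> i x else mat 1)"
    using assms(1) by (auto simp: unit_lifts_def)
  have "\<exists>s\<in>{1, - 1}. A i = s *\<^sub>R mat 1" using assms(3) by (auto simp: central_def)
  then obtain s where s: "s \<in> {1, - 1}" "A i = s *\<^sub>R mat 1" by blast
  have sK: "s \<in> K" using s(1) one uminus_mem[OF one] by auto
  have \<phi>s: "\<phi> k s = s" if "k < r" for k using s(1) emb_1[of k] emb_uminus[of k 1] one that rn by auto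
  have "\<rho> i x = \<rho> i (s, 0, 0, 0)" using rep_scalar[OF assms(2) sK] s(2) x(2) assms(2) \<phi>s by simp
  then have "x = (s, 0, 0, 0)" using rep_inj[OF assms(2) x(1) K4_scalar[OF sK]] by blast
  then show ?thesis using x(2) rep_scalar[OF _ sK] \<phi>s s(1) by (auto simp: central_def)
qed

text \<open>Commensurability enters as \<open>pow\<close>: a fixed positive power of each lift
  agrees, up to signs in the factors, with an element of \<open>unit_lifts \<Gamma>\<close>.\<close>

context
  fixes \<Gamma> :: "(nat \<Rightarrow> psl) set" and j m :: nat
  assumes \<Gamma>: "subgroup \<Gamma> (PSL2R_pow r)" and j: "j < r"
    and cof: "cofinite_fuchsian (factor j \<Gamma>)"
    and nondisc: "\<And>i. i < r \<Longrightarrow> i \<noteq> j \<Longrightarrow> \<not> discrete_in_PSL2R (factor i \<Gamma>)"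
    and field: "\<And>g. g \<in> factor j \<Gamma> \<Longrightarrow> hyperbolic g \<Longrightarrow>
      generated_field {psl_tr (g \<otimes>\<^bsub>PSL2R\<^esub> g)} = generated_field (psl_tr ` factor j (squares_group (PSL2R_pow r) \<Gamma>))"
    and pow: "\<And>A. A \<in> lifts r \<Gamma> \<Longrightarrow> \<exists>B\<in>unit_lifts \<Gamma>. \<forall>i. mpow (A i) (Suc m) = B i \<or> mpow (A i) (Suc m) = - B i"
begin

interpretation U: tuple_group "unit_lifts \<Gamma>" by (rule tuple_group_unit_lifts[OF \<Gamma>])

lemma unit_lifts_full: "proj_full {j} (unit_lifts \<Gamma>)"
proof (rule proj_full_power[where m = m, OF _ lifts_lattice_full[OF \<Gamma> j cof]])
  fix A assume "A \<in> lifts r \<Gamma>"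
  from pow[OF this] show "\<exists>B\<in>unit_lifts \<Gamma>. \<forall>i\<in>{j}. mpow (A i) (Suc m) = B i \<or> mpow (A i) (Suc m) = - B i" by blast
qed simp

text \<open>Changing the sign of component \<open>j\<close> does not change its class, so
  discreteness of the factor also controls signed components.\<close>

lemma unit_lifts_discrete:
  obtains e where "e > 0" "\<And>A s. A \<in> unit_lifts \<Gamma> \<Longrightarrow> \<bar>s\<bar> = 1 \<Longrightarrow> norm (s *\<^sub>R A j - mat 1) < e \<Longrightarrow> s *\<^sub>R A j = mat 1"
proof -
  have "discrete_in_PSL2R (factor j \<Gamma>)" using cof by (simp add: cofinite_fuchsian_def fuchsian_def)
  from lifts_discrete[OF \<Gamma> j this] obtain e where e: "e > 0"
    "\<And>A. A \<in> lifts r \<Gamma> \<Longrightarrow> norm (A j - mat 1) < e \<Longrightarrow> A j = mat 1" by blast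
  have "s *\<^sub>R A j = mat 1" if A: "A \<in> unit_lifts \<Gamma>" "\<bar>s\<bar> = 1" "norm (s *\<^sub>R A j - mat 1) < e" for A s
  proof -
    have AL: "A \<in> lifts r \<Gamma>" using A(1) unit_lifts_subset by blast
    then have "det (A j) = 1 \<and> psl_class (A j) \<in> factor j \<Gamma>" using factor_lifts[OF \<Gamma> j, of "A j"] by blast
    moreover have "psl_class (s *\<^sub>R A j) = psl_class (A j)"
      using A(2) psl_class_uminus[of "A j"] by (auto simp: abs_if split: if_splits)
    moreover have "det (s *\<^sub>R A j) = det (A j)" using A(2) by (simp add: det_scaleR2 abs_square_eq_1)
    ultimately obtain A' where "A' \<in> lifts r \<Gamma>" "A' j = s *\<^sub>R A j" using factor_lifts[OF \<Gamma> j, of "s *\<^sub>R A j"] by auto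
    then show ?thesis using e(2)[of A'] A(3) by simp
  qed
  with e(1) that show thesis by blast
qed

text \<open>Take the power of a nontrivial lift close to the identity. It is not the identity by
  \<open>mpow_eq_one_near\<close>, and it is too close to the identity to be its negative, so it is
  not central.\<close>

lemma unit_lifts_near_one:
  assumes i: "i < r" "i \<noteq> j"
  shows "near_one {i} (unit_lifts \<Gamma>)"
  unfolding near_one_def
proof (intro allI impI)
  fix e :: real assume "e > 0"
  obtain d1 where d1: "d1 > 0" "\<And>A. norm (A - mat 1) < d1 \<Longrightarrow> mpow A (Suc m) = mat 1 \<Longrightarrow> A = mat 1"
    using mpow_eq_one_near[of m] by blast
  have "((\<lambda>A. mpow A (Suc m)) \<longlongrightarrow> mpow (mat 1) (Suc m)) (nhds (mat 1))"
    by (intro tendsto_mpow filterlim_ident)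
  moreover have m1: "mpow (mat 1) k = mat 1" for k by (induction k) auto
  ultimately have "((\<lambda>A. mpow A (Suc m)) \<longlongrightarrow> mat 1) (nhds (mat 1))" by (simp only: m1)
  moreover have "min e 1 > 0" using \<open>e > 0\<close> by simp
  ultimately have "eventually (\<lambda>A. dist (mpow A (Suc m)) (mat 1) < min e 1) (nhds (mat 1))" by (rule tendstoD)
  then obtain d2 where d2: "d2 > 0" "\<And>A. dist A (mat 1) < d2 \<Longrightarrow> dist (mpow A (Suc m)) (mat 1) < min e 1"
    unfolding eventually_nhds_metric by blast
  have "min d1 d2 > 0" using d1 d2 by simp
  from lifts_nondiscrete[OF \<Gamma> i(1) nondisc[OF i] this]
  obtain A where A: "A \<in> lifts r \<Gamma>" "norm (A i - mat 1) < min d1 d2" "A i \<noteq> mat 1" by blast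
  obtain B where B: "B \<in> unit_lifts \<Gamma>" "mpow (A i) (Suc m) = B i \<or> mpow (A i) (Suc m) = - B i"
    using pow[OF A(1)] by blast
  define s where "s = (if mpow (A i) (Suc m) = B i then 1 else - 1 :: real)"
  have sB: "s *\<^sub>R B i = mpow (A i) (Suc m)" using B(2) by (auto simp: s_def)
  have n: "norm (mpow (A i) (Suc m) - mat 1) < e" "norm (mpow (A i) (Suc m) - mat 1) < 1"
    using d2(2)[of "A i"] A(2) by (auto simp: dist_norm)
  have "mpow (A i) (Suc m) \<noteq> mat 1" using d1(2)[of "A i"] A(2,3) by auto
  moreover have "mpow (A i) (Suc m) \<noteq> - mat 1" using n(2) uminus_mat_1_far by fastforce
  ultimately have "\<not> central (B i)" using B(2) by (auto simp: central_def)
  then have nc: "\<not> (\<forall>i. central (B i))" by blast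
  have sB1: "\<forall>k\<in>{i}. norm (s *\<^sub>R B k - mat 1) < e" using n(1) sB by simp
  have s1: "\<forall>i::nat. \<bar>s\<bar> = 1" by (simp add: s_def)
  show "\<exists>A\<in>unit_lifts \<Gamma>. \<exists>s. (\<forall>i. \<bar>s i\<bar> = 1) \<and> (\<forall>i\<in>{i}. norm (s i *\<^sub>R A i - mat 1) < e) \<and> \<not> (\<forall>i. central (A i))"
    by (rule bexI[OF _ B(1)], rule exI[of _ "\<lambda>_. s"]) (use s1 sB1 nc in blast)
qed

text \<open>If two embeddings agree on the trace field of the squares, then an element that is close to the
  identity in one factor is so in the other, because the squares span the matrix algebra.\<close>
lemma trace_agree_contradiction:
  assumes l: "l < r" "l \<noteq> j"
    and agree: "\<And>B C. B \<in> unit_lifts \<Gamma> \<Longrightarrow> C \<in> unit_lifts \<Gamma> \<Longrightarrow>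
      trace ((B l ** B l) ** (C l ** C l)) = trace ((B j ** B j) ** (C j ** C j))"
  shows False
proof -
  obtain e where e: "e > 0" "\<And>A s. A \<in> unit_lifts \<Gamma> \<Longrightarrow> \<bar>s\<bar> = 1 \<Longrightarrow> norm (s *\<^sub>R A j - mat 1) < e \<Longrightarrow> s *\<^sub>R A j = mat 1"
    using unit_lifts_discrete by blast
  have "\<exists>B s. B \<in> unit_lifts \<Gamma> \<and> (\<forall>i. \<bar>s i\<bar> = 1) \<and> (\<forall>i\<in>{l}. norm (s i *\<^sub>R B i - mat 1) < inverse (real (Suc k))) \<and>
     \<not> (\<forall>i. central (B i))" for k
  proof -
    have "inverse (real (Suc k)) > 0" by simp
    with unit_lifts_near_one[OF l] show ?thesis unfolding near_one_def by blast
  qed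
  then obtain B s where B: "\<And>k. B k \<in> unit_lifts \<Gamma>" "\<And>k i. \<bar>s k i\<bar> = (1::real)" "\<And>k. \<not> (\<forall>i. central (B k i))"
    "\<And>k i. i \<in> {l} \<Longrightarrow> norm (s k i *\<^sub>R B k i - mat 1) < inverse (real (Suc k))"
    by metis
  have "(\<lambda>k. s k l *\<^sub>R B k l) \<longlonglongrightarrow> mat 1" using B(4) by (intro tendsto_inverse_SucI) auto
  then have "(\<lambda>k. (s k l *\<^sub>R B k l) ** (s k l *\<^sub>R B k l)) \<longlonglongrightarrow> mat 1 ** mat 1" by (intro tendsto_intros)
  moreover have "(s k l *\<^sub>R B k l) ** (s k l *\<^sub>R B k l) = B k l ** B k l" for k
  proof -
    have "s k l * s k l = 1" using B(2)[of k l] by (metis abs_mult_self_eq mult_1)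
    then show ?thesis by (simp add: scaleR_matrix_mult)
  qed
  ultimately have limY: "(\<lambda>k. B k l ** B k l) \<longlonglongrightarrow> mat 1" by simp
  define T where "T k = B k j ** B k j" for k
  \<comment> \<open>\<open>W\<close> is a closed subspace. Agreement of traces places the squares of
    group elements in it, because the sequence tends to the identity in the factor \<open>l\<close>;
    then all limits of scaled squares are in it too.\<close>
  define W where "W = {X. (\<lambda>k. trace (T k ** X)) \<longlonglongrightarrow> trace X}"
  have sub: "subspace W"
  proof (rule subspaceI)
    have "T k ** 0 = 0" for k by (cases "T k" rule: mat2_cases) (simp add: mat2_zero)
    then show "0 \<in> W" by (simp add: W_def)
    have tadd: "trace (X ** (Y + Z)) = trace (X ** Y) + trace (X ** Z)" "trace (Y + Z) = trace Y + trace Z"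
      for X Y Z :: "real^2^2"
      by (cases X rule: mat2_cases; cases Y rule: mat2_cases; cases Z rule: mat2_cases; simp add: algebra_simps)+
    show "X + Y \<in> W" if "X \<in> W" "Y \<in> W" for X Y
      using that unfolding W_def mem_Collect_eq tadd by (intro tendsto_add)
    show "c *\<^sub>R X \<in> W" if "X \<in> W" for c X
      using that unfolding W_def mem_Collect_eq scaleR_matrix_mult trace_scaleR by (intro tendsto_mult_left)
  qed
  then have "closed W" by (rule closed_subspace)
  have sqW: "C j ** C j \<in> W" if C: "C \<in> unit_lifts \<Gamma>" for C
  proof -
    have "(\<lambda>k. trace ((B k l ** B k l) ** (C l ** C l))) \<longlonglongrightarrow> trace (mat 1 ** (C l ** C l))"
      by (intro tendsto_intros limY)
    moreover have "trace (C l ** C l) = trace (C j ** C j)" using agree[OF U.one_mem C] by simp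
    ultimately show ?thesis using agree[OF B(1) C] by (simp add: W_def T_def)
  qed
  have rk: "rank1 x z \<in> W" if xz: "cross z x = 1" for x z
  proof -
    have "(\<lambda>_. rank1 x z) \<in> proj_closure {j} (unit_lifts \<Gamma>)" using unit_lifts_full by (simp add: proj_full_def)
    then obtain A c where A: "\<And>k::nat. A k \<in> unit_lifts \<Gamma>" "\<And>i. i \<in> {j} \<Longrightarrow> (\<lambda>k. c k i *\<^sub>R A k i) \<longlonglongrightarrow> rank1 x z"
      by (rule proj_closure_seqE) blast
    have "(\<lambda>k. (c k j *\<^sub>R A k j) ** (c k j *\<^sub>R A k j)) \<longlonglongrightarrow> rank1 x z ** rank1 x z"
      by (intro tendsto_intros A(2)) simp_all
    moreover have "rank1 x z ** rank1 x z = rank1 x z" using xz by (simp add: rank1_mult_rank1)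
    ultimately have lim: "(\<lambda>k. (c k j *\<^sub>R A k j) ** (c k j *\<^sub>R A k j)) \<longlonglongrightarrow> rank1 x z" by (simp only:)
    have "(c k j *\<^sub>R A k j) ** (c k j *\<^sub>R A k j) \<in> W" for k
      using subspace_scale[OF sub sqW[OF A(1)], of "c k j * c k j" k] by (simp add: scaleR_matrix_mult)
    then show ?thesis by (rule closed_sequentially[OF \<open>closed W\<close> _ lim])
  qed
  have all: "X \<in> W" for X
  proof -
    obtain p q u v where X: "X = mat2 p q u v" by (rule mat2_cases)
    \<comment> \<open>Four idempotents that span the matrices. An idempotent is its own square and
      so a limit of scaled squares of group elements.\<close>
    have "X = (p - q) *\<^sub>R rank1 (1, 0) (0, -1) + q *\<^sub>R rank1 (1, 0) (1, -1) +
        ((v - u) *\<^sub>R rank1 (0, 1) (1, 0) + u *\<^sub>R rank1 (0, 1) (1, -1))"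
      by (simp add: X rank1_def)
    also have "\<dots> \<in> W" by (intro subspace_add subspace_scale sub rk) (simp_all add: cross_def)
    finally show ?thesis .
  qed
  have ent: "T k $ 1 $ 1 = trace (T k ** mat2 1 0 0 0)" "T k $ 1 $ 2 = trace (T k ** mat2 0 0 1 0)"
    "T k $ 2 $ 1 = trace (T k ** mat2 0 1 0 0)" "T k $ 2 $ 2 = trace (T k ** mat2 0 0 0 1)" for k
    by (cases "T k" rule: mat2_cases; simp)+
  have "T \<longlonglongrightarrow> mat 1"
    unfolding tendsto_mat_iff ent
    using all[of "mat2 1 0 0 0"] all[of "mat2 0 0 1 0"] all[of "mat2 0 1 0 0"] all[of "mat2 0 0 0 1"]
    by (simp add: W_def mat_def)
  then have "eventually (\<lambda>k. norm (T k - mat 1) < e) sequentially"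
    using e(1) by (auto simp: tendsto_iff dist_norm)
  then obtain k where k: "norm (T k - mat 1) < e" by (auto simp: eventually_sequentially)
  have "T k = mat 1"
    using e(2)[OF U.mult_mem[OF B(1) B(1)], of 1 k k] k by (simp add: T_def)
  then have "central (B k j)"
    using mat_eq_one_of_square[OF U.det_mem[OF B(1)], of k j] by (simp add: T_def)
  then show False using unit_lifts_central[OF B(1) j] B(3) by blast
qed

text \<open>At a ramified place the conjugate of y^2 is at most 1, while at \<open>j\<close> it
  exceeds 1. At an unramified place \<open>l\<close>, equality would put the trace 4 y^2 - 2 of the
  square into the image under \<open>\<phi> j\<close> of the field where \<open>\<phi> l\<close> and
  \<open>\<phi> j\<close> agree. The trace field hypothesis then puts all traces of the squares
  group there.\<close>

lemma trace_field_distinct: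
  assumes A: "A \<in> unit_lifts \<Gamma>" "\<bar>trace (A j)\<bar> > 2"
    and y: "y \<in> K" "\<And>i. i < r \<Longrightarrow> trace (A i) = 2 * \<phi> i y" "\<And>i. r \<le> i \<Longrightarrow> i < n \<Longrightarrow> (\<phi> i y)\<^sup>2 \<le> 1"
    and l: "l < n" "l \<noteq> j"
  shows "\<phi> l (y * y) \<noteq> \<phi> j (y * y)"
proof
  assume eq: "\<phi> l (y * y) = \<phi> j (y * y)"
  have jn: "j < n" using j rn by simp
  have "\<bar>2\<bar> < \<bar>trace (A j)\<bar>" using A(2) by simp
  then have "2\<^sup>2 < (trace (A j))\<^sup>2" using power_strict_mono[of 2 "\<bar>trace (A j)\<bar>" 2] by simp
  then have big: "\<phi> j (y * y) > 1" using y(1,2) j jn by (simp add: emb_mult power2_eq_square)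
  show False
  proof (cases "l < r")
    case False
    then have "\<phi> l (y * y) \<le> 1" using y(1) y(3)[of l] l by (simp add: emb_mult power2_eq_square)
    with eq big show False by simp
  next
    case True
    define S where "S = {\<phi> j z | z. z \<in> K \<and> \<phi> l z = \<phi> j z}"
    have SI: "\<phi> j z \<in> S" if "z \<in> K" "\<phi> l z = \<phi> j z" for z using that by (auto simp: S_def)
    have Sf: "real_subfield S"
      unfolding real_subfield_def
    proof (intro conjI ballI)
      show "1 \<in> S" using SI[OF one] emb_1[OF l(1)] emb_1[OF jn] by simp
      fix u assume "u \<in> S"
      then obtain w where w: "u = \<phi> j w" "w \<in> K" "\<phi> l w = \<phi> j w" by (auto simp: S_def)
      show "inverse u \<in> S" using SI[OF inv[OF w(2)]] emb_inverse[OF l(1) w(2)] emb_inverse[OF jn w(2)] w by simp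
      fix v assume "v \<in> S"
      then obtain z where z: "v = \<phi> j z" "z \<in> K" "\<phi> l z = \<phi> j z" by (auto simp: S_def)
      show "u - v \<in> S" using SI[OF diff[OF w(2) z(2)]] emb_diff[OF l(1) w(2) z(2)] emb_diff[OF jn w(2) z(2)] w z by simp
      show "u * v \<in> S" using SI[OF mult[OF w(2) z(2)]] emb_mult[OF l(1) w(2) z(2)] emb_mult[OF jn w(2) z(2)] w z by simp
    qed
    have AL: "A \<in> lifts r \<Gamma>" using A(1) unit_lifts_subset by blast
    define g where "g = psl_class (A j)"
    have g: "g \<in> factor j \<Gamma>" "det (A j) = 1" using factor_lifts[OF \<Gamma> j, of "A j"] AL by (auto simp: g_def)
    have hyp: "hyperbolic g" using A(2) by (simp add: hyperbolic_def g_def psl_tr_class)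
    have yy: "y * y \<in> K" using mult y(1) by blast
    have four: "4 \<in> K" "\<phi> i 4 = 4" if "i < n" for i using rat[of 4] emb_rat[OF that, of 4] by auto
    have trg: "psl_tr (g \<otimes>\<^bsub>PSL2R\<^esub> g) = \<phi> j (4 * (y * y) - 2)"
    proof -
      have "(trace (A j))\<^sup>2 = 4 * \<phi> j (y * y)" using y(1,2) j jn by (simp add: emb_mult power2_eq_square)
      then have "psl_tr (g \<otimes>\<^bsub>PSL2R\<^esub> g) = 4 * \<phi> j (y * y) - 2" using big unfolding g_def psl_tr_square[OF g(2)] by simp
      also have "\<dots> = \<phi> j (4 * (y * y) - 2)"
        using jn yy four by (simp add: emb_diff emb_mult emb_2 two_mem mult)
      finally show ?thesis .
    qed
    have "psl_tr (g \<otimes>\<^bsub>PSL2R\<^esub> g) \<in> S"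
      unfolding trg using eq l jn yy four by (intro SI) (simp_all add: diff mult two_mem emb_diff emb_mult emb_2)
    then have "generated_field {psl_tr (g \<otimes>\<^bsub>PSL2R\<^esub> g)} \<subseteq> S"
      unfolding generated_field_def by (intro hull_minimal Sf) simp
    then have "generated_field (psl_tr ` factor j (squares_group (PSL2R_pow r) \<Gamma>)) \<subseteq> S"
      by (simp only: field[OF g(1) hyp])
    then have trS: "psl_tr ` factor j (squares_group (PSL2R_pow r) \<Gamma>) \<subseteq> S"
      unfolding generated_field_def by (rule subset_trans[OF hull_subset])
    have agree: "trace (D l) = trace (D j)" if D: "D \<in> unit_lifts \<Gamma>"
      "(\<lambda>i\<in>{..<r}. psl_class (D i)) \<in> squares_group (PSL2R_pow r) \<Gamma>" for D
    proof -
      obtain w where w: "w \<in> K" "\<And>i. i < r \<Longrightarrow> trace (D i) = 2 * \<phi> i w" using unit_lifts_trace[OF D(1)] by blast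
      have "(\<lambda>i\<in>{..<r}. psl_class (D i)) j \<in> factor j (squares_group (PSL2R_pow r) \<Gamma>)"
        unfolding factor_def using D(2) by (rule imageI)
      then have "psl_class (D j) \<in> factor j (squares_group (PSL2R_pow r) \<Gamma>)" using j by simp
      from subsetD[OF trS imageI[OF this]] have "\<bar>trace (D j)\<bar> \<in> S" by (simp only: psl_tr_class)
      then obtain z where z: "z \<in> K" "\<phi> l z = \<phi> j z" "\<bar>trace (D j)\<bar> = \<phi> j z" by (auto simp: S_def)
      have t: "trace (D i) = \<phi> i (2 * w)" if "i < r" for i
        using w that rn two_mem emb_2[of i] by (simp add: emb_mult)
      have wK: "2 * w \<in> K" using w(1) two_mem mult by blast
      \<comment> \<open>Only the absolute value of the trace is known to lie in \<open>S\<close>;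
        either sign leads to agreement of the two embeddings on \<open>2 * w\<close>.\<close>
      have "\<phi> j (2 * w) = \<phi> j z \<or> \<phi> j (2 * w) = \<phi> j (- z)"
        using z(3) t[OF j] emb_uminus[OF jn z(1)] by (auto simp: abs_if split: if_splits)
      then have "2 * w = z \<or> 2 * w = - z" using emb_inject[OF jn wK] z(1) uminus_mem by blast
      then have "\<phi> l (2 * w) = \<phi> j (2 * w)" using z emb_uminus[OF jn z(1)] emb_uminus[OF l(1) z(1)] by auto
      then show ?thesis using t True j by simp
    qed
    show False
    proof (rule trace_agree_contradiction[OF True l(2)])
      fix B C assume BC: "B \<in> unit_lifts \<Gamma>" "C \<in> unit_lifts \<Gamma>"
      define D where "D i = (B i ** B i) ** (C i ** C i)" for i
      have D: "D \<in> unit_lifts \<Gamma>" unfolding D_def by (intro U.mult_mem BC)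
      have sq: "(\<lambda>i\<in>{..<r}. psl_class (E i ** E i)) \<in> generate (PSL2R_pow r) {g \<otimes>\<^bsub>PSL2R_pow r\<^esub> g | g. g \<in> \<Gamma>}"
        if "E \<in> unit_lifts \<Gamma>" for E
      proof -
        have "(\<lambda>i\<in>{..<r}. psl_class (E i)) \<in> \<Gamma>" using that unit_lifts_subset by (auto simp: lifts_def)
        then have "(\<lambda>i\<in>{..<r}. psl_class (E i)) \<otimes>\<^bsub>PSL2R_pow r\<^esub> (\<lambda>i\<in>{..<r}. psl_class (E i)) \<in>
            {g \<otimes>\<^bsub>PSL2R_pow r\<^esub> g | g. g \<in> \<Gamma>}" by blast
        then show ?thesis using PSL2R_pow_mult[of E E r] U.det_mem[OF that] by (simp add: generate.incl)
      qed
      have "(\<lambda>i\<in>{..<r}. psl_class (D i)) \<in> squares_group (PSL2R_pow r) \<Gamma>"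
        using generate.eng[OF sq[OF BC(1)] sq[OF BC(2)]]
          PSL2R_pow_mult[of "\<lambda>i. B i ** B i" "\<lambda>i. C i ** C i" r] U.det_mem BC
        by (simp add: squares_group_def D_def det_mul)
      from agree[OF D this] show "trace ((B l ** B l) ** (C l ** C l)) = trace ((B j ** B j) ** (C j ** C j))"
        by (simp add: D_def)
    qed
  qed
qed

theorem galois_unit_lifts: "galois_tuple_group (unit_lifts \<Gamma>) {..<r} j"
proof
  show "finite {..<r}" "j \<in> {..<r}" using j by auto
  show "central (A k)" if "A \<in> unit_lifts \<Gamma>" "i \<in> {..<r}" "central (A i)" for A i k
    using unit_lifts_central[OF that(1) _ that(3)] that(2) by simp
  \<comment> \<open>Half the trace is then 1 or -1, which every embedding fixes.\<close>
  show "trace (A k) = s" if t: "A \<in> unit_lifts \<Gamma>" "i \<in> {..<r}" "k \<in> {..<r}" "trace (A i) = s" "\<bar>s\<bar> = 2" for A i k s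
  proof -
    obtain y where y: "y \<in> K" "\<And>i. i < r \<Longrightarrow> trace (A i) = 2 * \<phi> i y" using unit_lifts_trace[OF t(1)] by blast
    have n: "i < n" "k < n" using t(2,3) rn by auto
    have "\<phi> i y = 1 \<or> \<phi> i y = - 1" using t y(2)[of i] by (auto simp: abs_if split: if_splits)
    then have "\<phi> i y = \<phi> i 1 \<or> \<phi> i y = \<phi> i (- 1)" using emb_1[OF n(1)] emb_uminus[OF n(1) one] by simp
    then have "y = 1 \<or> y = - 1" using emb_inject[OF n(1) y(1)] one uminus_mem[OF one] by blast
    then have "\<phi> k y = \<phi> i y" using emb_1 emb_uminus[OF _ one] n by auto
    then show ?thesis using y(2)[of i] y(2)[of k] t by simp
  qed
  show "(trace (A i))\<^sup>2 \<noteq> (trace (A k))\<^sup>2"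
    if A: "A \<in> unit_lifts \<Gamma>" "2 < \<bar>trace (A j)\<bar>" and ik: "i \<in> {..<r}" "k \<in> {..<r}" "i \<noteq> k" for A i k
  proof -
    obtain y where y: "y \<in> K" "\<And>i. i < r \<Longrightarrow> trace (A i) = 2 * \<phi> i y"
      "\<And>i. r \<le> i \<Longrightarrow> i < n \<Longrightarrow> (\<phi> i y)\<^sup>2 \<le> 1" using unit_lifts_trace[OF A(1)] by blast
    \<comment> \<open>The conjugate at \<open>j\<close> differs from all \<open>n\<close> - 1
      others, ramified places included, and this spreads to any two conjugates.\<close>
    have "\<phi> i (y * y) \<noteq> \<phi> k (y * y)"
    proof (rule embeddings_multiplicity)
      show "inverse z \<in> K" if "z \<in> K" for z using inv[OF that] .
      show "y * y \<in> K" by (rule mult[OF y(1) y(1)])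
      show "j < n" "i < n" "k < n" "i \<noteq> k" using j ik rn by auto
      show "\<phi> l (y * y) \<noteq> \<phi> j (y * y)" if "l < n" "l \<noteq> j" for l
        by (rule trace_field_distinct[OF A y(1) _ _ that]) (rule y(2) y(3); assumption)+
    qed
    moreover have "i < n" "k < n" using ik rn by auto
    ultimately have "\<phi> i y * \<phi> i y \<noteq> \<phi> k y * \<phi> k y" using emb_mult[OF _ y(1) y(1)] by metis
    moreover have "trace (A i) = 2 * \<phi> i y" "trace (A k) = 2 * \<phi> k y" using y(2) ik by simp_all
    ultimately show ?thesis by (simp add: power2_eq_square)
  qed
  show "proj_full {j} (unit_lifts \<Gamma>)" by (rule unit_lifts_full)
  show "near_one {i} (unit_lifts \<Gamma>)" if "i \<in> {..<r}" "i \<noteq> j" for i using unit_lifts_near_one that by simp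
  show "\<not> near_one {j} (unit_lifts \<Gamma>)"
  proof
    assume near: "near_one {j} (unit_lifts \<Gamma>)"
    obtain e where e: "e > 0" "\<And>A s. A \<in> unit_lifts \<Gamma> \<Longrightarrow> \<bar>s\<bar> = 1 \<Longrightarrow> norm (s *\<^sub>R A j - mat 1) < e \<Longrightarrow> s *\<^sub>R A j = mat 1"
      using unit_lifts_discrete by blast
    obtain A s where A: "A \<in> unit_lifts \<Gamma>" "\<forall>i. \<bar>s i\<bar> = 1" "norm (s j *\<^sub>R A j - mat 1) < e" "\<not> (\<forall>i. central (A i))"
    proof -
      from near e(1) have "\<exists>A\<in>unit_lifts \<Gamma>. \<exists>s. (\<forall>i. \<bar>s i\<bar> = 1) \<and> (\<forall>i\<in>{j}. norm (s i *\<^sub>R A i - mat 1) < e) \<and> \<not> (\<forall>i. central (A i))"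
        unfolding near_one_def by simp
      then show thesis using that by auto
    qed
    have "s j *\<^sub>R A j = mat 1" using e(2)[OF A(1) _ A(3)] A(2) by blast
    moreover have "\<bar>s j\<bar> = 1" using A(2) by blast
    then have "s j = 1 \<or> s j = - 1" by linarith
    ultimately have "A j = mat 1 \<or> - A j = mat 1" by auto
    then have "central (A j)" by (auto simp: central_def minus_equation_iff[of "A j"])
    then show False using unit_lifts_central[OF A(1) j] A(4) by blast
  qed
qed

end

end

theorem arithmetic_galois_tuple_group:
  assumes "irreducible_arithmetic r \<Delta>" and \<Gamma>: "subgroup \<Gamma> (PSL2R_pow r)" "\<Gamma> \<subseteq> \<Delta>" and "j < r"
    and "cofinite_fuchsian (factor j \<Gamma>)"
    and "\<forall>i<r. i \<noteq> j \<longrightarrow> \<not> discrete_in_PSL2R (factor i \<Gamma>)"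
    and "\<forall>g \<in> factor j \<Gamma>. hyperbolic g \<longrightarrow>
           generated_field {psl_tr (g \<otimes>\<^bsub>PSL2R\<^esub> g)} =
           generated_field (psl_tr ` factor j (squares_group (PSL2R_pow r) \<Gamma>))"
  shows "\<exists>G \<subseteq> lifts r \<Gamma>. galois_tuple_group G {..<r} j"
proof -
  obtain K n \<phi> a b \<rho> \<O> where K: "number_field_of_degree K n" "bij_betw \<phi> {..<n} (field_embeddings K)" "r \<le> n"
    and ab: "a \<in> K - {0}" "b \<in> K - {0}" and ram: "\<forall>i. r \<le> i \<and> i < n \<longrightarrow> ramified_at (\<phi> i) a b"
    and ext: "\<forall>i<r. extends_embedding K a b (\<phi> i) (\<rho> i)" and O: "quaternion_order K a b \<O>"
    and com: "commensurable (PSL2R_pow r) \<Delta> (arithmetic_image r a b \<O> \<rho>)"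
    using assms(1) unfolding irreducible_arithmetic_def by blast
  obtain bas where nfe: "number_field_embeddings K n bas \<phi>" using number_field_embeddingsI[OF K(1,2)] by blast
  have "real_subfield K" using K(1) by (simp add: number_field_of_degree_def)
  then interpret Q: quaternion_embeddings K n bas \<phi> a b \<rho> r
    using nfe K(3) ab ram ext
    by (auto simp: quaternion_embeddings_def quaternion_embeddings_axioms_def real_subfield_def)
  let ?T = "arithmetic_image r a b \<O> \<rho>"
  interpret P: group "PSL2R_pow r" by (rule group_PSL2R_pow)
  have sub: "subgroup \<Delta> (PSL2R_pow r)" "subgroup ?T (PSL2R_pow r)"
    and fin: "finite_index (PSL2R_pow r) (\<Delta> \<inter> ?T) \<Delta>" using com by (auto simp: commensurable_def)
  \<comment> \<open>A uniform exponent takes each element of \<Gamma> into the arithmetic group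
    while staying in \<Gamma>.\<close>
  obtain m where m: "\<forall>x\<in>\<Delta>. x [^]\<^bsub>PSL2R_pow r\<^esub> Suc m \<in> \<Delta> \<inter> ?T"
    using finite_index_power[OF group_PSL2R_pow sub(1) P.subgroups_Inter_pair[OF sub] _ fin] by blast
  have OK: "\<O> \<subseteq> Q.K4"
    using O subringE(1)[of \<O> "quaternion_algebra K a b"] by (auto simp: quaternion_order_def quaternion_algebra_def Q.K4_def)
  have pow: "\<exists>B\<in>Q.unit_lifts \<Gamma>. \<forall>i. mpow (A i) (Suc m) = B i \<or> mpow (A i) (Suc m) = - B i" if A: "A \<in> lifts r \<Gamma>" for A
  proof -
    interpret L: tuple_group "lifts r \<Gamma>" by (rule tuple_group_lifts[OF \<Gamma>(1)])
    have pA: "(\<lambda>i. mpow (A i) (Suc m)) \<in> lifts r \<Gamma>" by (rule L.mpow_mem[OF A])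
    have dA: "det (A i) = 1" for i using L.det_mem[OF A] .
    have "(\<lambda>i\<in>{..<r}. psl_class (A i)) \<in> \<Delta>" using A \<Gamma>(2) by (auto simp: lifts_def)
    then have "(\<lambda>i\<in>{..<r}. psl_class (A i)) [^]\<^bsub>PSL2R_pow r\<^esub> Suc m \<in> ?T" using m by blast
    then have "(\<lambda>i\<in>{..<r}. psl_class (mpow (A i) (Suc m))) \<in> ?T" unfolding PSL2R_pow_power[OF dA] .
    then obtain x where x: "x \<in> \<O>" "reduced_norm a b x = 1"
      and eq: "(\<lambda>i\<in>{..<r}. psl_class (mpow (A i) (Suc m))) = (\<lambda>i\<in>{..<r}. psl_class (\<rho> i x))"
      unfolding arithmetic_image_def norm_one_units_def by blast
    have "(\<lambda>i\<in>{..<r}. psl_class (mpow (A i) (Suc m))) \<in> \<Gamma>" using pA by (simp add: lifts_def)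
    then have "(\<lambda>i\<in>{..<r}. psl_class (\<rho> i x)) \<in> \<Gamma>" unfolding eq .
    then have B: "(\<lambda>i. if i < r then \<rho> i x else mat 1) \<in> Q.unit_lifts \<Gamma>"
      unfolding Q.unit_lifts_def using x OK by blast
    have "mpow (A i) (Suc m) = (if i < r then \<rho> i x else mat 1) \<or> mpow (A i) (Suc m) = - (if i < r then \<rho> i x else mat 1)" for i
    proof (cases "i < r")
      case True
      then show ?thesis using fun_cong[OF eq, of i] by (simp add: psl_class_eq_iff del: mpow.simps)
    next
      case False
      then show ?thesis using pA by (simp add: lifts_def del: mpow.simps)
    qed
    with B show ?thesis by (intro bexI[of _ "\<lambda>i. if i < r then \<rho> i x else mat 1"] allI)
  qed
  have "galois_tuple_group (Q.unit_lifts \<Gamma>) {..<r} j"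
    using Q.galois_unit_lifts[OF \<Gamma>(1) assms(4,5) _ _ pow] assms(6,7) by blast
  then show ?thesis using Q.unit_lifts_subset by blast
qed

section \<open>The hyperbolic plane\<close>

text \<open>The stabilizer of the point i, acting on directions there by twice the angle, so
  \<open>rot pi\<close> acts trivially.\<close>

definition rot :: "real \<Rightarrow> real^2^2" where
  "rot \<phi> = mat2 (cos \<phi>) (- sin \<phi>) (sin \<phi>) (cos \<phi>)"

text \<open>Translation by the signed distance t along the imaginary axis.\<close>

definition dia :: "real \<Rightarrow> real^2^2" where
  "dia t = mat2 (exp (t / 2)) 0 0 (exp (- t / 2))"

abbreviation pt :: "real^2^2 \<Rightarrow> complex" where
  "pt A \<equiv> moebius A \<i>"

lemma rot_add: "rot \<phi> ** rot \<psi> = rot (\<phi> + \<psi>)"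
  by (simp add: rot_def cos_add sin_add algebra_simps)

lemma det_rot [simp]: "det (rot \<phi>) = 1"
  by (simp add: rot_def flip: power2_eq_square)

lemma adj2_rot [simp]: "adj2 (rot \<phi>) = rot (- \<phi>)"
  by (simp add: rot_def)

lemma det_dia [simp]: "det (dia t) = 1"
  by (simp add: dia_def flip: exp_add)

lemma adj2_dia [simp]: "adj2 (dia t) = dia (- t)"
  by (simp add: dia_def)

lemma dia_0 [simp]: "dia 0 = mat 1"
  by (simp add: dia_def mat_1_eq)

lemma i_upper [simp]: "\<i> \<in> upper_half_plane"
  by (simp add: upper_half_plane_def)

lemma pt_upper [simp]: "det A = 1 \<Longrightarrow> pt A \<in> upper_half_plane"
  by (simp add: moebius_upper)

lemma pt_mult: "det B = 1 \<Longrightarrow> pt (A ** B) = moebius A (pt B)"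
  by (simp add: moebius_mult)

lemma moebius_dia: "moebius (dia t) z = of_real (exp t) * z"
proof -
  have e: "exp (- t / 2) \<noteq> (0::real)" "exp (t / 2) = exp t * exp (- t / 2)"
    by (simp_all flip: exp_add)
  have "moebius (dia t) z = (of_real (exp (t / 2)) * z) / of_real (exp (- t / 2))"
    by (simp add: moebius_def dia_def)
  also have "\<dots> = of_real (exp t) * z" by (subst e(2)) simp
  finally show ?thesis .
qed

lemma pt_rot [simp]: "pt (rot \<phi>) = \<i>"
proof -
  have nz: "of_real (sin \<phi>) * \<i> + of_real (cos \<phi>) \<noteq> (0::complex)"
    using moebius_denom_nonzero[of "rot \<phi>" \<i>] by (simp add: rot_def)
  show ?thesis
    using nz by (simp add: moebius_def rot_def field_simps)
qed

lemma pt_mult_rot [simp]: "pt (A ** rot \<phi>) = pt A"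
  by (simp add: pt_mult)

lemma upper_eq_pt:
  assumes "z \<in> upper_half_plane" obtains A where "det A = 1" "z = pt A"
proof -
  define y where "y = sqrt (Im z)"
  have y: "y > 0" "y\<^sup>2 = Im z" using assms by (simp_all add: y_def upper_half_plane_def)
  have "pt (mat2 y (Re z / y) 0 (1 / y)) = (of_real y * \<i> + of_real (Re z / y)) * of_real y"
    by (simp add: moebius_def divide_inverse)
  also have "\<dots> = z" using y by (auto simp: complex_eq_iff power2_eq_square)
  finally show thesis using y that[of "mat2 y (Re z / y) 0 (1 / y)"] by simp
qed

section \<open>The hyperbolic metric through matrix norms\<close>

lemma hyp_dist_arg_ge_1:
  "z \<in> upper_half_plane \<Longrightarrow> w \<in> upper_half_plane \<Longrightarrow> 1 \<le> 1 + (cmod (z - w))\<^sup>2 / (2 * Im z * Im w)"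
  by (simp add: upper_half_plane_def)

lemma hyp_dist_nonneg [simp]: "z \<in> upper_half_plane \<Longrightarrow> w \<in> upper_half_plane \<Longrightarrow> hyp_dist z w \<ge> 0"
  unfolding hyp_dist_def by (intro arcosh_nonneg_real hyp_dist_arg_ge_1)

lemma hyp_dist_commute: "hyp_dist z w = hyp_dist w z"
  by (simp add: hyp_dist_def norm_minus_commute mult.commute mult.left_commute)

lemma hyp_dist_self [simp]: "hyp_dist z z = 0"
  by (simp add: hyp_dist_def)

lemma hyp_dist_eq_0: "z \<in> upper_half_plane \<Longrightarrow> w \<in> upper_half_plane \<Longrightarrow> hyp_dist z w = 0 \<longleftrightarrow> z = w"
  unfolding hyp_dist_def
  by (subst arcosh_eq_0_iff_real[OF hyp_dist_arg_ge_1]) (auto simp: upper_half_plane_def)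

text \<open>Expressing distances by the norm of a quotient makes invariance under the group
  immediate and turns distance estimates into matrix estimates.\<close>

lemma cosh_hyp_dist_pt:
  assumes "det A = 1" "det B = 1"
  shows "cosh (hyp_dist (pt A) (pt B)) = (norm (adj2 A ** B))\<^sup>2 / 2"
proof -
  obtain a b c d where A: "A = mat2 a b c d" by (rule mat2_cases)
  obtain e f g h where B: "B = mat2 e f g h" by (rule mat2_cases)
  define p q where "p = Complex d c" and "q = Complex h g"
  have nz: "p \<noteq> 0" "q \<noteq> 0"
    using moebius_denom_nonzero[OF assms(1), of \<i>] moebius_denom_nonzero[OF assms(2), of \<i>]
    by (auto simp: A B p_def q_def complex_eq_iff)
  define N where "N = Complex b a * q - Complex f e * p"
  have pts: "pt A = Complex b a / p" "pt B = Complex f e / q"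
    by (simp_all add: moebius_def A B p_def q_def Complex_eq add.commute mult.commute)
  have "pt A - pt B = N / (p * q)" using nz by (simp add: pts N_def field_simps)
  then have "(cmod (pt A - pt B))\<^sup>2 = (cmod N)\<^sup>2 / ((cmod p)\<^sup>2 * (cmod q)\<^sup>2)"
    by (simp add: norm_divide norm_mult power_divide power_mult_distrib)
  moreover have "Im (pt A) = 1 / (cmod p)\<^sup>2" "Im (pt B) = 1 / (cmod q)\<^sup>2"
    using Im_moebius[OF assms(1), of \<i>] Im_moebius[OF assms(2), of \<i>]
    by (simp_all add: A B p_def q_def Complex_eq add.commute mult.commute)
  ultimately have *: "(cmod (pt A - pt B))\<^sup>2 / (2 * Im (pt A) * Im (pt B)) = (cmod N)\<^sup>2 / 2"
    using nz by simp
  have "1 + (cmod N)\<^sup>2 / 2 = (norm (adj2 A ** B))\<^sup>2 / 2"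
  proof -
    have "(cmod N)\<^sup>2 = (b * h - a * g - (f * d - e * c))\<^sup>2 + (b * g + a * h - (f * c + e * d))\<^sup>2"
      by (simp add: cmod_power2 N_def p_def q_def)
    moreover have "(norm (adj2 A ** B))\<^sup>2 =
        (d * e - b * g)\<^sup>2 + (d * f - b * h)\<^sup>2 + (a * g - c * e)\<^sup>2 + (a * h - c * f)\<^sup>2"
      by (simp add: norm_mat_sq A B algebra_simps)
    moreover have "a * d - b * c = 1" "e * h - f * g = 1" using assms by (simp_all add: A B)
    \<comment> \<open>The summand 1 on the left has to be expanded as the product of the two
      determinants.\<close>
    then have "(a * d - b * c) * (e * h - f * g) = 1" by simp
    ultimately show ?thesis by (simp add: power2_eq_square algebra_simps)
  qed
  moreover have "1 \<le> 1 + (cmod (pt A - pt B))\<^sup>2 / (2 * Im (pt A) * Im (pt B))"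
    using assms by (intro hyp_dist_arg_ge_1) simp_all
  ultimately show ?thesis
    unfolding hyp_dist_def * by (simp only: cosh_arcosh_real)
qed

lemma hyp_dist_eqI:
  assumes "z \<in> upper_half_plane" "w \<in> upper_half_plane" "cosh (hyp_dist z w) = cosh t"
  shows "hyp_dist z w = \<bar>t\<bar>"
  using assms by (metis abs_ge_zero arcosh_cosh_real cosh_real_abs hyp_dist_nonneg)

lemma hyp_dist_moebius:
  assumes "det A = 1" "z \<in> upper_half_plane" "w \<in> upper_half_plane"
  shows "hyp_dist (moebius A z) (moebius A w) = hyp_dist z w"
proof -
  obtain B where B: "det B = 1" "z = pt B" using assms(2) by (rule upper_eq_pt)
  obtain C where C: "det C = 1" "w = pt C" using assms(3) by (rule upper_eq_pt)
  have "adj2 (A ** B) ** (A ** C) = adj2 B ** ((adj2 A ** A) ** C)"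
    by (simp only: adj2_mult matrix_mul_assoc)
  also have "adj2 A ** A = mat 1" using mult_adj2_1[of "adj2 A"] assms(1) by simp
  finally have "cosh (hyp_dist (pt (A ** B)) (pt (A ** C))) = cosh (hyp_dist (pt B) (pt C))"
    using assms(1) B(1) C(1) by (simp add: cosh_hyp_dist_pt det_mul)
  then have "hyp_dist (pt (A ** B)) (pt (A ** C)) = \<bar>hyp_dist (pt B) (pt C)\<bar>"
    using assms(1) B(1) C(1) by (intro hyp_dist_eqI) (simp_all add: det_mul)
  also have "\<dots> = hyp_dist (pt B) (pt C)" using B(1) C(1) by (intro abs_of_nonneg) simp
  finally show ?thesis using B C by (simp add: pt_mult)
qed

text \<open>The hyperbolic law of cosines; all metric properties used below are read off from it.\<close>
lemma cosh_hyp_dist_polar: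
  assumes "det A = 1"
  shows "cosh (hyp_dist (pt (A ** rot \<phi> ** dia s)) (pt (A ** rot \<psi> ** dia t))) =
    cosh (s - t) + (sin (\<phi> - \<psi>))\<^sup>2 * (cosh (s + t) - cosh (s - t))"
proof -
  have "hyp_dist (pt (A ** rot \<phi> ** dia s)) (pt (A ** rot \<psi> ** dia t)) = hyp_dist (pt (rot \<phi> ** dia s)) (pt (rot \<psi> ** dia t))"
    using assms by (simp add: pt_mult hyp_dist_moebius moebius_upper det_mul flip: matrix_mul_assoc)
  also have "cosh \<dots> = (norm (dia (- s) ** rot (\<psi> - \<phi>) ** dia t))\<^sup>2 / 2"
    by (simp add: cosh_hyp_dist_pt det_mul adj2_mult matrix_mul_assoc rot_add[of "- \<phi>" \<psi>] flip: matrix_mul_assoc[of _ "rot (- \<phi>)"])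
  also have "dia (- s) ** rot (\<psi> - \<phi>) ** dia t = mat2 (exp ((t - s) / 2) * cos (\<phi> - \<psi>)) (exp (- (s + t) / 2) * sin (\<phi> - \<psi>))
      (exp ((s + t) / 2) * - sin (\<phi> - \<psi>)) (exp ((s - t) / 2) * cos (\<phi> - \<psi>))"
  proof -
    have e: "exp ((t - s) / 2) = exp (- s / 2) * exp (t / 2)" "exp (- (s + t) / 2) = exp (- s / 2) * exp (- t / 2)"
      "exp ((s + t) / 2) = exp (s / 2) * exp (t / 2)" "exp ((s - t) / 2) = exp (s / 2) * exp (- t / 2)"
      by (simp_all add: diff_divide_distrib add_divide_distrib flip: exp_add)
    have c: "cos (\<psi> - \<phi>) = cos (\<phi> - \<psi>)" "sin (\<psi> - \<phi>) = - sin (\<phi> - \<psi>)"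
      using cos_minus[of "\<phi> - \<psi>"] sin_minus[of "\<phi> - \<psi>"] by simp_all
    show ?thesis unfolding e c dia_def rot_def by (simp add: mult_ac)
  qed
  also have "(norm \<dots>)\<^sup>2 / 2 = (cos (\<phi> - \<psi>))\<^sup>2 * cosh (s - t) + (sin (\<phi> - \<psi>))\<^sup>2 * cosh (s + t)"
  proof -
    have e: "(exp (x / 2) * y)\<^sup>2 = exp x * y\<^sup>2" for x y :: real
      by (simp add: power_mult_distrib power2_eq_square flip: exp_add)
    show ?thesis by (simp only: norm_mat_sq mat2_nth e) (simp add: cosh_def algebra_simps)
  qed
  also have "\<dots> = cosh (s - t) + (sin (\<phi> - \<psi>))\<^sup>2 * (cosh (s + t) - cosh (s - t))"
    by (simp add: cos_squared_eq algebra_simps)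
  finally show ?thesis .
qed

lemma hyp_dist_dia:
  assumes "det A = 1" shows "hyp_dist (pt (A ** dia s)) (pt (A ** dia t)) = \<bar>s - t\<bar>"
proof (rule hyp_dist_eqI)
  have "rot 0 = mat 1" by (simp add: rot_def mat_1_eq)
  then show "cosh (hyp_dist (pt (A ** dia s)) (pt (A ** dia t))) = cosh (s - t)"
    using cosh_hyp_dist_polar[OF assms, of 0 s 0 t] by simp
qed (simp_all add: assms det_mul)

lemma hyp_dist_base:
  assumes "det A = 1" shows "hyp_dist (pt A) (pt (A ** rot \<phi> ** dia t)) = \<bar>t\<bar>"
  using hyp_dist_dia[of "A ** rot \<phi>" 0 t] assms by (simp add: det_mul)

lemma cosh_add_ge_diff:
  assumes "s \<ge> 0" "t \<ge> 0" shows "cosh (s - t) \<le> cosh (s + t :: real)"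
proof -
  have "0 \<le> sinh s * sinh t" using assms by simp
  then show ?thesis unfolding cosh_diff cosh_add by simp
qed

text \<open>\<open>rot (pi/2)\<close> acts as z to -1 / z and reverses the sign of the real part, so
  by the intermediate value theorem some rotation brings \<open>z\<close> to the imaginary
  axis.\<close>

lemma polar_i:
  assumes "z \<in> upper_half_plane"
  obtains \<phi> t where "t \<ge> 0" "z = pt (rot \<phi> ** dia t)"
proof -
  have cont: "continuous_on {0..pi/2} (\<lambda>\<phi>. Re (moebius (rot \<phi>) z))"
  proof -
    have "of_real (sin \<phi>) * z + of_real (cos \<phi>) \<noteq> 0" for \<phi>
      using moebius_denom_nonzero[of "rot \<phi>" z] assms by (simp add: rot_def upper_half_plane_def)
    then show ?thesis unfolding moebius_def by (auto simp: rot_def intro!: continuous_intros)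
  qed
  have ends: "Re (moebius (rot 0) z) = Re z" "Re (moebius (rot (pi/2)) z) = - (Re z / (cmod z)\<^sup>2)"
    by (simp_all add: moebius_def rot_def Re_divide cmod_power2)
  have "\<exists>\<phi>. Re (moebius (rot \<phi>) z) = 0"
  proof (cases "Re z \<ge> 0")
    case True
    then have "Re (moebius (rot (pi/2)) z) \<le> 0" "0 \<le> Re (moebius (rot 0) z)" by (simp_all add: ends)
    then show ?thesis using IVT2'[OF _ _ _ cont, of 0] by auto
  next
    case False
    then have "Re (moebius (rot 0) z) \<le> 0" "0 \<le> Re (moebius (rot (pi/2)) z)"
      by (simp_all add: ends divide_nonpos_nonneg)
    then show ?thesis using IVT'[OF _ _ _ cont, of 0] by auto
  qed
  then obtain \<phi> where \<phi>: "Re (moebius (rot \<phi>) z) = 0" by blast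
  define y where "y = Im (moebius (rot \<phi>) z)"
  have y: "y > 0" using moebius_upper[of "rot \<phi>" z] assms by (simp add: upper_half_plane_def y_def)
  have "moebius (rot \<phi>) z = of_real y * \<i>" using \<phi> by (simp add: complex_eq_iff y_def)
  then have "moebius (rot \<phi>) z = moebius (dia (ln y)) \<i>" using y by (simp add: moebius_dia)
  then have z: "z = moebius (rot (- \<phi>)) (pt (dia (ln y)))"
    using moebius_inverse(1)[of "rot \<phi>" z] assms by simp
  show thesis
  proof (cases "ln y \<ge> 0")
    case True
    then show thesis using that[of "ln y" "- \<phi>"] z by (simp add: pt_mult)
  next
    case False
    \<comment> \<open>The rotation by pi/2 conjugates a translation to its inverse; this makes the
      parameter nonnegative.\<close>
    have "rot (- \<phi>) ** dia (ln y) = rot (- \<phi> - pi/2) ** dia (- ln y) ** rot (pi/2)"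
      by (simp add: rot_def dia_def cos_diff sin_diff)
    then have "z = pt (rot (- \<phi> - pi/2) ** dia (- ln y))" using z by (metis pt_mult det_dia pt_mult_rot)
    then show thesis using that[of "- ln y" "- \<phi> - pi/2"] False by simp
  qed
qed

lemma polar:
  assumes A: "det A = 1" and z: "z \<in> upper_half_plane"
  obtains \<phi> where "z = pt (A ** rot \<phi> ** dia (hyp_dist (pt A) z))"
proof -
  have "moebius (adj2 A) z \<in> upper_half_plane" using A z by (intro moebius_upper) simp_all
  then obtain \<phi> t where t: "t \<ge> 0" "moebius (adj2 A) z = pt (rot \<phi> ** dia t)" by (rule polar_i)
  then have "z = pt (A ** (rot \<phi> ** dia t))"
    using moebius_inverse(2)[OF A z] by (simp add: pt_mult det_mul)
  then have zz: "z = pt (A ** rot \<phi> ** dia t)" by (simp add: matrix_mul_assoc)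
  then have "hyp_dist (pt A) z = t" using hyp_dist_base[OF A] t(1) by simp
  then show thesis using that zz by simp
qed

lemma segment:
  assumes "z \<in> upper_half_plane" "w \<in> upper_half_plane"
  obtains A where "det A = 1" "z = pt A" "w = pt (A ** dia (hyp_dist z w))"
proof -
  obtain A where A: "det A = 1" "z = pt A" using assms(1) by (rule upper_eq_pt)
  obtain \<phi> where "w = pt (A ** rot \<phi> ** dia (hyp_dist (pt A) w))" using A(1) assms(2) by (rule polar)
  then show thesis using that[of "A ** rot \<phi>"] A by (simp add: det_mul)
qed

text \<open>In the law of cosines the angle term is nonnegative and vanishes only if the sine is 0
  or a side has length 0. The inequality yields the triangle inequality, the equality case the
  uniqueness of geodesics.\<close>

lemma hyp_dist_segment_point:
  assumes A: "det A = 1" and v: "v \<in> upper_half_plane" and D: "D \<ge> 0"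
  shows "\<bar>hyp_dist (pt A) v - D\<bar> \<le> hyp_dist v (pt (A ** dia D))"
    and "hyp_dist v (pt (A ** dia D)) = \<bar>hyp_dist (pt A) v - D\<bar> \<Longrightarrow> D > 0 \<Longrightarrow> v = pt (A ** dia (hyp_dist (pt A) v))"
proof -
  define s where "s = hyp_dist (pt A) v"
  obtain \<phi> where v': "v = pt (A ** rot \<phi> ** dia s)" unfolding s_def using A v by (rule polar)
  have s: "s \<ge> 0" using A v by (simp add: s_def)
  have r0: "rot 0 = mat 1" by (simp add: rot_def mat_1_eq)
  define d where "d = hyp_dist v (pt (A ** dia D))"
  have d0: "d \<ge> 0" using A v by (simp add: d_def det_mul)
  have lc: "cosh d = cosh (s - D) + (sin \<phi>)\<^sup>2 * (cosh (s + D) - cosh (s - D))"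
    using cosh_hyp_dist_polar[OF A, of \<phi> s 0 D] by (simp add: v' d_def r0)
  have ge: "cosh (s + D) - cosh (s - D) \<ge> 0" using cosh_add_ge_diff[OF s D] by simp
  then have "cosh \<bar>s - D\<bar> \<le> cosh d" unfolding lc by (simp add: cosh_real_abs)
  then show "\<bar>hyp_dist (pt A) v - D\<bar> \<le> hyp_dist v (pt (A ** dia D))"
    using cosh_real_nonneg_le_iff[of "\<bar>s - D\<bar>" d] d0 by (simp add: s_def d_def)
  assume eq: "hyp_dist v (pt (A ** dia D)) = \<bar>hyp_dist (pt A) v - D\<bar>" and D0: "D > 0"
  then have "d = \<bar>s - D\<bar>" by (simp add: s_def d_def)
  then have 0: "(sin \<phi>)\<^sup>2 * (cosh (s + D) - cosh (s - D)) = 0" using lc by (simp add: cosh_real_abs)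
  have "v = pt (A ** dia s)"
  proof (cases "s = 0")
    case True
    then show ?thesis using v' by simp
  next
    case False
    then have "cosh (s + D) - cosh (s - D) \<noteq> 0" using D0 unfolding cosh_add cosh_diff by simp
    with 0 have "sin \<phi> = 0" by simp
    moreover then have "cos \<phi> = 1 \<or> cos \<phi> = - 1" using sin_zero_abs_cos_one[of \<phi>] by linarith
    ultimately have "A ** rot \<phi> ** dia s = dia 0 ** (A ** dia s) ** rot 0 \<or> A ** rot \<phi> ** dia s = A ** dia s ** rot pi"
      by (cases A rule: mat2_cases) (auto simp: rot_def dia_def)
    then show ?thesis using v' by (metis pt_mult_rot dia_0 matrix_mul_lid)
  qed
  then show "v = pt (A ** dia (hyp_dist (pt A) v))" by (simp only: s_def)
qed

lemma hyp_dist_triangle: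
  assumes "z \<in> upper_half_plane" "v \<in> upper_half_plane" "w \<in> upper_half_plane"
  shows "hyp_dist z w \<le> hyp_dist z v + hyp_dist v w"
proof -
  obtain A where A: "det A = 1" "z = pt A" "w = pt (A ** dia (hyp_dist z w))"
    using assms(1,3) by (rule segment)
  have "\<bar>hyp_dist z v - hyp_dist z w\<bar> \<le> hyp_dist v w"
    using hyp_dist_segment_point(1)[OF A(1) assms(2), of "hyp_dist z w"] assms A(2,3) by simp
  then show ?thesis by linarith
qed

section \<open>Geodesic rays and points at infinity\<close>

definition hray :: "real^2^2 \<Rightarrow> real \<Rightarrow> complex" where
  "hray A t = pt (A ** dia t)"

lemma hray_upper [simp]: "det A = 1 \<Longrightarrow> hray A t \<in> upper_half_plane"
  by (simp add: hray_def det_mul)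

lemma hyp_dist_hray: "det A = 1 \<Longrightarrow> hyp_dist (hray A s) (hray A t) = \<bar>s - t\<bar>"
  by (simp add: hray_def hyp_dist_dia)

lemma hray_0 [simp]: "hray A 0 = pt A"
  by (simp add: hray_def)

abbreviation hyp_rays :: "(real \<Rightarrow> complex) set" where
  "hyp_rays \<equiv> geodesic_rays upper_half_plane hyp_dist"

abbreviation hyp_asymptotic :: "((real \<Rightarrow> complex) \<times> (real \<Rightarrow> complex)) set" where
  "hyp_asymptotic \<equiv> asymptotic upper_half_plane hyp_dist"

lemma hray_geodesic: "det A = 1 \<Longrightarrow> hray A \<in> hyp_rays"
  by (simp add: geodesic_rays_def hyp_dist_hray)

text \<open>The values at times 0 and 1 fix the matrix; at any other time the distances to these two
  points realize equality in the segment estimate.\<close>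

lemma geodesic_ray_hray:
  assumes "\<sigma> \<in> hyp_rays"
  obtains A where "det A = 1" "\<And>t. t \<ge> 0 \<Longrightarrow> \<sigma> t = hray A t"
proof -
  have \<sigma>: "\<And>t. t \<ge> 0 \<Longrightarrow> \<sigma> t \<in> upper_half_plane" "\<And>s t. s \<ge> 0 \<Longrightarrow> t \<ge> 0 \<Longrightarrow> hyp_dist (\<sigma> s) (\<sigma> t) = \<bar>s - t\<bar>"
    using assms by (auto simp: geodesic_rays_def)
  obtain A where A: "det A = 1" "\<sigma> 0 = pt A" "\<sigma> 1 = pt (A ** dia (hyp_dist (\<sigma> 0) (\<sigma> 1)))"
    by (rule segment[of "\<sigma> 0" "\<sigma> 1"]) (simp_all add: \<sigma>)
  have "\<sigma> t = hray A t" if "t \<ge> 0" for t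
    using hyp_dist_segment_point(2)[OF A(1) \<sigma>(1)[OF that], of 1] A(2,3) \<sigma>(2)[of 0 t] \<sigma>(2)[of t 1] \<sigma>(2)[of 0 1] that
    by (simp add: hray_def)
  with A(1) that show thesis by blast
qed

lemma equiv_hyp_asymptotic: "equiv hyp_rays hyp_asymptotic"
proof (rule equivI)
  show "hyp_asymptotic \<subseteq> hyp_rays \<times> hyp_rays" by (auto simp: asymptotic_def)
  show "refl_on hyp_rays hyp_asymptotic"
    by (auto simp: refl_on_def asymptotic_def geodesic_rays_def intro!: exI[of _ 0])
  show "sym hyp_asymptotic"
    unfolding sym_def asymptotic_def using hyp_dist_commute by simp
  show "trans hyp_asymptotic"
  proof (rule transI)
    fix a b c assume "(a, b) \<in> hyp_asymptotic" "(b, c) \<in> hyp_asymptotic"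
    then obtain B1 B2 where *: "a \<in> hyp_rays" "b \<in> hyp_rays" "c \<in> hyp_rays"
      "\<And>t. t \<ge> 0 \<Longrightarrow> hyp_dist (a t) (b t) \<le> B1" "\<And>t. t \<ge> 0 \<Longrightarrow> hyp_dist (b t) (c t) \<le> B2"
      unfolding asymptotic_def by auto
    have "hyp_dist (a t) (c t) \<le> B1 + B2" if "t \<ge> 0" for t
      using hyp_dist_triangle[of "a t" "b t" "c t"] *(4,5)[OF that] *(1-3) that by (force simp: geodesic_rays_def)
    then show "(a, c) \<in> hyp_asymptotic" using *(1,3) by (auto simp: asymptotic_def)
  qed
qed

text \<open>Iwasawa decomposition: rotating the first column of \<open>A\<close> to the horizontal
  direction leaves an upper triangular matrix, whose conjugates by \<open>dia (- t)\<close> stay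
  bounded for t \<ge> 0.\<close>

lemma asymptotic_rot:
  assumes "det A = 1" obtains \<phi> where "(hray A, hray (rot \<phi>)) \<in> hyp_asymptotic"
proof -
  obtain a b c d where A: "A = mat2 a b c d" by (rule mat2_cases)
  have ac: "a * d - b * c = 1" using assms by (simp add: A)
  define \<rho> where "\<rho> = sqrt (a\<^sup>2 + c\<^sup>2)"
  have "a \<noteq> 0 \<or> c \<noteq> 0" using ac by auto
  then have "a\<^sup>2 + c\<^sup>2 > 0" by (simp only: sum_power2_gt_zero_iff)
  then have \<rho>: "\<rho> > 0" "\<rho>\<^sup>2 = a\<^sup>2 + c\<^sup>2" by (simp_all add: \<rho>_def)
  have "(a / \<rho>)\<^sup>2 + (c / \<rho>)\<^sup>2 = \<rho>\<^sup>2 / \<rho>\<^sup>2"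
    by (simp only: power_divide \<rho>(2) flip: add_divide_distrib)
  also have "\<dots> = 1" using \<rho>(1) by simp
  finally have "(a / \<rho>)\<^sup>2 + (c / \<rho>)\<^sup>2 = 1" .
  then obtain \<phi> where \<phi>: "a / \<rho> = cos \<phi>" "c / \<rho> = sin \<phi>" by (rule sincos_total_2pi) blast
  then have ac': "a = \<rho> * cos \<phi>" "c = \<rho> * sin \<phi>" using \<rho>(1) by (simp_all add: field_simps)
  define u where "u = rot (- \<phi>) ** A"
  have "u $ 2 $ 1 = 0" "u $ 1 $ 1 = \<rho>"
    using ac' by (simp_all add: u_def A rot_def algebra_simps flip: distrib_left power2_eq_square)
  then obtain x y where u: "u = mat2 \<rho> x 0 y" by (cases u rule: mat2_cases) simp
  have "det u = 1" using assms by (simp add: u_def det_mul)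
  have bound: "hyp_dist (hray A t) (hray (rot \<phi>) t) \<le> arcosh ((\<rho>\<^sup>2 + x\<^sup>2 + y\<^sup>2) / 2)" if t: "t \<ge> 0" for t
  proof -
    define d where "d = hyp_dist (hray (rot \<phi>) t) (hray A t)"
    have d0: "d \<ge> 0" using assms by (simp add: d_def)
    have "adj2 (rot \<phi> ** dia t) ** (A ** dia t) = dia (- t) ** u ** dia t"
      by (simp add: adj2_mult u_def matrix_mul_assoc)
    also have "\<dots> = mat2 \<rho> (x * exp (- t)) 0 y"
      by (simp add: u dia_def field_simps flip: exp_add)
    finally have "cosh d = (\<rho>\<^sup>2 + (x * exp (- t))\<^sup>2 + y\<^sup>2) / 2"
      using assms by (simp add: d_def hray_def cosh_hyp_dist_pt det_mul norm_mat_sq)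
    moreover have "(x * exp (- t))\<^sup>2 \<le> x\<^sup>2"
      using t by (simp add: power_mult_distrib mult_left_le power_le_one)
    ultimately have le: "cosh d \<le> (\<rho>\<^sup>2 + x\<^sup>2 + y\<^sup>2) / 2" by simp
    have "d = arcosh (cosh d)" using d0 by (simp add: arcosh_cosh_real)
    also have "\<dots> \<le> arcosh ((\<rho>\<^sup>2 + x\<^sup>2 + y\<^sup>2) / 2)"
    proof (cases "cosh d = (\<rho>\<^sup>2 + x\<^sup>2 + y\<^sup>2) / 2")
      case False
      with le have "cosh d < (\<rho>\<^sup>2 + x\<^sup>2 + y\<^sup>2) / 2" by simp
      then show ?thesis by (intro less_imp_le arcosh_real_strict_mono cosh_real_ge_1)
    next
      case True
      show ?thesis by (simp only: True order_refl)
    qed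
    finally show ?thesis by (simp add: d_def hyp_dist_commute)
  qed
  have "(hray A, hray (rot \<phi>)) \<in> hyp_asymptotic"
    unfolding asymptotic_def using hray_geodesic assms bound by auto
  then show thesis by (rule that)
qed

lemma hyp_boundary_rot:
  assumes "\<eta> \<in> geometric_boundary upper_half_plane hyp_dist"
  obtains \<phi> where "\<eta> = hyp_asymptotic `` {hray (rot \<phi>)}"
proof -
  obtain \<sigma> where \<sigma>: "\<sigma> \<in> hyp_rays" "\<eta> = hyp_asymptotic `` {\<sigma>}"
    using assms unfolding geometric_boundary_def by (rule quotientE)
  obtain A where A: "det A = 1" "\<And>t. t \<ge> 0 \<Longrightarrow> \<sigma> t = hray A t" using geodesic_ray_hray[OF \<sigma>(1)] by blast
  obtain \<phi> where "(hray A, hray (rot \<phi>)) \<in> hyp_asymptotic" using A(1) by (rule asymptotic_rot)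
  then have "(\<sigma>, hray (rot \<phi>)) \<in> hyp_asymptotic" using \<sigma>(1) A(2) by (auto simp: asymptotic_def)
  then have "\<eta> = hyp_asymptotic `` {hray (rot \<phi>)}" unfolding \<sigma>(2) by (rule equiv_class_eq[OF equiv_hyp_asymptotic])
  then show thesis by (rule that)
qed

lemma endpoint_hray:
  assumes A: "det A = 1" and w: "w > 0" and c: "\<And>t. t \<ge> 0 \<Longrightarrow> c t = hray A (w * t)"
  shows "endpoint upper_half_plane hyp_dist c = hyp_asymptotic `` {hray A}"
  unfolding endpoint_def
proof (rule the_equality)
  have "hray A \<in> hyp_asymptotic `` {hray A}"
    by (rule equiv_class_self[OF equiv_hyp_asymptotic hray_geodesic[OF A]])
  moreover have "hyp_asymptotic `` {hray A} \<in> geometric_boundary upper_half_plane hyp_dist"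
    unfolding geometric_boundary_def by (rule quotientI[OF hray_geodesic[OF A]])
  ultimately show "hyp_asymptotic `` {hray A} \<in> geometric_boundary upper_half_plane hyp_dist \<and>
      (\<exists>\<sigma>\<in>hyp_asymptotic `` {hray A}. \<exists>v>0. \<forall>t\<ge>0. c t = \<sigma> (v * t))"
    using w c by blast
  fix \<eta> assume "\<eta> \<in> geometric_boundary upper_half_plane hyp_dist \<and> (\<exists>\<sigma>\<in>\<eta>. \<exists>v>0. \<forall>t\<ge>0. c t = \<sigma> (v * t))"
  then obtain \<sigma> v where \<eta>: "\<eta> \<in> hyp_rays // hyp_asymptotic" "\<sigma> \<in> \<eta>" "v > 0"
    "\<And>t. t \<ge> 0 \<Longrightarrow> c t = \<sigma> (v * t)" unfolding geometric_boundary_def by blast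
  obtain \<tau> where \<tau>: "\<eta> = hyp_asymptotic `` {\<tau>}" using \<eta>(1) by (rule quotientE)
  then have \<sigma>\<tau>: "(\<tau>, \<sigma>) \<in> hyp_asymptotic" using \<eta>(2) by simp
  then have \<sigma>: "\<sigma> \<in> hyp_rays" by (simp add: asymptotic_def)
  have "hyp_dist (c 0) (c 1) = w" using hyp_dist_hray[OF A, of 0 w] w c[of 0] c[of 1] by simp
  moreover have "hyp_dist (c 0) (c 1) = v"
    using \<sigma> \<eta>(3) \<eta>(4)[of 0] \<eta>(4)[of 1] by (simp add: geodesic_rays_def)
  ultimately have vw: "v = w" by simp
  have "\<sigma> t = hray A t" if "t \<ge> 0" for t
    using c[of "t / w"] \<eta>(4)[of "t / w"] that w vw by simp
  then have "(\<sigma>, hray A) \<in> hyp_asymptotic"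
    using \<sigma> hray_geodesic[OF A]
    by (auto simp: asymptotic_def intro!: exI[of _ 0])
  then have "(\<tau>, hray A) \<in> hyp_asymptotic"
    using \<sigma>\<tau> equiv_hyp_asymptotic by (meson equivE transE)
  then show "\<eta> = hyp_asymptotic `` {hray A}" unfolding \<tau> by (rule equiv_class_eq[OF equiv_hyp_asymptotic])
qed

text \<open>The speeds agree by the triangle inequality, and then the law of cosines forces the angle
  between the rays to vanish.\<close>
lemma bounded_rays_equal:
  assumes w: "w \<ge> 0" "w' \<ge> 0"
    and B: "\<And>t. t \<ge> 0 \<Longrightarrow> hyp_dist (hray (rot \<phi>) (w * t)) (hray (rot \<psi>) (w' * t)) \<le> B"
  shows "hray (rot \<phi>) (w * t) = hray (rot \<psi>) (w' * t)"
proof -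
  let ?d = "\<lambda>t. hyp_dist (hray (rot \<phi>) (w * t)) (hray (rot \<psi>) (w' * t))"
  have speed: "\<bar>w - w'\<bar> * t \<le> B" if "t \<ge> 0" for t
  proof -
    have "\<bar>hyp_dist (pt (rot \<psi>)) (hray (rot \<phi>) (w * t)) - w' * t\<bar> \<le> ?d t"
      unfolding hray_def[of "rot \<psi>"] using w(2) that by (intro hyp_dist_segment_point(1)) simp_all
    moreover have "hyp_dist (pt (rot \<psi>)) (hray (rot \<phi>) (w * t)) = w * t"
      using hyp_dist_hray[of "rot \<phi>" 0 "w * t"] w(1) that by simp
    ultimately have "\<bar>w * t - w' * t\<bar> \<le> B" using B[OF that] by simp
    then show ?thesis using that by (simp add: abs_mult flip: left_diff_distrib)
  qed
  have B0: "B \<ge> 0" using speed[of 0] by simp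
  have ww: "w' = w"
  proof (rule ccontr)
    assume "w' \<noteq> w"
    then show False using speed[of "(B + 1) / \<bar>w - w'\<bar>"] B0 by simp
  qed
  have lc: "cosh (?d t) = 1 + (sin (\<phi> - \<psi>))\<^sup>2 * (cosh (2 * w * t) - 1)" for t
    using cosh_hyp_dist_polar[of "mat 1" \<phi> "w * t" \<psi> "w * t"] by (simp add: ww hray_def algebra_simps)
  have "w = 0 \<or> sin (\<phi> - \<psi>) = 0"
  proof (rule ccontr)
    assume neg: "\<not> ?thesis"
    define S where "S = (sin (\<phi> - \<psi>))\<^sup>2"
    have S: "S > 0" "w > 0" using neg w(1) by (simp_all add: S_def)
    \<comment> \<open>At this time cosh (2 w t) - 1 is at least w t - 1 = cosh B / S, so the law of
      cosines puts the hyperbolic cosine of the distance above cosh B.\<close>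
    define t where "t = (cosh B / S + 1) / w"
    have t: "t \<ge> 0" "w * t = cosh B / S + 1" using S by (simp_all add: t_def)
    have "cosh (?d t) \<le> cosh B" using B[OF t(1)] B0 by (subst cosh_real_nonneg_le_iff) simp_all
    moreover have "2 * cosh (2 * w * t) = exp (2 * w * t) + exp (- (2 * w * t))" by (simp add: cosh_def)
    then have "1 + 2 * w * t \<le> 2 * cosh (2 * w * t)"
      using exp_ge_add_one_self[of "2 * w * t"] exp_gt_zero[of "- (2 * w * t)"] by linarith
    then have "w * t - 1 \<le> cosh (2 * w * t) - 1" by simp
    then have "S * (cosh B / S) \<le> S * (cosh (2 * w * t) - 1)" using S t(2) by (intro mult_left_mono) simp_all
    then have "cosh B \<le> S * (cosh (2 * w * t) - 1)" using S by simp
    ultimately show False using lc[of t] by (simp add: S_def)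
  qed
  then have "cosh (?d t) = cosh 0" using lc[of t] by auto
  then have "?d t = 0" using hyp_dist_eqI[of _ _ 0] by simp
  then show ?thesis by (simp add: hyp_dist_eq_0)
qed

section \<open>Products of hyperbolic planes\<close>

text \<open>The equality case of Minkowski's inequality: it forces equality in Cauchy-Schwarz, hence
  proportionality, and equality in each componentwise triangle inequality.\<close>

lemma L2_set_additive:
  fixes a b e :: "'a \<Rightarrow> real"
  assumes fin: "finite I" and nn: "\<And>i. i \<in> I \<Longrightarrow> 0 \<le> a i" "\<And>i. i \<in> I \<Longrightarrow> 0 \<le> b i" "\<And>i. i \<in> I \<Longrightarrow> 0 \<le> e i"
    and le: "\<And>i. i \<in> I \<Longrightarrow> e i \<le> a i + b i" and eq: "L2_set a I + L2_set b I \<le> L2_set e I"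
    and i: "i \<in> I"
  shows "e i = a i + b i" and "L2_set b I * a i = L2_set a I * b i"
proof -
  define \<alpha> \<beta> where "\<alpha> = L2_set a I" and "\<beta> = L2_set b I"
  have sq: "(L2_set f I)\<^sup>2 = (\<Sum>i\<in>I. (f i)\<^sup>2)" for f :: "'a \<Rightarrow> real"
    by (simp add: L2_set_def sum_nonneg)
  have p0: "\<alpha> \<ge> 0" "\<beta> \<ge> 0" by (simp_all add: \<alpha>_def \<beta>_def)
  define P where "P = (\<Sum>i\<in>I. a i * b i)"
  have "(\<alpha> + \<beta>)\<^sup>2 \<le> (L2_set e I)\<^sup>2" using eq p0 by (intro power_mono) (simp_all add: \<alpha>_def \<beta>_def)
  then have 1: "(\<alpha> + \<beta>)\<^sup>2 \<le> (\<Sum>i\<in>I. (e i)\<^sup>2)" by (simp only: sq)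
  have 2: "(\<Sum>i\<in>I. (a i + b i)\<^sup>2) = \<alpha>\<^sup>2 + \<beta>\<^sup>2 + 2 * P"
    by (simp add: \<alpha>_def \<beta>_def sq P_def power2_sum sum.distrib sum_distrib_left mult.assoc)
  have le2: "(e i)\<^sup>2 \<le> (a i + b i)\<^sup>2" if "i \<in> I" for i using le nn that by (intro power_mono) simp_all
  have 3: "(\<Sum>i\<in>I. (e i)\<^sup>2) \<le> (\<Sum>i\<in>I. (a i + b i)\<^sup>2)" by (intro sum_mono le2)
  have "(\<Sum>i\<in>I. (\<beta> * a i - \<alpha> * b i)\<^sup>2) = (\<Sum>i\<in>I. \<beta>\<^sup>2 * (a i)\<^sup>2 + \<alpha>\<^sup>2 * (b i)\<^sup>2 - 2 * (\<alpha> * \<beta>) * (a i * b i))"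
    by (simp add: power2_diff power_mult_distrib mult_ac)
  also have "\<dots> = \<beta>\<^sup>2 * (\<Sum>i\<in>I. (a i)\<^sup>2) + \<alpha>\<^sup>2 * (\<Sum>i\<in>I. (b i)\<^sup>2) - 2 * (\<alpha> * \<beta>) * P"
    by (simp only: sum_subtractf sum.distrib P_def flip: sum_distrib_left)
  also have "\<dots> = \<beta>\<^sup>2 * \<alpha>\<^sup>2 + \<alpha>\<^sup>2 * \<beta>\<^sup>2 - 2 * (\<alpha> * \<beta>) * P" by (simp only: \<alpha>_def \<beta>_def sq)
  finally have "(\<Sum>i\<in>I. (\<beta> * a i - \<alpha> * b i)\<^sup>2) = \<beta>\<^sup>2 * \<alpha>\<^sup>2 + \<alpha>\<^sup>2 * \<beta>\<^sup>2 - 2 * (\<alpha> * \<beta>) * P" .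
  then have 4: "(\<Sum>i\<in>I. (\<beta> * a i - \<alpha> * b i)\<^sup>2) = 2 * (\<alpha> * \<beta>) * (\<alpha> * \<beta> - P)"
    by (simp add: power2_eq_square algebra_simps)
  have PP: "P \<ge> \<alpha> * \<beta>" using 1 2 3 by (simp add: power2_sum)
  have "(\<Sum>i\<in>I. \<bar>a i\<bar> * \<bar>b i\<bar>) \<le> \<alpha> * \<beta>" unfolding \<alpha>_def \<beta>_def by (rule L2_set_mult_ineq)
  also have "(\<Sum>i\<in>I. \<bar>a i\<bar> * \<bar>b i\<bar>) = P" unfolding P_def using nn by (intro sum.cong) simp_all
  finally have P: "P = \<alpha> * \<beta>" using PP by simp
  have "(\<Sum>i\<in>I. (\<beta> * a i - \<alpha> * b i)\<^sup>2) = 0" unfolding 4 P by simp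
  then have "(\<beta> * a i - \<alpha> * b i)\<^sup>2 = 0" using fin i by (simp add: sum_nonneg_eq_0_iff)
  then show "L2_set b I * a i = L2_set a I * b i" by (simp add: \<alpha>_def \<beta>_def)
  have "(\<Sum>i\<in>I. (a i + b i)\<^sup>2 - (e i)\<^sup>2) = 0" using 1 2 3 P by (simp add: sum_subtractf power2_sum)
  then have "(a i + b i)\<^sup>2 - (e i)\<^sup>2 = 0" using fin i le2 by (simp add: sum_nonneg_eq_0_iff)
  then have "(e i)\<^sup>2 = (a i + b i)\<^sup>2" by simp
  then show "e i = a i + b i" by (rule power2_eq_imp_eq) (use nn i in simp_all)
qed

lemma H2_pow_component [simp]: "z \<in> H2_pow r \<Longrightarrow> i < r \<Longrightarrow> z i \<in> upper_half_plane"
  by (auto simp: H2_pow_def)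

lemma hyp_dist_le_H2_pow_dist: "i < r \<Longrightarrow> hyp_dist (x i) (y i) \<le> H2_pow_dist r x y"
  unfolding H2_pow_dist_def by (rule member_le_L2_set) simp_all

lemma H2_pow_dist_triangle:
  assumes "x \<in> H2_pow r" "y \<in> H2_pow r" "z \<in> H2_pow r"
  shows "H2_pow_dist r x z \<le> H2_pow_dist r x y + H2_pow_dist r y z"
proof -
  have "H2_pow_dist r x z \<le> L2_set (\<lambda>i. hyp_dist (x i) (y i) + hyp_dist (y i) (z i)) {..<r}"
    unfolding H2_pow_dist_def using assms by (intro L2_set_mono hyp_dist_triangle) simp_all
  also have "\<dots> \<le> H2_pow_dist r x y + H2_pow_dist r y z"
    unfolding H2_pow_dist_def by (rule L2_set_triangle_ineq)
  finally show ?thesis .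
qed

abbreviation product_rays :: "nat \<Rightarrow> (real \<Rightarrow> nat \<Rightarrow> complex) set" where
  "product_rays r \<equiv> geodesic_rays (H2_pow r) (H2_pow_dist r)"

abbreviation product_asymptotic :: "nat \<Rightarrow> ((real \<Rightarrow> nat \<Rightarrow> complex) \<times> (real \<Rightarrow> nat \<Rightarrow> complex)) set" where
  "product_asymptotic r \<equiv> asymptotic (H2_pow r) (H2_pow_dist r)"

text \<open>Along a geodesic of the product the triangle inequality is an equality, so the equality
  case of Minkowski makes each projection a geodesic of constant speed.\<close>

lemma product_ray_component:
  assumes c: "c \<in> product_rays r" and i: "i < r"
  shows "\<exists>A w. det A = 1 \<and> w \<ge> 0 \<and> (\<forall>t\<ge>0. c t i = hray A (w * t))"
proof -
  have cX: "c t \<in> H2_pow r" if "t \<ge> 0" for t using c that by (simp add: geodesic_rays_def)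
  have cd: "H2_pow_dist r (c s) (c t) = \<bar>s - t\<bar>" if "s \<ge> 0" "t \<ge> 0" for s t using c that by (simp add: geodesic_rays_def)
  define d where "d s t = hyp_dist (c s i) (c t i)" for s t
  have up: "c t i \<in> upper_half_plane" if "t \<ge> 0" for t using cX[OF that] i by simp
  have add: "d s u = d s t + d t u" "(u - t) * d s t = (t - s) * d t u" if st: "0 \<le> s" "s \<le> t" "t \<le> u" for s t u
  proof -
    have X: "c s \<in> H2_pow r" "c t \<in> H2_pow r" "c u \<in> H2_pow r" using cX st by simp_all
    have L: "L2_set (\<lambda>i. hyp_dist (c s i) (c t i)) {..<r} = t - s" "L2_set (\<lambda>i. hyp_dist (c t i) (c u i)) {..<r} = u - t"
      "L2_set (\<lambda>i. hyp_dist (c s i) (c u i)) {..<r} = u - s"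
      using cd[of s t] cd[of t u] cd[of s u] st by (simp_all add: H2_pow_dist_def)
    note * = L2_set_additive[of "{..<r}" "\<lambda>i. hyp_dist (c s i) (c t i)" "\<lambda>i. hyp_dist (c t i) (c u i)" "\<lambda>i. hyp_dist (c s i) (c u i)" i]
    show "d s u = d s t + d t u" unfolding d_def using i X by (intro *(1)) (simp_all add: L hyp_dist_triangle)
    have "L2_set (\<lambda>i. hyp_dist (c t i) (c u i)) {..<r} * hyp_dist (c s i) (c t i) =
        L2_set (\<lambda>i. hyp_dist (c s i) (c t i)) {..<r} * hyp_dist (c t i) (c u i)"
      using i X by (intro *(2)) (simp_all add: L hyp_dist_triangle)
    then show "(u - t) * d s t = (t - s) * d t u" by (simp add: L d_def)
  qed
  define w where "w = d 0 1"
  have w: "w \<ge> 0" using up by (simp add: w_def d_def)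
  have d0: "d 0 t = w * t" if "t \<ge> 0" for t
  proof (cases "t \<le> 1")
    case True
    have "w = d 0 t + d t 1" "(1 - t) * d 0 t = t * d t 1" using add[of 0 t 1] that True by (simp_all add: w_def)
    then show ?thesis by (simp add: algebra_simps)
  next
    case False
    have "d 0 t = w + d 1 t" "(t - 1) * w = d 1 t" using add[of 0 1 t] False by (simp_all add: w_def)
    then show ?thesis by (simp add: algebra_simps)
  qed
  have "d s t = w * (t - s)" if "0 \<le> s" "s \<le> t" for s t
    using add(1)[of 0 s t] d0[of s] d0[of t] that by (simp add: algebra_simps)
  moreover have "d s t = d t s" for s t by (simp add: d_def hyp_dist_commute)
  ultimately have dst: "d s t = w * \<bar>s - t\<bar>" if "0 \<le> s" "0 \<le> t" for s t
    using that by (cases "s \<le> t") (force simp: abs_if)+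
  show ?thesis
  proof (cases "w = 0")
    case True
    obtain A where A: "det A = 1" "c 0 i = pt A" using up[of 0] by (auto elim: upper_eq_pt)
    have "c t i = c 0 i" if "t \<ge> 0" for t
      using dst[of t 0] that True hyp_dist_eq_0[OF up[OF that] up[of 0]] by (simp add: d_def)
    then have "\<forall>t\<ge>0. c t i = hray A (w * t)" using A(2) True by simp
    then show ?thesis using A(1) w by blast
  next
    case False
    then have w0: "w > 0" using w by simp
    have "w * \<bar>s / w - t / w\<bar> = \<bar>s - t\<bar>" for s t
      using w0 by (simp add: abs_divide flip: diff_divide_distrib)
    then have "(\<lambda>t. c (t / w) i) \<in> hyp_rays"
      using w0 up dst by (simp add: geodesic_rays_def d_def)
    then obtain A where A: "det A = 1" "\<And>t. t \<ge> 0 \<Longrightarrow> c (t / w) i = hray A t" by (rule geodesic_ray_hray) blast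
    have "\<forall>t\<ge>0. c t i = hray A (w * t)" using A(2)[of "w * _"] w0 by simp
    then show ?thesis using A(1) w by blast
  qed
qed

lemma product_ray:
  assumes c: "c \<in> product_rays r"
  obtains A w where "\<And>i. i < r \<Longrightarrow> det (A i) = 1" "\<And>i. i < r \<Longrightarrow> w i \<ge> 0"
    "\<And>i t. i < r \<Longrightarrow> t \<ge> 0 \<Longrightarrow> c t i = hray (A i) (w i * t)"
proof -
  have "\<forall>i\<in>{..<r}. \<exists>p. det (fst p) = 1 \<and> snd p \<ge> 0 \<and> (\<forall>t\<ge>0. c t i = hray (fst p) (snd p * t))"
    using product_ray_component[OF c] by fastforce
  from bchoice[OF this] obtain p where
    "\<forall>i\<in>{..<r}. det (fst (p i)) = 1 \<and> snd (p i) \<ge> 0 \<and> (\<forall>t\<ge>0. c t i = hray (fst (p i)) (snd (p i) * t))" ..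
  then show thesis using that[of "\<lambda>i. fst (p i)" "\<lambda>i. snd (p i)"] by simp
qed

definition product_hray :: "nat \<Rightarrow> (nat \<Rightarrow> real^2^2) \<Rightarrow> (nat \<Rightarrow> real) \<Rightarrow> real \<Rightarrow> nat \<Rightarrow> complex" where
  "product_hray r A w t = (\<lambda>i\<in>{..<r}. hray (A i) (w i * t))"

lemma product_hray_mem: "(\<And>i. i < r \<Longrightarrow> det (A i) = 1) \<Longrightarrow> product_hray r A w t \<in> H2_pow r"
  by (auto simp: product_hray_def H2_pow_def)

lemma H2_pow_dist_product_hray:
  assumes "\<And>i. i < r \<Longrightarrow> det (A i) = 1"
  shows "H2_pow_dist r (product_hray r A w s) (product_hray r A w t) = \<bar>s - t\<bar> * L2_set w {..<r}"
proof -
  have "H2_pow_dist r (product_hray r A w s) (product_hray r A w t) = L2_set (\<lambda>i. \<bar>w i * s - w i * t\<bar>) {..<r}"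
    unfolding H2_pow_dist_def using assms by (intro L2_set_cong) (simp_all add: product_hray_def hyp_dist_hray)
  also have "\<dots> = L2_set (\<lambda>i. \<bar>s - t\<bar> * w i) {..<r}"
    unfolding L2_set_def by (simp add: power_mult_distrib flip: right_diff_distrib)
      (simp add: mult.commute)
  also have "\<dots> = \<bar>s - t\<bar> * L2_set w {..<r}" by (simp add: L2_set_right_distrib)
  finally show ?thesis .
qed

lemma product_hray_geodesic:
  "(\<And>i. i < r \<Longrightarrow> det (A i) = 1) \<Longrightarrow> L2_set w {..<r} = 1 \<Longrightarrow> product_hray r A w \<in> product_rays r"
  by (simp add: geodesic_rays_def product_hray_mem H2_pow_dist_product_hray)

text \<open>A class is regular through one representative. Every other one has positive speeds too,
  since a stationary component would keep the regular ray bounded there.\<close>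

lemma regular_boundary_component:
  assumes \<xi>: "\<xi> \<in> regular_boundary r" "c \<in> \<xi>" and i: "i < r"
  shows "\<exists>A w. det A = 1 \<and> w > 0 \<and> (\<forall>t\<ge>0. c t i = hray A (w * t))"
proof -
  obtain c0 where c0: "regular_ray r c0" "\<xi> = product_asymptotic r `` {c0}" using \<xi>(1) by (auto simp: regular_boundary_def)
  obtain B where *: "c0 \<in> product_rays r" "c \<in> product_rays r" "\<And>t. t \<ge> 0 \<Longrightarrow> H2_pow_dist r (c0 t) (c t) \<le> B"
    using \<xi>(2) unfolding c0(2) asymptotic_def by auto
  obtain A0 w0 where A0: "det A0 = 1" "w0 \<ge> 0" "\<forall>t\<ge>0. c0 t i = hray A0 (w0 * t)" using product_ray_component[OF *(1) i] by blast
  obtain A w where A: "det A = 1" "w \<ge> 0" "\<forall>t\<ge>0. c t i = hray A (w * t)" using product_ray_component[OF *(2) i] by blast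
  have near: "hyp_dist (c0 t i) (c t i) \<le> B" if "t \<ge> 0" for t
    using hyp_dist_le_H2_pow_dist[OF i, of "c0 t" "c t"] *(3)[OF that] by simp
  have "w \<noteq> 0"
  proof
    assume w: "w = 0"
    have b: "w0 * t \<le> 2 * B" if t: "t \<ge> 0" for t
    proof -
      have "w0 * t = hyp_dist (c0 0 i) (c0 t i)" using A0 t hyp_dist_hray[OF A0(1), of 0 "w0 * t"] by simp
      also have "\<dots> \<le> hyp_dist (c0 0 i) (pt A) + hyp_dist (pt A) (c0 t i)"
        using A0(1,3) A(1) t by (intro hyp_dist_triangle) simp_all
      also have "\<dots> \<le> B + B"
        using near[of 0] near[OF t] A(3) w t hyp_dist_commute[of "pt A"] by (intro add_mono) simp_all
      finally show ?thesis by simp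
    qed
    have "w0 = 0"
    proof (rule ccontr)
      assume "w0 \<noteq> 0"
      then show False using b[of "(2 * B + 1) / w0"] b[of 0] A0(2) by simp
    qed
    then have "\<forall>t\<ge>0. c0 t i = pt A0" using A0(3) by simp
    then show False using c0(1) i by (auto simp: regular_ray_def)
  qed
  then show ?thesis using A by (metis order_le_less)
qed

lemma furstenberg_limit_set_subset: "furstenberg_limit_set r \<Gamma> x \<subseteq> furstenberg_boundary r"
proof
  fix \<zeta> assume "\<zeta> \<in> furstenberg_limit_set r \<Gamma> x"
  then obtain c \<xi> where \<zeta>: "\<zeta> = (\<lambda>i\<in>{..<r}. endpoint upper_half_plane hyp_dist (\<lambda>t. c t i))"
    and \<xi>: "\<xi> \<in> regular_boundary r" "c \<in> \<xi>"
    unfolding furstenberg_limit_set_def regular_limit_set_def by blast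
  have "endpoint upper_half_plane hyp_dist (\<lambda>t. c t i) \<in> geometric_boundary upper_half_plane hyp_dist" if i: "i < r" for i
  proof -
    obtain A w where A: "det A = 1" "w > 0" "\<forall>t\<ge>0. c t i = hray A (w * t)"
      using regular_boundary_component[OF \<xi> i] by blast
    have "endpoint upper_half_plane hyp_dist (\<lambda>t. c t i) = hyp_asymptotic `` {hray A}"
      using A by (intro endpoint_hray) auto
    then show ?thesis unfolding geometric_boundary_def using hray_geodesic[OF A(1)] by (simp add: quotientI)
  qed
  then show "\<zeta> \<in> furstenberg_boundary r" by (simp add: \<zeta> furstenberg_boundary_def)
qed

lemma pt_eq_i:
  assumes "det A = 1" "pt A = \<i>" obtains \<phi> where "A = rot \<phi>"
proof -
  obtain a b c d where A: "A = mat2 a b c d" by (rule mat2_cases)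
  have nz: "of_real c * \<i> + of_real d \<noteq> (0::complex)" using moebius_denom_nonzero[OF assms(1), of \<i>] by (simp add: A)
  have "of_real a * \<i> + of_real b = \<i> * (of_real c * \<i> + of_real d)"
    using assms(2) nz by (simp add: moebius_def A divide_eq_eq)
  then have "d = a" "b = - c" by (simp_all add: complex_eq_iff)
  moreover from this have "a\<^sup>2 + c\<^sup>2 = 1" using assms(1) by (simp add: A power2_eq_square)
  then obtain \<phi> where "a = cos \<phi>" "c = sin \<phi>" by (rule sincos_total_2pi) blast
  ultimately show thesis using that[of \<phi>] by (simp add: A rot_def)
qed

lemma product_ray_unique:
  assumes c: "(product_hray r (\<lambda>i. rot (\<psi> i)) w, c') \<in> product_asymptotic r" and w: "\<And>i. i < r \<Longrightarrow> w i \<ge> 0"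
    and c0: "c' 0 = H2_pow_basepoint r" and t: "t \<ge> 0"
  shows "c' t = product_hray r (\<lambda>i. rot (\<psi> i)) w t"
proof -
  obtain B where B: "c' \<in> product_rays r" "\<And>t. t \<ge> 0 \<Longrightarrow> H2_pow_dist r (product_hray r (\<lambda>i. rot (\<psi> i)) w t) (c' t) \<le> B"
    using c unfolding asymptotic_def by auto
  obtain A v where A: "\<And>i. i < r \<Longrightarrow> det (A i) = 1" "\<And>i. i < r \<Longrightarrow> v i \<ge> 0"
    "\<And>i t. i < r \<Longrightarrow> t \<ge> 0 \<Longrightarrow> c' t i = hray (A i) (v i * t)" using product_ray[OF B(1)] by blast
  have comp: "c' t i = hray (rot (\<psi> i)) (w i * t)" if i: "i < r" for i
  proof -
    have "pt (A i) = \<i>" using A(3)[OF i, of 0] c0 i by (simp add: H2_pow_basepoint_def)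
    with A(1)[OF i] obtain \<phi> where \<phi>: "A i = rot \<phi>" by (rule pt_eq_i)
    have "hray (rot (\<psi> i)) (w i * t) = hray (rot \<phi>) (v i * t)"
    proof (rule bounded_rays_equal[OF w[OF i] A(2)[OF i]])
      fix t :: real assume t: "t \<ge> 0"
      show "hyp_dist (hray (rot (\<psi> i)) (w i * t)) (hray (rot \<phi>) (v i * t)) \<le> B"
        using hyp_dist_le_H2_pow_dist[OF i, of "product_hray r (\<lambda>i. rot (\<psi> i)) w t" "c' t"] B(2)[OF t] A(3)[OF i t] i \<phi>
        by (simp add: product_hray_def)
    qed
    then show ?thesis using A(3)[OF i t] \<phi> by simp
  qed
  have "c' t \<in> H2_pow r" using B(1) t by (simp add: geodesic_rays_def)
  then have "c' t \<in> extensional {..<r}" by (auto simp: H2_pow_def PiE_def)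
  then show ?thesis by (intro extensionalityI[of _ "{..<r}"]) (simp_all add: product_hray_def comp)
qed

section \<open>Convergence to boundary points in the cone topology\<close>

lemma tendsto_hyp_dist_hray:
  assumes "(t \<longlonglongrightarrow> t')" "(\<lambda>n. sin (\<phi> n - \<psi>)) \<longlonglongrightarrow> 0"
  shows "(\<lambda>n. hyp_dist (hray (rot (\<phi> n)) (t n)) (hray (rot \<psi>) t')) \<longlonglongrightarrow> 0"
proof -
  let ?d = "\<lambda>n. hyp_dist (hray (rot (\<phi> n)) (t n)) (hray (rot \<psi>) t')"
  have "cosh (?d n) = cosh (t n - t') + (sin (\<phi> n - \<psi>))\<^sup>2 * (cosh (t n + t') - cosh (t n - t'))" for n
    using cosh_hyp_dist_polar[of "mat 1" "\<phi> n" "t n" \<psi> t'] by (simp add: hray_def)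
  moreover have "(\<lambda>n. cosh (t n - t') + (sin (\<phi> n - \<psi>))\<^sup>2 * (cosh (t n + t') - cosh (t n - t'))) \<longlonglongrightarrow>
      cosh (t' - t') + 0\<^sup>2 * (cosh (t' + t') - cosh (t' - t'))"
    by (intro tendsto_intros assms)
  ultimately have lim: "(\<lambda>n. cosh (?d n)) \<longlonglongrightarrow> 1" by simp
  have "continuous_on {1..} (arcosh :: real \<Rightarrow> real)" by (rule continuous_on_arcosh) simp
  then have "(\<lambda>n. arcosh (cosh (?d n))) \<longlonglongrightarrow> arcosh 1"
    by (rule continuous_on_tendsto_compose[OF _ lim]) (simp_all add: cosh_real_ge_1)
  then show ?thesis by (simp add: arcosh_cosh_real)
qed

text \<open>Convergence of the normalized displacements and of the angles makes the geodesics from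
  the base point to \<open>z n\<close> converge pointwise to the limit ray, which is what cone
  neighbourhoods test. Angles are compared through sines because they matter modulo pi.\<close>

lemma limit_point_criterion:
  assumes w: "\<And>i. i < r \<Longrightarrow> w i \<ge> 0" "L2_set w {..<r} = 1"
    and D: "\<And>n i. i < r \<Longrightarrow> D n i \<ge> 0"
    and z: "\<And>n. z n = (\<lambda>i\<in>{..<r}. hray (rot (\<phi> n i)) (D n i))"
    and N: "filterlim (\<lambda>n. L2_set (D n) {..<r}) at_top sequentially"
    and dir: "\<And>i. i < r \<Longrightarrow> (\<lambda>n. D n i / L2_set (D n) {..<r}) \<longlonglongrightarrow> w i"
    and ang: "\<And>i. i < r \<Longrightarrow> (\<lambda>n. sin (\<phi> n i - \<psi> i)) \<longlonglongrightarrow> 0"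
    and S: "\<And>n. z n \<in> S"
  defines "\<xi> \<equiv> product_asymptotic r `` {product_hray r (\<lambda>i. rot (\<psi> i)) w}"
  shows "Inr \<xi> \<in> cone_topology (H2_pow r) (H2_pow_dist r) (H2_pow_basepoint r) closure_of (Inl ` S)"
proof -
  define c where "c = product_hray r (\<lambda>i. rot (\<psi> i)) w"
  define X d p where "X = H2_pow r" and "d = H2_pow_dist r" and "p = H2_pow_basepoint r"
  have cg: "c \<in> product_rays r" unfolding c_def using w by (intro product_hray_geodesic) simp_all
  have c0: "c 0 = p" by (auto simp: c_def p_def product_hray_def H2_pow_basepoint_def)
  have cc: "(c, c) \<in> product_asymptotic r"
    using cg by (auto simp: asymptotic_def geodesic_rays_def intro!: exI[of _ 0])
  have \<xi>b: "\<xi> \<in> geometric_boundary X d"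
    unfolding \<xi>_def geometric_boundary_def X_def d_def using cg by (intro quotientI) (simp add: c_def)
  have c\<xi>: "c \<in> \<xi>" using cc by (simp add: \<xi>_def c_def)
  define N where "N n = L2_set (D n) {..<r}" for n
  have N_top: "filterlim N at_top sequentially" using N by (simp add: N_def[abs_def])
  define q where "q n = product_hray r (\<lambda>i. rot (\<phi> n i)) (\<lambda>i. D n i / N n)" for n
  have qX: "q n t \<in> X" for n t by (simp add: q_def X_def product_hray_mem)
  have q0: "q n 0 = p" for n by (auto simp: q_def p_def product_hray_def H2_pow_basepoint_def)
  have qN: "q n (N n) = z n" if "N n > 0" for n using that by (auto simp: q_def product_hray_def z)
  have qd: "d (q n s) (q n t) = \<bar>s - t\<bar>" if "N n > 0" for n s t
  proof -
    have "N n * L2_set (\<lambda>i. D n i / N n) {..<r} = L2_set (D n) {..<r}"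
      using that by (simp add: L2_set_right_distrib)
    then have "L2_set (\<lambda>i. D n i / N n) {..<r} = 1" using that by (simp add: N_def)
    then show ?thesis by (simp add: d_def q_def H2_pow_dist_product_hray)
  qed
  have qlim: "(\<lambda>n. d (q n R) (c R)) \<longlonglongrightarrow> 0" for R
  proof -
    have "(\<lambda>n. sqrt (\<Sum>i<r. (hyp_dist (q n R i) (c R i))\<^sup>2)) \<longlonglongrightarrow> sqrt (\<Sum>i<r. 0\<^sup>2)"
    proof (intro tendsto_intros)
      fix i assume i: "i \<in> {..<r}"
      have "(\<lambda>n. D n i / N n * R) \<longlonglongrightarrow> w i * R" using dir i by (intro tendsto_intros) (simp add: N_def)
      from tendsto_hyp_dist_hray[OF this ang] i show "(\<lambda>n. hyp_dist (q n R i) (c R i)) \<longlonglongrightarrow> 0"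
        by (simp add: q_def c_def product_hray_def)
    qed
    then show ?thesis by (simp add: d_def H2_pow_dist_def L2_set_def)
  qed
  have cone: "eventually (\<lambda>n. Inl (z n) \<in> cone_neighbourhood X d c' R e) sequentially"
    if c': "c' \<in> product_rays r" "c' 0 = p" "R > 0" and mem: "Inr \<xi> \<in> cone_neighbourhood X d c' R e" for c' R e
  proof -
    obtain c'' where c'': "c'' \<in> \<xi>" "c'' 0 = c' 0" "d (c'' R) (c' R) < e" using mem by (auto simp: cone_neighbourhood_def)
    \<comment> \<open>The representative of \<xi> starting at the base point is unique, so every
      neighbourhood condition on \<xi> becomes a strict inequality at \<open>c R\<close>.\<close>
    have "c'' R = c R" unfolding c_def
      using c'' c'(2,3) w(1) by (intro product_ray_unique) (simp_all add: \<xi>_def p_def)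
    then have ee: "e - d (c R) (c' R) > 0" using c''(3) by simp
    have "eventually (\<lambda>n. d (q n R) (c R) < e - d (c R) (c' R)) sequentially" by (rule order_tendstoD(2)[OF qlim ee])
    moreover have "eventually (\<lambda>n. N n > R) sequentially" using N_top by (simp add: filterlim_at_top_dense)
    ultimately show ?thesis
    proof eventually_elim
      case (elim n)
      have Np: "N n > 0" using elim(2) c'(3) by simp
      have "d (q n R) (c' R) \<le> d (q n R) (c R) + d (c R) (c' R)"
        unfolding d_def using qX[of n R] cg c'(1,3) by (intro H2_pow_dist_triangle) (simp_all add: X_def geodesic_rays_def)
      then have "d (q n R) (c' R) < e" using elim(1) by simp
      moreover have "d (c' 0) (z n) = N n" using qd[OF Np, of 0 "N n"] Np by (simp add: q0 qN c'(2))
      moreover have "d (c' 0) (q n R) = R" using qd[OF Np, of 0 R] c'(2,3) by (simp add: q0)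
      moreover have "d (q n R) (z n) = N n - R" using qd[OF Np, of R "N n"] elim(2) by (simp add: qN[OF Np])
      moreover have "z n \<in> X" using qX[of n "N n"] qN[OF Np] by simp
      ultimately show ?case
        using elim(2) qX[of n R] unfolding cone_neighbourhood_def
        by (intro UnI1 imageI CollectI conjI bexI[of _ "q n R"]) simp_all
    qed
  qed
  let ?B = "{Inl ` {y \<in> X. d x y < e} | x e. x \<in> X \<and> e > 0} \<union>
      {cone_neighbourhood X d c R e | c R e. c \<in> geodesic_rays X d \<and> c 0 = p \<and> R > 0 \<and> e > 0}"
  \<comment> \<open>Eventual membership survives finite intersections and unions, so only generating
    sets matter, and balls contain no boundary point.\<close>
  have open_ev: "eventually (\<lambda>n. Inl (z n) \<in> U) sequentially" if "generate_topology_on ?B U" "Inr \<xi> \<in> U" for U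
    using that
  proof (induction rule: generate_topology_on.induct)
    case (Int a b)
    then show ?case by (simp add: eventually_conj)
  next
    case (UN K)
    then obtain k where k: "k \<in> K" "Inr \<xi> \<in> k" by blast
    from UN.IH[OF this] show ?case by (rule eventually_mono) (use k in blast)
  next
    case (Basis s)
    then obtain c' R e where "s = cone_neighbourhood X d c' R e" "c' \<in> geodesic_rays X d" "c' 0 = p" "R > 0" by blast
    then show ?case using cone[of c' R e] Basis(2) by (simp add: X_def d_def)
  qed simp
  have "d (c 1) (c 1) = 0" using cg by (simp add: geodesic_rays_def d_def)
  then have "Inr \<xi> \<in> cone_neighbourhood X d c 1 1" 
    unfolding cone_neighbourhood_def using \<xi>b c\<xi> by (intro UnI2 imageI CollectI conjI bexI[of _ c]) simp_all
  then have top: "Inr \<xi> \<in> topspace (cone_topology X d p)"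
    unfolding cone_topology_def topology_generated_by_topspace
    using cg c0 by (intro UnionI[of "cone_neighbourhood X d c 1 1"] UnI2 CollectI exI[of _ c] exI[of _ "1::real"] conjI)
      (simp_all add: X_def d_def)
  show ?thesis
    unfolding X_def[symmetric] d_def[symmetric] p_def[symmetric] in_closure_of
  proof (intro conjI top allI impI)
    fix T assume T: "Inr \<xi> \<in> T \<and> openin (cone_topology X d p) T"
    then have "generate_topology_on ?B T" by (simp add: cone_topology_def openin_topology_generated_by_iff)
    with T have "eventually (\<lambda>n. Inl (z n) \<in> T) sequentially" using open_ev by blast
    then obtain n where "Inl (z n) \<in> T" by (auto simp: eventually_sequentially)
    then show "\<exists>y. y \<in> Inl ` S \<and> y \<in> T" using S by blast
  qed
qed

section \<open>Density of the limit directions\<close>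

text \<open>The squared norm of \<open>B m\<close> is twice the hyperbolic cosine of the
  displacement of i, so when the scaled matrices converge to a nonzero limit, ln |s m| plus half the
  displacement stays bounded. The direction is that of the vector stretched most, which must
  approach the image of \<open>M\<close>.\<close>

lemma translation_direction:
  fixes B :: "nat \<Rightarrow> real^2^2" and s \<phi> D k :: "nat \<Rightarrow> real"
  assumes B: "\<And>m. det (B m) = 1" and lim: "(\<lambda>m. s m *\<^sub>R B m) \<longlonglongrightarrow> M"
    and M: "M = rank1 (cos \<psi>, sin \<psi>) v" "M \<noteq> 0"
    and k: "filterlim k at_top sequentially" and rate: "(\<lambda>m. ln \<bar>s m\<bar> / k m) \<longlonglongrightarrow> - L"
    and z: "\<And>m. pt (B m) = hray (rot (\<phi> m)) (D m)" and D: "\<And>m. D m \<ge> 0"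
  shows "(\<lambda>m. D m / k m) \<longlonglongrightarrow> 2 * L" and "(\<lambda>m. sin (\<phi> m - \<psi>)) \<longlonglongrightarrow> 0"
proof -
  have nB: "(norm (B m))\<^sup>2 = 2 * cosh (D m)" for m
  proof -
    have "hyp_dist (pt (mat 1)) (pt (B m)) = D m"
      unfolding z using hyp_dist_hray[of "rot (\<phi> m)" 0 "D m"] D by simp
    then show ?thesis using cosh_hyp_dist_pt[of "mat 1" "B m"] B by simp
  qed
  define a where "a m = norm (s m *\<^sub>R B m)" for m
  have alim: "a \<longlonglongrightarrow> norm M" unfolding a_def by (intro tendsto_intros lim)
  have a2: "(a m)\<^sup>2 = (s m)\<^sup>2 * (2 * cosh (D m))" for m by (simp add: a_def power_mult_distrib nB)
  have a0: "a m \<ge> 0" for m by (simp add: a_def)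
  have apos: "eventually (\<lambda>m. a m > 0) sequentially" using order_tendstoD(1)[OF alim, of 0] M(2) by simp
  have inv_k: "(\<lambda>m. C / k m) \<longlonglongrightarrow> 0" for C :: real
    by (rule real_tendsto_divide_at_top[OF tendsto_const k])
  \<comment> \<open>The bounded error in replacing ln (2 cosh D) by D.\<close>
  define e where "e m = ln (2 * cosh (D m)) - D m" for m
  have e: "0 \<le> e m" "e m \<le> ln 2" for m
  proof -
    have c: "2 * cosh (D m) = exp (D m) + exp (- D m)" by (simp add: cosh_def)
    have "exp (- D m) \<le> exp (D m)" using D[of m] by simp
    then have "2 * cosh (D m) \<le> 2 * exp (D m)" unfolding c by simp
    then have "ln (2 * cosh (D m)) \<le> ln (2 * exp (D m))" using cosh_real_pos[of "D m"] by (simp only: ln_le_cancel_iff)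
    then show "e m \<le> ln 2" by (simp add: e_def ln_mult)
    have "exp (D m) \<le> 2 * cosh (D m)" unfolding c by simp
    then have "ln (exp (D m)) \<le> ln (2 * cosh (D m))" by (subst ln_le_cancel_iff) simp_all
    then show "0 \<le> e m" by (simp add: e_def)
  qed
  have elim0: "(\<lambda>m. e m / k m) \<longlonglongrightarrow> 0"
  proof (rule Lim_null_comparison[OF _ inv_k[of "ln 2"]])
    have "eventually (\<lambda>m. k m > 0) sequentially" using k by (simp add: filterlim_at_top_dense)
    then show "eventually (\<lambda>m. norm (e m / k m) \<le> ln 2 / k m) sequentially"
      by (rule eventually_mono) (use e in \<open>simp add: divide_right_mono\<close>)
  qed
  have lnlim: "(\<lambda>m. ln ((a m)\<^sup>2)) \<longlonglongrightarrow> ln ((norm M)\<^sup>2)"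
    using M(2) by (intro tendsto_ln tendsto_power alim) simp
  have "(\<lambda>m. ln ((a m)\<^sup>2) / k m - 2 * (ln \<bar>s m\<bar> / k m) - e m / k m) \<longlonglongrightarrow> 0 - 2 * (- L) - 0"
    by (intro tendsto_diff tendsto_mult rate elim0 tendsto_const real_tendsto_divide_at_top[OF lnlim k])
  moreover have "eventually (\<lambda>m. ln ((a m)\<^sup>2) / k m - 2 * (ln \<bar>s m\<bar> / k m) - e m / k m = D m / k m) sequentially"
    using apos
  proof eventually_elim
    case (elim m)
    then have "s m \<noteq> 0" by (auto simp: a_def)
    then have "ln ((a m)\<^sup>2) = ln ((s m)\<^sup>2) + ln (2 * cosh (D m))" unfolding a2 by (subst ln_mult) simp_all
    also have "(s m)\<^sup>2 = \<bar>s m\<bar> ^ 2" by simp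
    also have "ln (\<bar>s m\<bar> ^ 2) = 2 * ln \<bar>s m\<bar>" using \<open>s m \<noteq> 0\<close> by (subst ln_realpow) simp_all
    finally show ?case by (simp add: e_def diff_divide_distrib add_divide_distrib)
  qed
  ultimately have "(\<lambda>m. D m / k m) \<longlonglongrightarrow> 0 - 2 * (- L) - 0" by (rule Lim_transform_eventually)
  then show "(\<lambda>m. D m / k m) \<longlonglongrightarrow> 2 * L" by simp
  define n where "n m = norm (s m *\<^sub>R B m - M)" for m
  \<comment> \<open>The unit vector \<open>w\<close> is stretched to length exp (D / 2) in direction
    \<open>\<phi> m\<close>, while \<open>M\<close> sends it into direction \<psi>. The factor 8 is
    4 for the matrix entries times 2 from the bound on \<open>a m\<close>.\<close>
  have bound: "a m * \<bar>sin (\<phi> m - \<psi>)\<bar> \<le> 8 * n m" for m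
  proof -
    let ?P = "rot (\<phi> m) ** dia (D m)"
    have dP: "det ?P = 1" by (simp add: det_mul)
    have "pt (adj2 ?P ** B m) = moebius (adj2 ?P) (pt ?P)" using z[of m] B[of m] by (simp add: pt_mult hray_def)
    also have "\<dots> = \<i>" using moebius_inverse(1)[OF dP i_upper] .
    finally obtain \<theta> where \<theta>: "adj2 ?P ** B m = rot \<theta>" using pt_eq_i[of "adj2 ?P ** B m"] dP B by (auto simp: det_mul)
    define w where "w = (cos \<theta>, - sin \<theta>)"
    have "B m = ?P ** (adj2 ?P ** B m)" using dP by (simp add: matrix_mul_assoc mult_adj2_1)
    then have Bm: "B m = ?P ** rot \<theta>" by (simp only: \<theta>)
    have "mat_app (rot \<theta>) w = (1, 0)" by (simp add: mat_app_def rot_def w_def flip: power2_eq_square)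
    then have Bw: "mat_app (B m) w = (exp (D m / 2) * cos (\<phi> m), exp (D m / 2) * sin (\<phi> m))"
      unfolding Bm mat_app_mult by (simp add: mat_app_def rot_def dia_def)
    have sB: "mat_app (s m *\<^sub>R B m) w = s m *\<^sub>R mat_app (B m) w" by (simp add: mat_app_def algebra_simps)
    have "s m * exp (D m / 2) * sin (\<phi> m - \<psi>) = cross (cos \<psi>, sin \<psi>) (mat_app (s m *\<^sub>R B m) w)"
      unfolding sB Bw by (simp add: cross_def sin_diff algebra_simps)
    also have "\<dots> = cross (cos \<psi>, sin \<psi>) (mat_app (s m *\<^sub>R B m - M) w)"
    proof -
      have "cross (cos \<psi>, sin \<psi>) (mat_app M w) = 0" by (simp add: M(1) mat_app_rank1 cross_def)
      then show ?thesis by (simp add: mat_app_def cross_def algebra_simps)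
    qed
    finally have eq: "\<bar>s m\<bar> * exp (D m / 2) * \<bar>sin (\<phi> m - \<psi>)\<bar> = \<bar>cross (cos \<psi>, sin \<psi>) (mat_app (s m *\<^sub>R B m - M) w)\<bar>"
      by (metis abs_mult abs_exp_cancel)
    define Y where "Y = s m *\<^sub>R B m - M"
    have prod: "\<bar>p * (Y $ i $ j * q)\<bar> \<le> n m" if "\<bar>p\<bar> \<le> 1" "\<bar>q\<bar> \<le> 1" for p q i j
    proof -
      have "\<bar>p\<bar> * (\<bar>Y $ i $ j\<bar> * \<bar>q\<bar>) \<le> 1 * (\<bar>Y $ i $ j\<bar> * 1)"
        using that by (intro mult_mono mult_left_mono) simp_all
      then show ?thesis using mat_nth_le_norm[of Y i j] by (simp add: abs_mult n_def Y_def)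
    qed
    have "cross (cos \<psi>, sin \<psi>) (mat_app Y w) = cos \<psi> * (Y $ 2 $ 1 * cos \<theta>) - cos \<psi> * (Y $ 2 $ 2 * sin \<theta>)
        - sin \<psi> * (Y $ 1 $ 1 * cos \<theta>) + sin \<psi> * (Y $ 1 $ 2 * sin \<theta>)"
      by (simp add: cross_def mat_app_def w_def algebra_simps)
    then have c4: "\<bar>cross (cos \<psi>, sin \<psi>) (mat_app Y w)\<bar> \<le> 4 * n m"
      using prod[of "cos \<psi>" "cos \<theta>" 2 1] prod[of "cos \<psi>" "sin \<theta>" 2 2] prod[of "sin \<psi>" "cos \<theta>" 1 1]
        prod[of "sin \<psi>" "sin \<theta>" 1 2] by simp
    have "(a m)\<^sup>2 \<le> (2 * (\<bar>s m\<bar> * exp (D m / 2)))\<^sup>2"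
    proof -
      have "2 * cosh (D m) = exp (D m) + exp (- D m)" by (simp add: cosh_def)
      also have "\<dots> \<le> exp (D m) + exp (D m)" using D[of m] by simp
      also have "\<dots> \<le> 4 * exp (D m)" by simp
      also have "exp (D m) = (exp (D m / 2))\<^sup>2" by (simp add: power2_eq_square flip: exp_add)
      finally have "(s m)\<^sup>2 * (2 * cosh (D m)) \<le> (s m)\<^sup>2 * (4 * (exp (D m / 2))\<^sup>2)" by (intro mult_left_mono) simp_all
      then show ?thesis unfolding a2 by (simp add: power_mult_distrib)
    qed
    then have "a m \<le> 2 * (\<bar>s m\<bar> * exp (D m / 2))" by (rule power2_le_imp_le) simp
    then have "a m * \<bar>sin (\<phi> m - \<psi>)\<bar> \<le> 2 * (\<bar>s m\<bar> * exp (D m / 2)) * \<bar>sin (\<phi> m - \<psi>)\<bar>" by (rule mult_right_mono) simp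
    also have "\<dots> = 2 * \<bar>cross (cos \<psi>, sin \<psi>) (mat_app Y w)\<bar>" using eq by (simp add: Y_def)
    also have "\<dots> \<le> 8 * n m" using c4 by simp
    finally show ?thesis .
  qed
  have "n \<longlonglongrightarrow> norm (M - M)" unfolding n_def by (intro tendsto_intros lim)
  then have "(\<lambda>m. 8 * n m / a m) \<longlonglongrightarrow> 8 * norm (M - M) / norm M" using M(2) by (intro tendsto_intros alim) simp_all
  then have lim0: "(\<lambda>m. 8 * n m / a m) \<longlonglongrightarrow> 0" by simp
  show "(\<lambda>m. sin (\<phi> m - \<psi>)) \<longlonglongrightarrow> 0"
  proof (rule Lim_null_comparison[OF _ lim0])
    show "eventually (\<lambda>m. norm (sin (\<phi> m - \<psi>)) \<le> 8 * n m / a m) sequentially"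
      using apos by (rule eventually_mono) (use bound in \<open>simp add: pos_le_divide_eq mult.commute\<close>)
  qed
qed

lemma tendsto_mpow_hyperbolic:
  assumes Q: "det Q = 1" "\<bar>l\<bar> > 1" and k: "filterlim k at_top sequentially"
  shows "(\<lambda>m. (1 / l) ^ k m *\<^sub>R mpow (Q ** mat2 l 0 0 (1/l) ** adj2 Q) (k m)) \<longlonglongrightarrow> Q ** mat2 1 0 0 0 ** adj2 Q"
proof -
  have l: "l \<noteq> 0" using Q(2) by auto
  have "(\<lambda>m. (1 / (l * l)) ^ m) \<longlonglongrightarrow> 0"
  proof (rule LIMSEQ_power_zero)
    have "1 < \<bar>l\<bar> * \<bar>l\<bar>" using Q(2) by (metis less_1_mult)
    then show "norm (1 / (l * l)) < 1" by (simp add: abs_mult)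
  qed
  from filterlim_compose[OF this k] have lim: "(\<lambda>m. (1 / (l * l)) ^ k m) \<longlonglongrightarrow> 0" .
  have "(1 / l) ^ n *\<^sub>R mpow (Q ** mat2 l 0 0 (1/l) ** adj2 Q) n = Q ** mat2 1 0 0 ((1 / (l * l)) ^ n) ** adj2 Q" for n
  proof -
    have "(1 / l) ^ n * l ^ n = 1" using l by (simp add: power_one_over)
    moreover have "(1 / l) ^ n * (1 / l) ^ n = (1 / (l * l)) ^ n" by (simp flip: power_mult_distrib)
    ultimately have "(1 / l) ^ n *\<^sub>R mat2 (l ^ n) 0 0 ((1 / l) ^ n) = mat2 1 0 0 ((1 / (l * l)) ^ n)" by simp
    then have "Q ** ((1 / l) ^ n *\<^sub>R mat2 (l ^ n) 0 0 ((1 / l) ^ n)) ** adj2 Q = Q ** mat2 1 0 0 ((1 / (l * l)) ^ n) ** adj2 Q"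
      by (simp only:)
    then show ?thesis by (simp only: mpow_conj[OF Q(1)] mpow_diag scaleR_matrix_mult)
  qed
  moreover have "(\<lambda>m. Q ** mat2 1 0 0 ((1 / (l * l)) ^ k m) ** adj2 Q) \<longlonglongrightarrow> Q ** mat2 1 0 0 0 ** adj2 Q"
    by (intro tendsto_intros lim)
  ultimately show ?thesis by (simp only:)
qed

text \<open>Any boundary point \<open>\<eta>\<close> is approached by \<open>A m g\<^sup>k x\<close>: here \<open>g\<close> is hyperbolic in every factor and \<open>A m\<close> approximates,
  up to scaling, matrices of rank one whose images are the components of \<open>\<eta>\<close>. The exponent is so large
  that the rates of escape are dictated by \<open>g\<close>, which makes the limit regular.\<close>
lemma furstenberg_boundary_subset:
  assumes G: "galois_tuple_group G {..<r} j" "G \<subseteq> lifts r \<Gamma>" and x: "x \<in> H2_pow r"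
  shows "furstenberg_boundary r \<subseteq> furstenberg_limit_set r \<Gamma> x"
proof
  interpret galois_tuple_group G "{..<r}" j by (rule G(1))
  fix \<eta> assume \<eta>: "\<eta> \<in> furstenberg_boundary r"
  have "\<forall>i\<in>{..<r}. \<exists>\<phi>. \<eta> i = hyp_asymptotic `` {hray (rot \<phi>)}"
  proof
    fix i assume "i \<in> {..<r}"
    then have "\<eta> i \<in> geometric_boundary upper_half_plane hyp_dist" using \<eta> by (auto simp: furstenberg_boundary_def)
    then show "\<exists>\<phi>. \<eta> i = hyp_asymptotic `` {hray (rot \<phi>)}" by (rule hyp_boundary_rot) blast
  qed
  from bchoice[OF this] obtain \<psi> where \<psi>: "\<And>i. i < r \<Longrightarrow> \<eta> i = hyp_asymptotic `` {hray (rot (\<psi> i))}" by auto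
  obtain g where g: "g \<in> G" "\<And>i. i < r \<Longrightarrow> \<bar>trace (g i)\<bar> > 2" using exists_all_hyperbolic by auto
  have "\<forall>i\<in>{..<r}. \<exists>Ql. det (fst Ql) = 1 \<and> \<bar>snd Ql\<bar> > 1 \<and> g i = fst Ql ** mat2 (snd Ql) 0 0 (1 / snd Ql) ** adj2 (fst Ql)"
  proof
    fix i assume "i \<in> {..<r}"
    then have "\<bar>trace (g i)\<bar> > 2" using g(2) by simp
    then obtain Q l where "det Q = 1" "\<bar>l\<bar> > 1" "g i = Q ** mat2 l 0 0 (1/l) ** adj2 Q"
      by (rule hyperbolic_diagonalize[OF det_mem[OF g(1)]])
    then show "\<exists>Ql. det (fst Ql) = 1 \<and> \<bar>snd Ql\<bar> > 1 \<and> g i = fst Ql ** mat2 (snd Ql) 0 0 (1 / snd Ql) ** adj2 (fst Ql)"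
      by (intro exI[of _ "(Q, l)"]) simp
  qed
  from bchoice[OF this] obtain Ql where Ql: "\<forall>i\<in>{..<r}. det (fst (Ql i)) = 1 \<and> \<bar>snd (Ql i)\<bar> > 1 \<and>
      g i = fst (Ql i) ** mat2 (snd (Ql i)) 0 0 (1 / snd (Ql i)) ** adj2 (fst (Ql i))" ..
  define Q l where "Q i = fst (Ql i)" and "l i = snd (Ql i)" for i
  have Q: "det (Q i) = 1" "\<bar>l i\<bar> > 1" "g i = Q i ** mat2 (l i) 0 0 (1 / l i) ** adj2 (Q i)" if "i < r" for i
    using Ql that by (simp_all add: Q_def l_def)
  have "\<forall>i\<in>{..<r}. \<exists>Z. det Z = 1 \<and> x i = pt Z"
  proof
    fix i assume "i \<in> {..<r}"
    then have "x i \<in> upper_half_plane" using x by simp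
    then show "\<exists>Z. det Z = 1 \<and> x i = pt Z" by (rule upper_eq_pt) blast
  qed
  from bchoice[OF this] obtain Z where Z: "\<And>i. i < r \<Longrightarrow> det (Z i) = 1" "\<And>i. i < r \<Longrightarrow> x i = pt (Z i)" by auto
  define u where "u i = (cos (\<psi> i), sin (\<psi> i))" for i
  define q where "q i = mat_app (Q i) (1, 0)" for i
  \<comment> \<open>The kernel direction \<open>v i\<close> is orthogonal to the attracting
    direction \<open>q i\<close> of \<open>g\<close>, so the rank one factor does not annihilate the
    limit of the powers of \<open>g\<close>.\<close>
  define v where "v i = (- snd (q i), fst (q i))" for i
  have u0: "u i \<noteq> 0" for i using sin_zero_abs_cos_one[of "\<psi> i"] by (auto simp: u_def prod_eq_iff)
  define P where "P i = Q i ** mat2 1 0 0 0 ** adj2 (Q i)" for i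
  define M where "M i = rank1 (u i) (v i) ** P i ** Z i" for i
  have M: "M i = rank1 (u i) (mat_app (adj2 (P i ** Z i)) (v i))" "M i \<noteq> 0" "rank1 (u i) (v i) \<noteq> 0" if i: "i < r" for i
  proof -
    show "M i = rank1 (u i) (mat_app (adj2 (P i ** Z i)) (v i))"
      by (simp add: M_def rank1_mult adj2_mult mat_app_mult)
    have "q i \<noteq> 0"
    proof
      assume "q i = 0"
      then have "Q i $ 1 $ 1 = 0" "Q i $ 2 $ 1 = 0" by (simp_all add: q_def mat_app_def prod_eq_iff)
      then show False using Q(1)[OF i] by (simp add: det_eq)
    qed
    then have "fst (q i) \<noteq> 0 \<or> snd (q i) \<noteq> 0" by (auto simp: prod_eq_iff)
    then have "(fst (q i))\<^sup>2 + (snd (q i))\<^sup>2 > 0" by (simp only: sum_power2_gt_zero_iff)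
    then have "cross (v i) (q i) \<noteq> 0" by (simp add: cross_def v_def power2_eq_square)
    then have nz: "mat_app (rank1 (u i) (v i)) (q i) \<noteq> 0" using u0 by (simp add: mat_app_rank1)
    have app0: "mat_app 0 y = 0" for y by (cases y) (simp add: mat_app_def zero_prod_def)
    show "rank1 (u i) (v i) \<noteq> 0"
    proof
      assume "rank1 (u i) (v i) = 0"
      then show False using nz app0[of "q i"] by simp
    qed
    have "M i ** adj2 (Z i) ** Q i = rank1 (u i) (v i) ** (Q i ** mat2 1 0 0 0 ** ((adj2 (Q i) ** ((Z i ** adj2 (Z i)) ** Q i))))"
      by (simp only: M_def P_def matrix_mul_assoc)
    also have "Z i ** adj2 (Z i) = mat 1" using Z(1)[OF i] by (simp add: mult_adj2_1)
    also have "adj2 (Q i) ** (mat 1 ** Q i) = mat 1" using mult_adj2_1[of "adj2 (Q i)"] Q(1)[OF i] by simp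
    finally have "mat_app (M i ** adj2 (Z i) ** Q i) (1, 0) = mat_app (rank1 (u i) (v i)) (q i)"
      by (simp add: mat_app_mult q_def) (simp add: mat_app_def)
    then have *: "mat_app (M i) (mat_app (adj2 (Z i)) (mat_app (Q i) (1, 0))) = mat_app (rank1 (u i) (v i)) (q i)"
      by (simp only: mat_app_mult)
    show "M i \<noteq> 0"
    proof
      assume "M i = 0"
      then show False using * nz app0[of "mat_app (adj2 (Z i)) (mat_app (Q i) (1, 0))"] by simp
    qed
  qed
  have "(\<lambda>i. rank1 (u i) (v i)) \<in> proj_closure {..<r} G"
    using proj_full_all[of "{..<r}"] by (simp add: proj_full_def)
  then obtain A c where A: "\<And>m::nat. A m \<in> G" "\<And>i. i \<in> {..<r} \<Longrightarrow> (\<lambda>m. c m i *\<^sub>R A m i) \<longlonglongrightarrow> rank1 (u i) (v i)"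
    by (rule proj_closure_seqE) blast
  \<comment> \<open>\<open>C m\<close> bounds the logarithms of the scalars. The exponent
    \<open>k m\<close> is at least (m + 1) (1 + C m), so the scalars do not contribute to the rate
    of escape.\<close>
  define C where "C m = (\<Sum>i<r. \<bar>ln \<bar>c m i\<bar>\<bar>)" for m
  have C0: "C m \<ge> 0" for m by (simp add: C_def sum_nonneg)
  define k where "k m = Suc m * (1 + nat \<lceil>C m\<rceil>)" for m
  have kC: "real (k m) \<ge> real (Suc m) * (1 + C m)" for m
  proof -
    have "1 + C m \<le> real (1 + nat \<lceil>C m\<rceil>)" using C0[of m] by simp
    then show ?thesis unfolding k_def of_nat_mult by (intro mult_left_mono) simp_all
  qed
  have km: "m \<le> k m" for m by (simp add: k_def)
  have k_top: "filterlim k at_top sequentially"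
    by (rule filterlim_at_top_mono[OF filterlim_ident]) (simp add: km)
  have rk_top: "filterlim (\<lambda>m. real (k m)) at_top sequentially"
    by (rule filterlim_compose[OF filterlim_real_sequentially k_top])
  have k0: "real (k m) > 0" for m unfolding of_nat_0_less_iff by (simp add: k_def)
  define E where "E m i = A m i ** mpow (g i) (k m)" for m i
  have E: "E m \<in> G" for m using mult_mem[OF A(1) mpow_mem[OF g(1)], of m "k m"] by (simp add: E_def[abs_def])
  define B where "B m i = E m i ** Z i" for m i
  have dB: "det (B m i) = 1" if "i < r" for m i using det_mem[OF E] Z(1)[OF that] by (simp add: B_def det_mul)
  define s where "s m i = c m i * (1 / l i) ^ k m" for m i
  have lim: "(\<lambda>m. s m i *\<^sub>R B m i) \<longlonglongrightarrow> M i" if i: "i < r" for i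
  proof -
    have "s m i *\<^sub>R B m i = (c m i *\<^sub>R A m i) ** ((1 / l i) ^ k m *\<^sub>R mpow (g i) (k m)) ** Z i" for m
      by (simp add: s_def B_def E_def scaleR_matrix_mult)
    moreover have "(\<lambda>m. (c m i *\<^sub>R A m i) ** ((1 / l i) ^ k m *\<^sub>R mpow (g i) (k m)) ** Z i) \<longlonglongrightarrow> M i"
      unfolding M_def P_def Q(3)[OF i] using i
      by (intro tendsto_matrix_mult A(2) tendsto_mpow_hyperbolic Q(1,2) k_top tendsto_const) simp_all
    ultimately show ?thesis by (simp only:)
  qed
  have rate: "(\<lambda>m. ln \<bar>s m i\<bar> / real (k m)) \<longlonglongrightarrow> - ln \<bar>l i\<bar>" if i: "i < r" for i
  proof -
    have "(\<lambda>m. ln \<bar>c m i\<bar> / real (k m)) \<longlonglongrightarrow> 0"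
    proof (rule Lim_null_comparison[OF always_eventually LIMSEQ_inverse_real_of_nat], rule allI)
      fix m
      have "\<bar>ln \<bar>c m i\<bar>\<bar> \<le> C m" unfolding C_def using i by (intro member_le_sum) simp_all
      moreover have "real (Suc m) * C m \<le> real (k m)" using kC[of m] C0[of m] by (simp add: algebra_simps)
      ultimately have "real (Suc m) * \<bar>ln \<bar>c m i\<bar>\<bar> \<le> real (k m)"
        by (meson mult_left_mono of_nat_0_le_iff order_trans)
      then show "norm (ln \<bar>c m i\<bar> / real (k m)) \<le> inverse (real (Suc m))"
        using k0[of m] by (simp add: field_simps)
    qed
    then have "(\<lambda>m. ln \<bar>c m i\<bar> / real (k m) - ln \<bar>l i\<bar>) \<longlonglongrightarrow> 0 - ln \<bar>l i\<bar>" by (intro tendsto_intros)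
    moreover have "eventually (\<lambda>m. ln \<bar>c m i\<bar> / real (k m) - ln \<bar>l i\<bar> = ln \<bar>s m i\<bar> / real (k m)) sequentially"
    proof -
      have "eventually (\<lambda>m. c m i *\<^sub>R A m i \<noteq> 0) sequentially"
        using tendsto_imp_eventually_ne[OF A(2) M(3)[OF i]] i by simp
      then show ?thesis
      proof eventually_elim
        case (elim m)
        then have "c m i \<noteq> 0" by auto
        have l0: "\<bar>l i\<bar> > 0" using Q(2)[OF i] by simp
        have "ln \<bar>s m i\<bar> = ln (\<bar>c m i\<bar> * (1 / \<bar>l i\<bar>) ^ k m)" by (simp add: s_def abs_mult power_abs)
        also have "\<dots> = ln \<bar>c m i\<bar> + ln ((1 / \<bar>l i\<bar>) ^ k m)" using \<open>c m i \<noteq> 0\<close> l0 by (intro ln_mult_pos) simp_all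
        also have "ln ((1 / \<bar>l i\<bar>) ^ k m) = real (k m) * ln (1 / \<bar>l i\<bar>)" by (rule ln_realpow)
        also have "ln (1 / \<bar>l i\<bar>) = - ln \<bar>l i\<bar>" using l0 by (simp add: ln_div)
        finally show ?case using k0[of m] by (simp add: field_simps)
      qed
    qed
    ultimately show ?thesis using Lim_transform_eventually by fastforce
  qed
  have "\<forall>m. \<exists>p. \<forall>i\<in>{..<r}. fst (p i) \<ge> 0 \<and> pt (B m i) = hray (rot (snd (p i))) (fst (p i))"
  proof
    fix m
    have "\<forall>i\<in>{..<r}. \<exists>p. fst p \<ge> 0 \<and> pt (B m i) = hray (rot (snd p)) (fst p)"
    proof
      fix i assume "i \<in> {..<r}"
      then have "pt (B m i) \<in> upper_half_plane" using dB by simp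
      then obtain \<phi> t where "t \<ge> 0" "pt (B m i) = pt (rot \<phi> ** dia t)" by (rule polar_i)
      then show "\<exists>p. fst p \<ge> 0 \<and> pt (B m i) = hray (rot (snd p)) (fst p)"
        by (intro exI[of _ "(t, \<phi>)"]) (simp add: hray_def)
    qed
    then show "\<exists>p. \<forall>i\<in>{..<r}. fst (p i) \<ge> 0 \<and> pt (B m i) = hray (rot (snd (p i))) (fst (p i))" by (rule bchoice)
  qed
  from choice[OF this] obtain p where p: "\<And>m i. i < r \<Longrightarrow> fst (p m i) \<ge> 0"
    "\<And>m i. i < r \<Longrightarrow> pt (B m i) = hray (rot (snd (p m i))) (fst (p m i))" by auto
  define D \<phi> where "D m i = fst (p m i)" and "\<phi> m i = snd (p m i)" for m i
  have D: "D m i \<ge> 0" "pt (B m i) = hray (rot (\<phi> m i)) (D m i)" if "i < r" for m i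
    using p that by (simp_all add: D_def \<phi>_def)
  have dir: "(\<lambda>m. D m i / real (k m)) \<longlonglongrightarrow> 2 * ln \<bar>l i\<bar>" "(\<lambda>m. sin (\<phi> m i - \<psi> i)) \<longlonglongrightarrow> 0" if i: "i < r" for i
    using translation_direction[OF dB[OF i] lim[OF i] M(1)[OF i, unfolded u_def] M(2)[OF i] rk_top rate[OF i] D(2,1)[OF i]]
    by simp_all
  define N where "N m = L2_set (D m) {..<r}" for m
  define \<Lambda> where "\<Lambda> = L2_set (\<lambda>i. 2 * ln \<bar>l i\<bar>) {..<r}"
  have lpos: "ln \<bar>l i\<bar> > 0" if "i < r" for i using Q(2)[OF that] by simp
  have "2 * ln \<bar>l j\<bar> \<le> \<Lambda>" unfolding \<Lambda>_def using j_mem by (intro member_le_L2_set) simp_all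
  then have \<Lambda>: "\<Lambda> > 0" using lpos[of j] j_mem by simp
  have Nk: "N m / real (k m) = L2_set (\<lambda>i. D m i / real (k m)) {..<r}" for m
    using L2_set_left_distrib[of "1 / real (k m)" "D m" "{..<r}"] by (simp add: N_def)
  have Nlim: "(\<lambda>m. N m / real (k m)) \<longlonglongrightarrow> \<Lambda>"
    unfolding Nk \<Lambda>_def L2_set_def by (intro tendsto_intros dir(1)) simp
  have "filterlim (\<lambda>m. N m / real (k m) * real (k m)) at_top sequentially"
    by (rule filterlim_tendsto_pos_mult_at_top[OF Nlim \<Lambda> rk_top])
  then have N_top: "filterlim (\<lambda>m. L2_set (D m) {..<r}) at_top sequentially"
    using k0 by (simp add: less_imp_neq[THEN not_sym] N_def k_def)
  \<comment> \<open>The translation lengths of \<open>g\<close> in the factors, normalized to a unit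
    vector, are the speeds of the limit ray; their positivity makes it regular.\<close>
  define w where "w i = 2 * ln \<bar>l i\<bar> / \<Lambda>" for i
  have wpos: "w i > 0" if "i < r" for i using lpos[OF that] \<Lambda> by (simp add: w_def)
  have w1: "L2_set w {..<r} = 1"
    using L2_set_left_distrib[of "1 / \<Lambda>" "\<lambda>i. 2 * ln \<bar>l i\<bar>" "{..<r}"] \<Lambda> by (simp add: \<Lambda>_def[symmetric] w_def[abs_def])
  have wlim: "(\<lambda>m. D m i / L2_set (D m) {..<r}) \<longlonglongrightarrow> w i" if i: "i < r" for i
  proof -
    have "(\<lambda>m. (D m i / real (k m)) / (N m / real (k m))) \<longlonglongrightarrow> w i"
      unfolding w_def using \<Lambda> by (intro tendsto_divide dir(1)[OF i] Nlim) simp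
    moreover have "(D m i / real (k m)) / (N m / real (k m)) = D m i / N m" for m using k0[of m] by simp
    ultimately show ?thesis by (simp only: N_def)
  qed
  define z where "z m = (\<lambda>i\<in>{..<r}. hray (rot (\<phi> m i)) (D m i))" for m
  have zS: "z m \<in> (\<lambda>\<gamma>. psl_pow_act r \<gamma> x) ` \<Gamma>" for m
  proof -
    define \<gamma> where "\<gamma> = (\<lambda>i\<in>{..<r}. psl_class (E m i))"
    have "\<gamma> \<in> \<Gamma>" using E[of m] G(2) by (auto simp: lifts_def \<gamma>_def)
    moreover have "psl_act (\<gamma> i) (x i) = hray (rot (\<phi> m i)) (D m i)" if i: "i < r" for i
      using D(2)[OF i, of m] Z[OF i] i by (simp add: \<gamma>_def psl_act_class B_def pt_mult)
    then have "z m = psl_pow_act r \<gamma> x" by (auto simp: z_def psl_pow_act_def)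
    ultimately show ?thesis by blast
  qed
  define h where "h = product_hray r (\<lambda>i. rot (\<psi> i)) w"
  define \<xi> where "\<xi> = product_asymptotic r `` {h}"
  have hg: "h \<in> product_rays r" unfolding h_def by (rule product_hray_geodesic[OF _ w1]) simp
  have cl: "Inr \<xi> \<in> cone_topology (H2_pow r) (H2_pow_dist r) (H2_pow_basepoint r) closure_of (Inl ` ((\<lambda>\<gamma>. psl_pow_act r \<gamma> x) ` \<Gamma>))"
    unfolding \<xi>_def h_def
    by (rule limit_point_criterion[OF _ w1 D(1) z_def N_top wlim dir(2) zS]) (use wpos less_imp_le in auto)
  have "\<xi> \<in> boundary_H2_pow r"
    unfolding boundary_H2_pow_def geometric_boundary_def \<xi>_def by (rule quotientI[OF hg])
  then have limit: "\<xi> \<in> limit_set r \<Gamma> x" using cl by (simp add: limit_set_def)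
  have "regular_ray r h"
    unfolding regular_ray_def
  proof (intro conjI hg allI impI notI)
    fix i assume i: "i < r" "\<exists>z. \<forall>t\<ge>0. h t i = z"
    then have "h 0 i = h 1 i" by (metis order_refl zero_le_one)
    then show False using hyp_dist_hray[of "rot (\<psi> i)" "w i * 0" "w i * 1"] wpos[OF i(1)] i(1) by (simp add: h_def product_hray_def)
  qed
  then have reg: "\<xi> \<in> regular_boundary r" by (auto simp: regular_boundary_def \<xi>_def)
  have h\<xi>: "h \<in> \<xi>"
    unfolding \<xi>_def using hg by (auto simp: asymptotic_def geodesic_rays_def intro!: exI[of _ 0])
  have end_eq: "endpoint upper_half_plane hyp_dist (\<lambda>t. h t i) = \<eta> i" if i: "i < r" for i
    unfolding \<psi>[OF i] by (rule endpoint_hray[OF _ wpos[OF i]]) (simp_all add: h_def product_hray_def i)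
  have "\<eta> \<in> extensional {..<r}" using \<eta> by (auto simp: furstenberg_boundary_def PiE_def)
  then have "\<eta> = (\<lambda>i\<in>{..<r}. endpoint upper_half_plane hyp_dist (\<lambda>t. h t i))"
    by (intro extensionalityI[of _ "{..<r}"]) (simp_all add: end_eq)
  then show "\<eta> \<in> furstenberg_limit_set r \<Gamma> x"
    unfolding furstenberg_limit_set_def regular_limit_set_def using limit reg h\<xi> by blast
qed

theorem theorem4:
  fixes r j :: nat and \<Gamma> \<Delta> :: "(nat \<Rightarrow> psl) set" and x :: "nat \<Rightarrow> complex"
  assumes "r \<ge> 2"
    and "irreducible_arithmetic r \<Delta>"
    and "subgroup \<Gamma> (PSL2R_pow r)" and "\<Gamma> \<subseteq> \<Delta>"
    and "j < r"
    and "cofinite_fuchsian (factor j \<Gamma>)"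
    and "\<forall>i<r. i \<noteq> j \<longrightarrow> \<not> discrete_in_PSL2R (factor i \<Gamma>)"
    and "\<forall>g \<in> factor j \<Gamma>. hyperbolic g \<longrightarrow>
           generated_field {psl_tr (g \<otimes>\<^bsub>PSL2R\<^esub> g)} =
           generated_field (psl_tr ` factor j (squares_group (PSL2R_pow r) \<Gamma>))"
    and "x \<in> H2_pow r"
  shows "furstenberg_limit_set r \<Gamma> x = furstenberg_boundary r"
proof -
  obtain G where "G \<subseteq> lifts r \<Gamma>" "galois_tuple_group G {..<r} j"
    using arithmetic_galois_tuple_group[OF assms(2-8)] by blast
  then show ?thesis
    using furstenberg_limit_set_subset furstenberg_boundary_subset assms(9) by (intro subset_antisym) blast+
qed

end
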